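(* Let $\Omega=\mathbb R^2\times(0,1)$, $\alpha\ge0$, and let $(\mathbf u,P)$ be a smooth solution of $$-\Delta\mathbf u+(\mathbf u\cdot\nabla)\mathbf u+\nabla P=0,\qquad\nabla\cdot\mathbf u=0\qquad\text{in }\Omega,$$ with $\mathbf u$ bounded on $\Omega$, satisfying the Navier boundary conditions with friction coefficient $\alpha$ on $\partial\Omega$. Then: (i) $\mathbf u\equiv0$ if either (a) $u^\theta$ is axisymmetric or $u^r$ is axisymmetric, or (b) $r\,u^r(r,\theta,z)\to0$ as $r\to+\infty$ uniformly in $(\theta,z)$; (ii) if $\alpha=0$ and $\|\mathbf u\|_{L^\infty(\Omega)}<\pi$, then $\mathbf u\equiv(C_1,C_2,0)$ for some constants $C_1,C_2\in\mathbb R$; (iii) if $\alpha>0$ and $\|\mathbf u\|_{L^\infty(\Omega)}<\min\{\alpha/2,\,1/4\}$, then there are constants $C_3,C_4\in\mathbb R$ such that $$\mathbf u(x_1,x_2,x_3)=\big(C_3(-2\alpha x_3^2+2\alpha x_3+1),\ C_4(-2\alpha x_3^2+2\alpha x_3+1),\ 0\big).$$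
   Context: Navier boundary conditions with friction coefficient $\alpha\ge0$ on the slab: $\mathbf u\cdot\mathbf n=0$ and $(\mathbf n\cdot\mathbb D(\mathbf u)+\alpha\mathbf u)\cdot\mathbf t=0$ on $\partial\Omega$, where $\mathbb D(\mathbf u)_{ij}=(\partial_{x_j}u^i+\partial_{x_i}u^j)/2$, $\mathbf n$ the unit outer normal and $\mathbf t$ any unit tangent vector; in Cartesian components: $u^3=0$, $\mp\frac12\partial_{x_3}u^1+\alpha u^1=0$, $\mp\frac12\partial_{x_3}u^2+\alpha u^2=0$ at $x_3=0$ (upper sign) and $x_3=1$ (lower sign). Cylindrical coordinates $\mathbf x=(r\cos\theta,r\sin\theta,z)$, $\mathbf u=u^r\mathbf e_r+u^\theta\mathbf e_\theta+u^z\mathbf e_z$ with $\mathbf e_r=(\cos\theta,\sin\theta,0)$, $\mathbf e_\theta=(-\sin\theta,\cos\theta,0)$, $\mathbf e_z=(0,0,1)$. A component (e.g. $u^\theta$) is axisymmetric if it does not depend on $\theta$. *)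

theory Defs
  imports "HOL-Analysis.Analysis"
begin

definition slab :: "(real^3) set" where
  "slab = {x. 0 < x$3 \<and> x$3 < 1}"

definition pd :: "3 \<Rightarrow> (real^3 \<Rightarrow> real) \<Rightarrow> real^3 \<Rightarrow> real" where
  "pd i f x = deriv (\<lambda>t. f (x + t *\<^sub>R axis i 1)) 0"

fun iter_pd :: "3 list \<Rightarrow> (real^3 \<Rightarrow> real) \<Rightarrow> real^3 \<Rightarrow> real" where
  "iter_pd [] f = f"
| "iter_pd (i # is) f = pd i (iter_pd is f)"

definition smooth_on :: "(real^3) set \<Rightarrow> (real^3 \<Rightarrow> real) \<Rightarrow> bool" where
  "smooth_on U f \<longleftrightarrow> open U \<and>
     (\<forall>is. continuous_on U (iter_pd is f) \<and>
        (\<forall>x\<in>U. \<forall>i. (\<lambda>t. iter_pd is f (x + t *\<^sub>R axis i 1)) differentiable (at 0)))"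

definition smooth_up_to_boundary :: "(real^3 \<Rightarrow> real) \<Rightarrow> bool" where
  "smooth_up_to_boundary f \<longleftrightarrow> (\<exists>U. closure slab \<subseteq> U \<and> smooth_on U f)"

definition laplacian :: "(real^3 \<Rightarrow> real) \<Rightarrow> real^3 \<Rightarrow> real" where
  "laplacian f x = (\<Sum>j\<in>UNIV. pd j (pd j f) x)"

definition steady_NS :: "(real^3 \<Rightarrow> real^3) \<Rightarrow> (real^3 \<Rightarrow> real) \<Rightarrow> bool" where
  "steady_NS u P \<longleftrightarrow>
     (\<forall>x\<in>slab. \<forall>i. - laplacian (\<lambda>y. u y $ i) x
        + (\<Sum>j\<in>UNIV. u x $ j * pd j (\<lambda>y. u y $ i) x) + pd i P x = 0)
   \<and> (\<forall>x\<in>slab. (\<Sum>i\<in>UNIV. pd i (\<lambda>y. u y $ i) x) = 0)"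

definition navier_bc :: "real \<Rightarrow> (real^3 \<Rightarrow> real^3) \<Rightarrow> bool" where
  "navier_bc \<alpha> u \<longleftrightarrow>
     (\<forall>x. x$3 = 0 \<longrightarrow> u x $ 3 = 0
          \<and> - (1/2) * pd 3 (\<lambda>y. u y $ 1) x + \<alpha> * u x $ 1 = 0
          \<and> - (1/2) * pd 3 (\<lambda>y. u y $ 2) x + \<alpha> * u x $ 2 = 0)
   \<and> (\<forall>x. x$3 = 1 \<longrightarrow> u x $ 3 = 0
          \<and> (1/2) * pd 3 (\<lambda>y. u y $ 1) x + \<alpha> * u x $ 1 = 0
          \<and> (1/2) * pd 3 (\<lambda>y. u y $ 2) x + \<alpha> * u x $ 2 = 0)"

text \<open>Cylindrical coordinates: r = sqrt(x1^2+x2^2), e_r = (x1,x2,0)/r, e_theta = (-x2,x1,0)/r.\<close>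
definition rad :: "real^3 \<Rightarrow> real" where
  "rad x = sqrt ((x$1)\<^sup>2 + (x$2)\<^sup>2)"

definition u_r :: "(real^3 \<Rightarrow> real^3) \<Rightarrow> real^3 \<Rightarrow> real" where
  "u_r u x = (x$1 * u x $ 1 + x$2 * u x $ 2) / rad x"

definition u_theta :: "(real^3 \<Rightarrow> real^3) \<Rightarrow> real^3 \<Rightarrow> real" where
  "u_theta u x = (- x$2 * u x $ 1 + x$1 * u x $ 2) / rad x"

definition axisymmetric :: "(real^3 \<Rightarrow> real) \<Rightarrow> bool" where
  "axisymmetric f \<longleftrightarrow> (\<forall>x\<in>slab. \<forall>y\<in>slab.
      rad x > 0 \<and> rad x = rad y \<and> x$3 = y$3 \<longrightarrow> f x = f y)"

end

theory Submission
  imports Defs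
begin

text \<open>
The pressure has no a priori growth bound, so the basic energy estimates use explicit divergence-free
test fields for which the pressure term drops out, built from cutoffs \<open>\<phi>\<close> depending on \<open>r/R\<close> only.
Testing with the curl of \<open>\<phi>\<close> times a vorticity corrected by the friction term, whose tangential components
vanish on the boundary, bounds the Laplacian locally by the gradient. Differentiating the equation in a direction
\<open>k\<close> that preserves the boundary conditions and testing with
\<open>\<phi> \<partial>\<^sub>k u + u \<partial>\<^sub>k\<phi> - (u \<cdot> \<nabla>\<phi>) e\<^sub>k\<close> controls the energy of \<open>\<partial>\<^sub>k u\<close>; the
quadratic term is absorbed by a one-dimensional Wirtinger or Robin inequality across the slab, which is where
the smallness of \<open>u\<close> enters. What remains is an inequality of Saint-Venant type,
\<open>E(R) \<le> \<tau> W(\<kappa>R) + C/\<tau> + o(1)(1 + E(\<kappa>R))\<close> for every \<open>\<tau>\<close>, where \<open>W\<close> is the energy weighted by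
\<open>r\<^sup>2/R\<^sup>2\<close>: it first makes \<open>E\<close> bounded, then \<open>W\<close> small, and finally forces \<open>E = 0\<close>.
For the Liouville statements \<open>\<phi> u\<close> is the test field, and the Bernoulli pressure only meets
the flux \<open>r u\<^sub>r\<close>: in the axisymmetric cases its vertical mean vanishes, so the pressure
may be replaced by its vertical oscillation, while in the decaying case its smallness suffices.
\<close>

section \<open>Integrals over boxes in the slab\<close>

text \<open>The slab is a plane at large scale, which is the borderline dimension: a cutoff at
  radius \<open>R\<close> has gradient of order \<open>1/R\<close> on a box of volume of order
  \<open>R^2\<close>, so Young's inequality leaves a term \<open>C / \<tau>\<close> that does not
  decay with \<open>R\<close>. The way out is to retain the factor \<open>rho\<close> carried by
  every derivative of the cutoff, because an energy weighted by \<open>rho\<close> forgets each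
  fixed compact region. Fourth powers of the cutoff occur because the test fields contain its first
  derivatives and are differentiated once more. The threshold \<open>pi\<close> is the square root
  of the first Dirichlet eigenvalue of a vertical segment. For \<alpha> = 0 it only removes the
  vertical derivative, since no such inequality holds for the horizontal derivatives. A second pass
  is then required: in a planar flow the quadratic terms of the two horizontal directions cancel,
  and the gradient is recovered by integrating by parts against the bounded velocity. A bounded flow
  with constant gradient finally has gradient zero.\<close>

definition pt :: "real \<Rightarrow> real \<Rightarrow> real \<Rightarrow> real^3" where
  "pt a b c = a *\<^sub>R axis 1 1 + b *\<^sub>R axis 2 1 + c *\<^sub>R axis 3 1"

lemma pt_nth [simp]: "pt a b c $ 1 = a" "pt a b c $ 2 = b" "pt a b c $ 3 = c"
  by (simp_all add: pt_def axis_def)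

lemma pt_collapse [simp]: "pt (x $ 1) (x $ 2) (x $ 3) = x"
  by (simp add: vec_eq_iff forall_3)

lemma pt_add_axis:
  "pt a b c + t *\<^sub>R axis 1 1 = pt (a + t) b c"
  "pt a b c + t *\<^sub>R axis 2 1 = pt a (b + t) c"
  "pt a b c + t *\<^sub>R axis 3 1 = pt a b (c + t)"
  by (simp_all add: pt_def algebra_simps)

lemma continuous_on_pt [continuous_intros]:
  assumes "continuous_on A f" "continuous_on A g" "continuous_on A h"
  shows "continuous_on A (\<lambda>x. pt (f x) (g x) (h x))"
  unfolding pt_def by (intro continuous_intros assms)

definition cslab :: "(real^3) set" where
  "cslab = {x. 0 \<le> x$3 \<and> x$3 \<le> 1}"

lemma pt_in_cslab [simp]: "pt a b c \<in> cslab \<longleftrightarrow> 0 \<le> c \<and> c \<le> 1"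
  by (simp add: cslab_def)

lemma slab_subset_cslab: "slab \<subseteq> cslab"
  by (auto simp: slab_def cslab_def)

lemma open_slab: "open slab"
proof -
  have *: "slab = {x. 0 < x$3} \<inter> {x. x$3 < 1}" by (auto simp: slab_def)
  have "open {x::real^3. 0 < x$3}" "open {x::real^3. x$3 < 1}"
    by (auto intro!: open_Collect_less continuous_intros)
  then show ?thesis unfolding * by (rule open_Int)
qed

lemma cslab_subset_closure: "cslab \<subseteq> closure slab"
proof
  fix x assume x: "x \<in> cslab"
  \<comment> \<open>Moves the height towards the mid-plane by a vanishing fraction. A convex
    combination that gives positive weight to 1/2 stays strictly between the walls.\<close>
  let ?y = "\<lambda>n. pt (x$1) (x$2) (x$3 + inverse (real (Suc n)) * (1/2 - x$3))"
  have "?y n \<in> slab" for n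
  proof -
    define s where "s = inverse (real (Suc n))"
    have s: "0 < s" "s \<le> 1" by (auto simp: s_def field_simps)
    have c: "0 \<le> x$3" "x$3 \<le> 1" using x by (auto simp: cslab_def)
    have "x$3 + s * (1/2 - x$3) = (1 - s) * x$3 + s / 2" by (simp add: algebra_simps)
    moreover have "0 \<le> (1 - s) * x$3" "(1 - s) * x$3 \<le> (1 - s) * 1"
      using s c by (intro mult_nonneg_nonneg mult_left_mono; simp)+
    ultimately show ?thesis using s by (simp add: slab_def s_def[symmetric] del: of_nat_Suc)
  qed
  moreover have "?y \<longlonglongrightarrow> pt (x$1) (x$2) (x$3 + 0 * (1/2 - x$3))"
    unfolding pt_def by (intro tendsto_intros LIMSEQ_inverse_real_of_nat)
  ultimately show "x \<in> closure slab"
    unfolding closure_sequential by (intro exI[of _ ?y]) auto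
qed

lemma closure_slab_eq: "closure slab = cslab"
proof
  have "closed cslab"
  proof -
    have *: "cslab = {x. 0 \<le> x$3} \<inter> {x. x$3 \<le> 1}" by (auto simp: cslab_def)
    have "closed {x::real^3. 0 \<le> x$3}" "closed {x::real^3. x$3 \<le> 1}"
      by (auto intro!: closed_Collect_le continuous_intros)
    then show ?thesis unfolding * by (rule closed_Int)
  qed
  then show "closure slab \<subseteq> cslab" using slab_subset_cslab by (simp add: closure_minimal)
qed (rule cslab_subset_closure)

text \<open>The equations and the axisymmetry are given only in the open slab, while boundary terms
  need them on the walls. Continuity carries them there.\<close>

lemma cslab_eqI:
  fixes f g :: "real^3 \<Rightarrow> real"
  assumes "continuous_on cslab f" "continuous_on cslab g" "\<And>x. x \<in> slab \<Longrightarrow> f x = g x" "x \<in> cslab"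
  shows "f x = g x"
proof -
  have "f x - g x = 0"
    by (rule continuous_constant_on_closure[of slab "\<lambda>x. f x - g x"])
       (use assms in \<open>auto simp: closure_slab_eq intro!: continuous_intros\<close>)
  then show ?thesis by simp
qed

lemma cslab_leI:
  fixes f :: "real^3 \<Rightarrow> real"
  assumes "continuous_on cslab f" "\<And>x. x \<in> slab \<Longrightarrow> f x \<le> c" "x \<in> cslab"
  shows "f x \<le> c"
  by (rule continuous_le_on_closure[of slab f]) (use assms in \<open>auto simp: closure_slab_eq\<close>)

text \<open>Integration is split into a vertical segment and a horizontal square, because the
  Wirtinger and Robin inequalities hold segment by segment and are integrated against horizontal
  weights only afterwards.\<close>

definition vint :: "(real^3 \<Rightarrow> real) \<Rightarrow> real \<times> real \<Rightarrow> real" where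
  "vint f p = integral {0..1} (\<lambda>z. f (pt (fst p) (snd p) z))"

definition hint :: "real \<Rightarrow> (real \<times> real \<Rightarrow> real) \<Rightarrow> real" where
  "hint R e = integral (cbox (-R, -R) (R, R)) e"

definition sint :: "real \<Rightarrow> (real^3 \<Rightarrow> real) \<Rightarrow> real" where
  "sint R f = hint R (vint f)"

lemma continuous_on_pt_cslab:
  assumes "continuous_on cslab f" "continuous_on A a" "continuous_on A b" "continuous_on A c"
    "\<And>x. x \<in> A \<Longrightarrow> 0 \<le> c x \<and> c x \<le> 1"
  shows "continuous_on A (\<lambda>x. f (pt (a x) (b x) (c x)))"
  by (rule continuous_on_compose2[OF assms(1)]) (use assms in \<open>auto intro!: continuous_intros\<close>)

lemma continuous_on_vint [continuous_intros]:
  assumes "continuous_on cslab f"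
  shows "continuous_on A (vint f)"
proof -
  have "continuous_on A (\<lambda>p. integral (cbox 0 1) (\<lambda>z. f (pt (fst p) (snd p) z)))"
    by (rule integral_continuous_on_param)
       (auto simp: case_prod_unfold intro!: continuous_on_pt_cslab[OF assms] continuous_intros)
  then show ?thesis by (simp add: vint_def[abs_def])
qed

lemma vint_integrable:
  fixes f :: "real^3 \<Rightarrow> real"
  assumes "continuous_on cslab f"
  shows "(\<lambda>z. f (pt a b z)) integrable_on {0..1}"
proof -
  have "continuous_on {0..1} (\<lambda>z. f (pt a b z))"
    by (auto intro!: continuous_on_pt_cslab[OF assms] continuous_intros)
  then show ?thesis by (rule integrable_continuous_interval)
qed

lemma vint_add: "continuous_on cslab f \<Longrightarrow> continuous_on cslab g \<Longrightarrow>
   vint (\<lambda>x. f x + g x) p = vint f p + vint g p"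
  unfolding vint_def by (rule integral_add[OF vint_integrable vint_integrable])

lemma vint_cmult: "vint (\<lambda>x. c * f x) p = c * vint f p"
  unfolding vint_def by (rule integral_mult_right)

lemma vint_mono:
  assumes "continuous_on cslab f" "continuous_on cslab g"
    "\<And>z. 0 \<le> z \<Longrightarrow> z \<le> 1 \<Longrightarrow> f (pt (fst p) (snd p) z) \<le> g (pt (fst p) (snd p) z)"
  shows "vint f p \<le> vint g p"
  unfolding vint_def by (intro integral_le vint_integrable assms) (use assms in auto)

lemma vint_horizontal:
  fixes w :: "real \<Rightarrow> real \<Rightarrow> real"
  shows "vint (\<lambda>x. w (x$1) (x$2) * f x) p = w (fst p) (snd p) * vint f p"
  unfolding vint_def pt_nth by (rule integral_mult_right)

lemma hint_integrable:
  fixes e :: "real \<times> real \<Rightarrow> real"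
  assumes "continuous_on UNIV e"
  shows "e integrable_on (cbox (-R, -R) (R::real, R::real))"
proof (rule integrable_continuous)
  show "continuous_on (cbox (-R, -R) (R, R)) e" using assms by (rule continuous_on_subset) simp
qed

lemma hint_add: "continuous_on UNIV f \<Longrightarrow> continuous_on UNIV g \<Longrightarrow>
   hint R (\<lambda>x. f x + g x) = hint R f + hint R g"
  unfolding hint_def by (rule integral_add[OF hint_integrable hint_integrable])

lemma hint_cmult: "hint R (\<lambda>x. c * f x) = c * hint R f"
  unfolding hint_def by (rule integral_mult_right)

lemma hint_mono:
  assumes "continuous_on UNIV f" "continuous_on UNIV g"
    "\<And>a b. \<bar>a\<bar> \<le> R \<Longrightarrow> \<bar>b\<bar> \<le> R \<Longrightarrow> f (a, b) \<le> g (a, b)"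
  shows "hint R f \<le> hint R g"
  unfolding hint_def by (intro integral_le hint_integrable assms) (use assms in \<open>auto simp: cbox_Pair_iff abs_le_iff\<close>)

lemma hint_const: "R \<ge> 0 \<Longrightarrow> hint R (\<lambda>x. c) = 4 * R^2 * c"
  by (simp add: hint_def content_Pair power2_eq_square)

lemma hint_nonneg:
  assumes "continuous_on UNIV e" "\<And>a b. \<bar>a\<bar> \<le> R \<Longrightarrow> \<bar>b\<bar> \<le> R \<Longrightarrow> 0 \<le> e (a, b)"
  shows "0 \<le> hint R e"
  using hint_mono[of "\<lambda>_. 0" e R] assms by (simp add: hint_def)

lemma hint_mono_radius:
  assumes "continuous_on UNIV e" "\<And>p. 0 \<le> e p" "R \<le> R'"
  shows "hint R e \<le> hint R' e"
  unfolding hint_def by (intro integral_subset_le hint_integrable assms) (use assms in \<open>auto simp: cbox_Pair_iff\<close>)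

lemma sint_add: "continuous_on cslab f \<Longrightarrow> continuous_on cslab g \<Longrightarrow>
   sint R (\<lambda>x. f x + g x) = sint R f + sint R g"
  unfolding sint_def hint_add[OF continuous_on_vint continuous_on_vint, symmetric]
  by (rule arg_cong[where f="hint R"]) (simp add: vint_add fun_eq_iff)

lemma sint_cmult: "sint R (\<lambda>x. c * f x) = c * sint R f"
  unfolding sint_def hint_cmult[symmetric] by (rule arg_cong[where f="hint R"]) (simp add: vint_cmult fun_eq_iff)

lemma sint_diff:
  assumes "continuous_on cslab f" "continuous_on cslab g"
  shows "sint R (\<lambda>x. f x - g x) = sint R f - sint R g"
proof -
  have "continuous_on cslab (\<lambda>x. (-1) * g x)" by (intro continuous_intros assms)
  from sint_add[OF assms(1) this, of R] show ?thesis using sint_cmult[of R "-1" g] by simp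
qed

lemma sint_mono:
  assumes "continuous_on cslab f" "continuous_on cslab g"
    "\<And>x. x \<in> cslab \<Longrightarrow> \<bar>x$1\<bar> \<le> R \<Longrightarrow> \<bar>x$2\<bar> \<le> R \<Longrightarrow> f x \<le> g x"
  shows "sint R f \<le> sint R g"
  unfolding sint_def by (intro hint_mono vint_mono continuous_intros assms) (use assms in auto)

lemma sint_cong:
  assumes "continuous_on cslab f" "continuous_on cslab g"
    "\<And>x. x \<in> cslab \<Longrightarrow> \<bar>x$1\<bar> \<le> R \<Longrightarrow> \<bar>x$2\<bar> \<le> R \<Longrightarrow> f x = g x"
  shows "sint R f = sint R g"
  by (intro antisym sint_mono assms) (use assms in auto)

lemma sint_abs_le:
  assumes "continuous_on cslab f"
  shows "\<bar>sint R f\<bar> \<le> sint R (\<lambda>x. \<bar>f x\<bar>)"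
proof -
  have "sint R f \<le> sint R (\<lambda>x. \<bar>f x\<bar>)" by (intro sint_mono continuous_intros assms) auto
  moreover have "sint R (\<lambda>x. (-1) * f x) \<le> sint R (\<lambda>x. \<bar>f x\<bar>)" by (intro sint_mono continuous_intros assms) auto
  ultimately show ?thesis using sint_cmult[of R "-1" f] by simp
qed

lemma sint_const: "R \<ge> 0 \<Longrightarrow> sint R (\<lambda>x. c) = 4 * R^2 * c"
  by (simp add: sint_def vint_def[abs_def] hint_const)

lemma sint_const0 [simp]: "sint R (\<lambda>x. 0) = 0"
  by (simp add: sint_def vint_def[abs_def] hint_def)

lemma sint_nonneg:
  assumes "continuous_on cslab f" "\<And>x. x \<in> cslab \<Longrightarrow> \<bar>x$1\<bar> \<le> R \<Longrightarrow> \<bar>x$2\<bar> \<le> R \<Longrightarrow> 0 \<le> f x"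
  shows "0 \<le> sint R f"
  using sint_mono[of "\<lambda>_. 0" f R] assms by (simp add: sint_const0)

text \<open>A relation rather than a derivative operator, so that derivatives of composite
  expressions are assembled by resolution with product and chain rules. At wall points the
  derivative is still two-sided, as the functions are defined on all of space.\<close>

definition pdv :: "3 \<Rightarrow> (real^3 \<Rightarrow> real) \<Rightarrow> (real^3 \<Rightarrow> real) \<Rightarrow> bool" where
  "pdv j f f' \<longleftrightarrow> (\<forall>x\<in>cslab. ((\<lambda>t. f (x + t *\<^sub>R axis j 1)) has_real_derivative f' x) (at 0))"

lemma pdv_line:
  assumes "pdv 1 f f'" "0 \<le> c" "c \<le> 1"
  shows "((\<lambda>t. f (pt t b c)) has_real_derivative f' (pt a b c)) (at a)"
proof -
  have "((\<lambda>t. f (pt (a + t) b c)) has_real_derivative f' (pt a b c)) (at 0)"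
    using assms(1)[unfolded pdv_def, rule_format, of "pt a b c"] assms(2,3) by (simp add: pt_add_axis)
  then show ?thesis using DERIV_shift[of "\<lambda>t. f (pt t b c)" "f' (pt a b c)" 0 a] by (simp add: add.commute)
qed

lemma pdv_line2:
  assumes "pdv 2 f f'" "0 \<le> c" "c \<le> 1"
  shows "((\<lambda>t. f (pt a t c)) has_real_derivative f' (pt a b c)) (at b)"
proof -
  have "((\<lambda>t. f (pt a (b + t) c)) has_real_derivative f' (pt a b c)) (at 0)"
    using assms(1)[unfolded pdv_def, rule_format, of "pt a b c"] assms(2,3) by (simp add: pt_add_axis)
  then show ?thesis using DERIV_shift[of "\<lambda>t. f (pt a t c)" "f' (pt a b c)" 0 b] by (simp add: add.commute)
qed

lemma pdv_line3:
  assumes "pdv 3 f f'" "0 \<le> c" "c \<le> 1"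
  shows "((\<lambda>t. f (pt a b t)) has_real_derivative f' (pt a b c)) (at c)"
proof -
  have "((\<lambda>t. f (pt a b (c + t))) has_real_derivative f' (pt a b c)) (at 0)"
    using assms(1)[unfolded pdv_def, rule_format, of "pt a b c"] assms(2,3) by (simp add: pt_add_axis)
  then show ?thesis using DERIV_shift[of "\<lambda>t. f (pt a b t)" "f' (pt a b c)" 0 c] by (simp add: add.commute)
qed

lemma has_vector_derivative_within_real:
  "(f has_real_derivative f') (at x) \<Longrightarrow> (f has_vector_derivative f') (at x within A)"
  by (simp add: has_real_derivative_iff_has_vector_derivative[symmetric] has_field_derivative_at_within)

lemma vint_pdv3:
  assumes "pdv 3 g g'"
  shows "vint g' p = g (pt (fst p) (snd p) 1) - g (pt (fst p) (snd p) 0)"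
  unfolding vint_def
  by (intro integral_unique fundamental_theorem_of_calculus)
     (auto intro!: has_vector_derivative_within_real pdv_line3[OF assms] simp: cbox_Pair_iff)

lemma sint_pdv3:
  assumes "pdv 3 g g'" "continuous_on cslab g"
  shows "sint R g' = hint R (\<lambda>p. g (pt (fst p) (snd p) 1)) - hint R (\<lambda>p. g (pt (fst p) (snd p) 0))"
  unfolding sint_def vint_pdv3[OF assms(1), abs_def]
  unfolding hint_def
  by (intro integral_diff hint_integrable continuous_on_pt_cslab[OF assms(2)] continuous_intros) auto

section \<open>Orders of integration and the divergence theorem\<close>

lemma sint_iterated:
  assumes "continuous_on cslab f"
  shows "sint R f = integral {-R..R} (\<lambda>a. integral {-R..R} (\<lambda>b. integral {0..1} (\<lambda>c. f (pt a b c))))"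
proof -
  have "sint R f = integral (cbox (-R,-R) (R,R)) (vint f)" by (simp add: sint_def hint_def)
  also have "\<dots> = integral (cbox (-R) R) (\<lambda>a. integral (cbox (-R) R) (\<lambda>b. vint f (a, b)))"
    by (rule integral_prod_continuous) (intro continuous_intros assms)
  finally show ?thesis by (simp add: vint_def)
qed

lemma integral_eq_0I: "(\<And>x. x \<in> A \<Longrightarrow> f x = (0::real)) \<Longrightarrow> integral A f = 0"
  by (metis integral_0 integral_cong)

text \<open>The first coordinate is placed innermost so that the fundamental theorem of calculus can
  be applied in that direction.\<close>

lemma sint_order1:
  assumes c: "continuous_on cslab f"
  shows "sint R f = integral (cbox (-R,0) (R,1)) (\<lambda>q. integral {-R..R} (\<lambda>a. f (pt a (fst q) (snd q))))"
proof -
  have "integral (cbox (-R) R) (\<lambda>a. integral (cbox (-R,0) (R,1)) (\<lambda>q. f (pt a (fst q) (snd q))))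
     = integral (cbox (-R,0) (R,1)) (\<lambda>q. integral (cbox (-R) R) (\<lambda>a. f (pt a (fst q) (snd q))))"
    by (rule integral_swap_continuous)
       (auto simp: case_prod_unfold cbox_Pair_iff intro!: continuous_on_pt_cslab[OF c] continuous_intros)
  moreover have "integral (cbox (-R,0) (R,1)) (\<lambda>q. f (pt a (fst q) (snd q)))
     = integral {-R..R} (\<lambda>b. integral {0..1} (\<lambda>z. f (pt a b z)))" for a
  proof -
    have "continuous_on (cbox (-R,0) (R,1)) (\<lambda>q. f (pt a (fst q) (snd q)))"
      by (auto simp: cbox_Pair_iff intro!: continuous_on_pt_cslab[OF c] continuous_intros)
    from integral_prod_continuous[OF this] show ?thesis by simp
  qed
  ultimately show ?thesis by (simp add: sint_iterated[OF c])
qed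

lemma sint_order2:
  assumes c: "continuous_on cslab f"
  shows "sint R f = integral {-R..R} (\<lambda>a. integral {0..1} (\<lambda>z. integral {-R..R} (\<lambda>b. f (pt a b z))))"
proof -
  have "integral (cbox (-R) R) (\<lambda>b. integral (cbox 0 1) (\<lambda>z. f (pt a b z)))
     = integral (cbox 0 1) (\<lambda>z. integral (cbox (-R) R) (\<lambda>b. f (pt a b z)))" for a
    by (rule integral_swap_continuous)
       (auto simp: case_prod_unfold cbox_Pair_iff intro!: continuous_on_pt_cslab[OF c] continuous_intros)
  then show ?thesis by (simp add: sint_iterated[OF c])
qed

lemma sint_pdv1:
  assumes "pdv 1 g g'" "continuous_on cslab g'" "R \<ge> 0"
    "\<And>x. x \<in> cslab \<Longrightarrow> \<bar>x$1\<bar> = R \<Longrightarrow> \<bar>x$2\<bar> \<le> R \<Longrightarrow> g x = 0"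
  shows "sint R g' = 0"
proof -
  have "integral {-R..R} (\<lambda>a. g' (pt a b c)) = 0" if "(b, c) \<in> cbox (-R,0) (R,1)" for b c
  proof -
    have "integral {-R..R} (\<lambda>a. g' (pt a b c)) = g (pt R b c) - g (pt (-R) b c)"
      using that assms(3) by (intro integral_unique fundamental_theorem_of_calculus)
        (auto intro!: has_vector_derivative_within_real pdv_line[OF assms(1)] simp: cbox_Pair_iff)
    also have "\<dots> = 0" using that assms(3,4) by (auto simp: cbox_Pair_iff abs_le_iff)
    finally show ?thesis .
  qed
  then have "integral {-R..R} (\<lambda>a. g' (pt a (fst q) (snd q))) = 0" if "q \<in> cbox (-R,0) (R,1)" for q
    using that by (cases q) simp
  then show ?thesis unfolding sint_order1[OF assms(2)]
    by (rule integral_eq_0I)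
qed

lemma sint_pdv2:
  assumes "pdv 2 g g'" "continuous_on cslab g'" "R \<ge> 0"
    "\<And>x. x \<in> cslab \<Longrightarrow> \<bar>x$2\<bar> = R \<Longrightarrow> \<bar>x$1\<bar> \<le> R \<Longrightarrow> g x = 0"
  shows "sint R g' = 0"
proof -
  have 1: "integral {-R..R} (\<lambda>b. g' (pt a b c)) = 0" if "\<bar>a\<bar> \<le> R" "0 \<le> c" "c \<le> 1" for a c
  proof -
    have "integral {-R..R} (\<lambda>b. g' (pt a b c)) = g (pt a R c) - g (pt a (-R) c)"
      using that assms(3) by (intro integral_unique fundamental_theorem_of_calculus)
        (auto intro!: has_vector_derivative_within_real pdv_line2[OF assms(1)])
    also have "\<dots> = 0" using that assms(3,4) by auto
    finally show ?thesis .
  qed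
  have 2: "integral {0..1} (\<lambda>c. integral {-R..R} (\<lambda>b. g' (pt a b c))) = 0" if "\<bar>a\<bar> \<le> R" for a
    by (rule integral_eq_0I) (use 1 that in auto)
  show ?thesis unfolding sint_order2[OF assms(2)]
    by (rule integral_eq_0I) (use 2 in auto)
qed

text \<open>Only wall terms survive: the fields used later carry a cutoff that vanishes on the
  lateral faces, while the friction condition lives on the walls.\<close>

lemma divergence_theorem:
  fixes G :: "3 \<Rightarrow> real^3 \<Rightarrow> real"
  assumes R: "R \<ge> 0"
    and D: "\<And>j. pdv j (G j) (G' j)"
    and c: "\<And>j. continuous_on cslab (G' j)" "continuous_on cslab (G 3)"
    and lat: "\<And>x j. x \<in> cslab \<Longrightarrow> \<bar>x$1\<bar> = R \<or> \<bar>x$2\<bar> = R \<Longrightarrow> j = 1 \<or> j = 2 \<Longrightarrow> G j x = 0"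
  shows "sint R (\<lambda>x. G' 1 x + G' 2 x + G' 3 x)
     = hint R (\<lambda>p. G 3 (pt (fst p) (snd p) 1)) - hint R (\<lambda>p. G 3 (pt (fst p) (snd p) 0))"
proof -
  have "sint R (\<lambda>x. G' 1 x + G' 2 x + G' 3 x) = sint R (G' 1) + sint R (G' 2) + sint R (G' 3)"
    by (simp add: sint_add c continuous_on_add)
  also have "sint R (G' 1) = 0" by (rule sint_pdv1[OF D c(1) R]) (use lat in auto)
  also have "sint R (G' 2) = 0" by (rule sint_pdv2[OF D c(1) R]) (use lat in auto)
  also have "sint R (G' 3) = hint R (\<lambda>p. G 3 (pt (fst p) (snd p) 1)) - hint R (\<lambda>p. G 3 (pt (fst p) (snd p) 0))"
    by (rule sint_pdv3[OF D c(2)])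
  finally show ?thesis by simp
qed

lemma pdvD: "pdv j f f' \<Longrightarrow> x \<in> cslab \<Longrightarrow> ((\<lambda>t. f (x + t *\<^sub>R axis j 1)) has_real_derivative f' x) (at 0)"
  by (simp add: pdv_def)

lemma pdv_cong: "pdv j f f' \<Longrightarrow> (\<And>x. x \<in> cslab \<Longrightarrow> f' x = g' x) \<Longrightarrow> pdv j f g'"
  by (simp add: pdv_def)

lemma pdv_const: "pdv j (\<lambda>x. c) (\<lambda>x. 0)"
  by (simp add: pdv_def)

lemma pdv_add: "pdv j f f' \<Longrightarrow> pdv j g g' \<Longrightarrow> pdv j (\<lambda>x. f x + g x) (\<lambda>x. f' x + g' x)"
  unfolding pdv_def by (auto intro!: derivative_eq_intros)

lemma pdv_diff: "pdv j f f' \<Longrightarrow> pdv j g g' \<Longrightarrow> pdv j (\<lambda>x. f x - g x) (\<lambda>x. f' x - g' x)"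
  unfolding pdv_def by (auto intro!: derivative_eq_intros)

lemma pdv_minus: "pdv j f f' \<Longrightarrow> pdv j (\<lambda>x. - f x) (\<lambda>x. - f' x)"
  unfolding pdv_def by (auto intro!: derivative_eq_intros)

lemma pdv_mult: "pdv j f f' \<Longrightarrow> pdv j g g' \<Longrightarrow> pdv j (\<lambda>x. f x * g x) (\<lambda>x. f' x * g x + f x * g' x)"
  unfolding pdv_def by (auto intro!: derivative_eq_intros)

lemma pdv_sum: "(\<And>i. i \<in> A \<Longrightarrow> pdv j (f i) (f' i)) \<Longrightarrow> pdv j (\<lambda>x. \<Sum>i\<in>A. f i x) (\<lambda>x. \<Sum>i\<in>A. f' i x)"
  unfolding pdv_def by (auto intro!: derivative_eq_intros)

lemma pdv_chain:
  assumes "pdv j f f'" "\<And>x. x \<in> cslab \<Longrightarrow> (h has_real_derivative h' (f x)) (at (f x))"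
  shows "pdv j (\<lambda>x. h (f x)) (\<lambda>x. h' (f x) * f' x)"
  unfolding pdv_def
proof
  fix x assume x: "x \<in> cslab"
  have "(h has_real_derivative h' (f x)) (at (f (x + 0 *\<^sub>R axis j 1)))" using assms(2)[OF x] by simp
  from DERIV_chain2[OF this pdvD[OF assms(1) x]]
  show "((\<lambda>t. h (f (x + t *\<^sub>R axis j 1))) has_real_derivative h' (f x) * f' x) (at 0)" .
qed

lemma pdv_power: "pdv j f f' \<Longrightarrow> pdv j (\<lambda>x. f x ^ n) (\<lambda>x. real n * f x ^ (n - 1) * f' x)"
  by (rule pdv_chain) (auto intro!: derivative_eq_intros)

lemma pdv_coord: "pdv j (\<lambda>x. x $ k) (\<lambda>x. if j = k then 1 else 0)"
  unfolding pdv_def by (auto simp: axis_def intro!: derivative_eq_intros)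

lemma vint_mono_cslab:
  assumes "continuous_on cslab f" "continuous_on cslab g" "\<And>x. x \<in> cslab \<Longrightarrow> f x \<le> g x"
  shows "vint f p \<le> vint g p"
  by (rule vint_mono) (use assms in auto)

lemma vint_diff:
  assumes "continuous_on cslab f" "continuous_on cslab g"
  shows "vint (\<lambda>x. f x - g x) p = vint f p - vint g p"
  unfolding vint_def by (rule integral_diff[OF vint_integrable vint_integrable]) (use assms in auto)

section \<open>One-dimensional inequalities\<close>

text \<open>The weight \<open>2 * x$3 - 1\<close> equals -1 and 1 at the two ends, so the
  fundamental theorem applied to weight times square gives both boundary squares with a plus sign.
  As the weight is at most 1 in modulus, completing a square absorbs the cross term.\<close>

lemma vint_Robin:
  assumes f: "pdv 3 f f'" and c: "continuous_on cslab f" "continuous_on cslab f'"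
  shows "vint (\<lambda>x. (f x)\<^sup>2) p \<le> (f (pt (fst p) (snd p) 0))\<^sup>2 + (f (pt (fst p) (snd p) 1))\<^sup>2 + vint (\<lambda>x. (f' x)\<^sup>2) p"
proof -
  have *: "pdv 3 (\<lambda>x. (2 * x$3 - 1) * (f x)\<^sup>2) (\<lambda>x. 2 * (f x)\<^sup>2 + (2 * x$3 - 1) * (2 * f x * f' x))"
    by (rule pdv_cong, rule pdv_mult[OF pdv_diff[OF pdv_mult[OF pdv_const pdv_coord] pdv_const] pdv_power[OF f]]) auto
  have "vint (\<lambda>x. 2 * (f x)\<^sup>2 + (2 * x$3 - 1) * (2 * f x * f' x)) p
     = (f (pt (fst p) (snd p) 0))\<^sup>2 + (f (pt (fst p) (snd p) 1))\<^sup>2"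
    using vint_pdv3[OF *, of p] by simp
  moreover have "vint (\<lambda>x. (f x)\<^sup>2 - (f' x)\<^sup>2) p \<le> vint (\<lambda>x. 2 * (f x)\<^sup>2 + (2 * x$3 - 1) * (2 * f x * f' x)) p"
  proof (rule vint_mono_cslab)
    fix x assume "x \<in> cslab"
    define q where "q = 2 * x$3 - 1"
    have "\<bar>q\<bar> \<le> 1" using \<open>x \<in> cslab\<close> by (auto simp: cslab_def q_def)
    then have "q\<^sup>2 \<le> 1" by (simp add: abs_square_le_1)
    then have "q\<^sup>2 * (f' x)\<^sup>2 \<le> 1 * (f' x)\<^sup>2" by (intro mult_right_mono) auto
    moreover have "0 \<le> (f x + q * f' x)\<^sup>2" by simp
    ultimately show "(f x)\<^sup>2 - (f' x)\<^sup>2 \<le> 2 * (f x)\<^sup>2 + (2 * x$3 - 1) * (2 * f x * f' x)"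
      unfolding q_def[symmetric] by (simp add: power2_sum power_mult_distrib algebra_simps)
  qed (intro continuous_intros c)+
  moreover have "vint (\<lambda>x. (f x)\<^sup>2 - (f' x)\<^sup>2) p = vint (\<lambda>x. (f x)\<^sup>2) p - vint (\<lambda>x. (f' x)\<^sup>2) p"
    by (intro vint_diff continuous_intros c)
  ultimately show ?thesis by simp
qed

lemma vint_Wirtinger:
  assumes f: "pdv 3 f f'" and c: "continuous_on cslab f" "continuous_on cslab f'"
    and k: "0 < k" "k < pi"
    and bc: "\<And>x. x$3 = 0 \<or> x$3 = 1 \<Longrightarrow> f x = 0"
  shows "k\<^sup>2 * vint (\<lambda>x. (f x)\<^sup>2) p \<le> vint (\<lambda>x. (f' x)\<^sup>2) p"
proof -
  \<comment> \<open>Integrate \<open>(f' - g f)\<^sup>2 \<ge> 0\<close> for the Riccati solution \<open>g' = - (k\<^sup>2 + g\<^sup>2)\<close>.\<close>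
  define d where "d = (pi - k) / 2"
  define g where "g z = k * cot (k * z + d)" for z
  \<comment> \<open>The phase \<open>d\<close> centres the range of \<open>k * z + d\<close> in the
    interval from 0 to \<open>pi\<close>. Because \<open>k < pi\<close> the sine stays positive up
    to both ends, so \<open>g\<close> has no pole on the segment.\<close>
  have sin: "sin (k * z + d) > 0" if "0 \<le> z" "z \<le> 1" for z
  proof (rule sin_gt_zero)
    have "k * z \<le> k * 1" "0 \<le> k * z" using that k by (intro mult_left_mono mult_nonneg_nonneg; simp)+
    moreover have "d > 0" "k + d < pi" using k by (auto simp: d_def field_simps)
    ultimately show "0 < k * z + d" "k * z + d < pi" by linarith+
  qed
  have dg: "(g has_real_derivative - (k\<^sup>2 + (g z)\<^sup>2)) (at z)" if "0 \<le> z" "z \<le> 1" for z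
    unfolding g_def using sin[OF that]
    by (auto intro!: derivative_eq_intros simp: power2_eq_square cot_def divide_simps)
       (use sin_cos_squared_add[of "k * z + d"] in \<open>simp add: power2_eq_square algebra_simps\<close>)?
  have cg: "continuous_on cslab (\<lambda>x. g (x$3))"
  proof -
    have "continuous_on {0..1} g"
      by (auto intro!: continuous_at_imp_continuous_on DERIV_isCont dg)
    then show ?thesis
      by (rule continuous_on_compose2) (auto simp: cslab_def intro!: continuous_intros)
  qed
  have pg: "pdv 3 (\<lambda>x. g (x$3)) (\<lambda>x. - (k\<^sup>2 + (g (x$3))\<^sup>2))"
    using pdv_chain[OF pdv_coord[of 3 3], of g "\<lambda>z. - (k\<^sup>2 + (g z)\<^sup>2)"] dg by (auto simp: cslab_def)
  have *: "pdv 3 (\<lambda>x. g (x$3) * (f x)\<^sup>2)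
    (\<lambda>x. (- (k\<^sup>2 + (g (x$3))\<^sup>2)) * (f x)\<^sup>2 + g (x$3) * (2 * f x * f' x))"
    by (rule pdv_cong, rule pdv_mult[OF pg pdv_power[OF f]]) auto
  have "vint (\<lambda>x. (- (k\<^sup>2 + (g (x$3))\<^sup>2)) * (f x)\<^sup>2 + g (x$3) * (2 * f x * f' x)) p = 0"
    using vint_pdv3[OF *, of p] by (simp add: bc)
  moreover have "vint (\<lambda>x. (- (k\<^sup>2 + (g (x$3))\<^sup>2)) * (f x)\<^sup>2 + g (x$3) * (2 * f x * f' x)) p
     \<le> vint (\<lambda>x. (f' x)\<^sup>2 - k\<^sup>2 * (f x)\<^sup>2) p"
  proof (rule vint_mono_cslab)
    fix x
    have "0 \<le> (f' x - g (x$3) * f x)\<^sup>2" by simp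
    then show "(- (k\<^sup>2 + (g (x$3))\<^sup>2)) * (f x)\<^sup>2 + g (x$3) * (2 * f x * f' x) \<le> (f' x)\<^sup>2 - k\<^sup>2 * (f x)\<^sup>2"
      by (simp add: power2_diff power_mult_distrib algebra_simps)
  qed (intro continuous_intros c cg)+
  moreover have "vint (\<lambda>x. (f' x)\<^sup>2 - k\<^sup>2 * (f x)\<^sup>2) p = vint (\<lambda>x. (f' x)\<^sup>2) p - k\<^sup>2 * vint (\<lambda>x. (f x)\<^sup>2) p"
    by (subst vint_diff) (auto simp: vint_cmult intro!: continuous_intros c)
  ultimately show ?thesis by simp
qed

text \<open>Meant for the normal velocity, which vanishes on the walls although its vertical
  derivative need not. Integrating by parts gives minus the integral of \<open>f * f''\<close>;
  after Young the term in \<open>f\<close> is at most half of the left side by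
  \<open>vint_Wirtinger\<close> and is absorbed.\<close>

lemma vint_Wirtinger_deriv:
  assumes f: "pdv 3 f f'" "pdv 3 f' f''" and c: "continuous_on cslab f" "continuous_on cslab f'" "continuous_on cslab f''"
    and k: "0 < k" "k < pi"
    and bc: "\<And>x. x$3 = 0 \<or> x$3 = 1 \<Longrightarrow> f x = 0"
  shows "k\<^sup>2 * vint (\<lambda>x. (f' x)\<^sup>2) p \<le> vint (\<lambda>x. (f'' x)\<^sup>2) p"
proof -
  have *: "pdv 3 (\<lambda>x. f x * f' x) (\<lambda>x. (f' x)\<^sup>2 + f x * f'' x)"
    by (rule pdv_cong, rule pdv_mult[OF f]) (auto simp: power2_eq_square)
  have "0 = vint (\<lambda>x. (f' x)\<^sup>2 + f x * f'' x) p"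
    using vint_pdv3[OF *, of p] by (simp add: bc)
  also have "\<dots> \<ge> vint (\<lambda>x. (f' x)\<^sup>2 - ((k\<^sup>2 / 2) * (f x)\<^sup>2 + (1 / (2 * k\<^sup>2)) * (f'' x)\<^sup>2)) p"
  proof (rule vint_mono_cslab)
    fix x
    have "0 \<le> (k * f x + f'' x / k)\<^sup>2" by simp
    also have "\<dots> = k\<^sup>2 * (f x)\<^sup>2 + 2 * (f x * f'' x) + (f'' x)\<^sup>2 / k\<^sup>2"
      using k by (simp add: power2_sum power_mult_distrib power_divide)
    finally show "(f' x)\<^sup>2 - ((k\<^sup>2 / 2) * (f x)\<^sup>2 + (1 / (2 * k\<^sup>2)) * (f'' x)\<^sup>2) \<le> (f' x)\<^sup>2 + f x * f'' x"
      by (simp add: field_simps)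
  qed (intro continuous_intros c)+
  also have "vint (\<lambda>x. (f' x)\<^sup>2 - ((k\<^sup>2 / 2) * (f x)\<^sup>2 + (1 / (2 * k\<^sup>2)) * (f'' x)\<^sup>2)) p
      = vint (\<lambda>x. (f' x)\<^sup>2) p - ((k\<^sup>2 / 2) * vint (\<lambda>x. (f x)\<^sup>2) p + (1 / (2 * k\<^sup>2)) * vint (\<lambda>x. (f'' x)\<^sup>2) p)"
    by (subst vint_diff, (intro continuous_intros c)+, subst vint_add, (intro continuous_intros c)+) (simp only: vint_cmult)
  finally have 1: "vint (\<lambda>x. (f' x)\<^sup>2) p \<le> (k\<^sup>2 / 2) * vint (\<lambda>x. (f x)\<^sup>2) p + (1 / (2 * k\<^sup>2)) * vint (\<lambda>x. (f'' x)\<^sup>2) p"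
    by simp
  have "(k\<^sup>2 / 2) * vint (\<lambda>x. (f x)\<^sup>2) p \<le> (1/2) * vint (\<lambda>x. (f' x)\<^sup>2) p"
    using vint_Wirtinger[OF f(1) c(1,2) k bc, of p] by simp
  with 1 have "vint (\<lambda>x. (f' x)\<^sup>2) p \<le> (1 / k\<^sup>2) * vint (\<lambda>x. (f'' x)\<^sup>2) p" by simp
  then show ?thesis using k by (simp add: field_simps)
qed

text \<open>As \<open>h\<close> has mean zero, \<open>f\<close> may be replaced by
  \<open>f - f a\<close>, whose modulus is at most the total variation of \<open>f\<close>.\<close>

lemma integral_zero_mean_bound:
  fixes f f' h :: "real \<Rightarrow> real"
  assumes ab: "a \<le> b" and d: "\<And>x. a \<le> x \<Longrightarrow> x \<le> b \<Longrightarrow> (f has_real_derivative f' x) (at x)"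
    and c: "continuous_on {a..b} f'" "continuous_on {a..b} h"
    and 0: "integral {a..b} h = 0"
  shows "\<bar>integral {a..b} (\<lambda>x. f x * h x)\<bar> \<le> integral {a..b} (\<lambda>x. \<bar>f' x\<bar>) * integral {a..b} (\<lambda>x. \<bar>h x\<bar>)"
proof -
  have cf: "continuous_on {a..b} f"
    by (auto intro!: continuous_at_imp_continuous_on DERIV_isCont d)
  have le: "\<bar>f x - f a\<bar> \<le> integral {a..b} (\<lambda>x. \<bar>f' x\<bar>)" if x: "x \<in> {a..b}" for x
  proof -
    have s: "{a..x} \<subseteq> {a..b}" using x by auto
    have "(f' has_integral (f x - f a)) {a..x}"
      by (rule fundamental_theorem_of_calculus) (use x in \<open>auto intro!: has_vector_derivative_within_real d\<close>)
    then have "\<bar>f x - f a\<bar> = \<bar>integral {a..x} f'\<bar>" by (simp add: integral_unique)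
    also have "\<dots> \<le> integral {a..x} (\<lambda>x. \<bar>f' x\<bar>)"
      using integral_norm_bound_integral[of f' "{a..x}" "\<lambda>x. \<bar>f' x\<bar>"] continuous_on_subset[OF c(1) s]
      by (auto intro!: integrable_continuous_interval continuous_intros)
    also have "\<dots> \<le> integral {a..b} (\<lambda>x. \<bar>f' x\<bar>)"
      by (intro integral_subset_le s integrable_continuous_interval continuous_intros c continuous_on_subset[OF c(1) s]) auto
    finally show ?thesis .
  qed
  have "integral {a..b} (\<lambda>x. f x * h x) = integral {a..b} (\<lambda>x. (f x - f a) * h x + f a * h x)"
    by (simp add: algebra_simps)
  also have "\<dots> = integral {a..b} (\<lambda>x. (f x - f a) * h x) + f a * integral {a..b} h"
    by (subst integral_add) (auto intro!: integrable_continuous_interval continuous_intros c cf)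
  finally have "\<bar>integral {a..b} (\<lambda>x. f x * h x)\<bar> = \<bar>integral {a..b} (\<lambda>x. (f x - f a) * h x)\<bar>"
    using 0 by simp
  also have "\<dots> \<le> integral {a..b} (\<lambda>x. integral {a..b} (\<lambda>x. \<bar>f' x\<bar>) * \<bar>h x\<bar>)"
  proof -
    have "norm (integral {a..b} (\<lambda>x. (f x - f a) * h x)) \<le> integral {a..b} (\<lambda>x. integral {a..b} (\<lambda>x. \<bar>f' x\<bar>) * \<bar>h x\<bar>)"
      by (rule integral_norm_bound_integral)
         (use le in \<open>auto intro!: integrable_continuous_interval continuous_intros c cf mult_right_mono simp: abs_mult\<close>)
    then show ?thesis by simp
  qed
  also have "\<dots> = integral {a..b} (\<lambda>x. \<bar>f' x\<bar>) * integral {a..b} (\<lambda>x. \<bar>h x\<bar>)"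
    by (rule integral_mult_right)
  finally show ?thesis .
qed

lemma hint_mono_radius_on:
  assumes "continuous_on UNIV e" "\<And>a b. \<bar>a\<bar> \<le> R' \<Longrightarrow> \<bar>b\<bar> \<le> R' \<Longrightarrow> 0 \<le> e (a, b)" "R \<le> R'"
  shows "hint R e \<le> hint R' e"
  unfolding hint_def by (intro integral_subset_le hint_integrable assms) (use assms in \<open>auto simp: cbox_Pair_iff abs_le_iff\<close>)

section \<open>Iteration of the energy inequality\<close>

text \<open>After \<open>n\<close> steps the remainder has factor \<open>q ^ n\<close> and radius
  \<open>\<kappa> ^ n * R\<close>, so quadratic growth turns it into a multiple of
  \<open>(q * \<kappa>^2) ^ n\<close>, which tends to zero. The constants \<open>B\<close> add up to
  at most \<open>2 * B\<close> because \<open>q\<close> is at most 1/4.\<close>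

lemma geometric_decay_bound:
  fixes E :: "real \<Rightarrow> real"
  assumes q: "0 \<le> q" "q * \<kappa>\<^sup>2 \<le> 1/4" and \<kappa>: "\<kappa> \<ge> 1" and B: "B \<ge> 0" and R0: "R0 \<ge> 1"
    and step: "\<And>R. R \<ge> R0 \<Longrightarrow> E R \<le> q * E (\<kappa> * R) + B"
    and growth: "\<And>R. R \<ge> 1 \<Longrightarrow> E R \<le> C * R\<^sup>2"
    and R: "R \<ge> R0"
  shows "E R \<le> 2 * B"
proof -
  have "1 \<le> \<kappa>\<^sup>2" using \<kappa> by (simp add: one_le_power)
  then have "q * 1 \<le> q * \<kappa>\<^sup>2" using q by (intro mult_left_mono) auto
  then have q4: "q \<le> 1/4" using q by simp
  have iter: "E R \<le> q ^ n * E (\<kappa> ^ n * R) + 2 * B" if "R \<ge> R0" for n R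
    using that
  proof (induction n arbitrary: R)
    case 0 then show ?case using B by simp
  next
    case (Suc n)
    have "1 * R \<le> \<kappa> * R" using \<kappa> Suc.prems R0 by (intro mult_right_mono) auto
    then have "E (\<kappa> * R) \<le> q ^ n * E (\<kappa> ^ n * (\<kappa> * R)) + 2 * B" using Suc by simp
    then have "q * E (\<kappa> * R) \<le> q * (q ^ n * E (\<kappa> ^ n * (\<kappa> * R)) + 2 * B)" using q by (intro mult_left_mono)
    moreover have "q * (2 * B) \<le> 1/4 * (2 * B)" using q4 B by (intro mult_right_mono) auto
    ultimately show ?case using step[OF Suc.prems] B by (simp add: algebra_simps)
  qed
  have "E R \<le> (1/4) ^ n * (\<bar>C\<bar> * R\<^sup>2) + 2 * B" for n
  proof -
    have "1 * 1 \<le> \<kappa> ^ n * R" using \<kappa> R R0 by (intro mult_mono) auto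
    then have "E (\<kappa> ^ n * R) \<le> C * (\<kappa> ^ n * R)\<^sup>2" by (intro growth) simp
    also have "\<dots> \<le> \<bar>C\<bar> * (\<kappa> ^ n * R)\<^sup>2" by (intro mult_right_mono) auto
    finally have "q ^ n * E (\<kappa> ^ n * R) \<le> q ^ n * (\<bar>C\<bar> * (\<kappa> ^ n * R)\<^sup>2)"
      using q by (intro mult_left_mono) auto
    also have "\<dots> = (q * \<kappa>\<^sup>2) ^ n * (\<bar>C\<bar> * R\<^sup>2)"
      by (simp add: power_mult_distrib mult_ac flip: power_mult)
    also have "\<dots> \<le> (1/4) ^ n * (\<bar>C\<bar> * R\<^sup>2)"
      using q by (intro mult_right_mono power_mono) auto
    finally show ?thesis using iter[OF R, of n] by simp
  qed
  moreover have "(\<lambda>n. (1/4) ^ n * (\<bar>C\<bar> * R\<^sup>2) + 2 * B) \<longlonglongrightarrow> 0 * (\<bar>C\<bar> * R\<^sup>2) + 2 * B"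
    by (intro tendsto_intros LIMSEQ_power_zero) auto
  ultimately show ?thesis using LIMSEQ_le_const[of _ "2*B" "E R"] by simp
qed

lemma energy_iteration:
  fixes e :: "real \<times> real \<Rightarrow> real"
  assumes ce: "continuous_on UNIV e" and e0: "\<And>p. 0 \<le> e p" and \<kappa>: "\<kappa> \<ge> 1" and C: "C \<ge> 0"
    and growth: "\<And>R. R \<ge> 1 \<Longrightarrow> hint R e \<le> C * R\<^sup>2"
    and ineq: "\<And>\<tau>. \<tau> > 0 \<Longrightarrow> \<exists>\<eta>. (\<eta> \<longlongrightarrow> 0) at_top \<and> (\<forall>R\<ge>1. hint R e \<le>
        \<tau> * hint (\<kappa> * R) (\<lambda>p. ((fst p)\<^sup>2 + (snd p)\<^sup>2) / (\<kappa> * R)\<^sup>2 * e p) + C / \<tau> + \<eta> R * (1 + hint (\<kappa> * R) e))"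
  shows "e p = 0"
proof -
  define E where "E R = hint R e" for R
  define W where "W R = hint R (\<lambda>p. ((fst p)\<^sup>2 + (snd p)\<^sup>2) / R\<^sup>2 * e p)" for R
  have mono: "E R \<le> E R'" if "R \<le> R'" for R R'
    unfolding E_def by (rule hint_mono_radius[OF ce e0 that])
  have E0: "0 \<le> E R" for R unfolding E_def by (rule hint_nonneg[OF ce e0])
  have wle: "(a\<^sup>2 + b\<^sup>2) / R\<^sup>2 \<le> 2" if "\<bar>a\<bar> \<le> R" "\<bar>b\<bar> \<le> R" "R > 0" for a b R :: real
  proof -
    have "a\<^sup>2 \<le> R\<^sup>2" "b\<^sup>2 \<le> R\<^sup>2" using that by (auto simp: abs_le_square_iff[symmetric])
    then show ?thesis using that by (simp add: field_simps)
  qed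
  have cw: "continuous_on UNIV (\<lambda>p. ((fst p)\<^sup>2 + (snd p)\<^sup>2) / R\<^sup>2 * e p)" for R
  proof -
    have "continuous_on UNIV (\<lambda>p. ((fst p)\<^sup>2 + (snd p)\<^sup>2) * inverse (R\<^sup>2) * e p)"
      by (intro continuous_intros ce)
    then show ?thesis by (simp add: divide_inverse)
  qed
  \<comment> \<open>Splits the square at \<open>S\<close>. Outside, the weight is at most 2; inside,
    it is at most \<open>2 * S^2 / R^2\<close>. So a fixed inner region stops contributing as
    \<open>R\<close> grows and \<open>W\<close> sees only the tail of the energy.\<close>
  have WE: "W R \<le> 2 * (E R - E S) + 2 * S\<^sup>2 / R\<^sup>2 * E S" if "0 < S" "S \<le> R" for R S
  proof -
    have R: "R > 0" using that by simp
    define w where "w p = 2 - ((fst p)\<^sup>2 + (snd p)\<^sup>2) / R\<^sup>2" for p :: "real \<times> real"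
    have cwe: "continuous_on UNIV (\<lambda>p. w p * e p)"
      using continuous_on_diff[OF continuous_on_mult[OF continuous_on_const[of _ 2] ce] cw[of R]]
      by (simp add: w_def left_diff_distrib)
    have "2 * E R - W R = hint R (\<lambda>p. w p * e p)"
    proof -
      have "2 * E R = hint R (\<lambda>p. 2 * e p)" by (simp add: E_def hint_cmult)
      also have "\<dots> = hint R (\<lambda>p. w p * e p + ((fst p)\<^sup>2 + (snd p)\<^sup>2) / R\<^sup>2 * e p)"
        by (simp add: w_def left_diff_distrib)
      also have "\<dots> = hint R (\<lambda>p. w p * e p) + W R"
        unfolding W_def by (rule hint_add[OF cwe cw])
      finally show ?thesis by simp
    qed
    also have "\<dots> \<ge> hint S (\<lambda>p. w p * e p)"
      by (rule hint_mono_radius_on[OF cwe _ that(2)]) (use wle R e0 in \<open>auto simp: w_def\<close>)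
    also have "hint S (\<lambda>p. w p * e p) \<ge> hint S (\<lambda>p. (2 - 2 * S\<^sup>2 / R\<^sup>2) * e p)"
    proof (rule hint_mono[OF _ cwe])
      fix a b assume ab: "\<bar>a\<bar> \<le> S" "\<bar>b\<bar> \<le> S"
      have "a\<^sup>2 \<le> S\<^sup>2" "b\<^sup>2 \<le> S\<^sup>2" using that ab by (auto simp: abs_le_square_iff[symmetric])
      then have "(a\<^sup>2 + b\<^sup>2) / R\<^sup>2 \<le> 2 * S\<^sup>2 / R\<^sup>2" by (intro divide_right_mono) auto
      then show "(2 - 2 * S\<^sup>2 / R\<^sup>2) * e (a, b) \<le> w (a, b) * e (a, b)"
        by (intro mult_right_mono e0) (simp add: w_def)
    qed (intro continuous_intros ce)
    finally have "(2 - 2 * S\<^sup>2 / R\<^sup>2) * E S \<le> 2 * E R - W R" by (simp add: hint_cmult E_def)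
    then show ?thesis by (simp add: algebra_simps)
  qed
  have W2: "W R \<le> 2 * E R" if "R > 0" for R
    using WE[of R R] that by simp
  have ineq': "\<exists>\<eta>. (\<eta> \<longlongrightarrow> 0) at_top \<and> (\<forall>R\<ge>1. E R \<le> \<tau> * W (\<kappa> * R) + C / \<tau> + \<eta> R * (1 + E (\<kappa> * R)))"
    if "\<tau> > 0" for \<tau>
    using ineq[OF that] by (simp add: E_def W_def)
  have bdd: "\<exists>K. \<forall>R. E R \<le> K"
  proof -
    \<comment> \<open>The weighted energy contributes \<open>2 * \<tau>\<close> by \<open>W2\<close>
      and the error term one more \<open>\<tau>\<close>. The choice makes
      \<open>3 * \<tau> * \<kappa>^2\<close> equal to 1/4, as \<open>geometric_decay_bound\<close>
      requires.\<close>
    define \<tau> where "\<tau> = 1 / (12 * \<kappa>\<^sup>2)"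
    have \<tau>: "\<tau> > 0" using \<kappa> by (simp add: \<tau>_def)
    obtain \<eta> where \<eta>: "(\<eta> \<longlongrightarrow> 0) at_top" "\<And>R. R \<ge> 1 \<Longrightarrow> E R \<le> \<tau> * W (\<kappa> * R) + C / \<tau> + \<eta> R * (1 + E (\<kappa> * R))"
      using ineq'[OF \<tau>] by blast
    obtain N where N: "\<And>R. R \<ge> N \<Longrightarrow> \<eta> R < \<tau>"
      using order_tendstoD(2)[OF \<eta>(1) \<tau>] unfolding eventually_at_top_linorder by blast
    define R0 where "R0 = max 1 N"
    have "E R \<le> 2 * (C / \<tau> + \<tau>)" if "R \<ge> R0" for R
    proof (rule geometric_decay_bound[of "3 * \<tau>" \<kappa> "C / \<tau> + \<tau>" R0 E C])
      show "3 * \<tau> * \<kappa>\<^sup>2 \<le> 1 / 4" using \<kappa> by (simp add: \<tau>_def)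
      fix R assume R: "R \<ge> R0"
      then have R1: "R \<ge> 1" "R \<ge> N" by (auto simp: R0_def)
      have "\<kappa> * R > 0" using \<kappa> R1 by simp
      then have "\<tau> * W (\<kappa> * R) \<le> \<tau> * (2 * E (\<kappa> * R))" using \<tau> by (intro mult_left_mono W2) auto
      moreover have "\<eta> R * (1 + E (\<kappa> * R)) \<le> \<tau> * (1 + E (\<kappa> * R))"
        using N[OF R1(2)] E0[of "\<kappa> * R"] by (intro mult_right_mono) auto
      ultimately show "E R \<le> 3 * \<tau> * E (\<kappa> * R) + (C / \<tau> + \<tau>)"
        using \<eta>(2)[OF R1(1)] by (simp add: algebra_simps)
    qed (use \<tau> C \<kappa> growth that in \<open>auto simp: R0_def E_def\<close>)
    then have "E R \<le> 2 * (C / \<tau> + \<tau>)" for R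
      by (metis mono order_trans max.cobounded1 max.cobounded2)
    then show ?thesis by blast
  qed
  then obtain K where K: "\<And>R. E R \<le> K" by blast
  have tail: "\<exists>S>0. \<forall>R. E R - E S \<le> \<delta>" if "\<delta> > 0" for \<delta>
  proof -
    have bd: "bdd_above (range E)" using K by (auto intro!: bdd_aboveI)
    have "(SUP R. E R) - \<delta> < (SUP R. E R)" using that by simp
    then obtain S where S: "(SUP R. E R) - \<delta> < E S"
      using bd by (auto simp: less_cSUP_iff)
    have "E R - E (max 1 S) \<le> \<delta>" for R
      using cSUP_upper[OF _ bd, of R] S mono[of S "max 1 S"] by simp
    then show ?thesis by (intro exI[of _ "max 1 S"]) auto
  qed
  \<comment> \<open>With \<open>\<tau>\<close> fixed, let the radius in the inequality tend to
    infinity: the inner square contributes order \<open>1/R^2\<close>, the tail at most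
    \<open>2 * \<delta>\<close>, and the \<open>\<eta>\<close> term dies out because
    \<open>E\<close> is bounded.\<close>
  have small: "E R1 \<le> \<tau> * (2 * \<delta>) + C / \<tau>" if \<tau>: "\<tau> > 0" and \<delta>: "\<delta> > 0" for R1 \<tau> \<delta>
  proof -
    obtain S where S: "S > 0" "\<And>R. E R - E S \<le> \<delta>" using tail[OF \<delta>] by blast
    obtain \<eta> where \<eta>: "(\<eta> \<longlongrightarrow> 0) at_top" "\<And>R. R \<ge> 1 \<Longrightarrow> E R \<le> \<tau> * W (\<kappa> * R) + C / \<tau> + \<eta> R * (1 + E (\<kappa> * R))"
      using ineq'[OF \<tau>] by blast
    have "((\<lambda>R. \<tau> * (2 * \<delta> + (2 * S\<^sup>2 * K / \<kappa>\<^sup>2) * (inverse R)\<^sup>2) + C / \<tau> + \<bar>\<eta> R\<bar> * (1 + K)) \<longlongrightarrow>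
       \<tau> * (2 * \<delta> + (2 * S\<^sup>2 * K / \<kappa>\<^sup>2) * 0\<^sup>2) + C / \<tau> + \<bar>0\<bar> * (1 + K)) at_top"
      by (intro tendsto_intros \<eta>(1) tendsto_inverse_0_at_top filterlim_ident)
    moreover have "eventually (\<lambda>R. E R1 \<le> \<tau> * (2 * \<delta> + (2 * S\<^sup>2 * K / \<kappa>\<^sup>2) * (inverse R)\<^sup>2) + C / \<tau> + \<bar>\<eta> R\<bar> * (1 + K)) at_top"
      using eventually_ge_at_top[of "max 1 (max R1 S)"]
    proof eventually_elim
      case (elim R)
      then have R: "R \<ge> 1" "R1 \<le> R" "S \<le> R" by auto
      have "1 * R \<le> \<kappa> * R" using \<kappa> R by (intro mult_right_mono) auto
      then have "S \<le> \<kappa> * R" using R(3) by linarith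
      then have "W (\<kappa> * R) \<le> 2 * (E (\<kappa> * R) - E S) + 2 * S\<^sup>2 / (\<kappa> * R)\<^sup>2 * E S"
        using S by (intro WE)
      also have "\<dots> \<le> 2 * \<delta> + 2 * S\<^sup>2 / (\<kappa> * R)\<^sup>2 * K"
        using S(2)[of "\<kappa> * R"] K[of S] by (intro add_mono mult_left_mono) auto
      also have "\<dots> = 2 * \<delta> + (2 * S\<^sup>2 * K / \<kappa>\<^sup>2) * (inverse R)\<^sup>2"
        by (simp add: power_mult_distrib divide_simps)
      finally have "\<tau> * W (\<kappa> * R) \<le> \<tau> * \<dots>" using \<tau> by (intro mult_left_mono) auto
      moreover have "\<eta> R * (1 + E (\<kappa> * R)) \<le> \<bar>\<eta> R\<bar> * (1 + K)"
        using K[of "\<kappa> * R"] E0[of "\<kappa> * R"] by (intro mult_mono) auto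
      ultimately show ?case using \<eta>(2)[OF R(1)] mono[OF R(2)] by simp
    qed
    ultimately show ?thesis
      using tendsto_lowerbound[of _ _ at_top "E R1"] by force
  qed
  have "E R = 0" for R
  proof (rule ccontr)
    assume "E R \<noteq> 0"
    then have pos: "E R > 0" using E0[of R] by simp
    \<comment> \<open>Large \<open>\<tau>\<close> makes \<open>C / \<tau>\<close> small, and
      \<open>\<delta> = 1 / \<tau>^2\<close> keeps the tail term of the same order. The sum
      \<open>(2 + C) / \<tau>\<close> is then exactly half of \<open>E R\<close>.\<close>
    define \<tau> where "\<tau> = 2 * (2 + C) / E R"
    have \<tau>: "\<tau> > 0" using pos C by (simp add: \<tau>_def)
    have "E R \<le> \<tau> * (2 * (1 / \<tau>\<^sup>2)) + C / \<tau>" using \<tau> by (intro small) auto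
    also have "\<dots> = (2 + C) / \<tau>" using \<tau> by (simp add: power2_eq_square field_simps)
    also have "\<dots> = E R / 2" using pos C by (simp add: \<tau>_def field_simps)
    finally show False using pos by simp
  qed
  define R where "R = 1 + \<bar>fst p\<bar> + \<bar>snd p\<bar>"
  have "integral (cbox (-R,-R) (R,R)) e = 0" using \<open>E R = 0\<close> by (simp add: E_def hint_def)
  moreover have "continuous_on (cbox (-R,-R) (R,R)) e" using ce by (rule continuous_on_subset) simp
  moreover have "box (-R,-R) (R,R) \<noteq> {}"
  proof -
    have "(0,0) \<in> box (-R,-R) (R,R)" by (auto simp: mem_box Basis_prod_def R_def)
    then show ?thesis by blast
  qed
  ultimately have "\<forall>x\<in>cbox (-R,-R) (R,R). e x = 0"
    by (subst integral_cbox_eq_0_iff[symmetric]) (use e0 in auto)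
  moreover have "p \<in> cbox (-R,-R) (R,R)" by (cases p) (auto simp: cbox_Pair_iff R_def)
  ultimately show ?thesis by blast
qed

section \<open>Cutoff functions\<close>

definition rho :: "real \<Rightarrow> real^3 \<Rightarrow> real" where
  "rho R x = ((x$1)\<^sup>2 + (x$2)\<^sup>2) / R\<^sup>2"

text \<open>Squaring \<open>rho\<close> makes each first derivative carry a factor
  \<open>rho\<close>, which later produces the weighted energy. The positive part is not
  differentiable at the edge, but its powers from the second on are.\<close>

definition cutoff :: "real \<Rightarrow> real^3 \<Rightarrow> real" where
  "cutoff R x = max 0 (1 - (rho R x)\<^sup>2)"

text \<open>Half the gradient of the squared distance to the axis.\<close>

definition hx :: "3 \<Rightarrow> real^3 \<Rightarrow> real" where
  "hx j x = (if j = 3 then 0 else x$j)"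

lemma continuous_on_rho [continuous_intros]: "continuous_on A (rho R)"
proof -
  have "continuous_on A (\<lambda>x. ((x$1)\<^sup>2 + (x$2)\<^sup>2) * inverse (R\<^sup>2))" by (intro continuous_intros)
  then show ?thesis by (simp add: rho_def[abs_def] divide_inverse)
qed

lemma continuous_on_cutoff [continuous_intros]: "continuous_on A (cutoff R)"
  unfolding cutoff_def[abs_def] by (intro continuous_intros)

lemma continuous_on_hx [continuous_intros]: "continuous_on A (hx j)"
  unfolding hx_def[abs_def] by (cases "j = 3") (auto intro!: continuous_intros)

lemma DERIV_max_power:
  "((\<lambda>s. max 0 s ^ Suc (Suc n)) has_real_derivative real (n + 2) * max 0 s ^ Suc n) (at s)"
proof -
  consider "s > 0" | "s < 0" | "s = 0" by linarith
  then show ?thesis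
  proof cases
    case 1
    have "((\<lambda>s. s ^ Suc (Suc n)) has_real_derivative real (n + 2) * max 0 s ^ Suc n) (at s)"
      using 1 DERIV_pow[of "Suc (Suc n)" s] by simp
    then show ?thesis
      by (rule has_field_derivative_transform_within_open[of _ _ _ "{0<..}"]) (use 1 in auto)
  next
    case 2
    have "((\<lambda>s. 0) has_real_derivative real (n + 2) * max 0 s ^ Suc n) (at s)"
      using 2 by (auto intro!: derivative_eq_intros)
    then show ?thesis
      by (rule has_field_derivative_transform_within_open[of _ _ _ "{..<0}"]) (use 2 in auto)
  next
    case 3
    have "((\<lambda>h. max 0 h ^ Suc n) \<longlongrightarrow> max 0 0 ^ Suc n) (at (0::real))"
      by (intro tendsto_intros)
    \<comment> \<open>At the kink the difference quotient is itself a positive power of the positive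
      part, and so tends to zero.\<close>
    moreover have "eventually (\<lambda>h. max 0 h ^ Suc n = (max 0 (0 + h) ^ Suc (Suc n) - max 0 0 ^ Suc (Suc n)) / h) (at (0::real))"
      by (auto simp: eventually_at_filter max_def)
    ultimately have "((\<lambda>h. (max 0 (0 + h) ^ Suc (Suc n) - max 0 0 ^ Suc (Suc n)) / h) \<longlongrightarrow> 0) (at (0::real))"
      by (subst tendsto_cong[symmetric]) auto
    then show ?thesis using 3 by (simp add: DERIV_def)
  qed
qed

lemma pdv_hx: "pdv j (hx k) (\<lambda>x. if j = k \<and> k \<noteq> 3 then 1 else 0)"
  using pdv_coord[of j k] pdv_const[of j 0] unfolding hx_def[abs_def] by (cases "k = 3") auto

lemma pdv_rho: "pdv j (rho R) (\<lambda>x. 2 * hx j x / R\<^sup>2)"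
proof -
  have "pdv j (\<lambda>x. ((x$1)\<^sup>2 + (x$2)\<^sup>2) * (1 / R\<^sup>2)) (\<lambda>x. 2 * hx j x / R\<^sup>2)"
    by (rule pdv_cong, rule pdv_mult[OF pdv_add[OF pdv_power[OF pdv_coord] pdv_power[OF pdv_coord]] pdv_const])
       (use exhaust_3[of j] in \<open>auto simp: hx_def\<close>)
  then show ?thesis by (simp add: rho_def[abs_def])
qed

lemma pdv_cutoff:
  "pdv j (\<lambda>x. cutoff R x ^ Suc (Suc n)) (\<lambda>x. - (real (n + 2) * 4 / R\<^sup>2) * (cutoff R x ^ Suc n * rho R x * hx j x))"
proof -
  have "pdv j (\<lambda>x. max 0 (1 - (rho R x)\<^sup>2) ^ Suc (Suc n))
     (\<lambda>x. real (n + 2) * max 0 (1 - (rho R x)\<^sup>2) ^ Suc n * (0 - real 2 * rho R x ^ (2 - 1) * (2 * hx j x / R\<^sup>2)))"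
    by (rule pdv_chain[where h = "\<lambda>s. max 0 s ^ Suc (Suc n)" and h' = "\<lambda>s. real (n + 2) * max 0 s ^ Suc n",
          OF pdv_diff[OF pdv_const pdv_power[OF pdv_rho]] DERIV_max_power])
  then show ?thesis unfolding cutoff_def[symmetric] by (rule pdv_cong) simp
qed

lemma cutoff_nonneg: "0 \<le> cutoff R x" and cutoff_le1: "cutoff R x \<le> 1"
  by (auto simp: cutoff_def)

lemma rho_nonneg: "0 \<le> rho R x" by (simp add: rho_def)

lemma cutoff_lateral:
  assumes "R > 0" "\<bar>x$1\<bar> = R \<or> \<bar>x$2\<bar> = R"
  shows "cutoff R x = 0"
proof -
  have "(x$1)\<^sup>2 = R\<^sup>2 \<or> (x$2)\<^sup>2 = R\<^sup>2" using assms by (metis power2_abs)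
  then have "R\<^sup>2 \<le> (x$1)\<^sup>2 + (x$2)\<^sup>2" by auto
  then have "1 \<le> rho R x" using assms by (simp add: rho_def)
  then have "1 \<le> (rho R x)\<^sup>2" by (simp add: one_le_power)
  then show ?thesis by (simp add: cutoff_def)
qed

lemma cutoff_ge:
  assumes "R > 0" "\<bar>x$1\<bar> \<le> R" "\<bar>x$2\<bar> \<le> R"
  shows "3/4 \<le> cutoff (2 * R) x"
proof -
  have "(x$1)\<^sup>2 \<le> R\<^sup>2" "(x$2)\<^sup>2 \<le> R\<^sup>2" using assms by (auto simp: abs_le_square_iff[symmetric])
  then have "rho (2 * R) x \<le> 1/2" using assms by (simp add: rho_def field_simps)
  then have "(rho (2 * R) x)\<^sup>2 \<le> (1/2)\<^sup>2" using rho_nonneg by (intro power_mono) auto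
  then show ?thesis by (simp add: cutoff_def power2_eq_square)
qed

lemma cutoff_nz: "cutoff R x \<noteq> 0 \<Longrightarrow> rho R x \<le> 1"
  using rho_nonneg[of R x] abs_square_le_1[of "rho R x"] by (auto simp: cutoff_def max_def split: if_splits)

lemma hx_le: "R > 0 \<Longrightarrow> \<bar>hx j x\<bar> \<le> R * sqrt (rho R x)"
proof -
  assume R: "R > 0"
  have "(hx j x)\<^sup>2 \<le> (x$1)\<^sup>2 + (x$2)\<^sup>2" using exhaust_3[of j] by (auto simp: hx_def)
  then have "\<bar>hx j x\<bar> \<le> sqrt ((x$1)\<^sup>2 + (x$2)\<^sup>2)" by (metis real_sqrt_abs real_sqrt_le_mono)
  also have "\<dots> = R * sqrt (rho R x)" using R by (simp add: rho_def real_sqrt_divide)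
  finally show ?thesis .
qed

section \<open>First and second derivatives of powers of the cutoff\<close>

definition dcut :: "nat \<Rightarrow> real \<Rightarrow> 3 \<Rightarrow> real^3 \<Rightarrow> real" where
  "dcut n R j x = - (real (n + 2) * 4 / R\<^sup>2) * (cutoff R x ^ Suc n * rho R x * hx j x)"

text \<open>While \<open>dcut n R j\<close> is the derivative of \<open>cutoff R x ^ (n + 2)\<close>
  in direction \<open>j\<close>, this is the second derivative of the fourth power in directions
  \<open>j\<close> and \<open>l\<close>.\<close>

definition ddcut :: "real \<Rightarrow> 3 \<Rightarrow> 3 \<Rightarrow> real^3 \<Rightarrow> real" where
  "ddcut R l j x = - (16 / R\<^sup>2) * ((- (12 / R\<^sup>2) * (cutoff R x ^ 2 * rho R x * hx l x)) * (rho R x * hx j x)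
     + cutoff R x ^ 3 * (2 * hx l x / R\<^sup>2 * hx j x + rho R x * (if l = j \<and> j \<noteq> 3 then 1 else 0)))"

lemma pdv_cutoff4: "pdv j (\<lambda>x. cutoff R x ^ 4) (dcut 2 R j)"
  using pdv_cutoff[of j R 2] by (simp add: dcut_def[abs_def] eval_nat_numeral)

lemma pdv_cutoff2: "pdv j (\<lambda>x. cutoff R x ^ 2) (dcut 0 R j)"
  using pdv_cutoff[of j R 0] by (simp add: dcut_def[abs_def] eval_nat_numeral)

lemma pdv_cutoff3: "pdv j (\<lambda>x. cutoff R x ^ 3) (dcut 1 R j)"
  using pdv_cutoff[of j R 1] by (simp add: dcut_def[abs_def] eval_nat_numeral)

lemma pdv_dcut: "pdv l (dcut 2 R j) (ddcut R l j)"
  unfolding dcut_def[abs_def] ddcut_def[abs_def]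
  by (rule pdv_cong, rule pdv_mult[OF pdv_const])
     (use pdv_mult[OF pdv_mult[OF pdv_cutoff3[of l R] pdv_rho] pdv_hx, of R j] in \<open>simp add: dcut_def[abs_def] mult.assoc eval_nat_numeral\<close>,
      simp add: dcut_def eval_nat_numeral algebra_simps)

lemma continuous_on_dcut [continuous_intros]: "continuous_on A (dcut n R j)"
  unfolding dcut_def[abs_def] by (intro continuous_intros)

lemma continuous_on_ddcut [continuous_intros]: "continuous_on A (ddcut R l j)"
proof -
  have "continuous_on A (\<lambda>x. - (16 / R\<^sup>2) * ((- (12 / R\<^sup>2) * (cutoff R x ^ 2 * rho R x * hx l x)) * (rho R x * hx j x)
     + cutoff R x ^ 3 * (2 * hx l x * (1 / R\<^sup>2) * hx j x + rho R x * (if l = j \<and> j \<noteq> 3 then 1 else 0))))"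
    by (intro continuous_intros)
  then show ?thesis by (simp add: ddcut_def[abs_def])
qed

lemma dcut_3 [simp]: "dcut n R 3 x = 0"
  by (simp add: dcut_def hx_def)

lemma dcut_lateral:
  assumes "R > 0" "\<bar>x$1\<bar> = R \<or> \<bar>x$2\<bar> = R"
  shows "dcut n R j x = 0"
  by (simp add: dcut_def cutoff_lateral[OF assms])

lemma dcut_bound:
  assumes R: "R > 0"
  shows "\<bar>dcut n R j x\<bar> \<le> real (n + 2) * 4 / R * (cutoff R x ^ Suc n * (rho R x * sqrt (rho R x)))"
proof -
  have "\<bar>dcut n R j x\<bar> = real (n + 2) * 4 / R\<^sup>2 * (cutoff R x ^ Suc n * rho R x * \<bar>hx j x\<bar>)"
    by (simp add: dcut_def abs_mult cutoff_nonneg rho_nonneg)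
  also have "\<dots> \<le> real (n + 2) * 4 / R\<^sup>2 * (cutoff R x ^ Suc n * rho R x * (R * sqrt (rho R x)))"
    using R by (intro mult_left_mono hx_le) (auto simp: cutoff_nonneg rho_nonneg)
  also have "\<dots> = real (n + 2) * 4 / R * (cutoff R x ^ Suc n * (rho R x * sqrt (rho R x)))"
    using R by (simp add: power2_eq_square)
  finally show ?thesis .
qed

text \<open>Where the cutoff is nonzero \<open>rho\<close> is at most 1, so powers of it may be
  given up. The variants keep \<open>rho\<close>, \<open>sqrt rho\<close> or nothing: a factor
  \<open>sqrt rho\<close> becomes the weight after squaring in Young's inequality, a factor
  \<open>rho\<close> is the weight already.\<close>

lemma dcut_bound1:
  assumes R: "R > 0"
  shows "\<bar>dcut n R j x\<bar> \<le> real (n + 2) * 4 / R * (cutoff R x ^ Suc n * rho R x)"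
proof (cases "cutoff R x = 0")
  case False
  then have "sqrt (rho R x) \<le> 1" using cutoff_nz by (simp add: rho_nonneg)
  then have "real (n + 2) * 4 / R * (cutoff R x ^ Suc n * (rho R x * sqrt (rho R x))) \<le> real (n + 2) * 4 / R * (cutoff R x ^ Suc n * (rho R x * 1))"
    using R by (intro mult_left_mono) (auto simp: cutoff_nonneg rho_nonneg)
  then show ?thesis using dcut_bound[OF R, of n j x] by simp
qed (simp add: dcut_def)

lemma dcut_bound0:
  assumes R: "R > 0"
  shows "\<bar>dcut n R j x\<bar> \<le> real (n + 2) * 4 / R * (cutoff R x ^ Suc n * sqrt (rho R x))"
proof (cases "cutoff R x = 0")
  case False
  then have "rho R x * sqrt (rho R x) \<le> 1 * sqrt (rho R x)" using cutoff_nz by (intro mult_right_mono) (auto simp: rho_nonneg)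
  then have "real (n + 2) * 4 / R * (cutoff R x ^ Suc n * (rho R x * sqrt (rho R x))) \<le> real (n + 2) * 4 / R * (cutoff R x ^ Suc n * (1 * sqrt (rho R x)))"
    using R by (intro mult_left_mono) (auto simp: cutoff_nonneg rho_nonneg)
  then show ?thesis using dcut_bound[OF R, of n j x] by simp
qed (simp add: dcut_def)

lemma dcut_bound_cutoff:
  assumes R: "R > 0"
  shows "\<bar>dcut n R j x\<bar> \<le> real (n + 2) * 4 / R * cutoff R x ^ Suc n"
proof (cases "cutoff R x = 0")
  case False
  then have "cutoff R x ^ Suc n * rho R x \<le> cutoff R x ^ Suc n * 1" using cutoff_nz[OF False] by (intro mult_left_mono zero_le_power cutoff_nonneg)
  then have "real (n + 2) * 4 / R * (cutoff R x ^ Suc n * rho R x) \<le> real (n + 2) * 4 / R * (cutoff R x ^ Suc n * 1)"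
    using R by (intro mult_left_mono[where c = "real (n + 2) * 4 / R"]) auto
  then show ?thesis using dcut_bound1[OF R, of n j x] by simp
qed (simp add: dcut_def)

lemma ddcut_bound:
  assumes R: "R > 0"
  shows "\<bar>ddcut R l j x\<bar> \<le> 240 / R\<^sup>2 * (cutoff R x ^ 2 * rho R x)"
proof (cases "cutoff R x = 0")
  case False
  define q where "q = rho R x"
  define c where "c = cutoff R x"
  have q: "0 \<le> q" "q \<le> 1" using cutoff_nz[OF False] rho_nonneg by (auto simp: q_def)
  have c: "0 \<le> c" "c \<le> 1" by (simp_all add: c_def cutoff_nonneg cutoff_le1)
  have h: "\<bar>hx l x * hx j x\<bar> \<le> R\<^sup>2 * q"
  proof -
    have "\<bar>hx l x\<bar> * \<bar>hx j x\<bar> \<le> (R * sqrt q) * (R * sqrt q)"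
      using R by (intro mult_mono) (auto simp: q_def hx_le rho_nonneg)
    also have "\<dots> = R\<^sup>2 * (sqrt q * sqrt q)" by (simp add: power2_eq_square)
    also have "\<dots> = R\<^sup>2 * q" using q by simp
    finally show ?thesis by (simp add: abs_mult)
  qed
  define A where "A = hx l x * hx j x / R\<^sup>2"
  have A: "\<bar>A\<bar> \<le> q" using h R by (simp add: A_def abs_mult field_simps)
  define d where "d = (if l = j \<and> j \<noteq> 3 then 1 else 0 :: real)"
  have "ddcut R l j x = - (16 / R\<^sup>2) * (c\<^sup>2 * (- 12 * q\<^sup>2 * A + c * (2 * A + q * d)))"
    unfolding ddcut_def q_def[symmetric] c_def[symmetric] d_def[symmetric] A_def
    by (simp add: power2_eq_square power3_eq_cube divide_simps algebra_simps)
  then have "\<bar>ddcut R l j x\<bar> = 16 / R\<^sup>2 * (c\<^sup>2 * \<bar>- 12 * q\<^sup>2 * A + c * (2 * A + q * d)\<bar>)"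
    by (simp add: abs_mult)
  \<comment> \<open>In the bracket 12 comes from differentiating the power of the cutoff, 2 from
    differentiating \<open>rho\<close> and 1 from differentiating \<open>hx\<close>.\<close>
  also have "\<dots> \<le> 16 / R\<^sup>2 * (c\<^sup>2 * (15 * q))"
  proof (intro mult_left_mono)
    have "\<bar>- 12 * q\<^sup>2 * A + c * (2 * A + q * d)\<bar> \<le> \<bar>- 12 * q\<^sup>2 * A\<bar> + \<bar>c * (2 * A + q * d)\<bar>" by (rule abs_triangle_ineq)
    also have "\<bar>- 12 * q\<^sup>2 * A\<bar> \<le> 12 * q"
    proof -
      have "q\<^sup>2 * \<bar>A\<bar> \<le> 1 * q" using q A by (intro mult_mono) (auto simp: power_le_one)
      then show ?thesis by (simp add: abs_mult)
    qed
    also have "\<bar>c * (2 * A + q * d)\<bar> \<le> 3 * q"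
    proof -
      have "\<bar>2 * A + q * d\<bar> \<le> 3 * q" using A q by (auto simp: d_def)
      then have "c * \<bar>2 * A + q * d\<bar> \<le> 1 * (3 * q)" using c q by (intro mult_mono) auto
      then show ?thesis using c by (simp add: abs_mult)
    qed
    finally show "\<bar>- 12 * q\<^sup>2 * A + c * (2 * A + q * d)\<bar> \<le> 15 * q" by simp
  qed (use R in auto)
  finally show ?thesis by (simp add: c_def q_def)
qed (simp add: ddcut_def)

section \<open>Partial derivatives up to the boundary\<close>

lemma pd_has_derivative:
  assumes "smooth_on U f" "x \<in> U"
  shows "((\<lambda>t. iter_pd is f (x + t *\<^sub>R axis i 1)) has_real_derivative pd i (iter_pd is f) x) (at 0)"
  using assms unfolding smooth_on_def pd_def by (simp add: DERIV_deriv_iff_real_differentiable)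

lemma smooth_on_pd: "smooth_on U f \<Longrightarrow> smooth_on U (pd i f)"
proof -
  assume f: "smooth_on U f"
  have "iter_pd js (pd i f) = iter_pd (js @ [i]) f" for js
    by (induction js) auto
  then show ?thesis using f unfolding smooth_on_def by metis
qed

lemma smooth_on_continuous: "smooth_on U f \<Longrightarrow> continuous_on U f"
  unfolding smooth_on_def by (metis iter_pd.simps(1))

lemma pd_line:
  assumes "smooth_on U f" "x + s *\<^sub>R axis i 1 \<in> U"
  shows "((\<lambda>t. f (x + t *\<^sub>R axis i 1)) has_real_derivative pd i f (x + s *\<^sub>R axis i 1)) (at s)"
proof -
  have "((\<lambda>t. f (x + s *\<^sub>R axis i 1 + t *\<^sub>R axis i 1)) has_real_derivative pd i f (x + s *\<^sub>R axis i 1)) (at 0)"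
    using pd_has_derivative[OF assms, of "[]" i] by simp
  then have "((\<lambda>t. f (x + (t + s) *\<^sub>R axis i 1)) has_real_derivative pd i f (x + s *\<^sub>R axis i 1)) (at 0)"
    by (simp add: scaleR_add_left add_ac)
  then show ?thesis using DERIV_shift[of "\<lambda>t. f (x + t *\<^sub>R axis i 1)" "pd i f (x + s *\<^sub>R axis i 1)" 0 s] by simp
qed

text \<open>The second difference over a small square is, by the mean value theorem applied in either order, a value of either mixed derivative.\<close>
lemma mixed_difference:
  assumes f: "smooth_on U f" and h: "h > 0"
    and sq: "\<And>s t. 0 \<le> s \<Longrightarrow> s \<le> h \<Longrightarrow> 0 \<le> t \<Longrightarrow> t \<le> h \<Longrightarrow> x + s *\<^sub>R axis i 1 + t *\<^sub>R axis j 1 \<in> U"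
  shows "\<exists>s t. 0 \<le> s \<and> s \<le> h \<and> 0 \<le> t \<and> t \<le> h \<and>
    f (x + h *\<^sub>R axis i 1 + h *\<^sub>R axis j 1) - f (x + h *\<^sub>R axis i 1) - f (x + h *\<^sub>R axis j 1) + f x
      = h\<^sup>2 * pd j (pd i f) (x + s *\<^sub>R axis i 1 + t *\<^sub>R axis j 1)"
proof -
  define g where "g s = f (x + h *\<^sub>R axis j 1 + s *\<^sub>R axis i 1) - f (x + s *\<^sub>R axis i 1)" for s
  define g' where "g' s = pd i f (x + h *\<^sub>R axis j 1 + s *\<^sub>R axis i 1) - pd i f (x + s *\<^sub>R axis i 1)" for s
  have "\<exists>s. 0 < s \<and> s < h \<and> g h - g 0 = (h - 0) * g' s"
  proof (rule MVT2[OF h])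
    fix s assume s: "0 \<le> s" "s \<le> h"
    have "x + h *\<^sub>R axis j 1 + s *\<^sub>R axis i 1 \<in> U" "x + s *\<^sub>R axis i 1 \<in> U"
      using sq[of s h] sq[of s 0] s h by (auto simp: add_ac)
    then show "(g has_real_derivative g' s) (at s)"
      unfolding g_def g'_def by (intro DERIV_diff pd_line[OF f])
  qed
  then obtain s where s: "0 < s" "s < h" "g h - g 0 = h * g' s" by auto
  have "\<exists>t. 0 < t \<and> t < h \<and> pd i f (x + s *\<^sub>R axis i 1 + h *\<^sub>R axis j 1) - pd i f (x + s *\<^sub>R axis i 1 + 0 *\<^sub>R axis j 1)
     = (h - 0) * pd j (pd i f) (x + s *\<^sub>R axis i 1 + t *\<^sub>R axis j 1)"
    by (rule MVT2[OF h], rule pd_line[OF smooth_on_pd[OF f]]) (use sq s in auto)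
  then obtain t where t: "0 < t" "t < h" "pd i f (x + s *\<^sub>R axis i 1 + h *\<^sub>R axis j 1) - pd i f (x + s *\<^sub>R axis i 1)
     = h * pd j (pd i f) (x + s *\<^sub>R axis i 1 + t *\<^sub>R axis j 1)" by auto
  have "g' s = h * pd j (pd i f) (x + s *\<^sub>R axis i 1 + t *\<^sub>R axis j 1)"
    using t(3) by (simp add: g'_def add_ac)
  then have "g h - g 0 = h\<^sup>2 * pd j (pd i f) (x + s *\<^sub>R axis i 1 + t *\<^sub>R axis j 1)"
    using s(3) by (simp add: power2_eq_square)
  then show ?thesis using s t
    by (intro exI[of _ s] exI[of _ t]) (simp add: g_def add_ac)
qed

text \<open>Near \<open>x\<close> one and the same second difference is a value of either mixed
  derivative. Were the two values at \<open>x\<close> different, continuity would keep each mixed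
  derivative within half the gap of its own value, so they could not share a value.\<close>

lemma pd_commute:
  assumes f: "smooth_on U f" and x: "x \<in> U"
  shows "pd i (pd j f) x = pd j (pd i f) x"
proof (rule ccontr)
  define A where "A = pd j (pd i f)" define B where "B = pd i (pd j f)"
  assume "pd i (pd j f) x \<noteq> pd j (pd i f) x"
  then have e: "\<bar>A x - B x\<bar> / 2 > 0" by (simp add: A_def B_def)
  have U: "open U" using f by (simp add: smooth_on_def)
  have cont: "isCont A x" "isCont B x"
    using smooth_on_continuous[OF smooth_on_pd[OF smooth_on_pd[OF f]]] U x
    by (auto simp: A_def B_def continuous_on_eq_continuous_at)
  obtain d1 where d1: "d1 > 0" "\<And>y. dist y x < d1 \<Longrightarrow> dist (A y) (A x) < \<bar>A x - B x\<bar> / 2"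
    using cont(1) e unfolding continuous_at_eps_delta by metis
  obtain d2 where d2: "d2 > 0" "\<And>y. dist y x < d2 \<Longrightarrow> dist (B y) (B x) < \<bar>A x - B x\<bar> / 2"
    using cont(2) e unfolding continuous_at_eps_delta by metis
  obtain d3 where d3: "d3 > 0" "\<And>y. dist y x < d3 \<Longrightarrow> y \<in> U"
    using U x unfolding open_dist by blast
  define h where "h = min d1 (min d2 d3) / 3"
  have h: "h > 0" "2 * h < d1" "2 * h < d2" "2 * h < d3" using d1 d2 d3 by (auto simp: h_def)
  have near: "dist (x + s *\<^sub>R axis k 1 + t *\<^sub>R axis l 1) x \<le> 2 * h" if "0 \<le> s" "s \<le> h" "0 \<le> t" "t \<le> h" for s t k l
  proof -
    have "dist (x + s *\<^sub>R axis k 1 + t *\<^sub>R axis l 1) x = norm (s *\<^sub>R axis k (1::real) + t *\<^sub>R axis l 1)"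
      by (simp add: dist_norm add_ac)
    also have "\<dots> \<le> norm (s *\<^sub>R axis k (1::real)) + norm (t *\<^sub>R axis l (1::real))" by (rule norm_triangle_ineq)
    also have "\<dots> \<le> 2 * h" using that by (simp add: norm_axis_1)
    finally show ?thesis .
  qed
  have sq: "x + s *\<^sub>R axis k 1 + t *\<^sub>R axis l 1 \<in> U" if "0 \<le> s" "s \<le> h" "0 \<le> t" "t \<le> h" for s t k l
    using near[OF that, of k l] h by (intro d3) auto
  obtain s t where st: "0 \<le> s" "s \<le> h" "0 \<le> t" "t \<le> h"
    "f (x + h *\<^sub>R axis i 1 + h *\<^sub>R axis j 1) - f (x + h *\<^sub>R axis i 1) - f (x + h *\<^sub>R axis j 1) + f x
      = h\<^sup>2 * A (x + s *\<^sub>R axis i 1 + t *\<^sub>R axis j 1)"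
    using mixed_difference[OF f h(1) sq, of i j] unfolding A_def by blast
  obtain s' t' where st': "0 \<le> s'" "s' \<le> h" "0 \<le> t'" "t' \<le> h"
    "f (x + h *\<^sub>R axis j 1 + h *\<^sub>R axis i 1) - f (x + h *\<^sub>R axis j 1) - f (x + h *\<^sub>R axis i 1) + f x
      = h\<^sup>2 * B (x + s' *\<^sub>R axis j 1 + t' *\<^sub>R axis i 1)"
    using mixed_difference[OF f h(1) sq, of j i] unfolding B_def by blast
  have "h\<^sup>2 * A (x + s *\<^sub>R axis i 1 + t *\<^sub>R axis j 1) = h\<^sup>2 * B (x + s' *\<^sub>R axis j 1 + t' *\<^sub>R axis i 1)"
    using st(5) st'(5) by (simp only: add_ac(1)[of x] add.commute[of "h *\<^sub>R axis j 1" "h *\<^sub>R axis i 1"])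
  then have "A (x + s *\<^sub>R axis i 1 + t *\<^sub>R axis j 1) = B (x + s' *\<^sub>R axis j 1 + t' *\<^sub>R axis i 1)" using h by simp
  moreover have "dist (A (x + s *\<^sub>R axis i 1 + t *\<^sub>R axis j 1)) (A x) < \<bar>A x - B x\<bar> / 2"
    using near[OF st(1-4), of i j] h by (intro d1) auto
  moreover have "dist (B (x + s' *\<^sub>R axis j 1 + t' *\<^sub>R axis i 1)) (B x) < \<bar>A x - B x\<bar> / 2"
    using near[OF st'(1-4), of j i] h by (intro d2) auto
  ultimately show False by (simp add: dist_real_def abs_if split: if_splits)
qed

lemma pd_cong_open:
  assumes "open V" "x \<in> V" "\<And>y. y \<in> V \<Longrightarrow> f y = g y"
  shows "pd i f x = pd i g x"
proof -
  have "((\<lambda>t. x + t *\<^sub>R axis i 1) \<longlongrightarrow> x + 0 *\<^sub>R axis i 1) (nhds (0::real))"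
    by (intro tendsto_intros filterlim_ident)
  then have "eventually (\<lambda>t. x + t *\<^sub>R axis i 1 \<in> V) (nhds (0::real))"
    using assms(1,2) by (intro topological_tendstoD) auto
  then have "eventually (\<lambda>t. f (x + t *\<^sub>R axis i 1) = g (x + t *\<^sub>R axis i 1)) (nhds (0::real))"
    by eventually_elim (rule assms(3))
  then show ?thesis unfolding pd_def by (intro deriv_cong_ev) auto
qed

lemma pd_tangential_zero:
  assumes "\<And>y. y$3 = c \<Longrightarrow> f y = 0" "x$3 = c" "k \<noteq> 3"
  shows "pd k f x = 0"
proof -
  have "f (x + t *\<^sub>R axis k 1) = 0" for t
    using assms by (intro assms(1)) (simp add: axis_def)
  then show ?thesis by (simp add: pd_def)
qed

lemma pd_eq_pdv:
  assumes "pdv j f f'" "x \<in> cslab"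
  shows "pd j f x = f' x"
  using pdvD[OF assms] unfolding pd_def by (rule DERIV_imp_deriv)

abbreviation (input) "sm \<equiv> smooth_up_to_boundary"

lemma smE:
  assumes "sm f"
  obtains U where "open U" "cslab \<subseteq> U" "smooth_on U f"
  using assms unfolding smooth_up_to_boundary_def closure_slab_eq by (auto simp: smooth_on_def)

lemma sm_pd [intro]: "sm f \<Longrightarrow> sm (pd j f)"
  unfolding smooth_up_to_boundary_def using smooth_on_pd by blast

lemma sm_continuous: "sm f \<Longrightarrow> continuous_on cslab f"
  by (elim smE) (meson continuous_on_subset smooth_on_continuous)

lemma sm_pdv: "sm f \<Longrightarrow> pdv j f (pd j f)"
  unfolding pdv_def
proof
  fix x assume "sm f" "x \<in> cslab"
  then obtain U where U: "cslab \<subseteq> U" "smooth_on U f" by (auto elim: smE)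
  have "x + 0 *\<^sub>R axis j 1 \<in> U" using \<open>x \<in> cslab\<close> U by auto
  from pd_line[OF U(2) this]
  show "((\<lambda>t. f (x + t *\<^sub>R axis j 1)) has_real_derivative pd j f x) (at 0)" by simp
qed

lemma sm_commute:
  assumes "sm f" "x \<in> cslab"
  shows "pd i (pd j f) x = pd j (pd i f) x"
  using assms pd_commute by (metis smE subsetD)

lemma sm_commute3:
  assumes "sm f" "x \<in> cslab"
  shows "pd k (pd j (pd j f)) x = pd j (pd j (pd k f)) x"
proof -
  obtain U where U: "open U" "cslab \<subseteq> U" "smooth_on U f" using assms by (auto elim: smE)
  have "pd k (pd j (pd j f)) x = pd j (pd k (pd j f)) x"
    using assms by (intro sm_commute) auto
  also have "\<dots> = pd j (pd j (pd k f)) x"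
    by (rule pd_cong_open[OF U(1)]) (use assms(2) U pd_commute in auto)
  finally show ?thesis .
qed

section \<open>Flows in the slab\<close>

named_theorems pdv_intros
lemmas [pdv_intros] = pdv_cutoff4 pdv_cutoff2 pdv_cutoff3 pdv_dcut pdv_rho pdv_coord pdv_add pdv_diff pdv_minus pdv_mult pdv_sum pdv_power pdv_const

locale slab_flow =
  fixes u :: "real^3 \<Rightarrow> real^3" and P :: "real^3 \<Rightarrow> real" and \<alpha> :: real
  assumes alpha_nonneg: "\<alpha> \<ge> 0"
    and smooth_u: "\<And>i. smooth_up_to_boundary (\<lambda>x. u x $ i)"
    and smooth_P: "smooth_up_to_boundary P"
    and NS: "steady_NS u P"
    and bounded_u: "bounded (u ` slab)"
    and BC: "navier_bc \<alpha> u"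
begin

definition v :: "3 \<Rightarrow> real^3 \<Rightarrow> real" where "v i x = u x $ i"
definition d :: "3 \<Rightarrow> 3 \<Rightarrow> real^3 \<Rightarrow> real" where "d i j = pd j (v i)"
definition L :: "3 \<Rightarrow> real^3 \<Rightarrow> real" where "L i x = (\<Sum>j\<in>UNIV. pd j (d i j) x)"
definition N :: "3 \<Rightarrow> real^3 \<Rightarrow> real" where "N i x = (\<Sum>j\<in>UNIV. v j x * d i j x)"
definition M :: real where "M = (SUP x\<in>slab. norm (u x))"
definition g2 :: "real^3 \<Rightarrow> real" where "g2 x = (\<Sum>i\<in>UNIV. \<Sum>j\<in>UNIV. (d i j x)\<^sup>2)"

lemma sm_v: "sm (v i)" using smooth_u[of i] by (simp add: v_def[abs_def])
lemma sm_d: "sm (d i j)" unfolding d_def by (intro sm_pd sm_v)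
lemma sm_dd: "sm (pd k (d i j))" by (intro sm_pd sm_d)
lemma sm_ddd: "sm (pd l (pd k (d i j)))" by (intro sm_pd sm_d)
lemma sm_P: "sm P" by (rule smooth_P)
lemma sm_p: "sm (pd j P)" by (intro sm_pd sm_P)
lemma sm_pp: "sm (pd i (pd j P))" by (intro sm_pd sm_P)

lemmas sm_cont [continuous_intros] = sm_v[THEN sm_continuous] sm_d[THEN sm_continuous] sm_dd[THEN sm_continuous]
  sm_ddd[THEN sm_continuous] sm_P[THEN sm_continuous] sm_p[THEN sm_continuous] sm_pp[THEN sm_continuous]

lemma pdv_v: "pdv j (v i) (d i j)" using sm_pdv[OF sm_v] by (simp add: d_def)
lemmas pdv_flow [pdv_intros] = pdv_v sm_pdv[OF sm_d] sm_pdv[OF sm_dd] sm_pdv[OF sm_P] sm_pdv[OF sm_p]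

lemma cont_L [continuous_intros]: "continuous_on cslab (L i)" unfolding L_def by (intro continuous_intros)
lemma cont_N [continuous_intros]: "continuous_on cslab (N i)" unfolding N_def by (intro continuous_intros)
lemma cont_g2 [continuous_intros]: "continuous_on cslab g2" unfolding g2_def by (intro continuous_intros)

lemma pd_d_sym: "x \<in> cslab \<Longrightarrow> pd k (d i j) x = pd j (d i k) x"
  unfolding d_def by (rule sm_commute[OF sm_v])

lemma momentum_slab: "x \<in> slab \<Longrightarrow> L i x = N i x + pd i P x"
proof -
  assume x: "x \<in> slab"
  have "- laplacian (\<lambda>y. u y $ i) x + (\<Sum>j\<in>UNIV. u x $ j * pd j (\<lambda>y. u y $ i) x) + pd i P x = 0"
    using NS x unfolding steady_NS_def by blast
  moreover have "laplacian (\<lambda>y. u y $ i) x = L i x"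
    by (simp add: laplacian_def L_def d_def v_def[abs_def])
  moreover have "(\<Sum>j\<in>UNIV. u x $ j * pd j (\<lambda>y. u y $ i) x) = N i x"
    by (simp add: N_def d_def v_def[abs_def])
  ultimately show ?thesis by simp
qed

lemma momentum: "x \<in> cslab \<Longrightarrow> L i x = N i x + pd i P x"
  by (rule cslab_eqI[OF _ _ momentum_slab]) (intro continuous_intros)+

lemma div_free_slab: "x \<in> slab \<Longrightarrow> d 1 1 x + d 2 2 x + d 3 3 x = 0"
  using NS unfolding steady_NS_def by (simp add: d_def v_def[abs_def] sum_3)

lemma div_free: "x \<in> cslab \<Longrightarrow> d 1 1 x + d 2 2 x + d 3 3 x = 0"
  by (rule cslab_eqI[OF _ _ div_free_slab]) (intro continuous_intros)+

text \<open>An identity on the open slab may be differentiated there, as \<open>pd\<close> depends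
  only on values nearby. Continuity then gives the result on the walls. The same scheme serves
  \<open>momentum_deriv\<close>.\<close>

lemma div_free_deriv:
  assumes x: "x \<in> cslab"
  shows "pd k (d 1 1) x + pd k (d 2 2) x + pd k (d 3 3) x = 0"
proof (rule cslab_eqI[OF _ _ _ x])
  fix y assume y: "y \<in> slab"
  then have "y \<in> cslab" using slab_subset_cslab by auto
  have "pd k (\<lambda>x. d 1 1 x + d 2 2 x + d 3 3 x) y = pd k (\<lambda>_. 0) y"
    by (rule pd_cong_open[OF open_slab y div_free_slab])
  also have "pd k (\<lambda>_. 0) y = 0" by (simp add: pd_def)
  finally show "pd k (d 1 1) y + pd k (d 2 2) y + pd k (d 3 3) y = 0"
    using pd_eq_pdv[OF pdv_add[OF pdv_add[OF pdv_flow(2) pdv_flow(2)] pdv_flow(2)] \<open>y \<in> cslab\<close>, of k 1 1 2 2 3 3] by simp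
qed (intro continuous_intros)+

lemma momentum_deriv:
  assumes x: "x \<in> cslab"
  shows "(\<Sum>j\<in>UNIV. pd j (pd j (d i k)) x) =
    (\<Sum>j\<in>UNIV. d j k x * d i j x + v j x * pd j (d i k) x) + pd i (pd k P) x"
proof (rule cslab_eqI[OF _ _ _ x])
  fix y assume y: "y \<in> slab"
  then have c: "y \<in> cslab" using slab_subset_cslab by auto
  have "pd k (L i) y = pd k (\<lambda>x. N i x + pd i P x) y"
    by (rule pd_cong_open[OF open_slab y momentum_slab])
  moreover have "pd k (L i) y = (\<Sum>j\<in>UNIV. pd j (pd j (d i k)) y)"
  proof -
    have "pd k (L i) y = (\<Sum>j\<in>UNIV. pd k (pd j (d i j)) y)"
      unfolding L_def by (rule pd_eq_pdv[OF _ c]) (intro pdv_sum pdv_flow)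
    also have "\<dots> = (\<Sum>j\<in>UNIV. pd j (pd j (d i k)) y)"
      unfolding d_def using sm_commute3[OF sm_v c] by simp
    finally show ?thesis .
  qed
  moreover have "pd k (\<lambda>x. N i x + pd i P x) y = (\<Sum>j\<in>UNIV. d j k y * d i j y + v j y * pd j (d i k) y) + pd i (pd k P) y"
  proof -
    have "pd k (\<lambda>x. N i x + pd i P x) y = (\<Sum>j\<in>UNIV. d j k y * d i j y + v j y * pd k (d i j) y) + pd k (pd i P) y"
      unfolding N_def by (rule pd_eq_pdv[OF _ c]) (intro pdv_add pdv_sum pdv_mult pdv_flow)
    then show ?thesis using pd_d_sym[OF c] sm_commute[OF sm_P c] by simp
  qed
  ultimately show "(\<Sum>j\<in>UNIV. pd j (pd j (d i k)) y) =
    (\<Sum>j\<in>UNIV. d j k y * d i j y + v j y * pd j (d i k) y) + pd i (pd k P) y" by simp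
qed (intro continuous_intros)+

text \<open>The weight \<open>a\<close> interpolates the two boundary values so that the friction condition reads \<open>\<partial>\<^sub>3 u\<^sub>i = a u\<^sub>i\<close> on both walls.\<close>
definition a :: "real^3 \<Rightarrow> real" where "a x = 2 * \<alpha> * (1 - 2 * x$3)"

lemma bc3: "x$3 = 0 \<or> x$3 = 1 \<Longrightarrow> v 3 x = 0"
  using BC unfolding navier_bc_def by (auto simp: v_def)

lemma bcz: "x$3 = 0 \<or> x$3 = 1 \<Longrightarrow> i = 1 \<or> i = 2 \<Longrightarrow> d i 3 x = a x * v i x"
  using BC unfolding navier_bc_def by (auto simp: v_def[abs_def] d_def a_def field_simps)

lemma bc_tan:
  assumes "x$3 = 0 \<or> x$3 = 1" "k = 1 \<or> k = 2"
  shows "d 3 k x = 0"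
proof -
  have k: "k \<noteq> 3" using assms(2) by auto
  show ?thesis using assms(1) unfolding d_def
    using pd_tangential_zero[of 0 "v 3", OF _ _ k] pd_tangential_zero[of 1 "v 3", OF _ _ k] bc3 by blast
qed

text \<open>The coefficient \<open>a\<close> is constant along each wall, so horizontal
  differentiation preserves the friction condition.\<close>

lemma bcz_tan:
  assumes "x$3 = 0 \<or> x$3 = 1" "i = 1 \<or> i = 2" "k = 1 \<or> k = 2"
  shows "pd 3 (d i k) x = a x * d i k x"
proof -
  have k: "k \<noteq> 3" using assms(3) by auto
  have c: "x \<in> cslab" using assms(1) by (auto simp: cslab_def)
  have "pd k (\<lambda>x. d i 3 x - a x * v i x) x = 0"
    using assms(1) pd_tangential_zero[of 0 "\<lambda>x. d i 3 x - a x * v i x", OF _ _ k]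
       pd_tangential_zero[of 1 "\<lambda>x. d i 3 x - a x * v i x", OF _ _ k] bcz[OF _ assms(2)] by auto
  moreover have "pd k (\<lambda>x. d i 3 x - a x * v i x) x = pd k (d i 3) x - (0 * v i x + a x * d i k x)"
  proof (rule pd_eq_pdv[OF _ c], intro pdv_diff pdv_mult pdv_flow)
    show "pdv k a (\<lambda>x. 0)" unfolding a_def using k
      by - (rule pdv_cong, (rule pdv_intros)+, auto)
  qed
  ultimately show ?thesis using pd_d_sym[OF c, of k i 3] by simp
qed

lemma bdd_norm: "bdd_above ((\<lambda>x. norm (u x)) ` slab)"
  using bounded_u unfolding bounded_iff bdd_above_def by auto

lemma slab_nonempty: "pt 0 0 (1/2) \<in> slab" by (simp add: slab_def)

lemma M_nonneg: "0 \<le> M"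
  using cSUP_upper[OF slab_nonempty bdd_norm] unfolding M_def by (meson norm_ge_zero order_trans)

lemma v_sum_le: "x \<in> cslab \<Longrightarrow> (\<Sum>i\<in>UNIV. (v i x)\<^sup>2) \<le> M\<^sup>2"
proof (rule cslab_leI)
  fix x assume x: "x \<in> slab"
  have "norm (u x) \<le> M" unfolding M_def by (rule cSUP_upper[OF x bdd_norm])
  then have "(norm (u x))\<^sup>2 \<le> M\<^sup>2" by (intro power_mono) auto
  moreover have "(norm (u x))\<^sup>2 = (\<Sum>i\<in>UNIV. (v i x)\<^sup>2)"
    by (simp add: norm_vec_def L2_set_def sum_nonneg v_def)
  ultimately show "(\<Sum>i\<in>UNIV. (v i x)\<^sup>2) \<le> M\<^sup>2" by simp
qed (intro continuous_intros)

lemma v_le: "x \<in> cslab \<Longrightarrow> \<bar>v i x\<bar> \<le> M"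
proof -
  assume x: "x \<in> cslab"
  have "(v i x)\<^sup>2 \<le> (\<Sum>i\<in>UNIV. (v i x)\<^sup>2)" by (rule member_le_sum) auto
  then have "(v i x)\<^sup>2 \<le> M\<^sup>2" using v_sum_le[OF x] by simp
  then show ?thesis using M_nonneg abs_le_square_iff[of "v i x" M] by simp
qed

lemma g2_nonneg: "0 \<le> g2 x" unfolding g2_def by (intro sum_nonneg) auto

lemma d_le: "\<bar>d i j x\<bar> \<le> sqrt (g2 x)"
proof -
  have "(d i j x)\<^sup>2 \<le> (\<Sum>j\<in>UNIV. (d i j x)\<^sup>2)" by (rule member_le_sum) auto
  also have "\<dots> \<le> g2 x" unfolding g2_def by (rule member_le_sum[of i UNIV "\<lambda>i. \<Sum>j\<in>UNIV. (d i j x)\<^sup>2"]) (auto intro: sum_nonneg)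
  finally show ?thesis by (metis real_sqrt_abs real_sqrt_le_mono)
qed

end

section \<open>Local bounds on the Laplacian and the gradient\<close>

text \<open>For the test component \<open>E - m^4 * L\<close> and the pressure derivative
  \<open>L - N\<close>, the left side is their product without its main term
  \<open>- m^4 * L^2\<close>. Half of that term absorbs everything linear in \<open>L\<close> at
  cost \<open>2 * c^2\<close>, and the product of \<open>E\<close> and \<open>N\<close> costs one
  more \<open>c^2\<close>.\<close>

lemma young_test:
  fixes m g E L N c :: real
  assumes m: "0 \<le> m" "m \<le> 1" and g: "0 \<le> g" and c: "0 \<le> c"
    and E: "\<bar>E\<bar> \<le> c * (m ^ 3 * g)" and N: "\<bar>N\<bar> \<le> c * g"
  shows "m ^ 4 * L * N + E * L - E * N \<le> (1/2) * (m ^ 4 * L\<^sup>2) + 3 * c\<^sup>2 * (m\<^sup>2 * g\<^sup>2)"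
proof -
  have m43: "m ^ 4 \<le> m ^ 3" using m by (intro power_decreasing) auto
  have m32: "m ^ 3 \<le> m\<^sup>2" using m by (intro power_decreasing) auto
  have "m ^ 4 * \<bar>N\<bar> \<le> m ^ 3 * (c * g)" using m43 N m by (intro mult_mono) auto
  moreover have "\<bar>m ^ 4 * N + E\<bar> \<le> m ^ 4 * \<bar>N\<bar> + \<bar>E\<bar>"
    using abs_triangle_ineq[of "m ^ 4 * N" E] by (simp add: abs_mult)
  moreover have "m ^ 3 * (c * g) + c * (m ^ 3 * g) = 2 * c * (m ^ 3 * g)" by (simp add: mult_ac)
  ultimately have "\<bar>m ^ 4 * N + E\<bar> \<le> 2 * c * (m ^ 3 * g)" using E by linarith
  then have "\<bar>m ^ 4 * N + E\<bar> * \<bar>L\<bar> \<le> 2 * c * (m ^ 3 * g) * \<bar>L\<bar>" by (rule mult_right_mono) simp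
  then have "(m ^ 4 * N + E) * L \<le> 2 * c * (m ^ 3 * g) * \<bar>L\<bar>"
    using abs_ge_self[of "(m ^ 4 * N + E) * L"] unfolding abs_mult by (rule order_trans[rotated])
  moreover have "2 * c * (m ^ 3 * g) * \<bar>L\<bar> \<le> (1/2) * (m ^ 4 * L\<^sup>2) + 2 * c\<^sup>2 * (m\<^sup>2 * g\<^sup>2)"
  proof -
    have "0 \<le> (m\<^sup>2 * \<bar>L\<bar> - 2 * c * (m * g))\<^sup>2" by simp
    then show ?thesis by (simp add: power2_diff power_mult_distrib power2_eq_square power3_eq_cube power4_eq_xxxx algebra_simps)
  qed
  moreover have "- (E * N) \<le> c\<^sup>2 * (m\<^sup>2 * g\<^sup>2)"
  proof -
    have "\<bar>E\<bar> * \<bar>N\<bar> \<le> (c * (m ^ 3 * g)) * (c * g)" using E N m c g by (intro mult_mono) auto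
    also have "\<dots> = m ^ 3 * (c * g * (c * g))" by simp
    also have "\<dots> \<le> m\<^sup>2 * (c * g * (c * g))" using m32 c g by (intro mult_right_mono) auto
    finally have "\<bar>E * N\<bar> \<le> c\<^sup>2 * (m\<^sup>2 * g\<^sup>2)" by (simp add: abs_mult power2_eq_square mult_ac)
    then show ?thesis by linarith
  qed
  ultimately show ?thesis by (simp add: algebra_simps)
qed

context slab_flow begin

definition L2 :: "real^3 \<Rightarrow> real" where "L2 x = (\<Sum>i\<in>UNIV. (L i x)\<^sup>2)"
text \<open>The friction correction of the vorticity and its curl produce terms of size
  \<open>\<alpha>\<close> times the velocity, so these are counted with the gradient.\<close>

definition w2 :: "real^3 \<Rightarrow> real" where "w2 x = g2 x + \<alpha>\<^sup>2 * (\<Sum>i\<in>UNIV. (v i x)\<^sup>2)"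

lemma cont_L2 [continuous_intros]: "continuous_on cslab L2" unfolding L2_def by (intro continuous_intros)
lemma cont_w2 [continuous_intros]: "continuous_on cslab w2" unfolding w2_def by (intro continuous_intros)
lemma w2_nonneg: "0 \<le> w2 x" unfolding w2_def using g2_nonneg by (auto intro!: add_nonneg_nonneg sum_nonneg mult_nonneg_nonneg)
lemma L2_nonneg: "0 \<le> L2 x" unfolding L2_def by (auto intro!: sum_nonneg)

section \<open>A curl test field orthogonal to pressure gradients\<close>

definition om :: "3 \<Rightarrow> real^3 \<Rightarrow> real" where
  "om i x = (if i = 1 then d 3 2 x - d 2 3 x + a x * v 2 x
     else if i = 2 then d 1 3 x - d 3 1 x - a x * v 1 x else d 2 1 x - d 1 2 x)"

text \<open>\<open>T R\<close> is the curl of \<open>cutoff R ^ 4\<close> times \<open>om\<close>; since \<open>om 1\<close> and \<open>om 2\<close> vanish on the walls, it is orthogonal to gradients.\<close>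
definition T :: "real \<Rightarrow> 3 \<Rightarrow> real^3 \<Rightarrow> real" where
  "T R i x = cutoff R x ^ 4 * (- L i x + (if i = 1 then a x * d 1 3 x - 4 * \<alpha> * v 1 x
      else if i = 2 then a x * d 2 3 x - 4 * \<alpha> * v 2 x else - a x * (d 1 1 x + d 2 2 x)))
    + (if i = 1 then dcut 2 R 2 x * om 3 x else if i = 2 then - (dcut 2 R 1 x * om 3 x)
        else dcut 2 R 1 x * om 2 x - dcut 2 R 2 x * om 1 x)"

lemma om_eqs:
  "om 1 = (\<lambda>x. d 3 2 x - d 2 3 x + a x * v 2 x)"
  "om 2 = (\<lambda>x. d 1 3 x - d 3 1 x - a x * v 1 x)"
  "om 3 = (\<lambda>x. d 2 1 x - d 1 2 x)"
  by (simp_all add: om_def fun_eq_iff)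

lemma pdv_a: "pdv j a (\<lambda>x. if j = 3 then - 4 * \<alpha> else 0)"
  unfolding a_def by (rule pdv_cong, (rule pdv_intros)+, auto)

lemma cont_a [continuous_intros]: "continuous_on A a"
  unfolding a_def by (intro continuous_intros)

lemma cont_om [continuous_intros]: "continuous_on cslab (om i)"
  unfolding om_def using exhaust_3[of i] by (auto intro!: continuous_intros)

lemma cont_T [continuous_intros]: "continuous_on cslab (T R i)"
  unfolding T_def using exhaust_3[of i] by (auto intro!: continuous_intros)

text \<open>\<open>G\<close> is the cross product of \<open>cutoff R ^ 4\<close> times
  \<open>om\<close> with the pressure gradient. Its divergence is the curl of the first factor
  against the pressure gradient, since gradients have no curl, and its normal component on the walls
  contains only \<open>om 1\<close> and \<open>om 2\<close>.\<close>

lemma T_orthogonal: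
  assumes R: "R > 0"
  shows "sint R (\<lambda>x. \<Sum>i\<in>UNIV. T R i x * pd i P x) = 0"
proof -
  define G where "G j x = (if j = 1 then cutoff R x ^ 4 * (om 2 x * pd 3 P x - om 3 x * pd 2 P x)
     else if j = 2 then cutoff R x ^ 4 * (om 3 x * pd 1 P x - om 1 x * pd 3 P x)
     else cutoff R x ^ 4 * (om 1 x * pd 2 P x - om 2 x * pd 1 P x))" for j :: 3 and x
  define G1 where "G1 x = dcut 2 R 1 x * (om 2 x * pd 3 P x - om 3 x * pd 2 P x) + cutoff R x ^ 4 *
     (((pd 1 (d 1 3) x - pd 1 (d 3 1) x - (0 * v 1 x + a x * d 1 1 x)) * pd 3 P x + om 2 x * pd 1 (pd 3 P) x)
     - ((pd 1 (d 2 1) x - pd 1 (d 1 2) x) * pd 2 P x + om 3 x * pd 1 (pd 2 P) x))" for x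
  define G2 where "G2 x = dcut 2 R 2 x * (om 3 x * pd 1 P x - om 1 x * pd 3 P x) + cutoff R x ^ 4 *
     (((pd 2 (d 2 1) x - pd 2 (d 1 2) x) * pd 1 P x + om 3 x * pd 2 (pd 1 P) x)
     - ((pd 2 (d 3 2) x - pd 2 (d 2 3) x + (0 * v 2 x + a x * d 2 2 x)) * pd 3 P x + om 1 x * pd 2 (pd 3 P) x))" for x
  define G3 where "G3 x = dcut 2 R 3 x * (om 1 x * pd 2 P x - om 2 x * pd 1 P x) + cutoff R x ^ 4 *
     (((pd 3 (d 3 2) x - pd 3 (d 2 3) x + (- 4 * \<alpha> * v 2 x + a x * d 2 3 x)) * pd 2 P x + om 1 x * pd 3 (pd 2 P) x)
     - ((pd 3 (d 1 3) x - pd 3 (d 3 1) x - (- 4 * \<alpha> * v 1 x + a x * d 1 3 x)) * pd 1 P x + om 2 x * pd 3 (pd 1 P) x))" for x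
  define G' where "G' j = (if j = 1 then G1 else if j = 2 then G2 else G3)" for j :: 3
  have o: "pdv j (om 1) (\<lambda>x. pd j (d 3 2) x - pd j (d 2 3) x + ((if j = 3 then - 4 * \<alpha> else 0) * v 2 x + a x * d 2 j x))"
          "pdv j (om 2) (\<lambda>x. pd j (d 1 3) x - pd j (d 3 1) x - ((if j = 3 then - 4 * \<alpha> else 0) * v 1 x + a x * d 1 j x))"
          "pdv j (om 3) (\<lambda>x. pd j (d 2 1) x - pd j (d 1 2) x)" for j
    unfolding om_eqs by (intro pdv_add pdv_diff pdv_mult pdv_flow pdv_a)+
  have D: "pdv j (G j) (G' j)" for j
  proof -
    have "pdv 1 (G 1) G1" unfolding G_def G1_def
      by (simp, rule pdv_cong, (rule pdv_cutoff4 o pdv_flow pdv_mult pdv_diff)+, simp)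
    moreover have "pdv 2 (G 2) G2" unfolding G_def G2_def
      by (simp, rule pdv_cong, (rule pdv_cutoff4 o pdv_flow pdv_mult pdv_diff)+, simp)
    moreover have "pdv 3 (G 3) G3" unfolding G_def G3_def
      by (simp, rule pdv_cong, (rule pdv_cutoff4 o pdv_flow pdv_mult pdv_diff)+, simp)
    ultimately show ?thesis using exhaust_3[of j] by (auto simp: G'_def)
  qed
  have cG': "continuous_on cslab (G' j)" for j
    using exhaust_3[of j] unfolding G'_def G1_def G2_def G3_def by (auto intro!: continuous_intros)
  have cG: "continuous_on cslab (G 3)" unfolding G_def by (auto intro!: continuous_intros)
  have lat: "G j x = 0" if "\<bar>x$1\<bar> = R \<or> \<bar>x$2\<bar> = R" for j x
    using cutoff_lateral[OF R that] by (simp add: G_def)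
  have G3bc: "G 3 x = 0" if "x$3 = 0 \<or> x$3 = 1" for x
  proof -
    have "om 1 x = 0" "om 2 x = 0"
      using bcz[OF that, of 1] bcz[OF that, of 2] bc_tan[OF that, of 1] bc_tan[OF that, of 2]
      by (simp_all add: om_def)
    then show ?thesis by (simp add: G_def)
  qed
  have "sint R (\<lambda>x. \<Sum>i\<in>UNIV. T R i x * pd i P x) = sint R (\<lambda>x. G' 1 x + G' 2 x + G' 3 x)"
  proof (rule sint_cong)
    show "continuous_on cslab (\<lambda>x. \<Sum>i\<in>UNIV. T R i x * pd i P x)"
      by (intro continuous_intros)
    show "continuous_on cslab (\<lambda>x. G' 1 x + G' 2 x + G' 3 x)" by (intro continuous_intros cG')
    fix x assume x: "x \<in> cslab"
    have s: "pd 2 (d 3 1) x = pd 1 (d 3 2) x" "pd 3 (d 2 1) x = pd 1 (d 2 3) x" "pd 3 (d 1 2) x = pd 2 (d 1 3) x"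
        "pd 2 (pd 1 P) x = pd 1 (pd 2 P) x" "pd 3 (pd 1 P) x = pd 1 (pd 3 P) x" "pd 3 (pd 2 P) x = pd 2 (pd 3 P) x"
      by (rule pd_d_sym[OF x] sm_commute[OF sm_P x])+
    define A where "A = pd 1 (d 1 1) x" define B where "B = pd 2 (d 2 2) x" define C where "C = pd 3 (d 3 3) x"
    \<comment> \<open>The differentiated divergence condition removes the gradient of the divergence
      from the double curl and leaves minus the Laplacian.\<close>
    have t: "pd 1 (d 2 2) x = - A - pd 1 (d 3 3) x" "pd 2 (d 3 3) x = - B - pd 2 (d 1 1) x" "pd 3 (d 1 1) x = - C - pd 3 (d 2 2) x"
      using div_free_deriv[OF x, of 1] div_free_deriv[OF x, of 2] div_free_deriv[OF x, of 3] by (simp_all add: A_def B_def C_def)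
    have s1: "pd 1 (d 1 2) x = pd 2 (d 1 1) x" "pd 1 (d 1 3) x = pd 3 (d 1 1) x" "pd 2 (d 2 1) x = pd 1 (d 2 2) x"
       "pd 2 (d 2 3) x = pd 3 (d 2 2) x" "pd 3 (d 3 1) x = pd 1 (d 3 3) x" "pd 3 (d 3 2) x = pd 2 (d 3 3) x"
      by (rule pd_d_sym[OF x])+
    show "(\<Sum>i\<in>UNIV. T R i x * pd i P x) = G' 1 x + G' 2 x + G' 3 x"
      unfolding sum_3 T_def L_def G'_def G1_def G2_def G3_def
      by (simp add: s1 t s A_def[symmetric] B_def[symmetric] C_def[symmetric] om_eqs) (simp add: algebra_simps)
  qed
  also have "\<dots> = 0"
    by (subst divergence_theorem[of R G G']) (use R D cG' cG lat G3bc in \<open>auto simp: hint_def\<close>)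
  finally show ?thesis .
qed

lemma d_le_w2: "\<bar>d i j x\<bar> \<le> sqrt (w2 x)"
proof -
  have "g2 x \<le> w2 x" unfolding w2_def by (auto intro!: mult_nonneg_nonneg sum_nonneg)
  then show ?thesis using d_le[of i j x] by (meson order_trans real_sqrt_le_mono)
qed

lemma v_le_w2: "\<alpha> * \<bar>v i x\<bar> \<le> sqrt (w2 x)"
proof -
  have "(v i x)\<^sup>2 \<le> (\<Sum>i\<in>UNIV. (v i x)\<^sup>2)" by (rule member_le_sum) auto
  then have "\<alpha>\<^sup>2 * (v i x)\<^sup>2 \<le> \<alpha>\<^sup>2 * (\<Sum>i\<in>UNIV. (v i x)\<^sup>2)" by (intro mult_left_mono) auto
  then have "(\<alpha> * \<bar>v i x\<bar>)\<^sup>2 \<le> w2 x" using g2_nonneg by (simp add: w2_def power_mult_distrib add_increasing)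
  then show ?thesis using alpha_nonneg by (metis real_le_rsqrt)
qed

lemma N_le: "x \<in> cslab \<Longrightarrow> \<bar>N i x\<bar> \<le> 3 * M * sqrt (g2 x)"
proof -
  assume x: "x \<in> cslab"
  have "\<bar>N i x\<bar> \<le> (\<Sum>j\<in>UNIV. \<bar>v j x * d i j x\<bar>)" unfolding N_def by (rule sum_abs)
  also have "\<dots> \<le> (\<Sum>j\<in>(UNIV::3 set). M * sqrt (g2 x))"
    unfolding abs_mult by (intro sum_mono mult_mono v_le[OF x] d_le) (auto simp: M_nonneg)
  finally show ?thesis by simp
qed

lemma a_le: "x \<in> cslab \<Longrightarrow> \<bar>a x\<bar> \<le> 2 * \<alpha>"
proof -
  assume x: "x \<in> cslab"
  have "\<alpha> * \<bar>1 - 2 * x$3\<bar> \<le> \<alpha> * 1" using x alpha_nonneg by (intro mult_left_mono) (auto simp: cslab_def)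
  then show ?thesis using alpha_nonneg by (simp add: a_def abs_mult)
qed

lemma om_le: "x \<in> cslab \<Longrightarrow> \<bar>om i x\<bar> \<le> 4 * sqrt (w2 x)"
proof -
  assume x: "x \<in> cslab"
  have av: "\<bar>a x * v j x\<bar> \<le> 2 * sqrt (w2 x)" for j
  proof -
    have "\<bar>a x\<bar> * \<bar>v j x\<bar> \<le> 2 * \<alpha> * \<bar>v j x\<bar>" using a_le[OF x] by (intro mult_right_mono) auto
    then show ?thesis using v_le_w2[of j x] by (simp add: abs_mult)
  qed
  show ?thesis using exhaust_3[of i] d_le_w2[of 3 2 x] d_le_w2[of 2 3 x] d_le_w2[of 1 3 x] d_le_w2[of 3 1 x]
     d_le_w2[of 2 1 x] d_le_w2[of 1 2 x] av[of 1] av[of 2]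
    by (auto simp: om_def)
qed

lemma T_error_le:
  assumes x: "x \<in> cslab" and R: "R \<ge> 1"
  shows "\<bar>T R i x + cutoff R x ^ 4 * L i x\<bar> \<le> (4 * \<alpha> + 132) * (cutoff R x ^ 3 * sqrt (w2 x))"
proof -
  define m where "m = cutoff R x" define g where "g = sqrt (w2 x)"
  have m: "0 \<le> m" "m \<le> 1" by (simp_all add: m_def cutoff_nonneg cutoff_le1)
  have g: "0 \<le> g" by (simp add: g_def w2_nonneg)
  have m43: "m ^ 4 \<le> m ^ 3" using m by (intro power_decreasing) auto
  have ad: "\<bar>a x * d i j x\<bar> \<le> 2 * \<alpha> * g" for i j
    unfolding abs_mult g_def using alpha_nonneg by (intro mult_mono a_le[OF x] d_le_w2) auto
  have av: "\<bar>4 * \<alpha> * v i x\<bar> \<le> 4 * g" for i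
    using v_le_w2[of i x] alpha_nonneg by (simp add: abs_mult g_def)
  have dc: "\<bar>dcut 2 R j x\<bar> \<le> 16 * m ^ 3" for j
  proof -
    have "\<bar>dcut 2 R j x\<bar> \<le> 16 / R * m ^ 3" using dcut_bound_cutoff[of R 2 j x] R by (simp add: m_def eval_nat_numeral)
    also have "\<dots> \<le> 16 * m ^ 3" using R m by (intro mult_right_mono) (auto simp: field_simps)
    finally show ?thesis .
  qed
  have dom: "\<bar>dcut 2 R j x * om i x\<bar> \<le> 64 * (m ^ 3 * g)" for i j
  proof -
    have "\<bar>dcut 2 R j x\<bar> * \<bar>om i x\<bar> \<le> (16 * m ^ 3) * (4 * g)"
      using dc om_le[OF x] m by (intro mult_mono) (auto simp: g_def)
    then show ?thesis by (simp add: abs_mult)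
  qed
  \<comment> \<open>\<open>X\<close> stands for the friction terms multiplied by the cutoff itself
    and \<open>Y\<close> for the terms with a cutoff derivative. At most two of the latter occur,
    each of size 16 times 4, which gives 128; adding the 4 of \<open>X\<close> gives 132.\<close>
  have key: "\<bar>m ^ 4 * X + Y\<bar> \<le> (4 * \<alpha> + 132) * (m ^ 3 * g)"
    if X: "\<bar>X\<bar> \<le> (4 * \<alpha> + 4) * g" and Y: "\<bar>Y\<bar> \<le> 128 * (m ^ 3 * g)" for X Y
  proof -
    have "m ^ 4 * \<bar>X\<bar> \<le> m ^ 3 * ((4 * \<alpha> + 4) * g)" using m43 X m by (intro mult_mono) auto
    then show ?thesis using abs_triangle_ineq[of "m ^ 4 * X" Y] Y m by (simp add: abs_mult algebra_simps)
  qed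
  have ag: "0 \<le> \<alpha> * g" using alpha_nonneg g by simp
  have mg: "0 \<le> m ^ 3 * g" using m g by simp
  consider "i = 1" | "i = 2" | "i = 3" using exhaust_3[of i] by blast
  then show ?thesis
  proof cases
    case 1
    have "\<bar>m ^ 4 * (a x * d 1 3 x - 4 * \<alpha> * v 1 x) + dcut 2 R 2 x * om 3 x\<bar> \<le> (4 * \<alpha> + 132) * (m ^ 3 * g)"
      using ad[of 1 3] av[of 1] dom[of 2 3] ag mg by (intro key) (auto simp: algebra_simps)
    then show ?thesis using 1 by (simp add: T_def m_def[symmetric] g_def[symmetric] algebra_simps)
  next
    case 2
    have "\<bar>m ^ 4 * (a x * d 2 3 x - 4 * \<alpha> * v 2 x) + - (dcut 2 R 1 x * om 3 x)\<bar> \<le> (4 * \<alpha> + 132) * (m ^ 3 * g)"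
      using ad[of 2 3] av[of 2] dom[of 1 3] ag mg by (intro key) (auto simp: algebra_simps)
    then show ?thesis using 2 by (simp add: T_def m_def[symmetric] g_def[symmetric] algebra_simps)
  next
    case 3
    have "\<bar>m ^ 4 * (- (a x * d 1 1 x) - a x * d 2 2 x) + (dcut 2 R 1 x * om 2 x - dcut 2 R 2 x * om 1 x)\<bar> \<le> (4 * \<alpha> + 132) * (m ^ 3 * g)"
      using ad[of 1 1] ad[of 2 2] dom[of 1 2] dom[of 2 1] ag g by (intro key) (auto simp: algebra_simps)
    then show ?thesis using 3 by (simp add: T_def m_def[symmetric] g_def[symmetric] algebra_simps)
  qed
qed

text \<open>Each of the three components costs \<open>3 * c^2\<close> in \<open>young_test\<close>;
  clearing the factor 1/2 in front of the Laplacian doubles the total 9.\<close>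

definition CA :: real where "CA = 18 * (4 * \<alpha> + 132 + 3 * M)\<^sup>2"

lemma CA_pos: "CA > 0"
proof -
  have "4 * \<alpha> + 132 + 3 * M > 0" using alpha_nonneg M_nonneg by (intro add_pos_nonneg add_nonneg_pos) auto
  then show ?thesis by (simp add: CA_def)
qed

text \<open>The vanishing pairing of \<open>T\<close> with the pressure gradient is rewritten with
  \<open>L - N\<close> in place of that gradient. The Laplacian energy appears with a favourable
  sign, and the size of the pressure never enters.\<close>

lemma laplacian_energy:
  assumes R: "R \<ge> 1"
  shows "sint R (\<lambda>x. cutoff R x ^ 4 * L2 x) \<le> CA * sint R (\<lambda>x. (cutoff R x)\<^sup>2 * w2 x)"
proof -
  define c where "c = 4 * \<alpha> + 132 + 3 * M"
  have c: "0 \<le> c" "4 * \<alpha> + 132 \<le> c" "3 * M \<le> c" using alpha_nonneg M_nonneg by (auto simp: c_def)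
  have "0 = sint R (\<lambda>x. \<Sum>i\<in>UNIV. T R i x * pd i P x)" using T_orthogonal[of R] R by simp
  also have "\<dots> \<le> sint R (\<lambda>x. 9 * c\<^sup>2 * ((cutoff R x)\<^sup>2 * w2 x) - (1/2) * (cutoff R x ^ 4 * L2 x))"
  proof (rule sint_mono)
    fix x assume x: "x \<in> cslab"
    have "T R i x * pd i P x \<le> 3 * c\<^sup>2 * ((cutoff R x)\<^sup>2 * w2 x) - (1/2) * (cutoff R x ^ 4 * (L i x)\<^sup>2)" for i
    proof -
      define E where "E = T R i x + cutoff R x ^ 4 * L i x"
      have E: "\<bar>E\<bar> \<le> c * (cutoff R x ^ 3 * sqrt (w2 x))"
        using T_error_le[OF x R, of i] mult_right_mono[OF c(2), of "cutoff R x ^ 3 * sqrt (w2 x)"] cutoff_nonneg w2_nonneg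
        unfolding E_def by (auto intro: order_trans)
      have "sqrt (g2 x) \<le> sqrt (w2 x)" unfolding w2_def by (auto intro!: mult_nonneg_nonneg sum_nonneg)
      then have "3 * M * sqrt (g2 x) \<le> c * sqrt (w2 x)" using c M_nonneg g2_nonneg by (intro mult_mono) auto
      then have NN: "\<bar>N i x\<bar> \<le> c * sqrt (w2 x)" using N_le[OF x, of i] by simp
      have "T R i x * pd i P x = (E - cutoff R x ^ 4 * L i x) * (L i x - N i x)"
        using momentum[OF x, of i] by (simp add: E_def)
      also have "\<dots> = (cutoff R x ^ 4 * L i x * N i x + E * L i x - E * N i x) - cutoff R x ^ 4 * (L i x)\<^sup>2"
        by (simp add: algebra_simps power2_eq_square)
      also have "\<dots> \<le> 3 * c\<^sup>2 * ((cutoff R x)\<^sup>2 * w2 x) - (1/2) * (cutoff R x ^ 4 * (L i x)\<^sup>2)"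
        using young_test[OF cutoff_nonneg cutoff_le1 _ c(1) E NN, of "L i x"] w2_nonneg[of x] by simp
      finally show ?thesis .
    qed
    then have "(\<Sum>i\<in>UNIV. T R i x * pd i P x) \<le> (\<Sum>i\<in>(UNIV::3 set). 3 * c\<^sup>2 * ((cutoff R x)\<^sup>2 * w2 x) - (1/2) * (cutoff R x ^ 4 * (L i x)\<^sup>2))"
      by (intro sum_mono)
    also have "\<dots> = 9 * c\<^sup>2 * ((cutoff R x)\<^sup>2 * w2 x) - (1/2) * (cutoff R x ^ 4 * L2 x)"
      by (simp add: L2_def sum_3 algebra_simps)
    finally show "(\<Sum>i\<in>UNIV. T R i x * pd i P x) \<le> \<dots>" .
  qed (intro continuous_intros)+
  also have "\<dots> = 9 * c\<^sup>2 * sint R (\<lambda>x. (cutoff R x)\<^sup>2 * w2 x) - (1/2) * sint R (\<lambda>x. cutoff R x ^ 4 * L2 x)"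
    by (subst sint_diff, (intro continuous_intros)+) (simp only: sint_cmult)
  finally show ?thesis by (simp add: CA_def c_def)
qed

text \<open>Green's formula for the velocity against its own Laplacian, so neither the momentum
  equation nor the pressure is involved. Friction gives both wall terms a favourable sign, and they
  are dropped.\<close>

lemma gradient_identity:
  assumes R: "R > 0" and dw: "\<And>j. pdv j w (w' j)" and cw: "continuous_on cslab w" "\<And>j. continuous_on cslab (w' j)"
    and lat: "\<And>x. \<bar>x$1\<bar> = R \<or> \<bar>x$2\<bar> = R \<Longrightarrow> w x = 0"
    and w0: "\<And>x. x \<in> cslab \<Longrightarrow> 0 \<le> w x"
  shows "sint R (\<lambda>x. w x * g2 x) \<le> sint R (\<lambda>x. - (w x * (\<Sum>i\<in>UNIV. v i x * L i x)) - (\<Sum>i\<in>UNIV. \<Sum>j\<in>UNIV. v i x * d i j x * w' j x))"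
proof -
  define G where "G j x = w x * (\<Sum>i\<in>UNIV. v i x * d i j x)" for j x
  define G' where "G' j x = w' j x * (\<Sum>i\<in>UNIV. v i x * d i j x) + w x * (\<Sum>i\<in>UNIV. d i j x * d i j x + v i x * pd j (d i j) x)" for j x
  have D: "pdv j (G j) (G' j)" for j unfolding G_def G'_def
    by (intro pdv_mult pdv_sum pdv_flow dw)
  have cG': "continuous_on cslab (G' j)" for j unfolding G'_def by (intro continuous_intros cw)
  have cG: "continuous_on cslab (G 3)" unfolding G_def by (intro continuous_intros cw)
  have div: "sint R (\<lambda>x. G' 1 x + G' 2 x + G' 3 x) = hint R (\<lambda>p. G 3 (pt (fst p) (snd p) 1)) - hint R (\<lambda>p. G 3 (pt (fst p) (snd p) 0))"
    by (rule divergence_theorem[of R G G', OF _ D cG' cG]) (use R lat in \<open>auto simp: G_def\<close>)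
  have e: "G 3 x = a x * (w x * ((v 1 x)\<^sup>2 + (v 2 x)\<^sup>2))" if "x$3 = 0 \<or> x$3 = 1" for x
    using bcz[OF that, of 1] bcz[OF that, of 2] bc3[OF that] by (simp add: G_def sum_3 power2_eq_square algebra_simps)
  have ww: "0 \<le> w (pt b c z) * ((v 1 (pt b c z))\<^sup>2 + (v 2 (pt b c z))\<^sup>2)" if "0 \<le> z" "z \<le> 1" for b c z
    using that by (intro mult_nonneg_nonneg w0) auto
  have cb: "continuous_on UNIV (\<lambda>p. G 3 (pt (fst p) (snd p) z))" if "0 \<le> z" "z \<le> 1" for z
    by (intro continuous_on_pt_cslab[OF cG] continuous_intros) (use that in auto)
  have "hint R (\<lambda>p. G 3 (pt (fst p) (snd p) 1)) \<le> hint R (\<lambda>p. 0)"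
    by (rule hint_mono[OF cb]) (use alpha_nonneg ww[of 1] in \<open>auto simp: e a_def intro!: mult_nonpos_nonneg\<close>)
  moreover have "hint R (\<lambda>p. 0) \<le> hint R (\<lambda>p. G 3 (pt (fst p) (snd p) 0))"
    by (rule hint_mono[OF _ cb]) (use alpha_nonneg ww[of 0] in \<open>auto simp: e a_def intro!: mult_nonneg_nonneg continuous_intros\<close>)
  ultimately have "sint R (\<lambda>x. G' 1 x + G' 2 x + G' 3 x) \<le> 0" using div by simp
  moreover have "sint R (\<lambda>x. G' 1 x + G' 2 x + G' 3 x) = sint R (\<lambda>x. w x * g2 x
     - (- (w x * (\<Sum>i\<in>UNIV. v i x * L i x)) - (\<Sum>i\<in>UNIV. \<Sum>j\<in>UNIV. v i x * d i j x * w' j x)))"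
    by (rule arg_cong[where f = "sint R"]) (simp add: fun_eq_iff G'_def g2_def L_def sum_3 power2_eq_square algebra_simps)
  moreover have "\<dots> = sint R (\<lambda>x. w x * g2 x) - sint R (\<lambda>x. - (w x * (\<Sum>i\<in>UNIV. v i x * L i x)) - (\<Sum>i\<in>UNIV. \<Sum>j\<in>UNIV. v i x * d i j x * w' j x))"
    by (rule sint_diff) (intro continuous_intros cw)+
  ultimately show ?thesis by simp
qed

lemma young2: "x * y \<le> \<delta> * x\<^sup>2 + y\<^sup>2 / (4 * \<delta>)" if "\<delta> > 0" for x y \<delta> :: real
proof -
  have "0 \<le> (2 * \<delta> * x - y)\<^sup>2 / (4 * \<delta>)" using that by simp
  also have "\<dots> = \<delta> * x\<^sup>2 + y\<^sup>2 / (4 * \<delta>) - x * y"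
    using that by (simp add: power2_diff power_mult_distrib field_simps power2_eq_square)
  finally show ?thesis by simp
qed

text \<open>The two energies bound each other: the gradient needs a small multiple of the Laplacian,
  and by \<open>laplacian_energy\<close> the Laplacian needs the gradient and the velocity. The
  growth \<open>R^2\<close> is that of the box volume, on which the velocity is bounded by
  \<open>M\<close>.\<close>

lemma a_priori:
  "\<exists>C\<ge>0. \<forall>R\<ge>1. sint R (\<lambda>x. (cutoff R x)\<^sup>2 * g2 x) \<le> C * R\<^sup>2 \<and> sint R (\<lambda>x. cutoff R x ^ 4 * L2 x) \<le> C * R\<^sup>2"
proof -
  \<comment> \<open>Makes \<open>\<delta> * CA\<close> equal to 1/4: inserting the bound for
    \<open>Z\<close> returns \<open>D / 4\<close>, which together with \<open>D / 2\<close> is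
    absorbed on the left.\<close>
  define \<delta> where "\<delta> = 1 / (4 * CA)"
  have \<delta>: "\<delta> > 0" using CA_pos by (simp add: \<delta>_def)
  define B where "B = M\<^sup>2 / (4 * \<delta>) + 9 * (32 * M\<^sup>2)"
  have B: "B \<ge> 0" using \<delta> by (simp add: B_def)
  define C where "C = 16 * B + 4 * (\<alpha>\<^sup>2 * M\<^sup>2)"
  have C: "C \<ge> 0" using B by (simp add: C_def)
  have main: "sint R (\<lambda>x. (cutoff R x)\<^sup>2 * g2 x) \<le> C * R\<^sup>2 \<and> sint R (\<lambda>x. cutoff R x ^ 4 * L2 x) \<le> (CA * (C + 4 * (\<alpha>\<^sup>2 * M\<^sup>2))) * R\<^sup>2" if R: "R \<ge> 1" for R
  proof -
    define D where "D = sint R (\<lambda>x. (cutoff R x)\<^sup>2 * g2 x)"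
    define Z where "Z = sint R (\<lambda>x. cutoff R x ^ 4 * L2 x)"
    have "D \<le> sint R (\<lambda>x. - ((cutoff R x)\<^sup>2 * (\<Sum>i\<in>UNIV. v i x * L i x)) - (\<Sum>i\<in>UNIV. \<Sum>j\<in>UNIV. v i x * d i j x * dcut 0 R j x))"
      unfolding D_def using R by (intro gradient_identity pdv_cutoff2 continuous_intros) (auto simp: cutoff_lateral)
    also have "\<dots> \<le> sint R (\<lambda>x. (\<delta> * (cutoff R x ^ 4 * L2 x) + (1/2) * ((cutoff R x)\<^sup>2 * g2 x)) + B)"
    proof (rule sint_mono)
      fix x assume x: "x \<in> cslab"
      have 1: "- ((cutoff R x)\<^sup>2 * (\<Sum>i\<in>UNIV. v i x * L i x)) \<le> \<delta> * (cutoff R x ^ 4 * L2 x) + M\<^sup>2 / (4 * \<delta>)"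
      proof -
        have "((cutoff R x)\<^sup>2 * L i x) * (- v i x) \<le> \<delta> * ((cutoff R x)\<^sup>2 * L i x)\<^sup>2 + (- v i x)\<^sup>2 / (4 * \<delta>)" for i
          by (rule young2[OF \<delta>])
        then have "(\<Sum>i\<in>UNIV. ((cutoff R x)\<^sup>2 * L i x) * (- v i x)) \<le> (\<Sum>i\<in>UNIV. \<delta> * ((cutoff R x)\<^sup>2 * L i x)\<^sup>2 + (- v i x)\<^sup>2 / (4 * \<delta>))"
          by (intro sum_mono)
        also have "\<dots> = \<delta> * (cutoff R x ^ 4 * L2 x) + (\<Sum>i\<in>UNIV. (v i x)\<^sup>2) / (4 * \<delta>)"
          by (simp add: L2_def sum.distrib sum_distrib_left sum_divide_distrib power_mult_distrib flip: power_mult)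
        also have "\<dots> \<le> \<delta> * (cutoff R x ^ 4 * L2 x) + M\<^sup>2 / (4 * \<delta>)"
          using v_sum_le[OF x] \<delta> by (intro add_left_mono divide_right_mono) auto
        finally show ?thesis by (simp add: sum_distrib_left sum_negf mult_ac)
      qed
      have 2: "- (\<Sum>i\<in>UNIV. \<Sum>j\<in>UNIV. v i x * d i j x * dcut 0 R j x) \<le> (1/2) * ((cutoff R x)\<^sup>2 * g2 x) + 9 * (32 * M\<^sup>2)"
      proof -
        have "- (v i x * d i j x * dcut 0 R j x) \<le> (1/2) * ((cutoff R x)\<^sup>2 * (d i j x)\<^sup>2) + 32 * M\<^sup>2" for i j
        proof -
          have "\<bar>dcut 0 R j x\<bar> \<le> 8 / R * cutoff R x" using dcut_bound_cutoff[of R 0 j x] R by simp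
          also have "\<dots> \<le> 8 * cutoff R x" using R cutoff_nonneg by (intro mult_right_mono) (auto simp: field_simps)
          finally have "\<bar>v i x\<bar> * \<bar>d i j x\<bar> * \<bar>dcut 0 R j x\<bar> \<le> M * \<bar>d i j x\<bar> * (8 * cutoff R x)"
            using v_le[OF x] M_nonneg by (intro mult_mono) auto
          also have "\<dots> = (cutoff R x * \<bar>d i j x\<bar>) * (8 * M)" by simp
          also have "\<dots> \<le> (1/2) * (cutoff R x * \<bar>d i j x\<bar>)\<^sup>2 + (8 * M)\<^sup>2 / (4 * (1/2))" by (rule young2) simp
          finally have "\<bar>v i x * d i j x * dcut 0 R j x\<bar> \<le> (1/2) * ((cutoff R x)\<^sup>2 * (d i j x)\<^sup>2) + 32 * M\<^sup>2"
            by (simp add: abs_mult power_mult_distrib)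
          then show ?thesis by linarith
        qed
        then have "(\<Sum>i\<in>UNIV. \<Sum>j\<in>UNIV. - (v i x * d i j x * dcut 0 R j x)) \<le> (\<Sum>i\<in>(UNIV::3 set). \<Sum>j\<in>(UNIV::3 set). (1/2) * ((cutoff R x)\<^sup>2 * (d i j x)\<^sup>2) + 32 * M\<^sup>2)"
          by (intro sum_mono)
        then show ?thesis by (simp add: g2_def sum.distrib sum_distrib_left sum_negf)
      qed
      show "- ((cutoff R x)\<^sup>2 * (\<Sum>i\<in>UNIV. v i x * L i x)) - (\<Sum>i\<in>UNIV. \<Sum>j\<in>UNIV. v i x * d i j x * dcut 0 R j x)
         \<le> \<delta> * (cutoff R x ^ 4 * L2 x) + (1/2) * ((cutoff R x)\<^sup>2 * g2 x) + B"
        using 1 2 unfolding B_def by linarith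
    qed (intro continuous_intros)+
    also have "\<dots> = \<delta> * Z + (1/2) * D + 4 * R\<^sup>2 * B"
      unfolding D_def Z_def using R
      by (subst sint_add, (intro continuous_intros)+, subst sint_add, (intro continuous_intros)+) (simp only: sint_cmult, simp add: sint_const)
    finally have D1: "D \<le> \<delta> * Z + (1/2) * D + 4 * R\<^sup>2 * B" .
    have "Z \<le> CA * sint R (\<lambda>x. (cutoff R x)\<^sup>2 * w2 x)" unfolding Z_def by (rule laplacian_energy[OF R])
    also have "sint R (\<lambda>x. (cutoff R x)\<^sup>2 * w2 x) \<le> sint R (\<lambda>x. (cutoff R x)\<^sup>2 * g2 x + \<alpha>\<^sup>2 * M\<^sup>2)"
    proof (rule sint_mono)
      fix x assume x: "x \<in> cslab"
      have "(cutoff R x)\<^sup>2 * (\<alpha>\<^sup>2 * (\<Sum>i\<in>UNIV. (v i x)\<^sup>2)) \<le> 1 * (\<alpha>\<^sup>2 * M\<^sup>2)"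
        using v_sum_le[OF x] by (intro mult_mono) (auto simp: cutoff_nonneg cutoff_le1 power_le_one sum_nonneg)
      then show "(cutoff R x)\<^sup>2 * w2 x \<le> (cutoff R x)\<^sup>2 * g2 x + \<alpha>\<^sup>2 * M\<^sup>2"
        by (simp add: w2_def distrib_left)
    qed (intro continuous_intros)+
    also have "\<dots> = D + 4 * R\<^sup>2 * (\<alpha>\<^sup>2 * M\<^sup>2)"
      unfolding D_def using R by (subst sint_add, (intro continuous_intros)+) (simp add: sint_const)
    finally have Z1: "Z \<le> CA * (D + 4 * R\<^sup>2 * (\<alpha>\<^sup>2 * M\<^sup>2))" using CA_pos by simp
    then have "\<delta> * Z \<le> (1/4) * (D + 4 * R\<^sup>2 * (\<alpha>\<^sup>2 * M\<^sup>2))"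
      using CA_pos by (simp add: \<delta>_def field_simps)
    with D1 have D2: "D \<le> C * R\<^sup>2" by (simp add: C_def algebra_simps)
    have "Z \<le> CA * (C * R\<^sup>2 + 4 * R\<^sup>2 * (\<alpha>\<^sup>2 * M\<^sup>2))"
      using Z1 D2 CA_pos by (meson add_right_mono mult_left_mono order_trans less_imp_le)
    then show ?thesis using D2 by (simp add: D_def Z_def algebra_simps)
  qed
  define C' where "C' = max C (CA * (C + 4 * (\<alpha>\<^sup>2 * M\<^sup>2)))"
  have "sint R (\<lambda>x. (cutoff R x)\<^sup>2 * g2 x) \<le> C' * R\<^sup>2 \<and> sint R (\<lambda>x. cutoff R x ^ 4 * L2 x) \<le> C' * R\<^sup>2" if "R \<ge> 1" for R
    using main[OF that] mult_right_mono[of C C' "R\<^sup>2"] mult_right_mono[of "CA * (C + 4 * (\<alpha>\<^sup>2 * M\<^sup>2))" C' "R\<^sup>2"]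
    by (auto simp: C'_def)
  moreover have "C' \<ge> 0" using C by (simp add: C'_def)
  ultimately show ?thesis by blast
qed

end

section \<open>The energy of a derivative of the velocity\<close>

lemma sum3_abs_le: "(\<And>i. \<bar>f i\<bar> \<le> c) \<Longrightarrow> \<bar>\<Sum>i\<in>(UNIV::3 set). f i\<bar> \<le> 3 * (c::real)"
proof -
  assume "\<And>i. \<bar>f i\<bar> \<le> c"
  then have "(\<Sum>i\<in>(UNIV::3 set). \<bar>f i\<bar>) \<le> (\<Sum>i\<in>(UNIV::3 set). c)" by (intro sum_mono)
  then have "(\<Sum>i\<in>(UNIV::3 set). \<bar>f i\<bar>) \<le> 3 * c" by simp
  then show ?thesis by (rule order_trans[OF sum_abs])
qed

lemma abs_mult_le: "\<bar>x\<bar> \<le> a \<Longrightarrow> \<bar>y\<bar> \<le> b \<Longrightarrow> \<bar>x * y\<bar> \<le> a * (b::real)"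
  unfolding abs_mult by (rule mult_mono) auto

lemma abs_four_le:
  "\<bar>a\<bar> \<le> A \<Longrightarrow> \<bar>b\<bar> \<le> B \<Longrightarrow> \<bar>c\<bar> \<le> C \<Longrightarrow> \<bar>d\<bar> \<le> D \<Longrightarrow> \<bar>a + b + c - d\<bar> \<le> A + B + C + (D::real)"
  by linarith

lemma sum_four_le:
  "x \<le> a + b + c + d \<Longrightarrow> a \<le> a' \<Longrightarrow> c \<le> c' \<Longrightarrow> a' + c' \<le> e \<Longrightarrow> b + d = f \<Longrightarrow> x \<le> e + (f::real)"
  by linarith

definition bint :: "real \<Rightarrow> (real^3 \<Rightarrow> real) \<Rightarrow> real" where
  "bint R f = hint R (\<lambda>p. f (pt (fst p) (snd p) 0)) + hint R (\<lambda>p. f (pt (fst p) (snd p) 1))"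

lemma bcont: "continuous_on cslab f \<Longrightarrow> 0 \<le> z \<Longrightarrow> z \<le> 1 \<Longrightarrow> continuous_on A (\<lambda>p. f (pt (fst p) (snd p) z))"
  by (rule continuous_on_pt_cslab) (auto intro!: continuous_intros)

lemma bint_add:
  assumes "continuous_on cslab f" "continuous_on cslab g"
  shows "bint R (\<lambda>x. f x + g x) = bint R f + bint R g"
proof -
  have "hint R (\<lambda>p. f (pt (fst p) (snd p) z) + g (pt (fst p) (snd p) z)) =
      hint R (\<lambda>p. f (pt (fst p) (snd p) z)) + hint R (\<lambda>p. g (pt (fst p) (snd p) z))" if "0 \<le> z" "z \<le> 1" for z
    by (rule hint_add[OF bcont bcont]) (use assms that in auto)
  from this[of 0] this[of 1] show ?thesis by (simp add: bint_def)
qed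

lemma bint_cmult: "bint R (\<lambda>x. c * f x) = c * bint R f"
  unfolding bint_def hint_cmult by (simp add: algebra_simps)

lemma bint_const: "R \<ge> 0 \<Longrightarrow> bint R (\<lambda>x. c) = 8 * R\<^sup>2 * c"
  by (simp add: bint_def hint_const)

lemma bint_mono:
  assumes "continuous_on cslab f" "continuous_on cslab g"
    "\<And>x. x \<in> cslab \<Longrightarrow> \<bar>x$1\<bar> \<le> R \<Longrightarrow> \<bar>x$2\<bar> \<le> R \<Longrightarrow> x$3 = 0 \<or> x$3 = 1 \<Longrightarrow> f x \<le> g x"
  shows "bint R f \<le> bint R g"
proof -
  have "hint R (\<lambda>p. f (pt (fst p) (snd p) z)) \<le> hint R (\<lambda>p. g (pt (fst p) (snd p) z))" if "z = 0 \<or> z = 1" for z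
    by (rule hint_mono[OF bcont[OF assms(1)] bcont[OF assms(2)]]) (use assms(3) that in auto)
  from this[of 0] this[of 1] show ?thesis unfolding bint_def by (intro add_mono) auto
qed

lemma bint_nonneg:
  assumes "continuous_on cslab f" "\<And>x. x \<in> cslab \<Longrightarrow> x$3 = 0 \<or> x$3 = 1 \<Longrightarrow> 0 \<le> f x"
  shows "0 \<le> bint R f"
  using bint_mono[of "\<lambda>_. 0" f R] assms by (simp add: bint_def hint_def)

context slab_flow begin

definition H :: "3 \<Rightarrow> real^3 \<Rightarrow> real" where "H k x = (\<Sum>i\<in>UNIV. \<Sum>j\<in>UNIV. (pd j (d i k) x)\<^sup>2)"
definition V2 :: "3 \<Rightarrow> real^3 \<Rightarrow> real" where "V2 k x = (\<Sum>i\<in>UNIV. (d i k x)\<^sup>2)"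
text \<open>The cubic term left when the differentiated convection is tested with the derivative
  itself. With \<open>A\<close> the velocity gradient, its sum over \<open>k\<close> is the trace of
  \<open>A^T A^2\<close>.\<close>

definition Q :: "3 \<Rightarrow> real^3 \<Rightarrow> real" where "Q k x = (\<Sum>i\<in>UNIV. \<Sum>j\<in>UNIV. d j k x * d i j x * d i k x)"
text \<open>Adding \<open>X R k\<close> to \<open>cutoff R ^ 4\<close> times the \<open>k\<close>-th derivative of the velocity makes it divergence free; \<open>Rm R k\<close> collects the resulting lower-order terms.\<close>
definition X :: "real \<Rightarrow> 3 \<Rightarrow> 3 \<Rightarrow> real^3 \<Rightarrow> real" where
  "X R k i x = v i x * dcut 2 R k x - (if i = k then 1 else 0) * (\<Sum>l\<in>UNIV. v l x * dcut 2 R l x)"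
definition dX :: "real \<Rightarrow> 3 \<Rightarrow> 3 \<Rightarrow> 3 \<Rightarrow> real^3 \<Rightarrow> real" where
  "dX R k i j x = d i j x * dcut 2 R k x + v i x * ddcut R j k x
     - (if i = k then 1 else 0) * (\<Sum>l\<in>UNIV. d l j x * dcut 2 R l x + v l x * ddcut R j l x)"
definition Rm :: "real \<Rightarrow> 3 \<Rightarrow> real^3 \<Rightarrow> real" where
  "Rm R k x = (\<Sum>i\<in>UNIV. \<Sum>j\<in>UNIV. pd j (d i k) x * (dcut 2 R j x * d i k x + dX R k i j x))
     + (\<Sum>i\<in>UNIV. (\<Sum>j\<in>UNIV. d j k x * d i j x) * X R k i x)
     + (\<Sum>i\<in>UNIV. (\<Sum>j\<in>UNIV. v j x * pd j (d i k) x) * X R k i x)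
     - (1/2) * V2 k x * (\<Sum>l\<in>UNIV. v l x * dcut 2 R l x)"

lemma cont_H [continuous_intros]: "continuous_on cslab (H k)" unfolding H_def by (intro continuous_intros)
lemma cont_V2 [continuous_intros]: "continuous_on cslab (V2 k)" unfolding V2_def by (intro continuous_intros)
lemma cont_Q [continuous_intros]: "continuous_on cslab (Q k)" unfolding Q_def by (intro continuous_intros)
lemma cont_X [continuous_intros]: "continuous_on cslab (X R k i)" unfolding X_def by (intro continuous_intros)
lemma cont_dX [continuous_intros]: "continuous_on cslab (dX R k i j)" unfolding dX_def by (intro continuous_intros)
lemma cont_Rm [continuous_intros]: "continuous_on cslab (Rm R k)" unfolding Rm_def by (intro continuous_intros)
lemma H_nonneg: "0 \<le> H k x" unfolding H_def by (intro sum_nonneg) auto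
lemma V2_nonneg: "0 \<le> V2 k x" unfolding V2_def by (intro sum_nonneg) auto

lemma pdv_X: "pdv j (X R k i) (dX R k i j)"
  unfolding X_def dX_def
  by (rule pdv_cong, (rule pdv_diff pdv_mult pdv_sum pdv_flow pdv_dcut pdv_const)+) simp

text \<open>The left side is the wall flux of the differentiated energy identity. For horizontal
  \<open>k\<close> the test field is tangential and the derivative inherits the friction condition.
  For \<open>k = 3\<close> and \<alpha> = 0 the wall relations make \<open>L 3\<close> and
  \<open>N 3\<close> vanish, hence also the normal pressure derivative.\<close>

lemma bc_test:
  assumes x: "x$3 = 0 \<or> x$3 = 1" and k: "k \<noteq> 3 \<or> \<alpha> = 0"
  shows "(\<Sum>i\<in>UNIV. pd 3 (d i k) x * (cutoff R x ^ 4 * d i k x + X R k i x))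
     - pd k P x * (cutoff R x ^ 4 * d 3 k x + X R k 3 x) - (1/2) * V2 k x * v 3 x * cutoff R x ^ 4
    = a x * (\<Sum>i\<in>UNIV. d i k x * (cutoff R x ^ 4 * d i k x + X R k i x))"
proof -
  have c: "x \<in> cslab" using x by (auto simp: cslab_def)
  have v3: "v 3 x = 0" by (rule bc3[OF x])
  show ?thesis
  proof (cases "k = 3")
    case False
    then have k12: "k = 1 \<or> k = 2" using exhaust_3[of k] by blast
    have "d 3 k x = 0" by (rule bc_tan[OF x k12])
    moreover have "X R k 3 x = 0" using False v3 by (simp add: X_def)
    ultimately show ?thesis using bcz_tan[OF x _ k12] v3 by (simp add: sum_3 algebra_simps)
  next
    case True
    then have al: "\<alpha> = 0" using k by simp
    have a0: "a x = 0" unfolding a_def using al by simp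
    have d12: "d 1 3 x = 0" "d 2 3 x = 0" using bcz[OF x] a0 by auto
    have "pd 3 (d 1 1) x = 0" "pd 3 (d 2 2) x = 0" using bcz_tan[OF x] a0 by auto
    then have d33: "pd 3 (d 3 3) x = 0" using div_free_deriv[OF c, of 3] by simp
    have d31: "d 3 1 x = 0" "d 3 2 x = 0" by (auto intro: bc_tan[OF x])
    have dd: "pd l (d 3 l) x = 0" if "l = 1 \<or> l = 2" for l
    proof -
      have l: "l \<noteq> 3" using that by auto
      show ?thesis using x pd_tangential_zero[of 0 "d 3 l", OF _ _ l] pd_tangential_zero[of 1 "d 3 l", OF _ _ l] bc_tan[OF _ that] by blast
    qed
    have "L 3 x = 0" using dd d33 by (simp add: L_def sum_3)
    moreover have "N 3 x = 0" using d31 v3 by (simp add: N_def sum_3)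
    ultimately have "pd 3 P x = 0" using momentum[OF c, of 3] by simp
    moreover have "X R k 1 x = 0" "X R k 2 x = 0" using True by (simp_all add: X_def)
    ultimately show ?thesis using True d12 d33 v3 a0 by (simp add: sum_3)
  qed
qed

text \<open>The flux \<open>G\<close> collects viscous, pressure and kinetic energy transport for
  the differentiated equation. The pressure leaves no volume term because the test field is
  divergence free.\<close>

lemma derivative_energy_identity:
  assumes R: "R > 0" and k: "k \<noteq> 3 \<or> \<alpha> = 0"
  shows "sint R (\<lambda>x. cutoff R x ^ 4 * H k x) + 2 * \<alpha> * bint R (\<lambda>x. cutoff R x ^ 4 * V2 k x)
    = - sint R (\<lambda>x. cutoff R x ^ 4 * Q k x) - sint R (Rm R k) - 2 * \<alpha> * bint R (\<lambda>x. \<Sum>i\<in>UNIV. d i k x * X R k i x)"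
proof -
  define T where "T i x = cutoff R x ^ 4 * d i k x + X R k i x" for i x
  define dT where "dT i j x = dcut 2 R j x * d i k x + cutoff R x ^ 4 * pd j (d i k) x + dX R k i j x" for i j x
  define G where "G j x = (\<Sum>i\<in>UNIV. pd j (d i k) x * T i x) - pd k P x * T j x - (1/2) * V2 k x * v j x * cutoff R x ^ 4" for j x
  define G' where "G' j x = (\<Sum>i\<in>UNIV. pd j (pd j (d i k)) x * T i x + pd j (d i k) x * dT i j x)
     - (pd j (pd k P) x * T j x + pd k P x * dT j j x)
     - (((1/2) * (\<Sum>i\<in>UNIV. 2 * d i k x * pd j (d i k) x) * v j x + (1/2) * V2 k x * d j j x) * cutoff R x ^ 4
         + (1/2) * V2 k x * v j x * dcut 2 R j x)" for j x
  have pT: "pdv j (T i) (dT i j)" for i j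
    unfolding T_def dT_def by (intro pdv_add pdv_mult pdv_cutoff4 pdv_flow pdv_X)
  have pV: "pdv j (V2 k) (\<lambda>x. \<Sum>i\<in>UNIV. 2 * d i k x * pd j (d i k) x)" for j
    unfolding V2_def by (rule pdv_sum, rule pdv_cong, rule pdv_power, rule pdv_flow) simp
  have D: "pdv j (G j) (G' j)" for j unfolding G_def G'_def
    by (rule pdv_cong, (rule pdv_diff pdv_sum pT pV pdv_cutoff4 pdv_flow pdv_mult pdv_const)+) simp
  have cT: "continuous_on cslab (T i)" "continuous_on cslab (dT i j)" for i j
    unfolding T_def dT_def by (intro continuous_intros)+
  have cG': "continuous_on cslab (G' j)" for j unfolding G'_def by (intro continuous_intros cT)
  have cG: "continuous_on cslab (G 3)" unfolding G_def by (intro continuous_intros cT)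
  have lat: "G j x = 0" if "\<bar>x$1\<bar> = R \<or> \<bar>x$2\<bar> = R" for j x
    using cutoff_lateral[OF R that] dcut_lateral[OF R that] by (simp add: G_def T_def X_def)
  define B where "B x = (\<Sum>i\<in>UNIV. d i k x * T i x)" for x
  have cB: "continuous_on cslab B" unfolding B_def by (intro continuous_intros cT)
  have GB: "G 3 x = a x * B x" if "x$3 = 0 \<or> x$3 = 1" for x
    using bc_test[OF that k, of R] by (simp add: G_def T_def B_def)
  have "sint R (\<lambda>x. G' 1 x + G' 2 x + G' 3 x) = hint R (\<lambda>p. G 3 (pt (fst p) (snd p) 1)) - hint R (\<lambda>p. G 3 (pt (fst p) (snd p) 0))"
    by (rule divergence_theorem[of R G G', OF _ D cG' cG]) (use R lat in auto)
  also have "hint R (\<lambda>p. G 3 (pt (fst p) (snd p) 1)) = (- 2 * \<alpha>) * hint R (\<lambda>p. B (pt (fst p) (snd p) 1))"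
    unfolding hint_cmult[symmetric] by (rule arg_cong[where f = "hint R"]) (simp add: fun_eq_iff GB a_def)
  also have "hint R (\<lambda>p. G 3 (pt (fst p) (snd p) 0)) = (2 * \<alpha>) * hint R (\<lambda>p. B (pt (fst p) (snd p) 0))"
    unfolding hint_cmult[symmetric] by (rule arg_cong[where f = "hint R"]) (simp add: fun_eq_iff GB a_def)
  finally have 1: "sint R (\<lambda>x. G' 1 x + G' 2 x + G' 3 x) = - 2 * \<alpha> * bint R B"
    by (simp add: bint_def algebra_simps)
  have "B = (\<lambda>x. cutoff R x ^ 4 * V2 k x + (\<Sum>i\<in>UNIV. d i k x * X R k i x))"
    by (simp add: fun_eq_iff B_def T_def V2_def sum_3 algebra_simps power2_eq_square)
  then have 2: "bint R B = bint R (\<lambda>x. cutoff R x ^ 4 * V2 k x) + bint R (\<lambda>x. \<Sum>i\<in>UNIV. d i k x * X R k i x)"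
    by (simp, subst bint_add) (intro continuous_intros | simp)+
  have "sint R (\<lambda>x. G' 1 x + G' 2 x + G' 3 x) = sint R (\<lambda>x. (cutoff R x ^ 4 * H k x + cutoff R x ^ 4 * Q k x) + Rm R k x)"
  proof (rule sint_cong)
    fix x assume x: "x \<in> cslab"
    \<comment> \<open>The first part of the field has divergence
      \<open>grad \<phi> . pd k u\<close>, and \<open>u * pd k \<phi>\<close> has divergence
      \<open>u . grad (pd k \<phi>)\<close>. The correction along direction \<open>k\<close>
      subtracts exactly both.\<close>
    have divT: "dT 1 1 x + dT 2 2 x + dT 3 3 x = 0"
    proof -
      have "dT 1 1 x + dT 2 2 x + dT 3 3 x = (\<Sum>l\<in>UNIV. dcut 2 R l x * d l k x) + cutoff R x ^ 4 * (pd 1 (d 1 k) x + pd 2 (d 2 k) x + pd 3 (d 3 k) x)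
         + (d 1 1 x + d 2 2 x + d 3 3 x) * dcut 2 R k x + (\<Sum>l\<in>UNIV. v l x * ddcut R l k x)
         - (\<Sum>l\<in>UNIV. d l k x * dcut 2 R l x + v l x * ddcut R k l x)"
        using exhaust_3[of k] by (auto simp: dT_def dX_def sum_3 algebra_simps)
      moreover have "pd 1 (d 1 k) x + pd 2 (d 2 k) x + pd 3 (d 3 k) x = 0"
        using div_free_deriv[OF x, of k] pd_d_sym[OF x, of k 1 1] pd_d_sym[OF x, of k 2 2] pd_d_sym[OF x, of k 3 3] by simp
      moreover have "ddcut R k l x = ddcut R l k x" for l by (simp add: ddcut_def algebra_simps)
      ultimately show ?thesis using div_free[OF x] by (simp add: sum.distrib mult.commute)
    qed
    have mo: "pd i (pd k P) x = (\<Sum>j\<in>UNIV. pd j (pd j (d i k)) x) -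
      (\<Sum>j\<in>UNIV. d j k x * d i j x + v j x * pd j (d i k) x)" for i
      using momentum_deriv[OF x, of i k] by simp
    have "G' 1 x + G' 2 x + G' 3 x =
       (\<Sum>i\<in>UNIV. (\<Sum>j\<in>UNIV. pd j (pd j (d i k)) x) * T i x) + (\<Sum>i\<in>UNIV. \<Sum>j\<in>UNIV. pd j (d i k) x * dT i j x)
       - (\<Sum>i\<in>UNIV. pd i (pd k P) x * T i x) - pd k P x * (dT 1 1 x + dT 2 2 x + dT 3 3 x)
       - cutoff R x ^ 4 * (\<Sum>i\<in>UNIV. \<Sum>j\<in>UNIV. v j x * pd j (d i k) x * d i k x)
       - (1/2) * V2 k x * (d 1 1 x + d 2 2 x + d 3 3 x) * cutoff R x ^ 4
       - (1/2) * V2 k x * (\<Sum>l\<in>UNIV. v l x * dcut 2 R l x)"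
      by (simp add: G'_def sum_3 algebra_simps)
    also have "\<dots> = (\<Sum>i\<in>UNIV. (\<Sum>j\<in>UNIV. d j k x * d i j x + v j x * pd j (d i k) x) * T i x) + (\<Sum>i\<in>UNIV. \<Sum>j\<in>UNIV. pd j (d i k) x * dT i j x)
       - cutoff R x ^ 4 * (\<Sum>i\<in>UNIV. \<Sum>j\<in>UNIV. v j x * pd j (d i k) x * d i k x)
       - (1/2) * V2 k x * (\<Sum>l\<in>UNIV. v l x * dcut 2 R l x)"
      unfolding divT div_free[OF x] mo by (simp add: left_diff_distrib sum_subtractf)
    also have "\<dots> = (cutoff R x ^ 4 * H k x + cutoff R x ^ 4 * Q k x) + Rm R k x"
      unfolding T_def dT_def H_def Q_def Rm_def by (simp add: sum_3 algebra_simps power2_eq_square)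
    finally show "G' 1 x + G' 2 x + G' 3 x = (cutoff R x ^ 4 * H k x + cutoff R x ^ 4 * Q k x) + Rm R k x" .
  qed (intro continuous_intros cG')+
  also have "\<dots> = sint R (\<lambda>x. cutoff R x ^ 4 * H k x) + sint R (\<lambda>x. cutoff R x ^ 4 * Q k x) + sint R (Rm R k)"
    by (subst sint_add, (intro continuous_intros)+, subst sint_add, (intro continuous_intros)+) simp
  finally show ?thesis using 1 2 by (simp add: algebra_simps)
qed

lemma d_le_V2: "\<bar>d i k x\<bar> \<le> sqrt (V2 k x)"
proof -
  have "(d i k x)\<^sup>2 \<le> V2 k x" unfolding V2_def by (rule member_le_sum) auto
  then show ?thesis by (metis real_sqrt_abs real_sqrt_le_mono)
qed

lemma dd_le_H: "\<bar>pd j (d i k) x\<bar> \<le> sqrt (H k x)"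
proof -
  have "(pd j (d i k) x)\<^sup>2 \<le> (\<Sum>j\<in>UNIV. (pd j (d i k) x)\<^sup>2)" by (rule member_le_sum) auto
  also have "\<dots> \<le> H k x" unfolding H_def
    by (rule member_le_sum[of i UNIV "\<lambda>i. \<Sum>j\<in>UNIV. (pd j (d i k) x)\<^sup>2"]) (auto intro: sum_nonneg)
  finally show ?thesis by (metis real_sqrt_abs real_sqrt_le_mono)
qed

lemma V2_le_g2: "V2 k x \<le> g2 x"
  unfolding V2_def g2_def by (intro sum_mono member_le_sum) auto

lemma X_le:
  assumes x: "x \<in> cslab" and D: "\<And>j. \<bar>dcut 2 R j x\<bar> \<le> D"
  shows "\<bar>X R k i x\<bar> \<le> 4 * M * D"
proof -
  have t: "\<bar>v l x * dcut 2 R j x\<bar> \<le> M * D" for l j by (intro abs_mult_le v_le[OF x] D)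
  have "\<bar>\<Sum>l\<in>UNIV. v l x * dcut 2 R l x\<bar> \<le> 3 * (M * D)" by (rule sum3_abs_le) (rule t)
  then show ?thesis using t[of i k] abs_ge_zero[of "v i x * dcut 2 R k x"] by (auto simp: X_def)
qed

text \<open>Terms with a second derivative keep the factor \<open>m^2 * s\<close>, so that squaring
  the product with \<open>h\<close> gives exactly the weighted density
  \<open>rho * cutoff^4 * H\<close>. Products of two gradients keep a full \<open>rho\<close> and
  are left for a separate estimate.\<close>

lemma Rm_le:
  fixes k :: 3
  assumes x: "x \<in> cslab" and R: "R \<ge> 1"
  defines "m \<equiv> cutoff R x" and "s \<equiv> sqrt (rho R x)" and "h \<equiv> sqrt (H k x)" and "b \<equiv> sqrt (g2 x)" and "w \<equiv> sqrt (V2 k x)"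
  shows "\<bar>Rm R k x\<bar> \<le> (h * (m\<^sup>2 * s)) * ((720 + 8640 * M + 576 * M\<^sup>2) * (b * m + 1) / R)
    + 600 * M / R * (rho R x * m ^ 3 * w * b)"
proof -
  have R0: "R > 0" using R by simp
  have m: "0 \<le> m" "m \<le> 1" by (simp_all add: m_def cutoff_nonneg cutoff_le1)
  have nn: "0 \<le> s" "0 \<le> h" "0 \<le> b" "0 \<le> w" "0 \<le> rho R x" "0 \<le> M"
    by (simp_all add: s_def h_def b_def w_def rho_nonneg H_nonneg g2_nonneg V2_nonneg M_nonneg)
  have wb: "w \<le> b" unfolding w_def b_def using V2_le_g2 by simp
  have D0: "\<bar>dcut 2 R j x\<bar> \<le> 16 / R * (m ^ 3 * s)" for j
    using dcut_bound0[OF R0, of 2 j x] by (simp add: m_def s_def eval_nat_numeral)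
  have D1: "\<bar>dcut 2 R j x\<bar> \<le> 16 / R * (m ^ 3 * rho R x)" for j
    using dcut_bound1[OF R0, of 2 j x] by (simp add: m_def eval_nat_numeral)
  have DD: "\<bar>ddcut R l j x\<bar> \<le> 240 / R\<^sup>2 * (m\<^sup>2 * s)" for l j
  proof (cases "m = 0")
    case False
    then have "rho R x \<le> 1" using cutoff_nz by (simp add: m_def)
    then have "s \<le> 1" by (simp add: s_def)
    then have "s * s \<le> 1 * s" using nn by (intro mult_right_mono)
    then have "rho R x \<le> s" using nn by (simp add: s_def)
    then have "240 / R\<^sup>2 * (m\<^sup>2 * rho R x) \<le> 240 / R\<^sup>2 * (m\<^sup>2 * s)" by (intro mult_left_mono) auto
    then show ?thesis using ddcut_bound[OF R0, of l j x] by (simp add: m_def)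
  qed (use ddcut_bound[OF R0, of l j x] in \<open>simp add: m_def\<close>)
  have dw: "\<bar>d i k x\<bar> \<le> w" for i unfolding w_def by (rule d_le_V2)
  have db: "\<bar>d i j x\<bar> \<le> b" for i j unfolding b_def by (rule d_le)
  have dh: "\<bar>pd j (d i k) x\<bar> \<le> h" for i j unfolding h_def by (rule dd_le_H)
  define A where "A = 16 / R * (m ^ 3 * s) * b"
  define B where "B = M * (240 / R\<^sup>2 * (m\<^sup>2 * s))"
  have A0: "0 \<le> A" and B0: "0 \<le> B" using nn m R0 by (auto simp: A_def B_def)
  have dX: "\<bar>dX R k i j x\<bar> \<le> 4 * A + 4 * B" for i j
  proof -
    have t: "\<bar>d p j x * dcut 2 R q x + v p x * ddcut R j q x\<bar> \<le> A + B" for p q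
    proof -
      have "\<bar>d p j x * dcut 2 R q x\<bar> \<le> b * (16 / R * (m ^ 3 * s))" by (intro abs_mult_le db D0)
      moreover have "\<bar>v p x * ddcut R j q x\<bar> \<le> B" unfolding B_def by (intro abs_mult_le v_le[OF x] DD)
      ultimately show ?thesis unfolding A_def by (simp add: mult.commute)
    qed
    have "\<bar>\<Sum>l\<in>UNIV. d l j x * dcut 2 R l x + v l x * ddcut R j l x\<bar> \<le> 3 * (A + B)" by (rule sum3_abs_le) (rule t)
    then show ?thesis using t[of i k] A0 B0 by (auto simp: dX_def)
  qed
  have 1: "\<bar>\<Sum>i\<in>UNIV. \<Sum>j\<in>UNIV. pd j (d i k) x * (dcut 2 R j x * d i k x + dX R k i j x)\<bar> \<le> 3 * (3 * (h * (5 * A + 4 * B)))"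
  proof (intro sum3_abs_le abs_mult_le dh)
    fix i j
    have "\<bar>dcut 2 R j x * d i k x\<bar> \<le> A" unfolding A_def by (intro abs_mult_le D0 db)
    then show "\<bar>dcut 2 R j x * d i k x + dX R k i j x\<bar> \<le> 5 * A + 4 * B" using dX[of i j] by linarith
  qed
  have 2: "\<bar>\<Sum>i\<in>UNIV. (\<Sum>j\<in>UNIV. d j k x * d i j x) * X R k i x\<bar> \<le> 3 * (3 * (w * b) * (4 * M * (16 / R * (m ^ 3 * rho R x))))"
    by (intro sum3_abs_le abs_mult_le X_le[OF x D1] dw db)
  have 3: "\<bar>\<Sum>i\<in>UNIV. (\<Sum>j\<in>UNIV. v j x * pd j (d i k) x) * X R k i x\<bar> \<le> 3 * (3 * (M * h) * (4 * M * (16 / R * (m ^ 3 * s))))"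
    by (intro sum3_abs_le abs_mult_le X_le[OF x D0] dh v_le[OF x])
  have 4: "\<bar>(1/2) * V2 k x * (\<Sum>l\<in>UNIV. v l x * dcut 2 R l x)\<bar> \<le> (1/2) * (w * b) * (3 * (M * (16 / R * (m ^ 3 * rho R x))))"
  proof (intro abs_mult_le sum3_abs_le v_le[OF x] D1)
    have "V2 k x = w * w" using V2_nonneg by (simp add: w_def)
    also have "\<dots> \<le> w * b" using wb nn by (intro mult_left_mono)
    finally show "\<bar>V2 k x\<bar> \<le> w * b" using V2_nonneg[of k x] by simp
  qed simp
  have m32: "m ^ 3 \<le> m\<^sup>2" using m by (intro power_decreasing) auto
  have RR: "1 / R\<^sup>2 \<le> 1 / R" using R by (simp add: field_simps power2_eq_square)
  have 5: "3 * (3 * (h * (5 * A + 4 * B))) \<le> (h * (m\<^sup>2 * s)) * ((720 * (b * m) + 8640 * M) / R)"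
  proof -
    have "A = (m\<^sup>2 * s) * (16 * (b * m) / R)" by (simp add: A_def power2_eq_square power3_eq_cube)
    moreover have "B \<le> (m\<^sup>2 * s) * (240 * M / R)"
    proof -
      have "B = (240 * M * (m\<^sup>2 * s)) * (1 / R\<^sup>2)" by (simp add: B_def)
      also have "\<dots> \<le> (240 * M * (m\<^sup>2 * s)) * (1 / R)" using nn by (intro mult_left_mono RR) auto
      finally show ?thesis by (simp add: mult_ac)
    qed
    ultimately have "5 * A + 4 * B \<le> 5 * ((m\<^sup>2 * s) * (16 * (b * m) / R)) + 4 * ((m\<^sup>2 * s) * (240 * M / R))"
      by linarith
    also have "\<dots> = (m\<^sup>2 * s) * (80 * (b * m) / R + 960 * M / R)"
      using R0 by (simp add: field_simps)
    finally have "9 * h * (5 * A + 4 * B) \<le> 9 * h * ((m\<^sup>2 * s) * (80 * (b * m) / R + 960 * M / R))"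
      using nn by (intro mult_left_mono) auto
    also have "\<dots> = (h * (m\<^sup>2 * s)) * ((720 * (b * m) + 8640 * M) / R)"
      using R0 by (simp add: field_simps)
    finally show ?thesis by simp
  qed
  have 6: "3 * (3 * (M * h) * (4 * M * (16 / R * (m ^ 3 * s)))) \<le> (h * (m\<^sup>2 * s)) * (576 * M\<^sup>2 / R)"
  proof -
    have "3 * (3 * (M * h) * (4 * M * (16 / R * (m ^ 3 * s)))) = (h * s * (576 * M\<^sup>2 / R)) * m ^ 3"
      by (simp add: power2_eq_square)
    also have "\<dots> \<le> (h * s * (576 * M\<^sup>2 / R)) * m\<^sup>2" using nn R0 by (intro mult_left_mono m32) auto
    finally show ?thesis by (simp add: mult_ac)
  qed
  have 7: "(h * (m\<^sup>2 * s)) * ((720 * (b * m) + 8640 * M) / R) + (h * (m\<^sup>2 * s)) * (576 * M\<^sup>2 / R)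
     \<le> (h * (m\<^sup>2 * s)) * ((720 + 8640 * M + 576 * M\<^sup>2) * (b * m + 1) / R)"
  proof -
    have "0 \<le> 720 + (8640 * M + 576 * M\<^sup>2) * (b * m)" using nn m by auto
    then have "(720 * (b * m) + 8640 * M) / R + 576 * M\<^sup>2 / R \<le> (720 + 8640 * M + 576 * M\<^sup>2) * (b * m + 1) / R"
      using R0 by (simp add: add_divide_distrib[symmetric] divide_right_mono algebra_simps)
    then have "(h * (m\<^sup>2 * s)) * ((720 * (b * m) + 8640 * M) / R + 576 * M\<^sup>2 / R)
      \<le> (h * (m\<^sup>2 * s)) * ((720 + 8640 * M + 576 * M\<^sup>2) * (b * m + 1) / R)"
      using nn by (intro mult_left_mono) auto
    then show ?thesis by (simp add: distrib_left)
  qed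
  \<comment> \<open>600 is the sum of 3 * 3 * 4 * 16 = 576, from the first convection term tested
    with \<open>X\<close>, and 3 * 16 / 2 = 24, from the transport of kinetic energy.\<close>
  have 8: "3 * (3 * (w * b) * (4 * M * (16 / R * (m ^ 3 * rho R x)))) + (1/2) * (w * b) * (3 * (M * (16 / R * (m ^ 3 * rho R x))))
    = 600 * M / R * (rho R x * m ^ 3 * w * b)" by (simp add: field_simps)
  have "\<bar>Rm R k x\<bar> \<le> 3 * (3 * (h * (5 * A + 4 * B))) + 3 * (3 * (w * b) * (4 * M * (16 / R * (m ^ 3 * rho R x))))
     + 3 * (3 * (M * h) * (4 * M * (16 / R * (m ^ 3 * s)))) + (1/2) * (w * b) * (3 * (M * (16 / R * (m ^ 3 * rho R x))))"
    unfolding Rm_def by (rule abs_four_le[OF 1 2 3 4])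
  from sum_four_le[OF this 5 6 7 8] show ?thesis .
qed

definition KM :: real where "KM = 720 + 8640 * M + 576 * M\<^sup>2"

text \<open>The term \<open>C / \<tau>\<close> is free of \<open>R\<close> because the square of the
  factor \<open>1/R\<close> from the cutoff derivatives meets the quadratic growth of
  \<open>a_priori\<close> and of the box volume.\<close>

lemma derivative_energy_estimate:
  assumes k: "k \<noteq> 3 \<or> \<alpha> = 0"
  shows "\<exists>C\<ge>0. \<forall>\<tau>>0. \<forall>R\<ge>1.
    sint R (\<lambda>x. cutoff R x ^ 4 * H k x) + 2 * \<alpha> * bint R (\<lambda>x. cutoff R x ^ 4 * V2 k x)
    \<le> - sint R (\<lambda>x. cutoff R x ^ 4 * Q k x)
      + \<tau> * (sint R (\<lambda>x. rho R x * (cutoff R x ^ 4 * H k x)) + 2 * \<alpha> * bint R (\<lambda>x. rho R x * (cutoff R x ^ 4 * V2 k x)))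
      + C / \<tau> + C / R * sint R (\<lambda>x. rho R x * cutoff R x ^ 3 * sqrt (V2 k x) * sqrt (g2 x))"
proof -
  obtain C0 where C0: "C0 \<ge> 0" "\<And>R. R \<ge> 1 \<Longrightarrow> sint R (\<lambda>x. (cutoff R x)\<^sup>2 * g2 x) \<le> C0 * R\<^sup>2"
    using a_priori by blast
  \<comment> \<open>In \<open>C0 + 4\<close> the first summand is the growth of the gradient and the
    second the box volume \<open>4 * R^2\<close>. In \<open>C2\<close> the leading 8 is the area of
    the two wall squares.\<close>
  define C1 where "C1 = KM\<^sup>2 / 2 * (C0 + 4)"
  define C2 where "C2 = 2 * \<alpha> * (8 * ((192 * M)\<^sup>2 / 4))"
  define C where "C = C1 + C2 + 600 * M"
  have CC: "C1 \<ge> 0" "C2 \<ge> 0" using C0 alpha_nonneg by (auto simp: C1_def C2_def)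
  have C: "C \<ge> 0" "C1 + C2 \<le> C" "600 * M \<le> C" using CC M_nonneg by (auto simp: C_def)
  show ?thesis
  proof (intro exI[of _ C] conjI allI impI C(1))
    fix \<tau> R :: real assume \<tau>: "\<tau> > 0" and R: "R \<ge> 1"
    have R0: "R > 0" using R by simp
    define WH where "WH = sint R (\<lambda>x. rho R x * (cutoff R x ^ 4 * H k x))"
    define WV where "WV = bint R (\<lambda>x. rho R x * (cutoff R x ^ 4 * V2 k x))"
    define S where "S = sint R (\<lambda>x. rho R x * cutoff R x ^ 3 * sqrt (V2 k x) * sqrt (g2 x))"
    have S0: "S \<ge> 0" unfolding S_def
      by (rule sint_nonneg) (auto intro!: continuous_intros mult_nonneg_nonneg simp: rho_nonneg cutoff_nonneg V2_nonneg g2_nonneg)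
    define c3 where "c3 = KM\<^sup>2 / (2 * \<tau> * R\<^sup>2)"
    have c3: "c3 \<ge> 0" using \<tau> by (simp add: c3_def)
    have "- sint R (Rm R k) \<le> \<bar>sint R (Rm R k)\<bar>" by simp
    also have "\<dots> \<le> sint R (\<lambda>x. \<bar>Rm R k x\<bar>)" by (intro sint_abs_le continuous_intros)
    also have "\<dots> \<le> sint R (\<lambda>x. (\<tau> * (rho R x * (cutoff R x ^ 4 * H k x)) + c3 * ((cutoff R x)\<^sup>2 * g2 x + 1))
         + 600 * M / R * (rho R x * cutoff R x ^ 3 * sqrt (V2 k x) * sqrt (g2 x)))"
    proof (rule sint_mono)
      fix x assume x: "x \<in> cslab"
      define b where "b = sqrt (g2 x) * cutoff R x"
      have b: "b \<ge> 0" by (simp add: b_def cutoff_nonneg g2_nonneg)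
      have "(sqrt (H k x) * ((cutoff R x)\<^sup>2 * sqrt (rho R x))) * (KM * (b + 1) / R)
         \<le> \<tau> * (sqrt (H k x) * ((cutoff R x)\<^sup>2 * sqrt (rho R x)))\<^sup>2 + (KM * (b + 1) / R)\<^sup>2 / (4 * \<tau>)"
        by (rule young2[OF \<tau>])
      also have "(sqrt (H k x) * ((cutoff R x)\<^sup>2 * sqrt (rho R x)))\<^sup>2 = rho R x * (cutoff R x ^ 4 * H k x)"
        using H_nonneg rho_nonneg by (simp add: power_mult_distrib mult_ac flip: power_mult)
      also have "(KM * (b + 1) / R)\<^sup>2 / (4 * \<tau>) \<le> c3 * (b\<^sup>2 + 1)"
      proof -
        have "(b + 1)\<^sup>2 \<le> 2 * (b\<^sup>2 + 1)" using sum_squares_bound[of b 1] by (simp add: power2_sum)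
        then have "KM\<^sup>2 / (4 * \<tau> * R\<^sup>2) * (b + 1)\<^sup>2 \<le> KM\<^sup>2 / (4 * \<tau> * R\<^sup>2) * (2 * (b\<^sup>2 + 1))"
          using \<tau> by (intro mult_left_mono) auto
        moreover have "KM\<^sup>2 / (4 * \<tau> * R\<^sup>2) * (2 * (b\<^sup>2 + 1)) = c3 * (b\<^sup>2 + 1)"
          using \<tau> R0 by (simp add: c3_def field_simps)
        moreover have "(KM * (b + 1) / R)\<^sup>2 / (4 * \<tau>) = KM\<^sup>2 / (4 * \<tau> * R\<^sup>2) * (b + 1)\<^sup>2"
          by (simp add: power_mult_distrib power_divide mult.commute)
        ultimately show ?thesis by linarith
      qed
      also have "b\<^sup>2 = (cutoff R x)\<^sup>2 * g2 x" using g2_nonneg by (simp add: b_def power_mult_distrib mult.commute)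
      finally have "(sqrt (H k x) * ((cutoff R x)\<^sup>2 * sqrt (rho R x))) * (KM * (b + 1) / R)
         \<le> \<tau> * (rho R x * (cutoff R x ^ 4 * H k x)) + c3 * ((cutoff R x)\<^sup>2 * g2 x + 1)" by simp
      then show "\<bar>Rm R k x\<bar> \<le> (\<tau> * (rho R x * (cutoff R x ^ 4 * H k x)) + c3 * ((cutoff R x)\<^sup>2 * g2 x + 1))
         + 600 * M / R * (rho R x * cutoff R x ^ 3 * sqrt (V2 k x) * sqrt (g2 x))"
        using Rm_le[OF x R, of k] unfolding KM_def[symmetric] b_def by linarith
    qed (intro continuous_intros)+
    also have "\<dots> = \<tau> * WH + c3 * (sint R (\<lambda>x. (cutoff R x)\<^sup>2 * g2 x) + 4 * R\<^sup>2) + 600 * M / R * S"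
      unfolding WH_def S_def
      by (subst sint_add, (intro continuous_intros)+, subst sint_add, (intro continuous_intros)+)
         (simp only: sint_cmult, subst sint_add, (intro continuous_intros)+, use R in \<open>simp add: sint_const\<close>)
    also have "c3 * (sint R (\<lambda>x. (cutoff R x)\<^sup>2 * g2 x) + 4 * R\<^sup>2) \<le> c3 * (C0 * R\<^sup>2 + 4 * R\<^sup>2)"
      using C0(2)[OF R] c3 by (intro mult_left_mono) auto
    also have "c3 * (C0 * R\<^sup>2 + 4 * R\<^sup>2) = C1 / \<tau>" using R0 \<tau> by (simp add: c3_def C1_def field_simps)
    finally have rm: "- sint R (Rm R k) \<le> \<tau> * WH + C1 / \<tau> + 600 * M / R * S" by simp
    have "- bint R (\<lambda>x. \<Sum>i\<in>UNIV. d i k x * X R k i x) = bint R (\<lambda>x. (-1) * (\<Sum>i\<in>UNIV. d i k x * X R k i x))"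
      by (simp only: bint_cmult)
    also have "\<dots> \<le> bint R (\<lambda>x. \<tau> * (rho R x * (cutoff R x ^ 4 * V2 k x)) + (192 * M / R)\<^sup>2 / (4 * \<tau>))"
    proof (rule bint_mono)
      fix x assume x: "x \<in> cslab"
      have D0: "\<bar>dcut 2 R j x\<bar> \<le> 16 / R * (cutoff R x ^ 3 * sqrt (rho R x))" for j
        using dcut_bound0[OF R0, of 2 j x] by (simp add: eval_nat_numeral)
      have "\<bar>\<Sum>i\<in>UNIV. d i k x * X R k i x\<bar> \<le> 3 * (sqrt (V2 k x) * (4 * M * (16 / R * (cutoff R x ^ 3 * sqrt (rho R x)))))"
        by (intro sum3_abs_le abs_mult_le X_le[OF x D0] d_le_V2)
      also have "\<dots> = (sqrt (V2 k x) * sqrt (rho R x) * (192 * M / R)) * cutoff R x ^ 3" by simp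
      also have "\<dots> \<le> (sqrt (V2 k x) * sqrt (rho R x) * (192 * M / R)) * (cutoff R x)\<^sup>2"
        using R0 M_nonneg cutoff_nonneg cutoff_le1
        by (intro mult_left_mono power_decreasing) (auto simp: V2_nonneg rho_nonneg)
      also have "\<dots> = (sqrt (V2 k x) * ((cutoff R x)\<^sup>2 * sqrt (rho R x))) * (192 * M / R)" by simp
      also have "\<dots> \<le> \<tau> * (sqrt (V2 k x) * ((cutoff R x)\<^sup>2 * sqrt (rho R x)))\<^sup>2 + (192 * M / R)\<^sup>2 / (4 * \<tau>)"
        by (rule young2[OF \<tau>])
      also have "(sqrt (V2 k x) * ((cutoff R x)\<^sup>2 * sqrt (rho R x)))\<^sup>2 = rho R x * (cutoff R x ^ 4 * V2 k x)"
        using V2_nonneg rho_nonneg by (simp add: power_mult_distrib mult_ac flip: power_mult)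
      finally show "(-1) * (\<Sum>i\<in>UNIV. d i k x * X R k i x) \<le> \<tau> * (rho R x * (cutoff R x ^ 4 * V2 k x)) + (192 * M / R)\<^sup>2 / (4 * \<tau>)"
        by linarith
    qed (intro continuous_intros)+
    also have "\<dots> = \<tau> * WV + 8 * R\<^sup>2 * ((192 * M / R)\<^sup>2 / (4 * \<tau>))"
      unfolding WV_def using R by (subst bint_add, (intro continuous_intros)+) (simp only: bint_cmult, simp add: bint_const)
    finally have "2 * \<alpha> * (- bint R (\<lambda>x. \<Sum>i\<in>UNIV. d i k x * X R k i x)) \<le> 2 * \<alpha> * (\<tau> * WV + 8 * R\<^sup>2 * ((192 * M / R)\<^sup>2 / (4 * \<tau>)))"
      using alpha_nonneg by (intro mult_left_mono) auto
    also have "\<dots> = \<tau> * (2 * \<alpha> * WV) + C2 / \<tau>" using R0 \<tau> by (simp add: C2_def field_simps)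
    finally have bd: "- (2 * \<alpha> * bint R (\<lambda>x. \<Sum>i\<in>UNIV. d i k x * X R k i x)) \<le> \<tau> * (2 * \<alpha> * WV) + C2 / \<tau>" by simp
    have "C1 / \<tau> + C2 / \<tau> \<le> C / \<tau>" using C(2) \<tau> by (simp add: add_divide_distrib[symmetric] divide_right_mono)
    moreover have "600 * M / R * S \<le> C / R * S" using C(3) R0 S0 by (intro mult_right_mono divide_right_mono) auto
    ultimately show "sint R (\<lambda>x. cutoff R x ^ 4 * H k x) + 2 * \<alpha> * bint R (\<lambda>x. cutoff R x ^ 4 * V2 k x)
      \<le> - sint R (\<lambda>x. cutoff R x ^ 4 * Q k x)
      + \<tau> * (sint R (\<lambda>x. rho R x * (cutoff R x ^ 4 * H k x)) + 2 * \<alpha> * bint R (\<lambda>x. rho R x * (cutoff R x ^ 4 * V2 k x)))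
      + C / \<tau> + C / R * sint R (\<lambda>x. rho R x * cutoff R x ^ 3 * sqrt (V2 k x) * sqrt (g2 x))"
      using derivative_energy_identity[OF R0 k] rm bd
      unfolding WH_def[symmetric] WV_def[symmetric] S_def[symmetric] distrib_left by linarith
  qed
qed

end

section \<open>Vanishing of a derivative\<close>

lemma cutoff_horizontal: "cutoff R (pt a b c) = cutoff R (pt a b 0)" "rho R (pt a b c) = rho R (pt a b 0)"
  by (simp_all add: cutoff_def rho_def)

text \<open>The energy above one horizontal point, with the wall contributions included. This is the
  planar density to which \<open>energy_iteration\<close> is applied.\<close>

definition en :: "real \<Rightarrow> (real^3 \<Rightarrow> real) \<Rightarrow> (real^3 \<Rightarrow> real) \<Rightarrow> real \<times> real \<Rightarrow> real" where
  "en c f g p = vint f p + c * (g (pt (fst p) (snd p) 0) + g (pt (fst p) (snd p) 1))"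

lemma cont_en:
  assumes "continuous_on cslab f" "continuous_on cslab g"
  shows "continuous_on A (en c f g)"
proof -
  have "continuous_on A (\<lambda>p. g (pt (fst p) (snd p) 0))" "continuous_on A (\<lambda>p. g (pt (fst p) (snd p) 1))"
    by (auto intro: bcont assms)
  then show ?thesis unfolding en_def[abs_def] by (intro continuous_intros assms)
qed

lemma hint_en:
  assumes "continuous_on cslab f" "continuous_on cslab g"
  shows "hint R (en c f g) = sint R f + c * bint R g"
proof -
  have cg: "continuous_on UNIV (\<lambda>p. g (pt (fst p) (snd p) 0))" "continuous_on UNIV (\<lambda>p. g (pt (fst p) (snd p) 1))"
    by (auto intro: bcont assms)
  have "hint R (en c f g) = hint R (vint f) + hint R (\<lambda>p. c * (g (pt (fst p) (snd p) 0) + g (pt (fst p) (snd p) 1)))"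
    unfolding en_def[abs_def] by (rule hint_add) (intro continuous_intros assms cg)+
  also have "\<dots> = sint R f + c * bint R g"
    unfolding sint_def bint_def hint_cmult by (simp add: hint_add[OF cg])
  finally show ?thesis .
qed

lemma en_horizontal:
  assumes w: "\<And>a b z. w (pt a b z) = w (pt a b 0)"
  shows "en c (\<lambda>x. w x * f x) (\<lambda>x. w x * g x) p = w (pt (fst p) (snd p) 0) * en c f g p"
proof -
  have "vint (\<lambda>x. w x * f x) p = w (pt (fst p) (snd p) 0) * vint f p"
    unfolding vint_def by (subst w) (rule integral_mult_right)
  then show ?thesis using w[of "fst p" "snd p" 1] by (simp add: en_def algebra_simps)
qed

lemma vint_eq_en: "vint f p = en 0 f g p" by (simp add: en_def)

lemma vint_nonneg:
  assumes "continuous_on cslab f" "\<And>x. x \<in> cslab \<Longrightarrow> 0 \<le> f x"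
  shows "0 \<le> vint f p"
proof -
  have "vint (\<lambda>_. 0) p \<le> vint f p" by (rule vint_mono_cslab) (use assms in auto)
  then show ?thesis by (simp add: vint_def[of "\<lambda>_. 0"])
qed

lemma en_nonneg:
  assumes "continuous_on cslab f" "\<And>x. x \<in> cslab \<Longrightarrow> 0 \<le> f x" "\<And>x. x \<in> cslab \<Longrightarrow> 0 \<le> g x" "c \<ge> 0"
  shows "0 \<le> en c f g p"
proof -
  have "0 \<le> vint f p" by (rule vint_nonneg) (use assms in auto)
  moreover have "0 \<le> c * (g (pt (fst p) (snd p) 0) + g (pt (fst p) (snd p) 1))"
    using assms(3,4) by auto
  ultimately show ?thesis by (simp add: en_def)
qed

lemma vint_zeroD:
  assumes c: "continuous_on cslab f" and "\<And>x. x \<in> cslab \<Longrightarrow> 0 \<le> f x" "\<And>p. vint f p = 0" "x \<in> cslab"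
  shows "f x = 0"
proof -
  have cc: "continuous_on {0..1} (\<lambda>z. f (pt (x$1) (x$2) z))"
    by (auto intro!: continuous_on_pt_cslab[OF c] continuous_intros)
  have "integral {0..1} (\<lambda>z. f (pt (x$1) (x$2) z)) = 0"
    using assms(3)[of "(x$1, x$2)"] by (simp add: vint_def)
  then have "\<forall>z\<in>{0..1}. f (pt (x$1) (x$2) z) = 0"
    by (subst (asm) integral_eq_0_iff[OF cc]) (use assms(2) in auto)
  moreover have "x$3 \<in> {0..1}" using assms(4) by (simp add: cslab_def)
  ultimately have "f (pt (x$1) (x$2) (x$3)) = 0" by blast
  then show ?thesis by simp
qed

lemma sint_le_cutoff:
  assumes R: "R > 0" and c: "continuous_on cslab f" and f: "\<And>x. x \<in> cslab \<Longrightarrow> 0 \<le> f x"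
  shows "sint R f \<le> 4 * sint (2 * R) (\<lambda>x. cutoff (2 * R) x ^ 4 * f x)"
    "bint R f \<le> 4 * bint (2 * R) (\<lambda>x. cutoff (2 * R) x ^ 4 * f x)"
proof -
  have le: "f x \<le> 4 * (cutoff (2 * R) x ^ 4 * f x)" if "x \<in> cslab" "\<bar>x$1\<bar> \<le> R" "\<bar>x$2\<bar> \<le> R" for x
  proof -
    \<comment> \<open>The factor 4 suffices because 81/256 exceeds 1/4.\<close>
    have "(3/4) ^ 4 \<le> cutoff (2 * R) x ^ 4" using cutoff_ge[OF R that(2,3)] by (intro power_mono) auto
    then have "1 \<le> 4 * cutoff (2 * R) x ^ 4" by (simp add: power4_eq_xxxx)
    from mult_right_mono[OF this f[OF that(1)]] show ?thesis by simp
  qed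
  have cc: "continuous_on cslab (\<lambda>x. 4 * (cutoff (2 * R) x ^ 4 * f x))" "continuous_on cslab (\<lambda>x. cutoff (2 * R) x ^ 4 * f x)"
    by (intro continuous_intros c)+
  have nn: "0 \<le> cutoff (2 * R) x ^ 4 * f x" if "x \<in> cslab" for x using f[OF that] cutoff_nonneg by simp
  have "sint R f \<le> sint R (\<lambda>x. 4 * (cutoff (2 * R) x ^ 4 * f x))"
    by (rule sint_mono[OF c cc(1) le])
  also have "\<dots> = 4 * sint R (\<lambda>x. cutoff (2 * R) x ^ 4 * f x)" by (rule sint_cmult)
  also have "sint R (\<lambda>x. cutoff (2 * R) x ^ 4 * f x) \<le> sint (2 * R) (\<lambda>x. cutoff (2 * R) x ^ 4 * f x)"
    unfolding sint_def
  proof (rule hint_mono_radius)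
    show "0 \<le> vint (\<lambda>x. cutoff (2 * R) x ^ 4 * f x) p" for p
      by (rule vint_nonneg[OF cc(2) nn])
  qed (use R in \<open>auto intro!: continuous_intros c\<close>)
  finally show "sint R f \<le> 4 * sint (2 * R) (\<lambda>x. cutoff (2 * R) x ^ 4 * f x)" by simp
  have "bint R f \<le> bint R (\<lambda>x. 4 * (cutoff (2 * R) x ^ 4 * f x))"
    by (rule bint_mono[OF c cc(1) le])
  also have "\<dots> = 4 * bint R (\<lambda>x. cutoff (2 * R) x ^ 4 * f x)" by (rule bint_cmult)
  also have "bint R (\<lambda>x. cutoff (2 * R) x ^ 4 * f x) \<le> bint (2 * R) (\<lambda>x. cutoff (2 * R) x ^ 4 * f x)"
    unfolding bint_def using R
    by (intro add_mono hint_mono_radius bcont[OF cc(2)] nn) auto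
  finally show "bint R f \<le> 4 * bint (2 * R) (\<lambda>x. cutoff (2 * R) x ^ 4 * f x)" by simp
qed

text \<open>Reduction to \<open>energy_iteration\<close> for the density \<open>en c f g\<close>.
  The weight \<open>rho\<close> is constant along vertical segments and passes through the vertical
  integration and the wall values alike.\<close>

lemma liouville_iteration:
  assumes cf: "continuous_on cslab f" and cg: "continuous_on cslab g"
    and f0: "\<And>x. x \<in> cslab \<Longrightarrow> 0 \<le> f x" and g0: "\<And>x. x \<in> cslab \<Longrightarrow> 0 \<le> g x" and c: "c \<ge> 0" and \<kappa>: "\<kappa> \<ge> 1" and C: "C \<ge> 0"
    and growth: "\<And>R. R \<ge> 1 \<Longrightarrow> sint R f + c * bint R g \<le> C * R\<^sup>2"
    and ineq: "\<And>\<tau>. \<tau> > 0 \<Longrightarrow> \<exists>\<eta>. (\<eta> \<longlongrightarrow> 0) at_top \<and> (\<forall>R\<ge>1. sint R f + c * bint R g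
       \<le> \<tau> * (sint (\<kappa> * R) (\<lambda>x. rho (\<kappa> * R) x * f x) + c * bint (\<kappa> * R) (\<lambda>x. rho (\<kappa> * R) x * g x))
         + C / \<tau> + \<eta> R * (1 + (sint (\<kappa> * R) f + c * bint (\<kappa> * R) g)))"
    and x: "x \<in> cslab"
  shows "f x = 0" "c > 0 \<Longrightarrow> x$3 = 0 \<or> x$3 = 1 \<Longrightarrow> g x = 0"
proof -
  have en0: "0 \<le> en c f g p" for p by (rule en_nonneg[OF cf f0 g0 c])
  have W: "hint R (\<lambda>p. ((fst p)\<^sup>2 + (snd p)\<^sup>2) / R\<^sup>2 * en c f g p) = sint R (\<lambda>x. rho R x * f x) + c * bint R (\<lambda>x. rho R x * g x)" for R
  proof -
    have "(\<lambda>p. ((fst p)\<^sup>2 + (snd p)\<^sup>2) / R\<^sup>2 * en c f g p) = en c (\<lambda>x. rho R x * f x) (\<lambda>x. rho R x * g x)"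
      by (rule ext, subst en_horizontal[of "rho R", OF cutoff_horizontal(2)]) (simp add: rho_def)
    then show ?thesis by (simp add: hint_en continuous_intros cf cg)
  qed
  have z: "en c f g p = 0" for p
    by (rule energy_iteration[OF cont_en[OF cf cg] en0 \<kappa> C])
       (use growth ineq in \<open>simp_all only: W hint_en[OF cf cg]\<close>)
  have v0: "0 \<le> vint f p" for p by (rule vint_nonneg[OF cf f0])
  have g01: "0 \<le> g (pt a b 0)" "0 \<le> g (pt a b 1)" for a b by (auto intro: g0)
  have "vint f p = 0" for p
    using z[of p] v0[of p] mult_nonneg_nonneg[OF c add_nonneg_nonneg[OF g01]] by (auto simp: en_def add_nonneg_eq_0_iff)
  then show "f x = 0" using vint_zeroD[OF cf f0 _ x] by blast
  assume c0: "c > 0" and b: "x$3 = 0 \<or> x$3 = 1"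
  have "g (pt a b' 0) + g (pt a b' 1) = 0" for a b'
    using z[of "(a, b')"] \<open>\<And>p. vint f p = 0\<close> c0 by (simp add: en_def)
  then have "g (pt a b' 0) = 0 \<and> g (pt a b' 1) = 0" for a b'
    using g01 by (meson add_nonneg_eq_0_iff)
  then show "g x = 0" using b pt_collapse[of x] by metis
qed

text \<open>An inequality on each vertical segment may be multiplied by any nonnegative weight that
  is constant along the segment before it is integrated horizontally.\<close>

lemma sint_weighted_le:
  assumes cf: "continuous_on cslab f1" "continuous_on cslab f2" "continuous_on cslab g" and cw: "continuous_on cslab w"
    and le: "\<And>p. vint f1 p \<le> K * en c f2 g p"
    and w: "\<And>a b z. w (pt a b z) = w (pt a b 0)" "\<And>x. 0 \<le> w x"
  shows "sint R (\<lambda>x. w x * f1 x) \<le> K * (sint R (\<lambda>x. w x * f2 x) + c * bint R (\<lambda>x. w x * g x))"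
proof -
  have "sint R (\<lambda>x. w x * f1 x) = hint R (en 0 (\<lambda>x. w x * f1 x) (\<lambda>x. w x * g x))"
    by (subst hint_en) (auto intro!: continuous_intros cf cw)
  also have "\<dots> \<le> hint R (\<lambda>p. K * en c (\<lambda>x. w x * f2 x) (\<lambda>x. w x * g x) p)"
  proof (rule hint_mono)
    fix a b
    have "w (pt a b 0) * en 0 f1 g (a, b) \<le> w (pt a b 0) * (K * en c f2 g (a, b))"
      using le[of "(a,b)"] w(2) by (intro mult_left_mono) (auto simp: vint_eq_en[symmetric])
    moreover have e: "en c' (\<lambda>x. w x * f x) (\<lambda>x. w x * g x) (a, b) = w (pt a b 0) * en c' f g (a, b)" for c' f
      using en_horizontal[of w c' f g "(a, b)", OF w(1)] by simp
    ultimately show "en 0 (\<lambda>x. w x * f1 x) (\<lambda>x. w x * g x) (a, b) \<le> K * en c (\<lambda>x. w x * f2 x) (\<lambda>x. w x * g x) (a, b)"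
      unfolding e by (simp only: mult.left_commute)
  qed (intro continuous_intros cont_en cf cw)+
  also have "\<dots> = K * (sint R (\<lambda>x. w x * f2 x) + c * bint R (\<lambda>x. w x * g x))"
    by (subst hint_cmult, subst hint_en) (auto intro!: continuous_intros cf cw)
  finally show ?thesis .
qed

text \<open>In the corners of the box \<open>rho\<close> exceeds 1, but there the cutoff
  vanishes.\<close>

lemma rho_cutoff_le: "rho R x * (cutoff R x ^ n * y) \<le> cutoff R x ^ n * y" if "y \<ge> 0" "n > 0"
proof (cases "cutoff R x = 0")
  case False
  then have "rho R x * (cutoff R x ^ n * y) \<le> 1 * (cutoff R x ^ n * y)"
    using that cutoff_nz cutoff_nonneg by (intro mult_right_mono) auto
  then show ?thesis by simp
qed (use that in \<open>simp add: zero_power\<close>)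

lemma cutoff_mult_le: "cutoff R x ^ n * y \<le> y" if "y \<ge> 0"
  using mult_right_mono[of "cutoff R x ^ n" 1 y] that cutoff_nonneg cutoff_le1 by (simp add: power_le_one)

context slab_flow begin

text \<open>Moving the derivative off the undifferentiated gradient factor of \<open>Q\<close>
  replaces it by the velocity, so a cubic expression becomes \<open>M\<close> times a quadratic one.
  The wall flux vanishes: for horizontal \<open>k\<close> because \<open>d 3 k\<close> does, and for
  \<open>k = 3\<close> because \<open>v 3\<close> and, without friction, \<open>d 1 3\<close> and
  \<open>d 2 3\<close> do.\<close>

lemma convection_estimate:
  assumes k: "k \<noteq> 3 \<or> \<alpha> = 0" and R: "R \<ge> 1"
  shows "- sint R (\<lambda>x. cutoff R x ^ 4 * Q k x) \<le> M * sint R (\<lambda>x. cutoff R x ^ 4 * (sqrt (V2 k x) * sqrt (H k x)))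
     + 144 * M / R * sint R (\<lambda>x. rho R x * cutoff R x ^ 3 * sqrt (V2 k x) * sqrt (g2 x))"
proof -
  have R0: "R > 0" using R by simp
  define G where "G j x = (\<Sum>i\<in>UNIV. v i x * d i k x) * d j k x * cutoff R x ^ 4" for j x
  define G' where "G' j x = ((\<Sum>i\<in>UNIV. d i j x * d i k x + v i x * pd j (d i k) x) * d j k x
     + (\<Sum>i\<in>UNIV. v i x * d i k x) * pd j (d j k) x) * cutoff R x ^ 4
     + (\<Sum>i\<in>UNIV. v i x * d i k x) * d j k x * dcut 2 R j x" for j x
  have D: "pdv j (G j) (G' j)" for j unfolding G_def G'_def
    by (intro pdv_mult pdv_sum pdv_flow pdv_cutoff4)
  have cG': "continuous_on cslab (G' j)" for j unfolding G'_def by (intro continuous_intros)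
  have cG: "continuous_on cslab (G 3)" unfolding G_def by (intro continuous_intros)
  have bc: "G 3 x = 0" if x: "x$3 = 0 \<or> x$3 = 1" for x
  proof (cases "k = 3")
    case False
    then have "k = 1 \<or> k = 2" using exhaust_3[of k] by blast
    then show ?thesis using bc_tan[OF x] by (simp add: G_def)
  next
    case True
    then have "a x = 0" unfolding a_def using k by simp
    then show ?thesis using bcz[OF x] bc3[OF x] True by (simp add: G_def sum_3)
  qed
  have "sint R (\<lambda>x. G' 1 x + G' 2 x + G' 3 x) = hint R (\<lambda>p. G 3 (pt (fst p) (snd p) 1)) - hint R (\<lambda>p. G 3 (pt (fst p) (snd p) 0))"
    by (rule divergence_theorem[of R G G', OF _ D cG' cG]) (use R0 cutoff_lateral in \<open>auto simp: G_def\<close>)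
  also have "\<dots> = 0" by (simp add: bc)
  finally have z: "sint R (\<lambda>x. G' 1 x + G' 2 x + G' 3 x) = 0" .
  have "- sint R (\<lambda>x. cutoff R x ^ 4 * Q k x) = sint R (\<lambda>x. (G' 1 x + G' 2 x + G' 3 x) - cutoff R x ^ 4 * Q k x)"
    by (subst sint_diff, (intro continuous_intros cG')+) (simp add: z)
  also have "\<dots> \<le> sint R (\<lambda>x. M * (cutoff R x ^ 4 * (sqrt (V2 k x) * sqrt (H k x)))
     + 144 * M / R * (rho R x * cutoff R x ^ 3 * sqrt (V2 k x) * sqrt (g2 x)))"
  proof (rule sint_mono)
    fix x assume x: "x \<in> cslab"
    have dd: "pd 1 (d 1 k) x + pd 2 (d 2 k) x + pd 3 (d 3 k) x = 0"
      using div_free_deriv[OF x, of k] pd_d_sym[OF x, of k 1 1] pd_d_sym[OF x, of k 2 2] pd_d_sym[OF x, of k 3 3] by simp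
    have "G' 1 x + G' 2 x + G' 3 x - cutoff R x ^ 4 * Q k x =
       cutoff R x ^ 4 * (\<Sum>i\<in>UNIV. \<Sum>j\<in>UNIV. (v i x * d j k x) * pd j (d i k) x)
       + (\<Sum>i\<in>UNIV. v i x * d i k x) * cutoff R x ^ 4 * (pd 1 (d 1 k) x + pd 2 (d 2 k) x + pd 3 (d 3 k) x)
       + (\<Sum>i\<in>UNIV. v i x * d i k x) * (\<Sum>j\<in>UNIV. d j k x * dcut 2 R j x)"
      by (simp add: G'_def Q_def sum_3 algebra_simps)
    also have "\<dots> = cutoff R x ^ 4 * (\<Sum>i\<in>UNIV. \<Sum>j\<in>UNIV. (v i x * d j k x) * pd j (d i k) x)
       + (\<Sum>i\<in>UNIV. v i x * d i k x) * (\<Sum>j\<in>UNIV. d j k x * dcut 2 R j x)" using dd by simp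
    finally have e: "G' 1 x + G' 2 x + G' 3 x - cutoff R x ^ 4 * Q k x = cutoff R x ^ 4 * (\<Sum>i\<in>UNIV. \<Sum>j\<in>UNIV. (v i x * d j k x) * pd j (d i k) x)
       + (\<Sum>i\<in>UNIV. v i x * d i k x) * (\<Sum>j\<in>UNIV. d j k x * dcut 2 R j x)" .
    \<comment> \<open>Cauchy-Schwarz over pairs of indices keeps the constant exactly
      \<open>M\<close>. Bounding the nine summands separately would lose a factor and with it the
      amplitude thresholds.\<close>
    have A: "(\<Sum>i\<in>UNIV. \<Sum>j\<in>UNIV. (v i x * d j k x) * pd j (d i k) x) \<le> M * (sqrt (V2 k x) * sqrt (H k x))"
    proof -
      have CS: "(\<Sum>p\<in>A. f p * g p) \<le> sqrt (\<Sum>p\<in>A. (f p)\<^sup>2) * sqrt (\<Sum>p\<in>A. (g p)\<^sup>2)" for A and f g :: "3 \<times> 3 \<Rightarrow> real"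
      proof -
        have "(\<Sum>p\<in>A. f p * g p) \<le> \<bar>\<Sum>p\<in>A. f p * g p\<bar>" by simp
        also have "\<dots> = sqrt ((\<Sum>p\<in>A. f p * g p)\<^sup>2)" by simp
        also have "\<dots> \<le> sqrt ((\<Sum>p\<in>A. (f p)\<^sup>2) * (\<Sum>p\<in>A. (g p)\<^sup>2))"
          by (intro real_sqrt_le_mono Cauchy_Schwarz_ineq_sum)
        finally show ?thesis by (simp add: real_sqrt_mult)
      qed
      have "(\<Sum>i\<in>UNIV. \<Sum>j\<in>UNIV. (v i x * d j k x) * pd j (d i k) x) = (\<Sum>(i,j)\<in>UNIV \<times> UNIV. (v i x * d j k x) * pd j (d i k) x)"
        by (simp add: sum.cartesian_product)
      also have "\<dots> \<le> sqrt (\<Sum>(i,j)\<in>UNIV \<times> UNIV. (v i x * d j k x)\<^sup>2) * sqrt (\<Sum>(i,j)\<in>UNIV \<times> UNIV. (pd j (d i k) x)\<^sup>2)"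
        using CS[of "\<lambda>(i,j). v i x * d j k x" "\<lambda>(i,j). pd j (d i k) x" "UNIV \<times> UNIV"] by (simp add: case_prod_unfold)
      also have "(\<Sum>(i,j)\<in>UNIV \<times> UNIV. (pd j (d i k) x)\<^sup>2) = H k x" by (simp add: H_def sum.cartesian_product)
      also have "(\<Sum>(i,j)\<in>UNIV \<times> UNIV. (v i x * d j k x)\<^sup>2) = (\<Sum>i\<in>UNIV. (v i x)\<^sup>2) * V2 k x"
        by (simp add: V2_def sum_product sum.cartesian_product power_mult_distrib)
      also have "sqrt ((\<Sum>i\<in>UNIV. (v i x)\<^sup>2) * V2 k x) \<le> M * sqrt (V2 k x)"
      proof -
        have "sqrt (\<Sum>i\<in>UNIV. (v i x)\<^sup>2) \<le> M" using v_sum_le[OF x] M_nonneg by (simp add: real_le_lsqrt)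
        then show ?thesis unfolding real_sqrt_mult by (intro mult_right_mono) (auto simp: V2_nonneg)
      qed
      finally show ?thesis using H_nonneg[of k x] by (simp add: mult.assoc mult_right_mono)
    qed
    have B: "(\<Sum>i\<in>UNIV. v i x * d i k x) * (\<Sum>j\<in>UNIV. d j k x * dcut 2 R j x) \<le> 144 * M / R * (rho R x * cutoff R x ^ 3 * sqrt (V2 k x) * sqrt (g2 x))"
    proof -
      have D1: "\<bar>dcut 2 R j x\<bar> \<le> 16 / R * (cutoff R x ^ 3 * rho R x)" for j
        using dcut_bound1[OF R0, of 2 j x] by (simp add: eval_nat_numeral)
      have "\<bar>(\<Sum>i\<in>UNIV. v i x * d i k x) * (\<Sum>j\<in>UNIV. d j k x * dcut 2 R j x)\<bar> \<le> (3 * (M * sqrt (V2 k x))) * (3 * (sqrt (g2 x) * (16 / R * (cutoff R x ^ 3 * rho R x))))"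
        by (intro abs_mult_le sum3_abs_le v_le[OF x] d_le_V2 d_le D1)
      also have "\<dots> = 144 * M / R * (rho R x * cutoff R x ^ 3 * sqrt (V2 k x) * sqrt (g2 x))" by simp
      finally show ?thesis by linarith
    qed
    have "cutoff R x ^ 4 * (\<Sum>i\<in>UNIV. \<Sum>j\<in>UNIV. (v i x * d j k x) * pd j (d i k) x) \<le> cutoff R x ^ 4 * (M * (sqrt (V2 k x) * sqrt (H k x)))"
      using A cutoff_nonneg by (intro mult_left_mono) auto
    then have "cutoff R x ^ 4 * (\<Sum>i\<in>UNIV. \<Sum>j\<in>UNIV. (v i x * d j k x) * pd j (d i k) x) \<le> M * (cutoff R x ^ 4 * (sqrt (V2 k x) * sqrt (H k x)))"
      by (simp only: mult.left_commute)
    then show "G' 1 x + G' 2 x + G' 3 x - cutoff R x ^ 4 * Q k x \<le> M * (cutoff R x ^ 4 * (sqrt (V2 k x) * sqrt (H k x)))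
     + 144 * M / R * (rho R x * cutoff R x ^ 3 * sqrt (V2 k x) * sqrt (g2 x))"
      unfolding e using B by (rule add_mono)
  qed (intro continuous_intros cG')+
  also have "\<dots> = M * sint R (\<lambda>x. cutoff R x ^ 4 * (sqrt (V2 k x) * sqrt (H k x)))
     + 144 * M / R * sint R (\<lambda>x. rho R x * cutoff R x ^ 3 * sqrt (V2 k x) * sqrt (g2 x))"
    by (subst sint_add, (intro continuous_intros)+) (simp only: sint_cmult)
  finally show ?thesis .
qed

text \<open>One gradient factor is paid by the weighted energy, the other by
  \<open>a_priori\<close>, whose quadratic growth cancels the square of the prefactor
  \<open>1/R\<close>.\<close>

lemma cross_term_estimate:
  "\<exists>C\<ge>0. \<forall>\<tau>>0. \<forall>R\<ge>1. 1 / R * sint R (\<lambda>x. rho R x * cutoff R x ^ 3 * sqrt (V2 k x) * sqrt (g2 x))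
     \<le> \<tau> * sint R (\<lambda>x. rho R x * (cutoff R x ^ 4 * V2 k x)) + C / \<tau>"
proof -
  obtain C0 where C0: "C0 \<ge> 0" "\<And>R. R \<ge> 1 \<Longrightarrow> sint R (\<lambda>x. (cutoff R x)\<^sup>2 * g2 x) \<le> C0 * R\<^sup>2"
    using a_priori by blast
  have "1 / R * sint R (\<lambda>x. rho R x * cutoff R x ^ 3 * sqrt (V2 k x) * sqrt (g2 x))
     \<le> \<tau> * sint R (\<lambda>x. rho R x * (cutoff R x ^ 4 * V2 k x)) + (C0 / 4) / \<tau>" if \<tau>: "\<tau> > 0" and R: "R \<ge> 1" for \<tau> R
  proof -
    have "1 / R * sint R (\<lambda>x. rho R x * cutoff R x ^ 3 * sqrt (V2 k x) * sqrt (g2 x))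
       = sint R (\<lambda>x. 1 / R * (rho R x * cutoff R x ^ 3 * sqrt (V2 k x) * sqrt (g2 x)))" by (simp only: sint_cmult)
    also have "\<dots> \<le> sint R (\<lambda>x. \<tau> * (rho R x * (cutoff R x ^ 4 * V2 k x)) + (1 / (4 * \<tau> * R\<^sup>2)) * ((cutoff R x)\<^sup>2 * g2 x))"
    proof (rule sint_mono)
      fix x
      have "1 / R * (rho R x * cutoff R x ^ 3 * sqrt (V2 k x) * sqrt (g2 x)) = rho R x * ((cutoff R x ^ 2 * sqrt (V2 k x)) * (cutoff R x * sqrt (g2 x) / R))"
        by (simp add: power2_eq_square power3_eq_cube)
      also have "\<dots> \<le> rho R x * (\<tau> * (cutoff R x ^ 2 * sqrt (V2 k x))\<^sup>2 + (cutoff R x * sqrt (g2 x) / R)\<^sup>2 / (4 * \<tau>))"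
        by (intro mult_left_mono young2 \<tau> rho_nonneg)
      also have "\<dots> = \<tau> * (rho R x * (cutoff R x ^ 4 * V2 k x)) + (1 / (4 * \<tau> * R\<^sup>2)) * (rho R x * ((cutoff R x)\<^sup>2 * g2 x))"
        using V2_nonneg g2_nonneg by (simp add: power_mult_distrib power_divide distrib_left mult_ac flip: power_mult)
      also have "\<dots> \<le> \<tau> * (rho R x * (cutoff R x ^ 4 * V2 k x)) + (1 / (4 * \<tau> * R\<^sup>2)) * ((cutoff R x)\<^sup>2 * g2 x)"
        using \<tau> g2_nonneg by (intro add_left_mono mult_left_mono rho_cutoff_le) auto
      finally show "1 / R * (rho R x * cutoff R x ^ 3 * sqrt (V2 k x) * sqrt (g2 x)) \<le> \<tau> * (rho R x * (cutoff R x ^ 4 * V2 k x)) + (1 / (4 * \<tau> * R\<^sup>2)) * ((cutoff R x)\<^sup>2 * g2 x)" .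
    qed (intro continuous_intros)+
    also have "\<dots> = \<tau> * sint R (\<lambda>x. rho R x * (cutoff R x ^ 4 * V2 k x)) + (1 / (4 * \<tau> * R\<^sup>2)) * sint R (\<lambda>x. (cutoff R x)\<^sup>2 * g2 x)"
      by (subst sint_add, (intro continuous_intros)+) (simp only: sint_cmult)
    also have "(1 / (4 * \<tau> * R\<^sup>2)) * sint R (\<lambda>x. (cutoff R x)\<^sup>2 * g2 x) \<le> (1 / (4 * \<tau> * R\<^sup>2)) * (C0 * R\<^sup>2)"
      using \<tau> by (intro mult_left_mono C0(2) R) auto
    also have "\<dots> = (C0 / 4) / \<tau>" using R \<tau> by simp
    finally show ?thesis by simp
  qed
  then show ?thesis using C0(1) by (intro exI[of _ "C0 / 4"]) auto
qed

text \<open>The smallness of \<open>M\<close> enters only through \<open>P1\<close>, an inequality on each vertical segment with constant below one.\<close>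
lemma derivative_vanishes:
  assumes k: "k \<noteq> 3 \<or> \<alpha> = 0" and \<theta>: "\<theta> < 1" and K: "K \<ge> 0"
    and P1: "\<And>p. M * vint (\<lambda>x. sqrt (V2 k x) * sqrt (H k x)) p \<le> \<theta> * en (2 * \<alpha>) (H k) (V2 k) p"
    and P2: "\<And>p. vint (V2 k) p \<le> K * en (2 * \<alpha>) (H k) (V2 k) p"
    and x: "x \<in> cslab"
  shows "H k x = 0" "V2 k x = 0"
proof -
  obtain C1 where C1: "C1 \<ge> 0" and E1: "\<And>\<tau> R. \<tau> > 0 \<Longrightarrow> R \<ge> 1 \<Longrightarrow>
    sint R (\<lambda>x. cutoff R x ^ 4 * H k x) + 2 * \<alpha> * bint R (\<lambda>x. cutoff R x ^ 4 * V2 k x)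
    \<le> - sint R (\<lambda>x. cutoff R x ^ 4 * Q k x)
      + \<tau> * (sint R (\<lambda>x. rho R x * (cutoff R x ^ 4 * H k x)) + 2 * \<alpha> * bint R (\<lambda>x. rho R x * (cutoff R x ^ 4 * V2 k x)))
      + C1 / \<tau> + C1 / R * sint R (\<lambda>x. rho R x * cutoff R x ^ 3 * sqrt (V2 k x) * sqrt (g2 x))"
    using derivative_energy_estimate[OF k] by blast
  obtain C2 where C2: "C2 \<ge> 0" and E2: "\<And>\<tau> R. \<tau> > 0 \<Longrightarrow> R \<ge> 1 \<Longrightarrow>
    1 / R * sint R (\<lambda>x. rho R x * cutoff R x ^ 3 * sqrt (V2 k x) * sqrt (g2 x))
     \<le> \<tau> * sint R (\<lambda>x. rho R x * (cutoff R x ^ 4 * V2 k x)) + C2 / \<tau>"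
    using cross_term_estimate by blast
  define A where "A = C1 + 144 * M"
  have A: "A \<ge> 0" using C1 M_nonneg by (simp add: A_def)
  define B where "B = 1 + A * K"
  have B: "B \<ge> 1" using A K by (simp add: B_def)
  define \<gamma> where "\<gamma> = 1 - \<theta>"
  have \<gamma>: "\<gamma> > 0" using \<theta> by (simp add: \<gamma>_def)
  define C3 where "C3 = C1 + A * C2"
  have C3: "C3 \<ge> 0" using C1 C2 A by (simp add: C3_def)
  define E where "E R = sint R (\<lambda>x. cutoff R x ^ 4 * H k x) + 2 * \<alpha> * bint R (\<lambda>x. cutoff R x ^ 4 * V2 k x)" for R
  define W where "W R = sint R (\<lambda>x. rho R x * (cutoff R x ^ 4 * H k x)) + 2 * \<alpha> * bint R (\<lambda>x. rho R x * (cutoff R x ^ 4 * V2 k x))" for R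
  have main: "\<gamma> * E R \<le> \<tau> * B * W R + C3 / \<tau>" if \<tau>: "\<tau> > 0" and R: "R \<ge> 1" for \<tau> R
  proof -
    define S where "S = sint R (\<lambda>x. rho R x * cutoff R x ^ 3 * sqrt (V2 k x) * sqrt (g2 x))"
    define q where "q = sint R (\<lambda>x. cutoff R x ^ 4 * (sqrt (V2 k x) * sqrt (H k x)))"
    define w where "w = sint R (\<lambda>x. rho R x * (cutoff R x ^ 4 * V2 k x))"
    have 1: "E R \<le> - sint R (\<lambda>x. cutoff R x ^ 4 * Q k x) + \<tau> * W R + C1 / \<tau> + C1 * (1 / R * S)"
      using E1[OF \<tau> R] by (simp add: E_def W_def S_def)
    have 2: "- sint R (\<lambda>x. cutoff R x ^ 4 * Q k x) \<le> M * q + (144 * M) * (1 / R * S)"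
      using convection_estimate[OF k R] by (simp add: q_def S_def)
    have 3: "M * q \<le> \<theta> * E R"
    proof -
      have "sint R (\<lambda>x. cutoff R x ^ 4 * (M * (sqrt (V2 k x) * sqrt (H k x)))) \<le> \<theta> * E R"
        unfolding E_def
      proof (rule sint_weighted_le)
        show "vint (\<lambda>x. M * (sqrt (V2 k x) * sqrt (H k x))) p \<le> \<theta> * en (2 * \<alpha>) (H k) (V2 k) p" for p
          using P1 by (simp only: vint_cmult)
        show "cutoff R (pt a b z) ^ 4 = cutoff R (pt a b 0) ^ 4" for a b z
          by (metis cutoff_horizontal(1))
      qed (auto intro!: continuous_intros simp: cutoff_nonneg)
      moreover have "sint R (\<lambda>x. cutoff R x ^ 4 * (M * (sqrt (V2 k x) * sqrt (H k x)))) = M * q"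
        unfolding q_def sint_cmult[symmetric] by (rule arg_cong[where f = "sint R"]) (simp add: fun_eq_iff)
      ultimately show ?thesis by simp
    qed
    have 4: "w \<le> K * W R"
    proof -
      have h: "rho R (pt a b z) * cutoff R (pt a b z) ^ 4 = rho R (pt a b 0) * cutoff R (pt a b 0) ^ 4" for a b z
        by (metis cutoff_horizontal)
      have "sint R (\<lambda>x. (rho R x * cutoff R x ^ 4) * V2 k x) \<le> K * (sint R (\<lambda>x. (rho R x * cutoff R x ^ 4) * H k x) + 2 * \<alpha> * bint R (\<lambda>x. (rho R x * cutoff R x ^ 4) * V2 k x))"
      proof (rule sint_weighted_le)
        show "rho R (pt a b z) * cutoff R (pt a b z) ^ 4 = rho R (pt a b 0) * cutoff R (pt a b 0) ^ 4" for a b z by (rule h)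
      qed (auto intro!: continuous_intros P2 simp: rho_nonneg cutoff_nonneg)
      then show ?thesis unfolding w_def W_def mult.assoc .
    qed
    have 5: "A * (1 / R * S) \<le> A * (\<tau> * w + C2 / \<tau>)"
      using E2[OF \<tau> R] A unfolding S_def w_def by (intro mult_left_mono)
    have 6: "(A * \<tau>) * w \<le> (A * \<tau>) * (K * W R)" using 4 A \<tau> by (intro mult_left_mono) auto
    have "E R \<le> \<theta> * E R + \<tau> * W R + C1 / \<tau> + A * (1 / R * S)"
      using 1 2 3 unfolding A_def by (simp only: distrib_right)
    also have "\<dots> \<le> \<theta> * E R + \<tau> * W R + C1 / \<tau> + ((A * \<tau>) * (K * W R) + A * (C2 / \<tau>))"
      using 5 6 by (simp add: distrib_left mult.assoc)
    finally have "E R \<le> \<theta> * E R + (\<tau> * W R + (A * \<tau>) * (K * W R)) + (C1 / \<tau> + A * (C2 / \<tau>))" by simp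
    moreover have "\<tau> * W R + (A * \<tau>) * (K * W R) = \<tau> * B * W R" by (simp add: B_def algebra_simps)
    moreover have "C1 / \<tau> + A * (C2 / \<tau>) = C3 / \<tau>" by (simp add: C3_def add_divide_distrib)
    moreover have "\<gamma> * E R = E R - \<theta> * E R" by (simp add: \<gamma>_def left_diff_distrib)
    ultimately show ?thesis by linarith
  qed
  have WE: "W R \<le> E R" for R
    unfolding W_def E_def using alpha_nonneg
    by (intro add_mono mult_left_mono sint_mono bint_mono rho_cutoff_le continuous_intros) (auto simp: H_nonneg V2_nonneg)
  have WW: "W R \<le> sint R (\<lambda>x. rho R x * H k x) + 2 * \<alpha> * bint R (\<lambda>x. rho R x * V2 k x)" for R
    unfolding W_def using alpha_nonneg
    by (intro add_mono mult_left_mono sint_mono bint_mono cutoff_mult_le continuous_intros) (auto simp: H_nonneg V2_nonneg rho_nonneg)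
  define D where "D = 4 * C3 * B / \<gamma>\<^sup>2"
  have D: "D \<ge> 0" using C3 B by (simp add: D_def)
  have Ebd: "E R \<le> D" if R: "R \<ge> 1" for R
  proof -
    \<comment> \<open>Half of the margin \<open>\<gamma>\<close> absorbs the weighted energy, which
      is at most \<open>E\<close> by \<open>WE\<close>.\<close>
    define \<tau> where "\<tau> = \<gamma> / (2 * B)"
    have \<tau>: "\<tau> > 0" using \<gamma> B by (simp add: \<tau>_def)
    have tb: "\<tau> * B = \<gamma> / 2" using B by (simp add: \<tau>_def)
    have "\<gamma> / 2 * W R \<le> \<gamma> / 2 * E R" using WE \<gamma> by (intro mult_left_mono) auto
    moreover have "\<gamma> * E R \<le> \<gamma> / 2 * W R + C3 / \<tau>" using main[OF \<tau> R] unfolding tb .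
    ultimately have "\<gamma> / 2 * E R \<le> C3 / \<tau>" by linarith
    also have "C3 / \<tau> = 2 * C3 * B / \<gamma>" by (simp add: \<tau>_def)
    finally have "(\<gamma> / 2 * E R) * (2 / \<gamma>) \<le> (2 * C3 * B / \<gamma>) * (2 / \<gamma>)" using \<gamma> by (intro mult_right_mono) auto
    then show ?thesis using \<gamma> by (simp add: D_def power2_eq_square)
  qed
  have scale: "sint R (H k) + 2 * \<alpha> * bint R (V2 k) \<le> 4 * E (2 * R)" if R: "R \<ge> 1" for R
  proof -
    have R0: "R > 0" using R by simp
    have "2 * \<alpha> * bint R (V2 k) \<le> 2 * \<alpha> * (4 * bint (2 * R) (\<lambda>x. cutoff (2 * R) x ^ 4 * V2 k x))"
      using alpha_nonneg by (intro mult_left_mono sint_le_cutoff(2)[OF R0 cont_V2 V2_nonneg]) auto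
    then show ?thesis using sint_le_cutoff(1)[OF R0 cont_H H_nonneg, of k] by (simp add: E_def)
  qed
  define C where "C = 4 * D"
  have C0: "C \<ge> 0" using D by (simp add: C_def)
  have growth: "sint R (H k) + 2 * \<alpha> * bint R (V2 k) \<le> C * R\<^sup>2" if R: "R \<ge> 1" for R
  proof -
    have "E (2 * R) \<le> D" using R by (intro Ebd) simp
    then have "sint R (H k) + 2 * \<alpha> * bint R (V2 k) \<le> C * 1" using scale[OF R] by (simp add: C_def)
    also have "C * 1 \<le> C * R\<^sup>2" using R C0 by (intro mult_left_mono) (auto simp: one_le_power)
    finally show ?thesis .
  qed
  have ineq: "sint R (H k) + 2 * \<alpha> * bint R (V2 k) \<le> \<tau> * (sint (2 * R) (\<lambda>x. rho (2 * R) x * H k x) + 2 * \<alpha> * bint (2 * R) (\<lambda>x. rho (2 * R) x * V2 k x)) + C / \<tau>"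
    if \<tau>: "\<tau> > 0" and R: "R \<ge> 1" for \<tau> R
  proof -
    \<comment> \<open>The 4 compensates the factor in \<open>scale\<close>, and
      \<open>\<gamma>\<close> the division that follows. With this choice \<open>C3 / t\<close> is
      \<open>\<gamma> * D / \<tau>\<close>, which explains the form of \<open>D\<close>.\<close>
    define t where "t = \<tau> * \<gamma> / (4 * B)"
    have t: "t > 0" using \<tau> \<gamma> B by (simp add: t_def)
    have tB: "t * B = \<tau> * \<gamma> / 4" using B by (simp add: t_def)
    have "\<gamma> * E (2 * R) \<le> t * B * W (2 * R) + C3 / t" using R by (intro main t) auto
    also have "C3 / t = \<gamma> * (D / \<tau>)" using \<gamma> by (simp add: t_def D_def power2_eq_square mult_ac)
    also have "t * B * W (2 * R) = \<gamma> * (\<tau> / 4 * W (2 * R))" by (simp add: tB)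
    finally have "\<gamma> * E (2 * R) \<le> \<gamma> * (\<tau> / 4 * W (2 * R) + D / \<tau>)" by (simp only: distrib_left)
    then have "E (2 * R) \<le> \<tau> / 4 * W (2 * R) + D / \<tau>" using \<gamma> by simp
    then have "sint R (H k) + 2 * \<alpha> * bint R (V2 k) \<le> \<tau> * W (2 * R) + C / \<tau>"
      using scale[OF R] by (simp add: C_def)
    also have "\<tau> * W (2 * R) \<le> \<tau> * (sint (2 * R) (\<lambda>x. rho (2 * R) x * H k x) + 2 * \<alpha> * bint (2 * R) (\<lambda>x. rho (2 * R) x * V2 k x))"
      using \<tau> by (intro mult_left_mono WW) auto
    finally show ?thesis by simp
  qed
  have z: "H k y = 0" "2 * \<alpha> > 0 \<Longrightarrow> y$3 = 0 \<or> y$3 = 1 \<Longrightarrow> V2 k y = 0" if "y \<in> cslab" for y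
    by (rule liouville_iteration[of "H k" "V2 k" "2 * \<alpha>" 2 C],
        use that alpha_nonneg growth ineq C0 in \<open>auto intro!: continuous_intros H_nonneg V2_nonneg exI[of _ "\<lambda>_. 0"] simp: C_def\<close>)+
  show "H k x = 0" by (rule z(1)[OF x])
  \<comment> \<open>So far the derivative is only known to be constant. Its vanishing follows from
    \<open>P2\<close>, whose right side is zero: the wall terms vanish either by the iteration or
    through \<alpha> = 0.\<close>
  have "vint (H k) p = 0" for p
    unfolding vint_def by (rule integral_eq_0I) (use z(1) in auto)
  moreover have "2 * \<alpha> * (V2 k (pt a b 0) + V2 k (pt a b 1)) = 0" for a b
    using z(2)[of "pt a b 0"] z(2)[of "pt a b 1"] alpha_nonneg by (cases "\<alpha> = 0") auto
  ultimately have "en (2 * \<alpha>) (H k) (V2 k) p = 0" for p by (simp add: en_def)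
  then have "vint (V2 k) p \<le> 0" for p using P2[of p] by simp
  moreover have "0 \<le> vint (V2 k) p" for p
    by (rule vint_nonneg[OF cont_V2 V2_nonneg])
  ultimately have "vint (V2 k) p = 0" for p by (meson antisym)
  then show "V2 k x = 0" by (intro vint_zeroD[OF cont_V2 V2_nonneg _ x]) auto
qed

end

section \<open>Flows of small amplitude\<close>

lemma const_vertical:
  assumes "\<And>z. 0 \<le> z \<Longrightarrow> z \<le> 1 \<Longrightarrow> (h has_real_derivative 0) (at z)" "0 \<le> z" "z \<le> 1"
  shows "h z = h (0::real)"
proof (cases "z = 0")
  case False
  then have "\<exists>y. 0 < y \<and> y < z \<and> h z - h 0 = (z - 0) * 0"
    using assms by (intro MVT2) auto
  then have "h z - h 0 = (z - 0) * 0" by blast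
  then show ?thesis by simp
qed simp

lemma const_horizontal:
  assumes f: "sm f" and 0: "\<And>x. x \<in> cslab \<Longrightarrow> pd 1 f x = 0" "\<And>x. x \<in> cslab \<Longrightarrow> pd 2 f x = 0" and x: "x \<in> cslab"
  shows "f x = f (pt 0 0 (x$3))"
proof -
  have z: "0 \<le> x$3" "x$3 \<le> 1" using x by (auto simp: cslab_def)
  have "f (pt (x$1) (x$2) (x$3)) = f (pt 0 (x$2) (x$3))"
    by (rule DERIV_isconst_all[where f = "\<lambda>t. f (pt t (x$2) (x$3))"])
       (use pdv_line[OF sm_pdv[OF f] z] 0(1) z in auto)
  also have "\<dots> = f (pt 0 0 (x$3))"
    by (rule DERIV_isconst_all[where f = "\<lambda>t. f (pt 0 t (x$3))"])
       (use pdv_line2[OF sm_pdv[OF f] z] 0(2) z in auto)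
  finally show ?thesis by simp
qed

lemma const_cslab:
  assumes f: "sm f" and 0: "\<And>x j. x \<in> cslab \<Longrightarrow> pd j f x = 0" and x: "x \<in> cslab"
  shows "f x = f (pt 0 0 0)"
proof -
  have z: "0 \<le> x$3" "x$3 \<le> 1" using x by (auto simp: cslab_def)
  have "f (pt 0 0 (x$3)) = f (pt 0 0 0)"
    by (rule const_vertical[where h = "\<lambda>t. f (pt 0 0 t)", OF _ z])
       (use pdv_line3[OF sm_pdv[OF f]] 0 in auto)
  then show ?thesis using const_horizontal[OF f 0 0 x] by simp
qed

lemma pd_zero_cslab:
  assumes f: "sm f" and 0: "\<And>x. x \<in> cslab \<Longrightarrow> f x = 0" and x: "x \<in> cslab"
  shows "pd j f x = 0"
proof (rule cslab_eqI[where f = "pd j f" and g = "\<lambda>_. 0", OF _ _ _ x])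
  show "continuous_on cslab (pd j f)" by (intro sm_continuous sm_pd f)
  fix y assume y: "y \<in> slab"
  have "pd j f y = pd j (\<lambda>_. 0) y"
    by (rule pd_cong_open[OF open_slab y]) (use 0 slab_subset_cslab in auto)
  then show "pd j f y = 0" by (simp add: pd_def)
qed (intro continuous_intros)

context slab_flow begin

lemma vint_V2: "vint (V2 k) p = (\<Sum>i\<in>UNIV. vint (\<lambda>x. (d i k x)\<^sup>2) p)"
  unfolding V2_def sum_3 by (subst vint_add, (intro continuous_intros)+, subst vint_add, (intro continuous_intros)+) simp

lemma vint_H_ge: "(\<Sum>i\<in>UNIV. vint (\<lambda>x. (pd 3 (d i k) x)\<^sup>2) p) \<le> vint (H k) p"
proof -
  have "(\<Sum>i\<in>UNIV. vint (\<lambda>x. (pd 3 (d i k) x)\<^sup>2) p) = vint (\<lambda>x. \<Sum>i\<in>UNIV. (pd 3 (d i k) x)\<^sup>2) p"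
    unfolding sum_3 by (subst vint_add, (intro continuous_intros)+, subst vint_add, (intro continuous_intros)+) simp
  also have "\<dots> \<le> vint (H k) p"
  proof (rule vint_mono_cslab)
    fix x
    have "(pd 3 (d i k) x)\<^sup>2 \<le> (\<Sum>j\<in>UNIV. (pd j (d i k) x)\<^sup>2)" for i
      by (rule member_le_sum[of 3 UNIV "\<lambda>j. (pd j (d i k) x)\<^sup>2"]) auto
    then show "(\<Sum>i\<in>UNIV. (pd 3 (d i k) x)\<^sup>2) \<le> H k x" unfolding H_def by (intro sum_mono)
  qed (intro continuous_intros)+
  finally show ?thesis .
qed

lemma vint_cross_le:
  assumes s: "s > 0"
  shows "vint (\<lambda>x. sqrt (V2 k x) * sqrt (H k x)) p \<le> s / 2 * vint (V2 k) p + 1 / (2 * s) * vint (H k) p"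
proof -
  have "vint (\<lambda>x. sqrt (V2 k x) * sqrt (H k x)) p \<le> vint (\<lambda>x. s / 2 * V2 k x + 1 / (2 * s) * H k x) p"
  proof (rule vint_mono_cslab)
    fix x
    have "sqrt (V2 k x) * sqrt (H k x) \<le> s / 2 * (sqrt (V2 k x))\<^sup>2 + (sqrt (H k x))\<^sup>2 / (4 * (s / 2))"
      using s by (intro young2) auto
    then show "sqrt (V2 k x) * sqrt (H k x) \<le> s / 2 * V2 k x + 1 / (2 * s) * H k x"
      using V2_nonneg H_nonneg by simp
  qed (intro continuous_intros)+
  also have "\<dots> = s / 2 * vint (V2 k) p + 1 / (2 * s) * vint (H k) p"
    by (subst vint_add, (intro continuous_intros)+) (simp only: vint_cmult)
  finally show ?thesis .
qed

text \<open>The derivative need not vanish on the walls, but its wall values belong to the energy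
  with coefficient \<open>2 * \<alpha>\<close>, so the Robin inequality replaces Wirtinger's. Young
  with equal weights leaves \<open>b / 2\<close> plus the integral of \<open>H k\<close>; the
  thresholds \<open>\<alpha> / 2\<close> and \<open>1 / 4\<close> bring \<open>M\<close> times each
  part below a quarter of the energy.\<close>

lemma horizontal_derivatives_vanish:
  assumes al: "\<alpha> > 0" and MM: "M \<le> min (\<alpha> / 2) (1 / 4)" and k: "k = 1 \<or> k = 2" and x: "x \<in> cslab"
  shows "H k x = 0" "V2 k x = 0"
proof -
  have k3: "k \<noteq> 3 \<or> \<alpha> = 0" using k by auto
  define b where "b p = V2 k (pt (fst p) (snd p) 0) + V2 k (pt (fst p) (snd p) 1)" for p :: "real \<times> real"
  have b0: "0 \<le> b p" for p by (simp add: b_def V2_nonneg)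
  have h0: "0 \<le> vint (H k) p" for p by (rule vint_nonneg[OF cont_H H_nonneg])
  have Rob: "vint (V2 k) p \<le> b p + vint (H k) p" for p
  proof -
    have "vint (\<lambda>x. (d i k x)\<^sup>2) p \<le> (d i k (pt (fst p) (snd p) 0))\<^sup>2 + (d i k (pt (fst p) (snd p) 1))\<^sup>2 + vint (\<lambda>x. (pd 3 (d i k) x)\<^sup>2) p" for i
      by (rule vint_Robin[OF pdv_flow(2)]) (intro continuous_intros)+
    then have "vint (V2 k) p \<le> (\<Sum>i\<in>UNIV. (d i k (pt (fst p) (snd p) 0))\<^sup>2 + (d i k (pt (fst p) (snd p) 1))\<^sup>2 + vint (\<lambda>x. (pd 3 (d i k) x)\<^sup>2) p)"
      unfolding vint_V2 by (intro sum_mono)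
    also have "\<dots> = b p + (\<Sum>i\<in>UNIV. vint (\<lambda>x. (pd 3 (d i k) x)\<^sup>2) p)"
      by (simp add: sum.distrib b_def V2_def)
    finally show ?thesis using vint_H_ge[of k p] by linarith
  qed
  have en: "en (2 * \<alpha>) (H k) (V2 k) p = vint (H k) p + 2 * \<alpha> * b p" for p by (simp add: en_def b_def)
  have P1: "M * vint (\<lambda>x. sqrt (V2 k x) * sqrt (H k x)) p \<le> 1/4 * en (2 * \<alpha>) (H k) (V2 k) p" for p
  proof -
    have "vint (\<lambda>x. sqrt (V2 k x) * sqrt (H k x)) p \<le> b p / 2 + vint (H k) p"
      using vint_cross_le[of 1 k p] Rob[of p] by simp
    then have "M * vint (\<lambda>x. sqrt (V2 k x) * sqrt (H k x)) p \<le> M * (b p / 2 + vint (H k) p)"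
      using M_nonneg by (intro mult_left_mono)
    also have "\<dots> = M * (b p / 2) + M * vint (H k) p" by (rule distrib_left)
    also have "M * (b p / 2) \<le> (\<alpha> / 2) * (b p / 2)" using MM b0[of p] by (intro mult_right_mono) auto
    also have "M * vint (H k) p \<le> (1/4) * vint (H k) p" using MM h0[of p] by (intro mult_right_mono) auto
    also have "\<alpha> / 2 * (b p / 2) \<le> 1/4 * (2 * \<alpha> * b p)" using al b0[of p] by simp
    finally show ?thesis unfolding en by (simp add: distrib_left)
  qed
  have P2: "vint (V2 k) p \<le> (1 + 1 / (2 * \<alpha>)) * en (2 * \<alpha>) (H k) (V2 k) p" for p
  proof -
    have "b p + vint (H k) p \<le> (1 + 1 / (2 * \<alpha>)) * (vint (H k) p + 2 * \<alpha> * b p)"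
    proof -
      have "(1 + 1 / (2 * \<alpha>)) * (vint (H k) p + 2 * \<alpha> * b p) = vint (H k) p + 2 * \<alpha> * b p + vint (H k) p / (2 * \<alpha>) + b p"
        using al by (simp add: field_simps)
      moreover have "0 \<le> 2 * \<alpha> * b p" "0 \<le> vint (H k) p / (2 * \<alpha>)" using al b0 h0 by auto
      ultimately show ?thesis by linarith
    qed
    then show ?thesis using Rob[of p] unfolding en by linarith
  qed
  have t: "1/4 < (1::real)" "0 \<le> 1 + 1 / (2 * \<alpha>)" using al by auto
  show "H k x = 0" by (rule derivative_vanishes(1)[OF k3 t P1 P2 x])
  show "V2 k x = 0" by (rule derivative_vanishes(2)[OF k3 t P1 P2 x])
qed

text \<open>Without friction \<open>d 1 3\<close> and \<open>d 2 3\<close> vanish on the walls, so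
  Wirtinger applies to them directly. The remaining component \<open>d 3 3\<close> is handled as the
  derivative of \<open>v 3\<close>, which vanishes there.\<close>

lemma vertical_derivative_vanishes:
  assumes al: "\<alpha> = 0" and MM: "M < pi" and x: "x \<in> cslab"
  shows "H 3 x = 0" "V2 3 x = 0"
proof -
  \<comment> \<open>Strictly between \<open>M\<close> and \<open>pi\<close>: below \<open>pi\<close>
    for the Wirtinger inequality, above \<open>M\<close> so that \<open>M / c\<close> is less than
    1.\<close>
  define c where "c = (M + pi) / 2"
  have c: "0 < c" "c < pi" "M < c" using MM M_nonneg pi_gt_zero by (auto simp: c_def)
  have a0: "a x = 0" for x unfolding a_def using al by simp
  have en: "en (2 * \<alpha>) (H 3) (V2 3) p = vint (H 3) p" for p using al by (simp add: en_def)
  have Wir: "c\<^sup>2 * vint (V2 3) p \<le> vint (H 3) p" for p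
  proof -
    have "c\<^sup>2 * vint (\<lambda>x. (d i 3 x)\<^sup>2) p \<le> vint (\<lambda>x. (pd 3 (d i 3) x)\<^sup>2) p" for i
    proof (cases "i = 3")
      case True
      show ?thesis unfolding True
        by (rule vint_Wirtinger_deriv[OF pdv_v pdv_flow(2) _ _ _ c(1,2) bc3]) (auto intro: continuous_intros)
    next
      case False
      then have i: "i = 1 \<or> i = 2" using exhaust_3[of i] by blast
      show ?thesis
        by (rule vint_Wirtinger[OF pdv_flow(2) _ _ c(1,2)]) (use bcz[OF _ i] a0 in \<open>auto intro: continuous_intros\<close>)
    qed
    then have "(\<Sum>i\<in>UNIV. c\<^sup>2 * vint (\<lambda>x. (d i 3 x)\<^sup>2) p) \<le> (\<Sum>i\<in>UNIV. vint (\<lambda>x. (pd 3 (d i 3) x)\<^sup>2) p)"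
      by (intro sum_mono)
    then show ?thesis using vint_H_ge[of 3 p] by (simp add: vint_V2 sum_distrib_left)
  qed
  have P1: "M * vint (\<lambda>x. sqrt (V2 3 x) * sqrt (H 3 x)) p \<le> (M / c) * en (2 * \<alpha>) (H 3) (V2 3) p" for p
  proof -
    have "c / 2 * vint (V2 3) p = 1 / (2 * c) * (c\<^sup>2 * vint (V2 3) p)" using c by (simp add: power2_eq_square)
    also have "\<dots> \<le> 1 / (2 * c) * vint (H 3) p" using Wir c by (intro mult_left_mono) auto
    finally have "vint (\<lambda>x. sqrt (V2 3 x) * sqrt (H 3 x)) p \<le> 1 / c * vint (H 3) p"
      using vint_cross_le[OF c(1), of 3 p] by simp
    then have "M * vint (\<lambda>x. sqrt (V2 3 x) * sqrt (H 3 x)) p \<le> M * (1 / c * vint (H 3) p)"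
      using M_nonneg by (intro mult_left_mono)
    then show ?thesis unfolding en by simp
  qed
  have P2: "vint (V2 3) p \<le> (1 / c\<^sup>2) * en (2 * \<alpha>) (H 3) (V2 3) p" for p
    unfolding en using Wir[of p] c by (simp add: field_simps)
  have t: "3 \<noteq> (3::3) \<or> \<alpha> = 0" "M / c < 1" "0 \<le> 1 / c\<^sup>2" using al c by auto
  show "H 3 x = 0" by (rule derivative_vanishes(1)[OF t P1 P2 x])
  show "V2 3 x = 0" by (rule derivative_vanishes(2)[OF t P1 P2 x])
qed

lemma V2_zeroD: "V2 k x = 0 \<Longrightarrow> d i k x = 0"
  using d_le_V2[of i k x] by simp

lemma H_zeroD: "H k x = 0 \<Longrightarrow> pd j (d i k) x = 0"
  using dd_le_H[of j i k x] by simp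

lemma v3_zero:
  assumes "\<And>x. x \<in> cslab \<Longrightarrow> d 3 3 x = 0" "x \<in> cslab"
  shows "v 3 x = 0"
proof -
  have z: "0 \<le> x$3" "x$3 \<le> 1" using assms by (auto simp: cslab_def)
  have "v 3 (pt (x$1) (x$2) (x$3)) = v 3 (pt (x$1) (x$2) 0)"
    by (rule const_vertical[where h = "\<lambda>t. v 3 (pt (x$1) (x$2) t)", OF _ z])
       (use pdv_line3[OF pdv_v[of 3 3]] assms(1) in auto)
  also have "\<dots> = 0" by (rule bc3) simp
  finally show ?thesis by simp
qed

lemma d3_zero:
  assumes "\<And>x. x \<in> cslab \<Longrightarrow> d 3 3 x = 0" "x \<in> cslab"
  shows "d 3 j x = 0"
proof (cases "j = 3")
  case False
  have "v 3 y = 0" if "y$3 = x$3" for y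
    by (rule v3_zero[OF assms(1)]) (use that assms(2) in \<open>auto simp: cslab_def\<close>)
  then show ?thesis unfolding d_def by (rule pd_tangential_zero[OF _ refl False])
qed (use assms in auto)

text \<open>Once the horizontal derivatives are gone, the convection vanishes and each horizontal
  momentum equation says that the second vertical derivative equals a pressure derivative. The
  latter is constant, so the profile is a parabola.\<close>

theorem poiseuille_rigidity:
  assumes al: "\<alpha> > 0" and MM: "M < min (\<alpha> / 2) (1 / 4)"
  shows "\<exists>C3 C4. \<forall>x\<in>slab. u x = vector [C3 * (- 2 * \<alpha> * (x$3)\<^sup>2 + 2 * \<alpha> * x$3 + 1),
                            C4 * (- 2 * \<alpha> * (x$3)\<^sup>2 + 2 * \<alpha> * x$3 + 1), 0]"
proof -
  have MM': "M \<le> min (\<alpha> / 2) (1 / 4)" using MM by simp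
  have d0: "d i 1 x = 0" "d i 2 x = 0" if "x \<in> cslab" for i x
    by (rule V2_zeroD[OF horizontal_derivatives_vanish(2)[OF al MM' _ that]], simp)+
  have dd0: "pd j (d i 1) x = 0" "pd j (d i 2) x = 0" if "x \<in> cslab" for i j x
    by (rule H_zeroD[OF horizontal_derivatives_vanish(1)[OF al MM' _ that]], simp)+
  have d33: "d 3 3 x = 0" if "x \<in> cslab" for x
    using div_free[OF that] d0[OF that] by simp
  have v3: "v 3 x = 0" if "x \<in> cslab" for x
    by (rule v3_zero[OF d33 that])
  have ddd0: "pd j (pd j (d i 1)) x = 0" "pd j (pd j (d i 2)) x = 0" if x: "x \<in> cslab" for i j x
  proof -
    show "pd j (pd j (d i 1)) x = 0" by (rule pd_zero_cslab[OF sm_dd _ x]) (rule dd0(1))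
    show "pd j (pd j (d i 2)) x = 0" by (rule pd_zero_cslab[OF sm_dd _ x]) (rule dd0(2))
  qed
  \<comment> \<open>In the differentiated momentum equation every velocity term contains a
    horizontal derivative, so the second pressure derivatives are zero as well.\<close>
  have pp0: "pd i (pd k P) x = 0" if "x \<in> cslab" "k = 1 \<or> k = 2" for i k x
    using ddd0[OF that(1)] momentum_deriv[OF that(1), of i k] that(2) d0[OF that(1)] dd0[OF that(1)] by auto
  have prof: "v i x = v i (pt 0 0 0) * (- 2 * \<alpha> * (x$3)\<^sup>2 + 2 * \<alpha> * x$3 + 1)" if i: "i = 1 \<or> i = 2" and x: "x \<in> cslab" for i x
  proof -
    have z: "0 \<le> x$3" "x$3 \<le> 1" using x by (auto simp: cslab_def)
    define c where "c = pd i P (pt 0 0 0)"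
    have pc: "pd i P y = c" if "y \<in> cslab" for y
      unfolding c_def by (rule const_cslab[OF sm_p pp0[OF _ i] that])
    have L: "pd 3 (d i 3) y = c" if y: "y \<in> cslab" for y
    proof -
      have "L i y = pd 3 (d i 3) y" using dd0[OF y] by (simp add: L_def sum_3)
      moreover have "N i y = 0" using d0[OF y] v3[OF y] by (simp add: N_def sum_3)
      ultimately show ?thesis using momentum[OF y, of i] pc[OF y] by simp
    qed
    define f where "f t = v i (pt 0 0 t)" for t
    define f' where "f' t = d i 3 (pt 0 0 t)" for t
    have Df: "(f has_real_derivative f' t) (at t)" if "0 \<le> t" "t \<le> 1" for t
      unfolding f_def f'_def by (rule pdv_line3[OF pdv_v that])
    have Df': "(f' has_real_derivative c) (at t)" if "0 \<le> t" "t \<le> 1" for t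
      using pdv_line3[OF pdv_flow(2)[of 3 i 3] that, of 0 0] L[of "pt 0 0 t"] that by (simp add: f'_def[abs_def])
    have f't: "f' t = f' 0 + c * t" if "0 \<le> t" "t \<le> 1" for t
    proof -
      have "f' t - c * t = f' 0 - c * 0"
        by (rule const_vertical[where h = "\<lambda>t. f' t - c * t", OF _ that]) (auto intro!: derivative_eq_intros Df')
      then show ?thesis by simp
    qed
    have ft: "f t = f 0 + f' 0 * t + c * t\<^sup>2 / 2" if "0 \<le> t" "t \<le> 1" for t
    proof -
      have "f t - (f' 0 * t + c * t\<^sup>2 / 2) = f 0 - (f' 0 * 0 + c * 0\<^sup>2 / 2)"
      proof (rule const_vertical[where h = "\<lambda>t. f t - (f' 0 * t + c * t\<^sup>2 / 2)", OF _ that])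
        fix s :: real assume s: "0 \<le> s" "s \<le> 1"
        have "((\<lambda>t. f t - (f' 0 * t + c * t\<^sup>2 / 2)) has_real_derivative f' s - (f' 0 + c * s)) (at s)"
          by (auto intro!: derivative_eq_intros Df s)
        then show "((\<lambda>t. f t - (f' 0 * t + c * t\<^sup>2 / 2)) has_real_derivative 0) (at s)"
          using f't[OF s] by simp
      qed
      then show ?thesis by simp
    qed
    have b0: "f' 0 = 2 * \<alpha> * f 0" unfolding f_def f'_def
      using bcz[of "pt 0 0 0", OF _ i] by (simp add: a_def)
    have b1: "f' 1 = - 2 * \<alpha> * f 1" unfolding f_def f'_def
      using bcz[of "pt 0 0 1", OF _ i] by (simp add: a_def)
    \<comment> \<open>Inserting the parabola into both friction conditions relates its curvature
      \<open>c\<close> to the wall value \<open>f 0\<close>. The common factor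
      \<open>1 + \<alpha>\<close> is positive and cancels.\<close>
    have "2 * \<alpha> * f 0 + c = - 2 * \<alpha> * (f 0 + 2 * \<alpha> * f 0 + c / 2)"
      using b0 b1 f't[of 1] ft[of 1] by simp
    then have "(1 + \<alpha>) * c = (1 + \<alpha>) * (- 4 * \<alpha> * f 0)" by (simp add: algebra_simps)
    then have "c = - 4 * \<alpha> * f 0" unfolding mult_cancel_left using al by linarith
    then have "f (x$3) = f 0 * (- 2 * \<alpha> * (x$3)\<^sup>2 + 2 * \<alpha> * x$3 + 1)"
      using ft[OF z] b0 by (simp add: algebra_simps)
    moreover have "v i x = f (x$3)"
      unfolding f_def by (rule const_horizontal[OF sm_v _ _ x]) (use d0 in \<open>auto simp: d_def\<close>)
    ultimately show ?thesis by (simp add: f_def)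
  qed
  show ?thesis
  proof (intro exI ballI)
    fix x assume "x \<in> slab"
    then have x: "x \<in> cslab" using slab_subset_cslab by auto
    show "u x = vector [v 1 (pt 0 0 0) * (- 2 * \<alpha> * (x$3)\<^sup>2 + 2 * \<alpha> * x$3 + 1),
                            v 2 (pt 0 0 0) * (- 2 * \<alpha> * (x$3)\<^sup>2 + 2 * \<alpha> * x$3 + 1), 0]"
      using prof[OF _ x, of 1] prof[OF _ x, of 2] v3[OF x] by (simp add: vec_eq_iff forall_3 v_def)
  qed
qed

section \<open>Planar flows: vanishing vertical derivatives, no friction\<close>

context
  assumes al: "\<alpha> = 0" and d3: "\<And>i x. x \<in> cslab \<Longrightarrow> d i 3 x = 0"
begin

text \<open>Derivatives involving direction 3 vanish here, so this is the full squared Hessian of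
  the planar velocity.\<close>

definition F :: "real^3 \<Rightarrow> real" where "F x = H 1 x + H 2 x"

lemma cont_F [continuous_intros]: "continuous_on cslab F" unfolding F_def by (intro continuous_intros)
lemma F_nonneg: "0 \<le> F x" unfolding F_def using H_nonneg by (intro add_nonneg_nonneg)

lemma L_le_F: "x \<in> cslab \<Longrightarrow> \<bar>L i x\<bar> \<le> 3 * sqrt (F x)"
proof -
  assume x: "x \<in> cslab"
  have "\<bar>pd j (d i j) x\<bar> \<le> sqrt (F x)" for j
  proof -
    consider "j = 1" | "j = 2" | "j = 3" using exhaust_3[of j] by blast
    then show ?thesis
    proof cases
      case 1
      show ?thesis unfolding 1 by (rule order_trans[OF dd_le_H real_sqrt_le_mono]) (use H_nonneg in \<open>simp add: F_def\<close>)
    next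
      case 2
      show ?thesis unfolding 2 by (rule order_trans[OF dd_le_H real_sqrt_le_mono]) (use H_nonneg in \<open>simp add: F_def\<close>)
    next
      case 3
      then show ?thesis using pd_zero_cslab[OF sm_d[of i 3] d3 x, of 3] F_nonneg by simp
    qed
  qed
  then show ?thesis unfolding L_def by (rule sum3_abs_le)
qed

text \<open>The sum is the trace of \<open>A^T A^2\<close> for the planar gradient \<open>A\<close>.
  A trace-free 2 by 2 matrix has a scalar square, so this is a multiple of the trace of
  \<open>A\<close>, hence zero. It is the absence of vortex stretching in the plane and removes any
  smallness condition from this stage.\<close>

lemma planar_Q: "x \<in> cslab \<Longrightarrow> Q 1 x + Q 2 x = 0"
proof -
  assume x: "x \<in> cslab"
  have "d 3 j x = 0" for j by (rule d3_zero[OF d3 x])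
  moreover have "d 2 2 x = - d 1 1 x" using div_free[OF x] d3[OF x] by simp
  ultimately show ?thesis using d3[OF x] by (simp add: Q_def sum_3 algebra_simps)
qed

lemma gradient_by_laplacian:
  assumes R: "R > 0" and dw: "\<And>j. pdv j w (w' j)" and cw: "continuous_on cslab w" "\<And>j. continuous_on cslab (w' j)"
    and lat: "\<And>x. \<bar>x$1\<bar> = R \<or> \<bar>x$2\<bar> = R \<Longrightarrow> w x = 0"
    and w0: "\<And>x. x \<in> cslab \<Longrightarrow> 0 \<le> w x"
    and D: "\<And>x j. x \<in> cslab \<Longrightarrow> \<bar>w' j x\<bar> \<le> D x" and cD: "continuous_on cslab D"
  shows "sint R (\<lambda>x. w x * g2 x) \<le> sint R (\<lambda>x. 9 * M * (w x * sqrt (F x)) + 9 * M * (sqrt (g2 x) * D x))"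
proof -
  have "sint R (\<lambda>x. w x * g2 x) \<le> sint R (\<lambda>x. - (w x * (\<Sum>i\<in>UNIV. v i x * L i x)) - (\<Sum>i\<in>UNIV. \<Sum>j\<in>UNIV. v i x * d i j x * w' j x))"
    by (rule gradient_identity[OF R dw cw lat w0])
  also have "\<dots> \<le> sint R (\<lambda>x. 9 * M * (w x * sqrt (F x)) + 9 * M * (sqrt (g2 x) * D x))"
  proof (rule sint_mono)
    fix x assume x: "x \<in> cslab"
    have "\<bar>w x * (\<Sum>i\<in>UNIV. v i x * L i x)\<bar> \<le> w x * (3 * (M * (3 * sqrt (F x))))"
      by (intro abs_mult_le sum3_abs_le v_le[OF x] L_le_F[OF x]) (use w0[OF x] in simp)
    moreover have "\<bar>\<Sum>i\<in>UNIV. \<Sum>j\<in>UNIV. v i x * d i j x * w' j x\<bar> \<le> 3 * (3 * (M * sqrt (g2 x) * D x))"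
      by (intro abs_mult_le sum3_abs_le v_le[OF x] d_le D[OF x])
    ultimately show "- (w x * (\<Sum>i\<in>UNIV. v i x * L i x)) - (\<Sum>i\<in>UNIV. \<Sum>j\<in>UNIV. v i x * d i j x * w' j x)
       \<le> 9 * M * (w x * sqrt (F x)) + 9 * M * (sqrt (g2 x) * D x)"
      by (simp add: mult_ac abs_le_iff)
  qed (intro continuous_intros cw cD)+
  finally show ?thesis .
qed

text \<open>Improves the quadratic growth of \<open>a_priori\<close>. The Laplacian is now bounded
  by \<open>sqrt F\<close>, and Young with weight \<open>R\<close> costs \<open>R * F\<close> plus
  \<open>M^2 / R\<close> on a volume of order \<open>R^2\<close>, that is, order
  \<open>R\<close>.\<close>

lemma planar_gradient_growth:
  "\<exists>C\<ge>0. \<forall>R\<ge>1. sint R (\<lambda>x. (cutoff R x)\<^sup>2 * g2 x) \<le> R * (sint R F + C)"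
proof -
  obtain C0 where C0: "C0 \<ge> 0" "\<And>R. R \<ge> 1 \<Longrightarrow> sint R (\<lambda>x. (cutoff R x)\<^sup>2 * g2 x) \<le> C0 * R\<^sup>2"
    using a_priori by blast
  define C where "C = 81 * M\<^sup>2 + C0 + 5184 * M\<^sup>2"
  have "sint R (\<lambda>x. (cutoff R x)\<^sup>2 * g2 x) \<le> R * (sint R F + C)" if R: "R \<ge> 1" for R
  proof -
    have R0: "R > 0" using R by simp
    have "sint R (\<lambda>x. (cutoff R x)\<^sup>2 * g2 x) \<le> sint R (\<lambda>x. 9 * M * ((cutoff R x)\<^sup>2 * sqrt (F x)) + 9 * M * (sqrt (g2 x) * (8 / R * cutoff R x)))"
    proof (rule gradient_by_laplacian[OF R0 pdv_cutoff2])
      show "\<bar>dcut 0 R j x\<bar> \<le> 8 / R * cutoff R x" for j x using dcut_bound_cutoff[OF R0, of 0 j x] by simp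
    qed (use R0 in \<open>auto intro!: continuous_intros simp: cutoff_lateral[OF R0]\<close>)
    also have "\<dots> \<le> sint R (\<lambda>x. (R * F x + 1 / R * ((cutoff R x)\<^sup>2 * g2 x)) + (81 * M\<^sup>2 / (4 * R) + 1296 * M\<^sup>2 / R))"
    proof (rule sint_mono)
      fix x
      have "((cutoff R x)\<^sup>2 * sqrt (F x)) * (9 * M) \<le> R * ((cutoff R x)\<^sup>2 * sqrt (F x))\<^sup>2 + (9 * M)\<^sup>2 / (4 * R)"
        by (rule young2[OF R0])
      also have "((cutoff R x)\<^sup>2 * sqrt (F x))\<^sup>2 = cutoff R x ^ 4 * F x"
        using F_nonneg by (simp add: power_mult_distrib flip: power_mult)
      also have "R * (cutoff R x ^ 4 * F x) \<le> R * F x" using R0 F_nonneg by (intro mult_left_mono cutoff_mult_le) auto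
      finally have 1: "9 * M * ((cutoff R x)\<^sup>2 * sqrt (F x)) \<le> R * F x + 81 * M\<^sup>2 / (4 * R)"
        by (simp add: power_mult_distrib mult_ac)
      have "(cutoff R x * sqrt (g2 x)) * (72 * M / R) \<le> 1 / R * (cutoff R x * sqrt (g2 x))\<^sup>2 + (72 * M / R)\<^sup>2 / (4 * (1 / R))"
        using R0 by (intro young2) simp
      also have "(cutoff R x * sqrt (g2 x))\<^sup>2 = (cutoff R x)\<^sup>2 * g2 x" using g2_nonneg by (simp add: power_mult_distrib)
      also have "(72 * M / R)\<^sup>2 / (4 * (1 / R)) = 1296 * M\<^sup>2 / R" using R0 by (simp add: power_divide power_mult_distrib power2_eq_square)
      finally have 2: "9 * M * (sqrt (g2 x) * (8 / R * cutoff R x)) \<le> 1 / R * ((cutoff R x)\<^sup>2 * g2 x) + 1296 * M\<^sup>2 / R"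
        by (simp add: mult_ac)
      show "9 * M * ((cutoff R x)\<^sup>2 * sqrt (F x)) + 9 * M * (sqrt (g2 x) * (8 / R * cutoff R x))
        \<le> (R * F x + 1 / R * ((cutoff R x)\<^sup>2 * g2 x)) + (81 * M\<^sup>2 / (4 * R) + 1296 * M\<^sup>2 / R)"
        using add_mono[OF 1 2] by simp
    qed (intro continuous_intros)+
    also have "\<dots> = R * sint R F + 1 / R * sint R (\<lambda>x. (cutoff R x)\<^sup>2 * g2 x) + 4 * R\<^sup>2 * (81 * M\<^sup>2 / (4 * R) + 1296 * M\<^sup>2 / R)"
      by (subst sint_add, (intro continuous_intros)+, subst sint_add, (intro continuous_intros)+)
         (simp only: sint_cmult, use R0 in \<open>simp add: sint_const\<close>)
    also have "1 / R * sint R (\<lambda>x. (cutoff R x)\<^sup>2 * g2 x) \<le> 1 / R * (C0 * R\<^sup>2)"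
      using R0 C0(2)[OF R] by (intro mult_left_mono) auto
    also have "R * sint R F + 1 / R * (C0 * R\<^sup>2) + 4 * R\<^sup>2 * (81 * M\<^sup>2 / (4 * R) + 1296 * M\<^sup>2 / R) = R * (sint R F + C)"
      using R0 by (simp add: C_def field_simps power2_eq_square)
    finally show ?thesis by simp
  qed
  then show ?thesis using C0(1) by (intro exI[of _ C]) (auto simp: C_def)
qed

text \<open>No inequality bounds first by second derivatives in the plane, so the gradient is
  integrated by parts against the velocity. The leftover has coefficient \<open>\<tau> / R\<close>,
  since \<open>planar_gradient_growth\<close> gains one power of \<open>R\<close>; it becomes the
  vanishing term of the iteration.\<close>

lemma planar_cross_term:
  "\<exists>C\<ge>0. \<forall>\<tau>>0. \<forall>R\<ge>1. 1 / R * sint R (\<lambda>x. rho R x * cutoff R x ^ 3 * g2 x)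
    \<le> \<tau> * sint R (\<lambda>x. rho R x * (cutoff R x ^ 4 * F x)) + C / \<tau> + \<tau> / R * (sint R F + C)"
proof -
  obtain C0 where C0: "C0 \<ge> 0" "\<And>R. R \<ge> 1 \<Longrightarrow> sint R (\<lambda>x. (cutoff R x)\<^sup>2 * g2 x) \<le> R * (sint R F + C0)"
    using planar_gradient_growth by blast
  define C where "C = 81 * M\<^sup>2 + 15876 * M\<^sup>2 + C0"
  have "1 / R * sint R (\<lambda>x. rho R x * cutoff R x ^ 3 * g2 x)
    \<le> \<tau> * sint R (\<lambda>x. rho R x * (cutoff R x ^ 4 * F x)) + C / \<tau> + \<tau> / R * (sint R F + C)" if \<tau>: "\<tau> > 0" and R: "R \<ge> 1" for \<tau> R
  proof -
    have R0: "R > 0" using R by simp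
    have "sint R (\<lambda>x. (rho R x * cutoff R x ^ 3) * g2 x) \<le> sint R (\<lambda>x. 9 * M * ((rho R x * cutoff R x ^ 3) * sqrt (F x)) + 9 * M * (sqrt (g2 x) * (14 / R * cutoff R x)))"
    proof (rule gradient_by_laplacian[OF R0 pdv_mult[OF pdv_rho pdv_cutoff3]])
      fix x :: "real^3" and j :: 3
      define m where "m = cutoff R x"
      \<comment> \<open>The weight is the product of \<open>rho\<close> and the third power of the
        cutoff: the former contributes \<open>2 / R\<close> and the latter
        \<open>12 / R\<close>.\<close>
      show "\<bar>2 * hx j x / R\<^sup>2 * cutoff R x ^ 3 + rho R x * dcut 1 R j x\<bar> \<le> 14 / R * cutoff R x"
      proof (cases "m = 0")
        case False
        have m: "0 \<le> m" "m \<le> 1" by (simp_all add: m_def cutoff_nonneg cutoff_le1)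
        have m1: "m ^ 3 \<le> m" "m\<^sup>2 \<le> m" using m power_decreasing[of 1 3 m] power_decreasing[of 1 2 m] by auto
        have r: "0 \<le> rho R x" "rho R x \<le> 1" using cutoff_nz False by (auto simp: m_def rho_nonneg)
        have "R * sqrt (rho R x) \<le> R * 1" using r R0 by (intro mult_left_mono) auto
        then have "\<bar>hx j x\<bar> \<le> R" using hx_le[OF R0, of j x] by simp
        then have "2 * \<bar>hx j x\<bar> / R\<^sup>2 \<le> 2 * R / R\<^sup>2" by (intro divide_right_mono) auto
        then have "2 * \<bar>hx j x\<bar> / R\<^sup>2 \<le> 2 / R" using R0 by (simp add: power2_eq_square)
        then have "2 * \<bar>hx j x\<bar> / R\<^sup>2 * m ^ 3 \<le> 2 / R * m" using m m1 R0 by (intro mult_mono) auto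
        then have 1: "\<bar>2 * hx j x / R\<^sup>2 * m ^ 3\<bar> \<le> 2 / R * m" using m by (simp add: abs_mult)
        have "\<bar>dcut 1 R j x\<bar> \<le> 12 / R * m\<^sup>2" using dcut_bound_cutoff[OF R0, of 1 j x] by (simp add: m_def eval_nat_numeral)
        also have "\<dots> \<le> 12 / R * m" using m1 R0 by (intro mult_left_mono) auto
        finally have "\<bar>rho R x * dcut 1 R j x\<bar> \<le> 1 * (12 / R * m)" using r by (intro abs_mult_le) auto
        then have "\<bar>2 * hx j x / R\<^sup>2 * m ^ 3 + rho R x * dcut 1 R j x\<bar> \<le> 2 / R * m + 12 / R * m" using 1 by linarith
        then show ?thesis by (simp add: m_def)
      qed (simp add: m_def dcut_def)
    qed (use R0 in \<open>auto intro!: continuous_intros mult_nonneg_nonneg simp: cutoff_lateral[OF R0] rho_nonneg cutoff_nonneg\<close>)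
    then have "1 / R * sint R (\<lambda>x. rho R x * cutoff R x ^ 3 * g2 x) \<le> 1 / R * sint R (\<lambda>x. 9 * M * ((rho R x * cutoff R x ^ 3) * sqrt (F x)) + 9 * M * (sqrt (g2 x) * (14 / R * cutoff R x)))"
      using R0 by (intro mult_left_mono) auto
    also have "\<dots> = sint R (\<lambda>x. 1 / R * (9 * M * ((rho R x * cutoff R x ^ 3) * sqrt (F x)) + 9 * M * (sqrt (g2 x) * (14 / R * cutoff R x))))"
      by (simp only: sint_cmult)
    also have "\<dots> \<le> sint R (\<lambda>x. (\<tau> * (rho R x * (cutoff R x ^ 4 * F x)) + \<tau> / R\<^sup>2 * ((cutoff R x)\<^sup>2 * g2 x)) + (81 * M\<^sup>2 / (4 * \<tau> * R\<^sup>2) + 15876 * M\<^sup>2 / (4 * \<tau> * R\<^sup>2)))"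
    proof (rule sint_mono)
      fix x
      have rc: "rho R x * (cutoff R x)\<^sup>2 \<le> 1"
        using rho_cutoff_le[of 1 2 R x] power_le_one[OF cutoff_nonneg cutoff_le1, of R x 2] by simp
      have "1 / R * (9 * M * ((rho R x * cutoff R x ^ 3) * sqrt (F x))) = rho R x * (((cutoff R x)\<^sup>2 * sqrt (F x)) * (9 * M * cutoff R x / R))"
        by (simp add: power2_eq_square power3_eq_cube)
      also have "\<dots> \<le> rho R x * (\<tau> * ((cutoff R x)\<^sup>2 * sqrt (F x))\<^sup>2 + (9 * M * cutoff R x / R)\<^sup>2 / (4 * \<tau>))"
        by (intro mult_left_mono young2 \<tau> rho_nonneg)
      also have "\<dots> = \<tau> * (rho R x * (cutoff R x ^ 4 * F x)) + 81 * M\<^sup>2 / (4 * \<tau> * R\<^sup>2) * (rho R x * (cutoff R x)\<^sup>2)"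
        using F_nonneg by (simp add: power_mult_distrib power_divide distrib_left mult_ac flip: power_mult)
      also have "\<dots> \<le> \<tau> * (rho R x * (cutoff R x ^ 4 * F x)) + 81 * M\<^sup>2 / (4 * \<tau> * R\<^sup>2) * 1"
        using \<tau> by (intro add_left_mono mult_left_mono rc) auto
      finally have 1: "1 / R * (9 * M * ((rho R x * cutoff R x ^ 3) * sqrt (F x))) \<le> \<tau> * (rho R x * (cutoff R x ^ 4 * F x)) + 81 * M\<^sup>2 / (4 * \<tau> * R\<^sup>2)" by simp
      have "1 / R * (9 * M * (sqrt (g2 x) * (14 / R * cutoff R x))) = 1 / R\<^sup>2 * ((cutoff R x * sqrt (g2 x)) * (126 * M))"
        by (simp add: power2_eq_square)
      also have "\<dots> \<le> 1 / R\<^sup>2 * (\<tau> * (cutoff R x * sqrt (g2 x))\<^sup>2 + (126 * M)\<^sup>2 / (4 * \<tau>))"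
        by (intro mult_left_mono young2 \<tau>) auto
      also have "\<dots> = \<tau> / R\<^sup>2 * ((cutoff R x)\<^sup>2 * g2 x) + 15876 * M\<^sup>2 / (4 * \<tau> * R\<^sup>2)"
        using g2_nonneg by (simp add: power_mult_distrib distrib_left mult_ac)
      finally have 2: "1 / R * (9 * M * (sqrt (g2 x) * (14 / R * cutoff R x))) \<le> \<tau> / R\<^sup>2 * ((cutoff R x)\<^sup>2 * g2 x) + 15876 * M\<^sup>2 / (4 * \<tau> * R\<^sup>2)" .
      show "1 / R * (9 * M * ((rho R x * cutoff R x ^ 3) * sqrt (F x)) + 9 * M * (sqrt (g2 x) * (14 / R * cutoff R x)))
        \<le> (\<tau> * (rho R x * (cutoff R x ^ 4 * F x)) + \<tau> / R\<^sup>2 * ((cutoff R x)\<^sup>2 * g2 x)) + (81 * M\<^sup>2 / (4 * \<tau> * R\<^sup>2) + 15876 * M\<^sup>2 / (4 * \<tau> * R\<^sup>2))"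
        using add_mono[OF 1 2] unfolding distrib_left by linarith
    qed (intro continuous_intros)+
    also have "\<dots> = \<tau> * sint R (\<lambda>x. rho R x * (cutoff R x ^ 4 * F x)) + \<tau> / R\<^sup>2 * sint R (\<lambda>x. (cutoff R x)\<^sup>2 * g2 x)
       + 4 * R\<^sup>2 * (81 * M\<^sup>2 / (4 * \<tau> * R\<^sup>2) + 15876 * M\<^sup>2 / (4 * \<tau> * R\<^sup>2))"
      by (subst sint_add, (intro continuous_intros)+, subst sint_add, (intro continuous_intros)+)
         (simp only: sint_cmult, use R0 in \<open>simp add: sint_const\<close>)
    also have "4 * R\<^sup>2 * (81 * M\<^sup>2 / (4 * \<tau> * R\<^sup>2) + 15876 * M\<^sup>2 / (4 * \<tau> * R\<^sup>2)) = (81 * M\<^sup>2 + 15876 * M\<^sup>2) / \<tau>"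
      using R0 \<tau> by (simp add: field_simps)
    also have "\<tau> / R\<^sup>2 * sint R (\<lambda>x. (cutoff R x)\<^sup>2 * g2 x) \<le> \<tau> / R\<^sup>2 * (R * (sint R F + C0))"
      using \<tau> C0(2)[OF R] by (intro mult_left_mono) auto
    also have "\<tau> / R\<^sup>2 * (R * (sint R F + C0)) = \<tau> / R * (sint R F + C0)" using R0 by (simp add: power2_eq_square)
    also have "\<tau> / R * (sint R F + C0) \<le> \<tau> / R * (sint R F + C)"
      using \<tau> R0 by (intro mult_left_mono) (auto simp: C_def)
    also have "(81 * M\<^sup>2 + 15876 * M\<^sup>2) / \<tau> \<le> C / \<tau>" using \<tau> C0(1) by (intro divide_right_mono) (auto simp: C_def)
    finally show ?thesis by simp
  qed
  then show ?thesis using C0(1) by (intro exI[of _ C]) (auto simp: C_def)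
qed

lemma planar_second_derivatives_vanish:
  assumes x: "x \<in> cslab"
  shows "F x = 0"
proof -
  obtain C1a where C1a: "C1a \<ge> 0" and E1a: "\<And>\<tau> R. \<tau> > 0 \<Longrightarrow> R \<ge> 1 \<Longrightarrow>
    sint R (\<lambda>x. cutoff R x ^ 4 * H 1 x) + 2 * \<alpha> * bint R (\<lambda>x. cutoff R x ^ 4 * V2 1 x)
    \<le> - sint R (\<lambda>x. cutoff R x ^ 4 * Q 1 x)
      + \<tau> * (sint R (\<lambda>x. rho R x * (cutoff R x ^ 4 * H 1 x)) + 2 * \<alpha> * bint R (\<lambda>x. rho R x * (cutoff R x ^ 4 * V2 1 x)))
      + C1a / \<tau> + C1a / R * sint R (\<lambda>x. rho R x * cutoff R x ^ 3 * sqrt (V2 1 x) * sqrt (g2 x))"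
    using derivative_energy_estimate[of 1] by auto
  obtain C1b where C1b: "C1b \<ge> 0" and E1b: "\<And>\<tau> R. \<tau> > 0 \<Longrightarrow> R \<ge> 1 \<Longrightarrow>
    sint R (\<lambda>x. cutoff R x ^ 4 * H 2 x) + 2 * \<alpha> * bint R (\<lambda>x. cutoff R x ^ 4 * V2 2 x)
    \<le> - sint R (\<lambda>x. cutoff R x ^ 4 * Q 2 x)
      + \<tau> * (sint R (\<lambda>x. rho R x * (cutoff R x ^ 4 * H 2 x)) + 2 * \<alpha> * bint R (\<lambda>x. rho R x * (cutoff R x ^ 4 * V2 2 x)))
      + C1b / \<tau> + C1b / R * sint R (\<lambda>x. rho R x * cutoff R x ^ 3 * sqrt (V2 2 x) * sqrt (g2 x))"
    using derivative_energy_estimate[of 2] by auto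
  define C1 where "C1 = C1a + C1b"
  have C1: "C1 \<ge> 0" using C1a C1b by (simp add: C1_def)
  obtain C2 where C2: "C2 \<ge> 0" and E2: "\<And>\<tau> R. \<tau> > 0 \<Longrightarrow> R \<ge> 1 \<Longrightarrow> 1 / R * sint R (\<lambda>x. rho R x * cutoff R x ^ 3 * g2 x)
    \<le> \<tau> * sint R (\<lambda>x. rho R x * (cutoff R x ^ 4 * F x)) + C2 / \<tau> + \<tau> / R * (sint R F + C2)"
    using planar_cross_term by blast
  obtain C0 where C0: "C0 \<ge> 0" "\<And>R. R \<ge> 1 \<Longrightarrow> sint R (\<lambda>x. (cutoff R x)\<^sup>2 * g2 x) \<le> C0 * R\<^sup>2"
    using a_priori by blast
  define E where "E R = sint R (\<lambda>x. cutoff R x ^ 4 * F x)" for R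
  define W where "W R = sint R (\<lambda>x. rho R x * (cutoff R x ^ 4 * F x))" for R
  define S where "S R = sint R (\<lambda>x. rho R x * cutoff R x ^ 3 * g2 x)" for R
  have main: "E R \<le> \<tau> * W R + C1 / \<tau> + C1 * (1 / R * S R)" if \<tau>: "\<tau> > 0" and R: "R \<ge> 1" for \<tau> R
  proof -
    have R0: "R > 0" using R by simp
    have Sle: "sint R (\<lambda>x. rho R x * cutoff R x ^ 3 * sqrt (V2 k x) * sqrt (g2 x)) \<le> S R" for k
      unfolding S_def
    proof (rule sint_mono)
      fix x
      have "sqrt (V2 k x) * sqrt (g2 x) \<le> sqrt (g2 x) * sqrt (g2 x)"
        using V2_le_g2 by (intro mult_right_mono) (auto simp: g2_nonneg)
      then have "sqrt (V2 k x) * sqrt (g2 x) \<le> g2 x" using g2_nonneg by simp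
      then have "(rho R x * cutoff R x ^ 3) * (sqrt (V2 k x) * sqrt (g2 x)) \<le> (rho R x * cutoff R x ^ 3) * g2 x"
        using rho_nonneg cutoff_nonneg by (intro mult_left_mono) auto
      then show "rho R x * cutoff R x ^ 3 * sqrt (V2 k x) * sqrt (g2 x) \<le> rho R x * cutoff R x ^ 3 * g2 x" by (simp add: mult.assoc)
    qed (intro continuous_intros)+
    \<comment> \<open>The quadratic terms carry no smallness at this stage; they cancel once the
      estimates for directions 1 and 2 are added.\<close>
    have Q0: "sint R (\<lambda>x. cutoff R x ^ 4 * Q 1 x) + sint R (\<lambda>x. cutoff R x ^ 4 * Q 2 x) = 0"
    proof -
      have "sint R (\<lambda>x. cutoff R x ^ 4 * Q 1 x) + sint R (\<lambda>x. cutoff R x ^ 4 * Q 2 x) = sint R (\<lambda>x. cutoff R x ^ 4 * Q 1 x + cutoff R x ^ 4 * Q 2 x)"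
        by (subst sint_add, (intro continuous_intros)+) simp
      also have "\<dots> = sint R (\<lambda>x. 0)"
        by (rule sint_cong) (auto intro!: continuous_intros simp: planar_Q distrib_left[symmetric])
      finally show ?thesis by simp
    qed
    have Eeq: "E R = sint R (\<lambda>x. cutoff R x ^ 4 * H 1 x) + sint R (\<lambda>x. cutoff R x ^ 4 * H 2 x)"
      unfolding E_def F_def distrib_left by (subst sint_add, (intro continuous_intros)+) simp
    have Weq: "W R = sint R (\<lambda>x. rho R x * (cutoff R x ^ 4 * H 1 x)) + sint R (\<lambda>x. rho R x * (cutoff R x ^ 4 * H 2 x))"
      unfolding W_def F_def distrib_left by (subst sint_add, (intro continuous_intros)+) simp
    have a: "C1a / R * sint R (\<lambda>x. rho R x * cutoff R x ^ 3 * sqrt (V2 1 x) * sqrt (g2 x)) \<le> C1a / R * S R"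
      using Sle C1a R0 by (intro mult_left_mono) auto
    have b: "C1b / R * sint R (\<lambda>x. rho R x * cutoff R x ^ 3 * sqrt (V2 2 x) * sqrt (g2 x)) \<le> C1b / R * S R"
      using Sle C1b R0 by (intro mult_left_mono) auto
    have c: "C1 / \<tau> = C1a / \<tau> + C1b / \<tau>" "C1 * (1 / R * S R) = C1a / R * S R + C1b / R * S R"
      by (simp_all add: C1_def add_divide_distrib distrib_right)
    have e1: "sint R (\<lambda>x. cutoff R x ^ 4 * H 1 x) \<le> - sint R (\<lambda>x. cutoff R x ^ 4 * Q 1 x)
      + \<tau> * sint R (\<lambda>x. rho R x * (cutoff R x ^ 4 * H 1 x)) + C1a / \<tau> + C1a / R * sint R (\<lambda>x. rho R x * cutoff R x ^ 3 * sqrt (V2 1 x) * sqrt (g2 x))"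
      using E1a[OF \<tau> R] al by simp
    have e2: "sint R (\<lambda>x. cutoff R x ^ 4 * H 2 x) \<le> - sint R (\<lambda>x. cutoff R x ^ 4 * Q 2 x)
      + \<tau> * sint R (\<lambda>x. rho R x * (cutoff R x ^ 4 * H 2 x)) + C1b / \<tau> + C1b / R * sint R (\<lambda>x. rho R x * cutoff R x ^ 3 * sqrt (V2 2 x) * sqrt (g2 x))"
      using E1b[OF \<tau> R] al by simp
    show ?thesis using e1 e2 a b c Q0 unfolding Eeq Weq distrib_left by linarith
  qed
  have WE: "W R \<le> E R" for R
    unfolding W_def E_def by (intro sint_mono rho_cutoff_le continuous_intros) (auto simp: F_nonneg)
  have WW: "W R \<le> sint R (\<lambda>x. rho R x * F x)" for R
    unfolding W_def by (intro sint_mono mult_left_mono cutoff_mult_le continuous_intros) (auto simp: F_nonneg rho_nonneg)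
  have scale: "sint R F \<le> 4 * E (2 * R)" if "R \<ge> 1" for R
    unfolding E_def using that by (intro sint_le_cutoff(1) cont_F F_nonneg) auto
  define A where "A = 2 * (2 * C1 + C1 * C0)"
  have A: "A \<ge> 0" using C1 C0 by (simp add: A_def)
  \<comment> \<open>A crude bound that only starts the iteration: the cross term is estimated by
    \<open>a_priori\<close>, and \<open>\<tau> = 1/2\<close> lets half of \<open>E\<close> absorb
    the weighted energy.\<close>
  have Egrow: "E R \<le> A * R\<^sup>2" if R: "R \<ge> 1" for R
  proof -
    have R0: "R > 0" using R by simp
    have "S R \<le> sint R (\<lambda>x. (cutoff R x)\<^sup>2 * g2 x)"
      unfolding S_def
    proof (rule sint_mono)
      fix x
      have "rho R x * (cutoff R x ^ 3 * g2 x) \<le> cutoff R x ^ 3 * g2 x" by (rule rho_cutoff_le) (auto simp: g2_nonneg)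
      also have "\<dots> \<le> (cutoff R x)\<^sup>2 * g2 x"
        using cutoff_nonneg cutoff_le1 g2_nonneg by (intro mult_right_mono power_decreasing) auto
      finally show "rho R x * cutoff R x ^ 3 * g2 x \<le> (cutoff R x)\<^sup>2 * g2 x" by (simp add: mult.assoc)
    qed (intro continuous_intros)+
    then have "S R \<le> C0 * R\<^sup>2" using C0(2)[OF R] by simp
    then have "C1 * (1 / R * S R) \<le> C1 * (1 / R * (C0 * R\<^sup>2))" using C1 R0 by (intro mult_left_mono) auto
    also have "\<dots> = C1 * C0 * R" using R0 by (simp add: power2_eq_square)
    finally have "E R \<le> 1/2 * E R + 2 * C1 + C1 * C0 * R" using main[of "1/2" R] WE[of R] R by simp
    then have "E R \<le> 4 * C1 + 2 * (C1 * C0 * R)" by simp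
    also have "4 * C1 \<le> 4 * C1 * R\<^sup>2" using C1 R mult_left_mono[of 1 "R\<^sup>2" "4 * C1"] by (simp add: one_le_power)
    also have "C1 * C0 * R \<le> C1 * C0 * R\<^sup>2" using C1 C0 R by (intro mult_left_mono) (auto simp: power2_eq_square)
    finally show ?thesis by (simp add: A_def algebra_simps)
  qed
  define B where "B = 1 + C1"
  have B: "B \<ge> 1" using C1 by (simp add: B_def)
  define C where "C = 16 * A + 16 * B * (C1 + C1 * C2)"
  have CC: "0 \<le> C1 + C1 * C2" "0 \<le> C1 * C2" using C1 C2 by auto
  have CB: "0 \<le> 16 * B * (C1 + C1 * C2)" using B CC by auto
  have C: "C \<ge> 0" using A CB by (simp add: C_def)
  show ?thesis
  proof (rule liouville_iteration(1)[of F "\<lambda>_. 0" 0 2 C])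
    fix R :: real assume R: "R \<ge> 1"
    have "sint R F \<le> 4 * (A * (2 * R)\<^sup>2)" using scale[OF R] Egrow[of "2 * R"] R by simp
    also have "\<dots> = 16 * A * R\<^sup>2" by (simp add: power2_eq_square)
    also have "\<dots> \<le> C * R\<^sup>2" using CB by (intro mult_right_mono) (auto simp: C_def)
    finally show "sint R F + 0 * bint R (\<lambda>_. 0) \<le> C * R\<^sup>2" by simp
  next
    fix \<tau> :: real assume \<tau>: "\<tau> > 0"
    \<comment> \<open>\<open>B\<close> sums the two occurrences of the weighted energy, and the 4 is
      the factor lost in \<open>scale\<close>. The remainder of \<open>planar_cross_term\<close>
      gives an \<open>\<eta>\<close> of order \<open>1/R\<close>.\<close>
    define t where "t = \<tau> / (4 * B)"
    have t: "t > 0" using \<tau> B by (simp add: t_def)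
    define \<eta> where "\<eta> R = 2 * C1 * t * (1 + C2) * inverse R" for R :: real
    have lim: "(\<eta> \<longlongrightarrow> 0) at_top"
    proof -
      have "((\<lambda>R. 2 * C1 * t * (1 + C2) * inverse R) \<longlongrightarrow> 2 * C1 * t * (1 + C2) * 0) at_top"
        by (intro tendsto_intros tendsto_inverse_0_at_top filterlim_ident)
      then show ?thesis by (simp add: \<eta>_def[abs_def])
    qed
    have "sint R F \<le> \<tau> * sint (2 * R) (\<lambda>x. rho (2 * R) x * F x) + C / \<tau> + \<eta> R * (1 + sint (2 * R) F)" if R: "R \<ge> 1" for R
    proof -
      have R2: "2 * R \<ge> 1" "2 * R > 0" using R by auto
      have f0: "0 \<le> sint (2 * R) F" by (rule sint_nonneg) (auto intro: continuous_intros F_nonneg)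
      have "C1 * (1 / (2 * R) * S (2 * R)) \<le> C1 * (t * W (2 * R) + C2 / t + t / (2 * R) * (sint (2 * R) F + C2))"
        using E2[OF t R2(1)] C1 unfolding S_def W_def by (intro mult_left_mono)
      then have "E (2 * R) \<le> t * W (2 * R) + C1 / t + C1 * (t * W (2 * R) + C2 / t + t / (2 * R) * (sint (2 * R) F + C2))"
        using main[OF t R2(1)] by linarith
      also have "\<dots> = t * B * W (2 * R) + (C1 + C1 * C2) / t + C1 * (t / (2 * R) * (sint (2 * R) F + C2))"
        by (simp add: B_def algebra_simps add_divide_distrib)
      also have "t * B * W (2 * R) = \<tau> / 4 * W (2 * R)" using B by (simp add: t_def)
      also have "(C1 + C1 * C2) / t = 4 * B * (C1 + C1 * C2) / \<tau>" by (simp add: t_def)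
      also have "C1 * (t / (2 * R) * (sint (2 * R) F + C2)) \<le> C1 * (t / (2 * R) * ((1 + C2) * (1 + sint (2 * R) F)))"
        using C1 t R C2 f0 by (intro mult_left_mono) (auto simp: algebra_simps)
      also have "\<dots> = \<eta> R / 4 * (1 + sint (2 * R) F)" using R by (simp add: \<eta>_def field_simps)
      finally have "sint R F \<le> 4 * (\<tau> / 4 * W (2 * R) + 4 * B * (C1 + C1 * C2) / \<tau> + \<eta> R / 4 * (1 + sint (2 * R) F))"
        using scale[OF R] by simp
      also have "\<dots> = \<tau> * W (2 * R) + 16 * B * (C1 + C1 * C2) / \<tau> + \<eta> R * (1 + sint (2 * R) F)" by simp
      also have "\<tau> * W (2 * R) \<le> \<tau> * sint (2 * R) (\<lambda>x. rho (2 * R) x * F x)"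
        using \<tau> by (intro mult_left_mono WW) auto
      also have "16 * B * (C1 + C1 * C2) / \<tau> \<le> C / \<tau>" using \<tau> A by (intro divide_right_mono) (auto simp: C_def)
      finally show ?thesis by simp
    qed
    then show "\<exists>\<eta>. (\<eta> \<longlongrightarrow> 0) at_top \<and> (\<forall>R\<ge>1. sint R F + 0 * bint R (\<lambda>_. 0) \<le>
       \<tau> * (sint (2 * R) (\<lambda>x. rho (2 * R) x * F x) + 0 * bint (2 * R) (\<lambda>x. rho (2 * R) x * 0)) + C / \<tau>
        + \<eta> R * (1 + (sint (2 * R) F + 0 * bint (2 * R) (\<lambda>_. 0))))"
      using lim by (intro exI[of _ \<eta>]) simp
  qed (use C x in \<open>auto intro: continuous_intros F_nonneg\<close>)
qed

text \<open>A vanishing Hessian makes each derivative constant, so the velocity is affine along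
  horizontal lines, and boundedness forces the slope to be zero.\<close>

lemma planar_gradient_vanishes:
  assumes x: "x \<in> cslab"
  shows "d i j x = 0"
proof (cases "j = 3")
  case False
  have H0: "H k y = 0" if "y \<in> cslab" for k y
  proof -
    have "H 1 y = 0" "H 2 y = 0" using planar_second_derivatives_vanish[OF that] H_nonneg[of 1 y] H_nonneg[of 2 y]
      by (auto simp: F_def add_nonneg_eq_0_iff)
    moreover have "H 3 y = 0" using pd_zero_cslab[OF sm_d d3 that] by (simp add: H_def)
    ultimately show ?thesis using exhaust_3[of k] by auto
  qed
  have const: "d i j y = d i j (pt 0 0 0)" if "y \<in> cslab" for y
    by (rule const_cslab[OF sm_d _ that]) (rule H_zeroD[OF H0])
  define c where "c = d i j (pt 0 0 0)"
  have "c = 0"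
  proof (rule ccontr)
    assume c: "c \<noteq> 0"
    define f where "f t = v i (pt 0 0 0 + t *\<^sub>R axis j 1)" for t
    have in_c: "pt 0 0 0 + t *\<^sub>R axis j 1 \<in> cslab" for t using False by (simp add: cslab_def axis_def)
    have "(f has_real_derivative c) (at t)" for t
    proof -
      have "((\<lambda>s. v i (pt 0 0 0 + t *\<^sub>R axis j 1 + s *\<^sub>R axis j 1)) has_real_derivative c) (at 0)"
        using pdvD[OF pdv_v[of j i] in_c[of t]] const[OF in_c, of t] by (simp add: c_def)
      then have "((\<lambda>s. f (s + t)) has_real_derivative c) (at 0)"
        by (simp add: f_def scaleR_add_left add_ac)
      then show ?thesis using DERIV_shift[of f c 0 t] by simp
    qed
    then have "((\<lambda>t. f t - c * t) has_real_derivative 0) (at t)" for t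
      by (auto intro!: derivative_eq_intros)
    then have "f t - c * t = f 0 - c * 0" for t by (intro DERIV_isconst_all) auto
    \<comment> \<open>At this distance the affine function has changed by \<open>2 * M + 1\<close>,
      more than two values of modulus at most \<open>M\<close> can differ.\<close>
    from this[of "(2 * M + 1) / c"] have "f ((2 * M + 1) / c) = f 0 + (2 * M + 1)" using c by simp
    moreover have b: "\<bar>f t\<bar> \<le> M" for t unfolding f_def by (rule v_le[OF in_c])
    ultimately show False using b[of 0] b[of "(2 * M + 1) / c"] by linarith
  qed
  then show ?thesis using const[OF x] by (simp add: c_def)
qed (use d3[OF x] in simp)

end

theorem constant_flow:
  assumes al: "\<alpha> = 0" and MM: "M < pi"
  shows "\<exists>C1 C2. \<forall>x\<in>slab. u x = vector [C1, C2, 0]"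
proof -
  have d3: "d i 3 x = 0" if "x \<in> cslab" for i x
    by (rule V2_zeroD[OF vertical_derivative_vanishes(2)[OF al MM that]])
  have d0: "d i j x = 0" if "x \<in> cslab" for i j x
    by (rule planar_gradient_vanishes[OF al d3 that])
  show ?thesis
  proof (intro exI ballI)
    fix x assume "x \<in> slab"
    then have x: "x \<in> cslab" using slab_subset_cslab by auto
    have "v i x = v i (pt 0 0 0)" for i
      by (rule const_cslab[OF sm_v _ x]) (use d0 in \<open>simp add: d_def\<close>)
    moreover have "v 3 (pt 0 0 0) = 0" by (rule bc3) simp
    ultimately show "u x = vector [v 1 (pt 0 0 0), v 2 (pt 0 0 0), 0]"
      by (simp add: vec_eq_iff forall_3 v_def)
  qed
qed

end

section \<open>Liouville statements controlled by the flux\<close>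

lemma continuous_on_integral1:
  fixes f :: "real^3 \<Rightarrow> real"
  assumes c: "continuous_on cslab f"
  shows "continuous_on (cbox (-R,0) (R,1)) (\<lambda>q. integral {-R..R} (\<lambda>a. f (pt a (fst q) (snd q))))"
proof -
  have "continuous_on (cbox (-R,0) (R,1)) (\<lambda>q. integral (cbox (-R) R) (\<lambda>a. f (pt a (fst q) (snd q))))"
    by (rule integral_continuous_on_param)
       (auto simp: case_prod_unfold cbox_Pair_iff intro!: continuous_on_pt_cslab[OF c] continuous_intros)
  then show ?thesis by simp
qed

text \<open>Allows a comparison that holds only after integration along the first direction, as
  produced by \<open>integral_zero_mean_bound\<close>.\<close>

lemma sint_mono_inner1:
  assumes c: "continuous_on cslab f" "continuous_on cslab g"
    and le: "\<And>b z. \<bar>b\<bar> \<le> R \<Longrightarrow> 0 \<le> z \<Longrightarrow> z \<le> 1 \<Longrightarrow> integral {-R..R} (\<lambda>a. f (pt a b z)) \<le> integral {-R..R} (\<lambda>a. g (pt a b z))"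
  shows "sint R f \<le> sint R g"
  unfolding sint_order1[OF c(1)] sint_order1[OF c(2)]
proof (rule integral_le)
  fix q assume "q \<in> cbox (-R,0) (R,1::real)"
  then show "integral {-R..R} (\<lambda>a. f (pt a (fst q) (snd q))) \<le> integral {-R..R} (\<lambda>a. g (pt a (fst q) (snd q)))"
    by (intro le; cases q; auto simp: cbox_Pair_iff abs_le_iff)
qed (rule integrable_continuous[OF continuous_on_integral1[OF c(1)]] integrable_continuous[OF continuous_on_integral1[OF c(2)]])+

lemma sint_mono_inner2:
  assumes c: "continuous_on cslab f" "continuous_on cslab g"
    and le: "\<And>a z. \<bar>a\<bar> \<le> R \<Longrightarrow> 0 \<le> z \<Longrightarrow> z \<le> 1 \<Longrightarrow> integral {-R..R} (\<lambda>b. f (pt a b z)) \<le> integral {-R..R} (\<lambda>b. g (pt a b z))"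
  shows "sint R f \<le> sint R g"
proof -
  have c1: "continuous_on (X \<times> {0..1}) (\<lambda>q. integral {-R..R} (\<lambda>b. h (pt (fst q) b (snd q))))" if "continuous_on cslab h" for h :: "real^3 \<Rightarrow> real" and X :: "real set"
  proof -
    have "continuous_on (X \<times> {0..1}) (\<lambda>q. integral (cbox (-R) R) (\<lambda>b. h (pt (fst q) b (snd q))))"
      by (rule integral_continuous_on_param)
         (auto simp: case_prod_unfold intro!: continuous_on_pt_cslab[OF that] continuous_intros)
    then show ?thesis by simp
  qed
  have i1: "(\<lambda>z. integral {-R..R} (\<lambda>b. h (pt a b z))) integrable_on {0..1}" if "continuous_on cslab h" for h :: "real^3 \<Rightarrow> real" and a
  proof (rule integrable_continuous_interval)
    have p: "continuous_on {0..1} (\<lambda>z. (a, z))" by (intro continuous_intros)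
    have "(\<lambda>z. (a, z)) ` {0..1} \<subseteq> UNIV \<times> {0..1}" by auto
    from continuous_on_compose2[OF c1[OF that, of UNIV] p this]
    show "continuous_on {0..1} (\<lambda>z. integral {-R..R} (\<lambda>b. h (pt a b z)))" by simp
  qed
  have i2: "(\<lambda>a. integral {0..1} (\<lambda>z. integral {-R..R} (\<lambda>b. h (pt a b z)))) integrable_on {-R..R}" if "continuous_on cslab h" for h :: "real^3 \<Rightarrow> real"
  proof (rule integrable_continuous_interval)
    have "continuous_on {-R..R} (\<lambda>a. integral (cbox 0 1) (\<lambda>z. integral {-R..R} (\<lambda>b. h (pt a b z))))"
      by (rule integral_continuous_on_param) (use c1[OF that, of "{-R..R}"] in \<open>simp add: case_prod_unfold\<close>)
    then show "continuous_on {-R..R} (\<lambda>a. integral {0..1} (\<lambda>z. integral {-R..R} (\<lambda>b. h (pt a b z))))" by simp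
  qed
  show ?thesis
    unfolding sint_order2[OF c(1)] sint_order2[OF c(2)]
    by (rule integral_le[OF i2[OF c(1)] i2[OF c(2)]], rule integral_le[OF i1[OF c(1)] i1[OF c(2)]], rule le) auto
qed

lemma integral_abs_le_const:
  fixes h :: "real \<Rightarrow> real"
  assumes "continuous_on {a..b} h" "a \<le> b" "\<And>x. x \<in> {a..b} \<Longrightarrow> \<bar>h x\<bar> \<le> K"
  shows "integral {a..b} (\<lambda>x. \<bar>h x\<bar>) \<le> (b - a) * K"
proof -
  have "integral {a..b} (\<lambda>x. \<bar>h x\<bar>) \<le> integral {a..b} (\<lambda>x. K)"
    by (rule integral_le) (use assms in \<open>auto intro!: integrable_continuous_interval continuous_intros\<close>)
  then show ?thesis using assms(2) by simp
qed

lemma integral_abs_bound: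
  fixes h :: "real \<Rightarrow> real"
  assumes "continuous_on {a..b} h" "a \<le> b" "\<And>x. x \<in> {a..b} \<Longrightarrow> \<bar>h x\<bar> \<le> K"
  shows "\<bar>integral {a..b} h\<bar> \<le> (b - a) * K"
proof -
  have "\<bar>integral {a..b} h\<bar> \<le> integral {a..b} (\<lambda>x. \<bar>h x\<bar>)"
    using integral_norm_bound_integral[of h "{a..b}" "\<lambda>x. \<bar>h x\<bar>"] assms(1)
    by (auto intro!: integrable_continuous_interval continuous_intros)
  then show ?thesis using integral_abs_le_const[OF assms] by linarith
qed

text \<open>Splitting a mean-zero weight into its successive one-dimensional fluctuations replaces a Poincare inequality on the box.\<close>
lemma sint_mean_zero_bound:
  assumes R: "R \<ge> 1" and q: "\<And>j. pdv j \<Phi> (q j)" and cq: "\<And>j. continuous_on cslab (q j)" and cP: "continuous_on cslab \<Phi>"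
    and cg: "continuous_on cslab g" and B: "\<And>x. x \<in> cslab \<Longrightarrow> \<bar>x$1\<bar> \<le> R \<Longrightarrow> \<bar>x$2\<bar> \<le> R \<Longrightarrow> \<bar>g x\<bar> \<le> B"
    and z: "sint R g = 0"
  shows "sint R (\<lambda>x. \<Phi> x * g x) \<le> 4 * R * B * (sint R (\<lambda>x. \<bar>q 1 x\<bar>) + sint R (\<lambda>x. \<bar>q 2 x\<bar>) + sint R (\<lambda>x. \<bar>q 3 x\<bar>))"
proof -
  have R0: "R > 0" using R by simp
  have B0: "0 \<le> B" using B[of "pt 0 0 0"] R by simp
  \<comment> \<open>\<open>A\<close> is the vertical mean and \<open>b\<close> the mean over the
    second direction as well. Then \<open>g - A\<close>, \<open>A - b\<close> and \<open>b\<close>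
    have mean zero in directions 3, 2 and 1, the last one by \<open>z\<close>. The lengths 1,
    \<open>2 * R\<close>, \<open>2 * R\<close> and the bounds \<open>2 * B\<close>,
    \<open>2 * B\<close>, \<open>B\<close> are all covered by \<open>4 * R * B\<close>.\<close>
  define A where "A = vint g"
  define b where "b a = integral {-R..R} (\<lambda>t. A (a, t)) / (2 * R)" for a
  have cA: "continuous_on X A" for X unfolding A_def by (intro continuous_intros cg)
  have cA': "continuous_on X (\<lambda>x. A (f x, h x))" if "continuous_on X f" "continuous_on X h" for X and f h :: "'x::topological_space \<Rightarrow> real"
    by (rule continuous_on_compose2[OF cA[of UNIV]]) (auto intro!: continuous_intros that)
  have cb0: "continuous_on UNIV b"
  proof -
    have "continuous_on UNIV (\<lambda>a. integral (cbox (-R) R) (\<lambda>t. A (a, t)))"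
      by (rule integral_continuous_on_param) (use cA in \<open>simp add: case_prod_unfold\<close>)
    then show ?thesis unfolding b_def using R0 by (intro continuous_intros) auto
  qed
  have cb: "continuous_on X (\<lambda>x. b (f x))" if "continuous_on X f" for X and f :: "'x::topological_space \<Rightarrow> real"
    by (rule continuous_on_compose2[OF cb0]) (auto intro!: that)
  have Ab: "\<bar>A (a, t)\<bar> \<le> B" if "\<bar>a\<bar> \<le> R" "\<bar>t\<bar> \<le> R" for a t
  proof -
    have "\<bar>integral {0..1} (\<lambda>z. g (pt a t z))\<bar> \<le> (1 - 0) * B"
      by (rule integral_abs_bound) (use B that in \<open>auto intro!: continuous_on_pt_cslab[OF cg] continuous_intros\<close>)
    then show ?thesis by (simp add: A_def vint_def)
  qed
  have bb: "\<bar>b a\<bar> \<le> B" if "\<bar>a\<bar> \<le> R" for a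
  proof -
    have "\<bar>integral {-R..R} (\<lambda>t. A (a, t))\<bar> \<le> (R - (-R)) * B"
      by (rule integral_abs_bound) (use Ab that R0 in \<open>auto intro!: cA' continuous_intros simp: abs_le_iff\<close>)
    then show ?thesis using R0 by (simp add: b_def field_simps)
  qed
  have c1: "continuous_on cslab (\<lambda>x. A (x$1, x$2))" by (intro cA' continuous_intros)
  have c2: "continuous_on cslab (\<lambda>x. b (x$1))" by (intro cb continuous_intros)
  have 3: "sint R (\<lambda>x. \<Phi> x * (g x - A (x$1, x$2))) \<le> sint R (\<lambda>x. 2 * B * \<bar>q 3 x\<bar>)"
    unfolding sint_def
  proof (rule hint_mono)
    fix a t assume at: "\<bar>a\<bar> \<le> R" "\<bar>t\<bar> \<le> R"
    have cc: "continuous_on {0..1} (\<lambda>z. g (pt a t z) - A (a, t))" "continuous_on {0..1} (\<lambda>z. q 3 (pt a t z))"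
      by (auto intro!: continuous_on_pt_cslab[OF cg] continuous_on_pt_cslab[OF cq] continuous_intros)
    have "integral {0..1} (\<lambda>z. g (pt a t z) - A (a, t)) = 0"
      by (subst integral_diff) (auto intro!: vint_integrable cg simp: A_def vint_def)
    then have "\<bar>integral {0..1} (\<lambda>z. \<Phi> (pt a t z) * (g (pt a t z) - A (a, t)))\<bar>
      \<le> integral {0..1} (\<lambda>z. \<bar>q 3 (pt a t z)\<bar>) * integral {0..1} (\<lambda>z. \<bar>g (pt a t z) - A (a, t)\<bar>)"
      by (intro integral_zero_mean_bound cc pdv_line3[OF q]) auto
    also have "\<dots> \<le> integral {0..1} (\<lambda>z. \<bar>q 3 (pt a t z)\<bar>) * ((1 - 0) * (2 * B))"
    proof (intro mult_left_mono integral_abs_le_const cc)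
      fix z :: real assume "z \<in> {0..1}"
      then show "\<bar>g (pt a t z) - A (a, t)\<bar> \<le> 2 * B" using B[of "pt a t z"] Ab[OF at] at by auto
    next
      show "0 \<le> integral {0..1} (\<lambda>z. \<bar>q 3 (pt a t z)\<bar>)"
        by (rule integral_nonneg) (use cc(2) in \<open>auto intro!: integrable_continuous_interval continuous_intros\<close>)
    qed simp
    finally have "vint (\<lambda>x. \<Phi> x * (g x - A (x$1, x$2))) (a, t) \<le> 2 * B * vint (\<lambda>x. \<bar>q 3 x\<bar>) (a, t)"
      by (simp add: vint_def mult_ac abs_le_iff)
    then show "vint (\<lambda>x. \<Phi> x * (g x - A (x$1, x$2))) (a, t) \<le> vint (\<lambda>x. 2 * B * \<bar>q 3 x\<bar>) (a, t)"
      by (simp only: vint_cmult)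
  qed (intro continuous_intros cP cg c1 cq)+
  have 2: "sint R (\<lambda>x. \<Phi> x * (A (x$1, x$2) - b (x$1))) \<le> sint R (\<lambda>x. 4 * R * B * \<bar>q 2 x\<bar>)"
  proof (rule sint_mono_inner2)
    fix a z assume az: "\<bar>a\<bar> \<le> R" "0 \<le> z" "z \<le> (1::real)"
    have cc: "continuous_on {-R..R} (\<lambda>t. A (a, t) - b a)" "continuous_on {-R..R} (\<lambda>t. q 2 (pt a t z))"
      using az by (auto intro!: continuous_on_pt_cslab[OF cq] continuous_intros cA')
    have "integral {-R..R} (\<lambda>t. A (a, t) - b a) = integral {-R..R} (\<lambda>t. A (a, t)) - integral {-R..R} (\<lambda>t. b a)"
      by (rule integral_diff) (auto intro!: integrable_continuous_interval cA' continuous_intros)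
    also have "\<dots> = 0" using R0 by (simp add: b_def)
    finally have "\<bar>integral {-R..R} (\<lambda>t. \<Phi> (pt a t z) * (A (a, t) - b a))\<bar>
      \<le> integral {-R..R} (\<lambda>t. \<bar>q 2 (pt a t z)\<bar>) * integral {-R..R} (\<lambda>t. \<bar>A (a, t) - b a\<bar>)"
      using R0 az by (intro integral_zero_mean_bound cc pdv_line2[OF q]) auto
    also have "\<dots> \<le> integral {-R..R} (\<lambda>t. \<bar>q 2 (pt a t z)\<bar>) * ((R - (-R)) * (2 * B))"
    proof (intro mult_left_mono integral_abs_le_const cc)
      fix t :: real assume "t \<in> {-R..R}"
      then have "\<bar>A (a, t)\<bar> \<le> B" by (intro Ab az) (auto simp: abs_le_iff)
      then show "\<bar>A (a, t) - b a\<bar> \<le> 2 * B" using bb[OF az(1)] by linarith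
    next
      show "0 \<le> integral {-R..R} (\<lambda>t. \<bar>q 2 (pt a t z)\<bar>)"
        by (rule integral_nonneg) (use cc(2) in \<open>auto intro!: integrable_continuous_interval continuous_intros\<close>)
    qed (use R0 in simp)
    finally have "integral {-R..R} (\<lambda>t. \<Phi> (pt a t z) * (A (a, t) - b a)) \<le> 4 * R * B * integral {-R..R} (\<lambda>t. \<bar>q 2 (pt a t z)\<bar>)"
      by (simp add: mult_ac abs_le_iff)
    then show "integral {-R..R} (\<lambda>t. \<Phi> (pt a t z) * (A (pt a t z $ 1, pt a t z $ 2) - b (pt a t z $ 1)))
       \<le> integral {-R..R} (\<lambda>t. 4 * R * B * \<bar>q 2 (pt a t z)\<bar>)"
      by simp
  qed (intro continuous_intros cP c1 c2 cq)+
  have b_zero: "integral {-R..R} b = 0"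
  proof -
    have "0 = integral {-R..R} (\<lambda>a. integral {-R..R} (\<lambda>t. A (a, t)))"
      using z unfolding sint_iterated[OF cg] by (simp add: A_def vint_def)
    also have "\<dots> = integral {-R..R} (\<lambda>a. 2 * R * b a)" using R0 by (simp add: b_def)
    also have "\<dots> = 2 * R * integral {-R..R} b" by (rule integral_mult_right)
    finally show ?thesis using R0 by simp
  qed
  have 1: "sint R (\<lambda>x. \<Phi> x * b (x$1)) \<le> sint R (\<lambda>x. 2 * R * B * \<bar>q 1 x\<bar>)"
  proof (rule sint_mono_inner1)
    fix t z assume tz: "\<bar>t\<bar> \<le> R" "0 \<le> z" "z \<le> (1::real)"
    have cc: "continuous_on {-R..R} b" "continuous_on {-R..R} (\<lambda>a. q 1 (pt a t z))"
      using tz by (auto intro!: continuous_on_pt_cslab[OF cq] continuous_intros cb)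
    have "\<bar>integral {-R..R} (\<lambda>a. \<Phi> (pt a t z) * b a)\<bar>
      \<le> integral {-R..R} (\<lambda>a. \<bar>q 1 (pt a t z)\<bar>) * integral {-R..R} (\<lambda>a. \<bar>b a\<bar>)"
      using R0 tz by (intro integral_zero_mean_bound cc pdv_line[OF q] b_zero) auto
    also have "\<dots> \<le> integral {-R..R} (\<lambda>a. \<bar>q 1 (pt a t z)\<bar>) * ((R - (-R)) * B)"
    proof (intro mult_left_mono integral_abs_le_const cc bb)
      show "0 \<le> integral {-R..R} (\<lambda>a. \<bar>q 1 (pt a t z)\<bar>)"
        by (rule integral_nonneg) (use cc(2) in \<open>auto intro!: integrable_continuous_interval continuous_intros\<close>)
    qed (use R0 in \<open>auto simp: abs_le_iff\<close>)
    finally have "integral {-R..R} (\<lambda>a. \<Phi> (pt a t z) * b a) \<le> 2 * R * B * integral {-R..R} (\<lambda>a. \<bar>q 1 (pt a t z)\<bar>)"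
      by (simp add: mult_ac abs_le_iff)
    then show "integral {-R..R} (\<lambda>a. \<Phi> (pt a t z) * b (pt a t z $ 1)) \<le> integral {-R..R} (\<lambda>a. 2 * R * B * \<bar>q 1 (pt a t z)\<bar>)"
      by simp
  qed (intro continuous_intros cP c2 cq)+
  have "sint R (\<lambda>x. \<Phi> x * g x) = sint R (\<lambda>x. (\<Phi> x * (g x - A (x$1, x$2)) + \<Phi> x * (A (x$1, x$2) - b (x$1))) + \<Phi> x * b (x$1))"
    by (rule arg_cong[where f = "sint R"]) (simp add: fun_eq_iff algebra_simps)
  also have "\<dots> = sint R (\<lambda>x. \<Phi> x * (g x - A (x$1, x$2))) + sint R (\<lambda>x. \<Phi> x * (A (x$1, x$2) - b (x$1))) + sint R (\<lambda>x. \<Phi> x * b (x$1))"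
    by (subst sint_add, (intro continuous_intros cP cg c1 c2)+, subst sint_add, (intro continuous_intros cP cg c1 c2)+) simp
  finally have "sint R (\<lambda>x. \<Phi> x * g x) \<le> 2 * B * sint R (\<lambda>x. \<bar>q 3 x\<bar>) + 4 * R * B * sint R (\<lambda>x. \<bar>q 2 x\<bar>) + 2 * R * B * sint R (\<lambda>x. \<bar>q 1 x\<bar>)"
    using 1 2 3 by (simp only: sint_cmult)
  moreover have i0: "0 \<le> sint R (\<lambda>x. \<bar>q j x\<bar>)" for j by (rule sint_nonneg) (auto intro!: continuous_intros cq)
  moreover have "2 * B * sint R (\<lambda>x. \<bar>q 3 x\<bar>) \<le> 4 * R * B * sint R (\<lambda>x. \<bar>q 3 x\<bar>)"
  proof (rule mult_right_mono[OF _ i0])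
    have "B \<le> R * B" "0 \<le> R * B" using R B0 mult_right_mono[of 1 R B] by simp_all
    then have "2 * B \<le> 4 * (R * B)" by linarith
    then show "2 * B \<le> 4 * R * B" by (simp only: mult.assoc)
  qed
  moreover have "2 * R * B * sint R (\<lambda>x. \<bar>q 1 x\<bar>) \<le> 4 * R * B * sint R (\<lambda>x. \<bar>q 1 x\<bar>)"
    using R0 B0 by (intro mult_right_mono i0) auto
  ultimately show ?thesis unfolding distrib_left by linarith
qed

section \<open>The velocity as its own test field, and the Bernoulli pressure\<close>

context slab_flow begin

definition U2 :: "real^3 \<Rightarrow> real" where "U2 x = (\<Sum>i\<in>UNIV. (v i x)\<^sup>2)"
text \<open>The Bernoulli pressure: the work of the pressure and the convection of kinetic energy
  combine into the transport of this single function.\<close>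

definition Bn :: "real^3 \<Rightarrow> real" where "Bn x = P x + (1/2) * U2 x"
definition q :: "3 \<Rightarrow> real^3 \<Rightarrow> real" where "q j x = pd j P x + (\<Sum>i\<in>UNIV. v i x * d i j x)"
text \<open>The radial velocity times the distance to the axis, written without a division so that
  it is regular across the axis.\<close>

definition xu :: "real^3 \<Rightarrow> real" where "xu x = x$1 * v 1 x + x$2 * v 2 x"
definition fl :: "real \<Rightarrow> real^3 \<Rightarrow> real" where "fl R x = (\<Sum>j\<in>UNIV. v j x * dcut 2 R j x)"
text \<open>The Laplacian is included because the gradient \<open>q\<close> of \<open>Bn\<close> is
  controlled by it together with first derivatives.\<close>

definition f :: "real^3 \<Rightarrow> real" where "f x = g2 x + L2 x"

lemma cont_U2 [continuous_intros]: "continuous_on cslab U2" unfolding U2_def by (intro continuous_intros)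
lemma cont_Bn [continuous_intros]: "continuous_on cslab Bn" unfolding Bn_def by (intro continuous_intros)
lemma cont_q [continuous_intros]: "continuous_on cslab (q j)" unfolding q_def by (intro continuous_intros)
lemma cont_xu [continuous_intros]: "continuous_on cslab xu" unfolding xu_def by (intro continuous_intros)
lemma cont_fl [continuous_intros]: "continuous_on cslab (fl R)" unfolding fl_def by (intro continuous_intros)
lemma cont_f [continuous_intros]: "continuous_on cslab f" unfolding f_def by (intro continuous_intros)
lemma U2_nonneg: "0 \<le> U2 x" unfolding U2_def by (intro sum_nonneg) auto
lemma f_nonneg: "0 \<le> f x" unfolding f_def using g2_nonneg L2_nonneg by (intro add_nonneg_nonneg)

lemma pdv_Bn: "pdv j Bn (q j)"
  unfolding Bn_def U2_def q_def
  by (rule pdv_cong, (rule pdv_flow pdv_add pdv_mult pdv_const pdv_sum pdv_power)+) (simp add: sum_distrib_left)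

lemma fl_eq: "fl R x = - (16 / R\<^sup>2) * (cutoff R x ^ 3 * rho R x) * xu x"
  by (simp add: fl_def sum_3 dcut_def hx_def xu_def eval_nat_numeral algebra_simps add_divide_distrib)

lemma xu_le:
  assumes R: "R > 0" and x: "x \<in> cslab"
  shows "\<bar>xu x\<bar> \<le> 2 * M * R * sqrt (rho R x)"
proof -
  have "\<bar>x$1 * v 1 x\<bar> \<le> (R * sqrt (rho R x)) * M" "\<bar>x$2 * v 2 x\<bar> \<le> (R * sqrt (rho R x)) * M"
    using hx_le[OF R, of 1 x] hx_le[OF R, of 2 x] by (auto simp: hx_def intro!: abs_mult_le v_le[OF x])
  then have "\<bar>xu x\<bar> \<le> R * sqrt (rho R x) * M + R * sqrt (rho R x) * M" unfolding xu_def by linarith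
  then show ?thesis by (simp add: mult_ac)
qed

text \<open>By the momentum equation the gradient of \<open>Bn\<close> differs from the Laplacian by
  the cross product of velocity and vorticity. This is at most \<open>6 * M\<close> times the
  gradient norm, and 72 is twice the square of 6.\<close>

lemma q_le: "x \<in> cslab \<Longrightarrow> (q j x)\<^sup>2 \<le> 2 * (L j x)\<^sup>2 + 72 * M\<^sup>2 * g2 x"
proof -
  assume x: "x \<in> cslab"
  define r where "r = (\<Sum>i\<in>UNIV. v i x * d i j x) - N j x"
  have "\<bar>\<Sum>i\<in>UNIV. v i x * d i j x\<bar> \<le> 3 * (M * sqrt (g2 x))"
    by (intro sum3_abs_le abs_mult_le v_le[OF x] d_le)
  then have "\<bar>r\<bar> \<le> 3 * (M * sqrt (g2 x)) + 3 * M * sqrt (g2 x)" using N_le[OF x, of j] unfolding r_def by linarith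
  then have "\<bar>r\<bar> \<le> 6 * M * sqrt (g2 x)" by simp
  then have "r\<^sup>2 \<le> (6 * M * sqrt (g2 x))\<^sup>2" by (rule power2_le_iff_abs_le[THEN iffD2, rotated]) (simp add: M_nonneg g2_nonneg)
  then have r: "r\<^sup>2 \<le> 36 * M\<^sup>2 * g2 x" using g2_nonneg by (simp add: power_mult_distrib)
  have "q j x = L j x + r" using momentum[OF x, of j] by (simp add: q_def r_def)
  moreover have "(L j x + r)\<^sup>2 \<le> 2 * (L j x)\<^sup>2 + 2 * r\<^sup>2" using sum_squares_bound[of "L j x" r] by (simp add: power2_sum)
  ultimately show ?thesis using r by simp
qed

text \<open>The flux \<open>G\<close> combines viscous work with the transport of \<open>Bn\<close>.
  Both are incompressibly transported, so \<open>Bn\<close> itself survives only where the cutoff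
  varies, multiplied by \<open>fl R\<close>.\<close>

lemma energy_identity:
  assumes R: "R > 0"
  shows "sint R (\<lambda>x. cutoff R x ^ 4 * g2 x) + 2 * \<alpha> * bint R (\<lambda>x. cutoff R x ^ 4 * U2 x)
    = - sint R (\<lambda>x. \<Sum>i\<in>UNIV. \<Sum>j\<in>UNIV. d i j x * v i x * dcut 2 R j x) + sint R (\<lambda>x. Bn x * fl R x)"
proof -
  define G where "G j x = ((\<Sum>i\<in>UNIV. d i j x * v i x) - Bn x * v j x) * cutoff R x ^ 4" for j x
  define G' where "G' j x = ((\<Sum>i\<in>UNIV. pd j (d i j) x * v i x + d i j x * d i j x) - (q j x * v j x + Bn x * d j j x)) * cutoff R x ^ 4
     + ((\<Sum>i\<in>UNIV. d i j x * v i x) - Bn x * v j x) * dcut 2 R j x" for j x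
  have D: "pdv j (G j) (G' j)" for j unfolding G_def G'_def
    by (intro pdv_mult pdv_diff pdv_sum pdv_flow pdv_cutoff4 pdv_Bn)
  have cG': "continuous_on cslab (G' j)" for j unfolding G'_def by (intro continuous_intros)
  have cG: "continuous_on cslab (G 3)" unfolding G_def by (intro continuous_intros)
  have G3: "G 3 x = a x * (cutoff R x ^ 4 * U2 x)" if "x$3 = 0 \<or> x$3 = 1" for x
    using bcz[OF that, of 1] bcz[OF that, of 2] bc3[OF that]
    by (simp add: G_def U2_def sum_3 power2_eq_square algebra_simps)
  have "sint R (\<lambda>x. G' 1 x + G' 2 x + G' 3 x) = hint R (\<lambda>p. G 3 (pt (fst p) (snd p) 1)) - hint R (\<lambda>p. G 3 (pt (fst p) (snd p) 0))"
    by (rule divergence_theorem[of R G G', OF _ D cG' cG]) (use R cutoff_lateral in \<open>auto simp: G_def\<close>)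
  also have "hint R (\<lambda>p. G 3 (pt (fst p) (snd p) 1)) = (- 2 * \<alpha>) * hint R (\<lambda>p. cutoff R (pt (fst p) (snd p) 1) ^ 4 * U2 (pt (fst p) (snd p) 1))"
    unfolding hint_cmult[symmetric] by (rule arg_cong[where f = "hint R"]) (simp add: fun_eq_iff G3 a_def)
  also have "hint R (\<lambda>p. G 3 (pt (fst p) (snd p) 0)) = (2 * \<alpha>) * hint R (\<lambda>p. cutoff R (pt (fst p) (snd p) 0) ^ 4 * U2 (pt (fst p) (snd p) 0))"
    unfolding hint_cmult[symmetric] by (rule arg_cong[where f = "hint R"]) (simp add: fun_eq_iff G3 a_def)
  finally have 1: "sint R (\<lambda>x. G' 1 x + G' 2 x + G' 3 x) = - 2 * \<alpha> * bint R (\<lambda>x. cutoff R x ^ 4 * U2 x)"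
    by (simp add: bint_def algebra_simps)
  have "sint R (\<lambda>x. G' 1 x + G' 2 x + G' 3 x) = sint R (\<lambda>x. (cutoff R x ^ 4 * g2 x + (\<Sum>i\<in>UNIV. \<Sum>j\<in>UNIV. d i j x * v i x * dcut 2 R j x)) - Bn x * fl R x)"
  proof (rule sint_cong)
    fix x assume x: "x \<in> cslab"
    have "G' 1 x + G' 2 x + G' 3 x = cutoff R x ^ 4 * (\<Sum>i\<in>UNIV. (L i x - pd i P x) * v i x - v i x * N i x) + cutoff R x ^ 4 * g2 x
      - cutoff R x ^ 4 * Bn x * (d 1 1 x + d 2 2 x + d 3 3 x)
      + (\<Sum>i\<in>UNIV. \<Sum>j\<in>UNIV. d i j x * v i x * dcut 2 R j x) - Bn x * fl R x"
      by (simp add: G'_def L_def N_def g2_def q_def fl_def sum_3 power2_eq_square algebra_simps)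
    then show "G' 1 x + G' 2 x + G' 3 x = (cutoff R x ^ 4 * g2 x + (\<Sum>i\<in>UNIV. \<Sum>j\<in>UNIV. d i j x * v i x * dcut 2 R j x)) - Bn x * fl R x"
      using div_free[OF x] momentum[OF x] by (simp add: mult.commute)
  qed (intro continuous_intros cG')+
  also have "\<dots> = sint R (\<lambda>x. cutoff R x ^ 4 * g2 x) + sint R (\<lambda>x. \<Sum>i\<in>UNIV. \<Sum>j\<in>UNIV. d i j x * v i x * dcut 2 R j x) - sint R (\<lambda>x. Bn x * fl R x)"
    by (subst sint_diff, (intro continuous_intros)+, subst sint_add, (intro continuous_intros)+) simp
  finally show ?thesis using 1 by linarith
qed

text \<open>The Robin inequality bounds the velocity by its wall values and the gradient. The energy
  contains the wall values only with coefficient \<open>2 * \<alpha>\<close>, which is why the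
  factor \<open>\<alpha>^2\<close> stays on the left.\<close>

lemma velocity_control: "vint U2 p * \<alpha>\<^sup>2 \<le> (\<alpha> / 2 + \<alpha>\<^sup>2) * en (2 * \<alpha>) g2 U2 p"
proof -
  define b where "b = U2 (pt (fst p) (snd p) 0) + U2 (pt (fst p) (snd p) 1)"
  have b0: "0 \<le> b" by (simp add: b_def U2_nonneg)
  have i0: "0 \<le> vint g2 p" by (rule vint_nonneg[OF cont_g2 g2_nonneg])
  have "vint (\<lambda>x. (v i x)\<^sup>2) p \<le> (v i (pt (fst p) (snd p) 0))\<^sup>2 + (v i (pt (fst p) (snd p) 1))\<^sup>2 + vint (\<lambda>x. (d i 3 x)\<^sup>2) p" for i
    by (rule vint_Robin[OF pdv_v]) (intro continuous_intros)+
  then have "(\<Sum>i\<in>UNIV. vint (\<lambda>x. (v i x)\<^sup>2) p) \<le> (\<Sum>i\<in>UNIV. (v i (pt (fst p) (snd p) 0))\<^sup>2 + (v i (pt (fst p) (snd p) 1))\<^sup>2 + vint (\<lambda>x. (d i 3 x)\<^sup>2) p)"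
    by (intro sum_mono)
  also have "\<dots> = b + vint (V2 3) p" by (simp add: sum.distrib b_def U2_def vint_V2)
  also have "vint (V2 3) p \<le> vint g2 p" by (intro vint_mono_cslab V2_le_g2 continuous_intros)
  also have "(\<Sum>i\<in>UNIV. vint (\<lambda>x. (v i x)\<^sup>2) p) = vint U2 p"
    unfolding U2_def sum_3 by (subst vint_add, (intro continuous_intros)+, subst vint_add, (intro continuous_intros)+) simp
  finally have "vint U2 p * \<alpha>\<^sup>2 \<le> (b + vint g2 p) * \<alpha>\<^sup>2" by (intro mult_right_mono) auto
  also have "\<dots> = \<alpha> / 2 * (2 * \<alpha> * b) + \<alpha>\<^sup>2 * vint g2 p" by (simp add: power2_eq_square algebra_simps)
  also have "\<dots> \<le> (\<alpha> / 2 + \<alpha>\<^sup>2) * (2 * \<alpha> * b) + (\<alpha> / 2 + \<alpha>\<^sup>2) * vint g2 p"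
    using alpha_nonneg b0 i0 by (intro add_mono mult_right_mono) auto
  also have "\<dots> = (\<alpha> / 2 + \<alpha>\<^sup>2) * en (2 * \<alpha>) g2 U2 p" by (simp add: en_def b_def distrib_left add.commute)
  finally show ?thesis .
qed

definition K3 :: real where "K3 = 1 + (\<alpha> / 2 + \<alpha>\<^sup>2)"

text \<open>The bound by \<open>laplacian_energy\<close> contains \<open>\<alpha>^2\<close> times
  the squared velocity; \<open>velocity_control\<close>, used under a horizontal weight, returns it
  to the energy. The doubled radius and the factor 4 come from
  \<open>sint_le_cutoff\<close>.\<close>

lemma laplacian_by_energy:
  assumes R: "R \<ge> 1"
  shows "sint R L2 \<le> 4 * CA * K3 * (sint (2 * R) g2 + 2 * \<alpha> * bint (2 * R) U2)"
proof -
  have R0: "R > 0" "2 * R \<ge> 1" using R by auto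
  define w where "w x = (cutoff (2 * R) x)\<^sup>2" for x
  have cw: "continuous_on cslab w" unfolding w_def by (intro continuous_intros)
  have wh: "w (pt a b z) = w (pt a b 0)" for a b z unfolding w_def by (metis cutoff_horizontal(1))
  have w01: "0 \<le> w x" "w x \<le> 1" for x using cutoff_nonneg cutoff_le1 by (auto simp: w_def power_le_one)
  have bnn: "0 \<le> bint (2 * R) (\<lambda>x. w x * U2 x)"
    by (rule bint_nonneg) (auto intro!: continuous_intros cw mult_nonneg_nonneg w01 U2_nonneg)
  define e where "e = sint (2 * R) (\<lambda>x. w x * g2 x) + 2 * \<alpha> * bint (2 * R) (\<lambda>x. w x * U2 x)"
  have 1: "sint R L2 \<le> 4 * sint (2 * R) (\<lambda>x. cutoff (2 * R) x ^ 4 * L2 x)"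
    by (rule sint_le_cutoff(1)[OF R0(1) cont_L2 L2_nonneg])
  have 2: "sint (2 * R) (\<lambda>x. cutoff (2 * R) x ^ 4 * L2 x) \<le> CA * sint (2 * R) (\<lambda>x. w x * w2 x)"
    unfolding w_def by (rule laplacian_energy[OF R0(2)])
  have 3: "sint (2 * R) (\<lambda>x. w x * w2 x) = sint (2 * R) (\<lambda>x. w x * g2 x) + sint (2 * R) (\<lambda>x. w x * (\<alpha>\<^sup>2 * U2 x))"
    unfolding w2_def U2_def[symmetric] distrib_left by (rule sint_add) (intro continuous_intros cw)+
  have 4: "sint (2 * R) (\<lambda>x. w x * (\<alpha>\<^sup>2 * U2 x)) \<le> (\<alpha> / 2 + \<alpha>\<^sup>2) * e"
    unfolding e_def
  proof (rule sint_weighted_le[OF _ _ _ cw _ wh w01(1)])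
    show "vint (\<lambda>x. \<alpha>\<^sup>2 * U2 x) p \<le> (\<alpha> / 2 + \<alpha>\<^sup>2) * en (2 * \<alpha>) g2 U2 p" for p
      using velocity_control[of p] by (simp only: vint_cmult mult.commute[of "vint U2 p"])
  qed (intro continuous_intros)+
  have 5: "sint (2 * R) (\<lambda>x. w x * g2 x) \<le> e" unfolding e_def using alpha_nonneg bnn by simp
  have 6: "e \<le> sint (2 * R) g2 + 2 * \<alpha> * bint (2 * R) U2"
    unfolding e_def using alpha_nonneg w01 g2_nonneg U2_nonneg
    by (intro add_mono mult_left_mono sint_mono bint_mono continuous_intros cw) (auto intro: mult_left_le_one_le)
  have "sint (2 * R) (\<lambda>x. w x * w2 x) \<le> e + (\<alpha> / 2 + \<alpha>\<^sup>2) * e" using 3 4 5 by linarith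
  also have "\<dots> = K3 * e" by (simp add: K3_def distrib_right)
  also have "\<dots> \<le> K3 * (sint (2 * R) g2 + 2 * \<alpha> * bint (2 * R) U2)"
    using alpha_nonneg by (intro mult_left_mono 6) (simp add: K3_def)
  finally have "CA * sint (2 * R) (\<lambda>x. w x * w2 x) \<le> CA * (K3 * (sint (2 * R) g2 + 2 * \<alpha> * bint (2 * R) U2))"
    using CA_pos by (intro mult_left_mono) auto
  then have "sint R L2 \<le> 4 * (CA * (K3 * (sint (2 * R) g2 + 2 * \<alpha> * bint (2 * R) U2)))" using 1 2 by linarith
  then show ?thesis by (simp only: mult.assoc)
qed

text \<open>Reduces both Liouville cases to a bound on the flux of the Bernoulli pressure. That
  bound may involve the Laplacian, because \<open>f\<close> contains it and the energy at a larger
  radius controls it.\<close>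

lemma vanishing_gradient:
  assumes C0: "C0 \<ge> 0" and flux: "\<And>\<tau>. \<tau> > 0 \<Longrightarrow> \<exists>\<eta>. (\<eta> \<longlongrightarrow> 0) at_top \<and> (\<forall>R\<ge>1. sint R (\<lambda>x. Bn x * fl R x)
       \<le> \<tau> * sint R (\<lambda>x. rho R x * f x) + C0 / \<tau> + \<eta> R * (1 + sint R f))"
    and x: "x \<in> cslab"
  shows "g2 x = 0"
proof -
  define C1 where "C1 = (144 * M)\<^sup>2"
  have C1: "C1 \<ge> 0" by (simp add: C1_def)
  have first: "- sint R (\<lambda>x. \<Sum>i\<in>UNIV. \<Sum>j\<in>UNIV. d i j x * v i x * dcut 2 R j x) \<le> \<tau> * sint R (\<lambda>x. rho R x * f x) + C1 / \<tau>"
    if \<tau>: "\<tau> > 0" and R: "R \<ge> 1" for \<tau> R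
  proof -
    have R0: "R > 0" using R by simp
    have "- sint R (\<lambda>x. \<Sum>i\<in>UNIV. \<Sum>j\<in>UNIV. d i j x * v i x * dcut 2 R j x) = sint R (\<lambda>x. (-1) * (\<Sum>i\<in>UNIV. \<Sum>j\<in>UNIV. d i j x * v i x * dcut 2 R j x))"
      by (subst sint_cmult) simp
    also have "\<dots> \<le> sint R (\<lambda>x. \<tau> * (rho R x * f x) + (144 * M / R)\<^sup>2 / (4 * \<tau>))"
    proof (rule sint_mono)
      fix x assume x: "x \<in> cslab"
      have D0: "\<bar>dcut 2 R j x\<bar> \<le> 16 / R * (cutoff R x ^ 3 * sqrt (rho R x))" for j
        using dcut_bound0[OF R0, of 2 j x] by (simp add: eval_nat_numeral)
      have c3: "cutoff R x ^ 3 * sqrt (rho R x) \<le> sqrt (rho R x)" by (rule cutoff_mult_le) (simp add: rho_nonneg)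
      have "16 / R * (cutoff R x ^ 3 * sqrt (rho R x)) \<le> 16 / R * sqrt (rho R x)" using R0 c3 by (intro mult_left_mono) auto
      then have D: "\<bar>dcut 2 R j x\<bar> \<le> 16 / R * sqrt (rho R x)" for j using D0[of j] by linarith
      have "\<bar>\<Sum>i\<in>UNIV. \<Sum>j\<in>UNIV. d i j x * v i x * dcut 2 R j x\<bar> \<le> 3 * (3 * (sqrt (g2 x) * M * (16 / R * sqrt (rho R x))))"
        by (intro sum3_abs_le abs_mult_le d_le v_le[OF x] D)
      also have "\<dots> = (sqrt (g2 x) * sqrt (rho R x)) * (144 * M / R)" by simp
      also have "\<dots> \<le> \<tau> * (sqrt (g2 x) * sqrt (rho R x))\<^sup>2 + (144 * M / R)\<^sup>2 / (4 * \<tau>)" by (rule young2[OF \<tau>])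
      also have "(sqrt (g2 x) * sqrt (rho R x))\<^sup>2 = rho R x * g2 x" using g2_nonneg rho_nonneg by (simp add: power_mult_distrib mult.commute)
      also have "\<tau> * (rho R x * g2 x) \<le> \<tau> * (rho R x * f x)" using \<tau> rho_nonneg L2_nonneg by (intro mult_left_mono) (auto simp: f_def)
      finally show "(-1) * (\<Sum>i\<in>UNIV. \<Sum>j\<in>UNIV. d i j x * v i x * dcut 2 R j x) \<le> \<tau> * (rho R x * f x) + (144 * M / R)\<^sup>2 / (4 * \<tau>)"
        by linarith
    qed (intro continuous_intros)+
    also have "\<dots> = \<tau> * sint R (\<lambda>x. rho R x * f x) + 4 * R\<^sup>2 * ((144 * M / R)\<^sup>2 / (4 * \<tau>))"
      using R0 by (subst sint_add, (intro continuous_intros)+) (simp only: sint_cmult, simp add: sint_const)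
    also have "4 * R\<^sup>2 * ((144 * M / R)\<^sup>2 / (4 * \<tau>)) = C1 / \<tau>" using R0 \<tau> by (simp add: C1_def power_divide)
    finally show ?thesis .
  qed
  define A where "A = 1 + 4 * CA * K3"
  have K3: "K3 \<ge> 1" using alpha_nonneg by (simp add: K3_def)
  have A: "A \<ge> 1" using CA_pos K3 by (simp add: A_def)
  define E where "E R = sint R (\<lambda>x. cutoff R x ^ 4 * g2 x) + 2 * \<alpha> * bint R (\<lambda>x. cutoff R x ^ 4 * U2 x)" for R
  have E0: "sint R g2 + 2 * \<alpha> * bint R U2 \<le> 4 * E (2 * R)" if "R \<ge> 1" for R
  proof -
    have "R > 0" using that by simp
    note le = sint_le_cutoff(1)[OF this cont_g2 g2_nonneg] sint_le_cutoff(2)[OF this cont_U2 U2_nonneg]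
    have "2 * \<alpha> * bint R U2 \<le> 2 * \<alpha> * (4 * bint (2 * R) (\<lambda>x. cutoff (2 * R) x ^ 4 * U2 x))"
      by (rule mult_left_mono[OF le(2)]) (use alpha_nonneg in simp)
    with le(1) show ?thesis by (simp add: E_def)
  qed
  have bU: "0 \<le> bint R U2" for R by (rule bint_nonneg[OF cont_U2 U2_nonneg])
  have sf: "sint R f = sint R g2 + sint R L2" for R unfolding f_def by (rule sint_add) (intro continuous_intros)+
  \<comment> \<open>The radius is doubled once to control the Laplacian and once more to fit the
    cutoff of the energy identity.\<close>
  have total: "sint R f + 2 * \<alpha> * bint R U2 \<le> 4 * A * E (4 * R)" if R: "R \<ge> 1" for R
  proof -
    have "sint R g2 + 2 * \<alpha> * bint R U2 \<le> sint (2 * R) g2 + 2 * \<alpha> * bint (2 * R) U2"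
    proof (intro add_mono mult_left_mono)
      show "sint R g2 \<le> sint (2 * R) g2" unfolding sint_def using R
        by (intro hint_mono_radius continuous_intros vint_nonneg g2_nonneg) auto
      show "bint R U2 \<le> bint (2 * R) U2" unfolding bint_def using R
        by (intro add_mono hint_mono_radius bcont[OF cont_U2] U2_nonneg) auto
    qed (use alpha_nonneg in auto)
    from add_mono[OF this laplacian_by_energy[OF R]]
    have "sint R f + 2 * \<alpha> * bint R U2 \<le> A * (sint (2 * R) g2 + 2 * \<alpha> * bint (2 * R) U2)"
      unfolding sf A_def distrib_right[of 1] by simp
    also have "\<dots> \<le> A * (4 * E (2 * (2 * R)))" using R A by (intro mult_left_mono E0) auto
    finally show ?thesis by (simp add: mult_ac)
  qed
  obtain Ca where Ca: "Ca \<ge> 0" "\<And>R. R \<ge> 1 \<Longrightarrow> sint R (\<lambda>x. (cutoff R x)\<^sup>2 * g2 x) \<le> Ca * R\<^sup>2"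
    "\<And>R. R \<ge> 1 \<Longrightarrow> sint R (\<lambda>x. cutoff R x ^ 4 * L2 x) \<le> Ca * R\<^sup>2"
    using a_priori by blast
  define C where "C = 64 * A * (Ca + 16 * \<alpha> * M\<^sup>2) + 32 * A\<^sup>2 * (C0 + C1)"
  have CC: "0 \<le> 64 * A * (Ca + 16 * \<alpha> * M\<^sup>2)" "0 \<le> 32 * A\<^sup>2 * (C0 + C1)"
    using A Ca alpha_nonneg C0 C1 by auto
  have C: "C \<ge> 0" using CC by (simp add: C_def)
  have growth: "sint R f + 2 * \<alpha> * bint R U2 \<le> C * R\<^sup>2" if R: "R \<ge> 1" for R
  proof -
    have R4: "4 * R \<ge> 1" using R by simp
    have "sint (4 * R) (\<lambda>x. cutoff (4 * R) x ^ 4 * g2 x) \<le> sint (4 * R) (\<lambda>x. (cutoff (4 * R) x)\<^sup>2 * g2 x)"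
      using cutoff_nonneg cutoff_le1 g2_nonneg by (intro sint_mono mult_right_mono power_decreasing continuous_intros) auto
    then have "sint (4 * R) (\<lambda>x. cutoff (4 * R) x ^ 4 * g2 x) \<le> Ca * (4 * R)\<^sup>2" using Ca(2)[OF R4] by linarith
    moreover have "bint (4 * R) (\<lambda>x. cutoff (4 * R) x ^ 4 * U2 x) \<le> bint (4 * R) (\<lambda>x. M\<^sup>2)"
    proof (rule bint_mono)
      fix x assume x: "x \<in> cslab"
      have "cutoff (4 * R) x ^ 4 * U2 x \<le> U2 x" by (rule cutoff_mult_le[OF U2_nonneg])
      also have "\<dots> \<le> M\<^sup>2" unfolding U2_def by (rule v_sum_le[OF x])
      finally show "cutoff (4 * R) x ^ 4 * U2 x \<le> M\<^sup>2" .
    qed (intro continuous_intros)+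
    then have "2 * \<alpha> * bint (4 * R) (\<lambda>x. cutoff (4 * R) x ^ 4 * U2 x) \<le> 2 * \<alpha> * (8 * (4 * R)\<^sup>2 * M\<^sup>2)"
      using alpha_nonneg R by (intro mult_left_mono) (auto simp: bint_const)
    ultimately have "E (4 * R) \<le> Ca * (4 * R)\<^sup>2 + 2 * \<alpha> * (8 * (4 * R)\<^sup>2 * M\<^sup>2)" unfolding E_def by linarith
    then have "4 * A * E (4 * R) \<le> 4 * A * (Ca * (4 * R)\<^sup>2 + 2 * \<alpha> * (8 * (4 * R)\<^sup>2 * M\<^sup>2))" using A by (intro mult_left_mono) auto
    also have "\<dots> = 64 * A * (Ca + 16 * \<alpha> * M\<^sup>2) * R\<^sup>2" by (simp add: power_mult_distrib algebra_simps)
    also have "\<dots> \<le> C * R\<^sup>2" using CC by (intro mult_right_mono) (auto simp: C_def)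
    finally show ?thesis using total[OF R] by linarith
  qed
  have "f x = 0"
  proof (rule liouville_iteration(1)[of f U2 "2 * \<alpha>" 4 C, OF _ _ _ _ _ _ C growth _ x])
    fix \<tau> :: real assume \<tau>: "\<tau> > 0"
    \<comment> \<open>The weighted energy occurs twice with coefficient \<open>t\<close>, from
      \<open>first\<close> and from the flux, and everything is multiplied by
      \<open>4 * A\<close>.\<close>
    define t where "t = \<tau> / (8 * A)"
    have t: "t > 0" using \<tau> A by (simp add: t_def)
    obtain \<eta> where \<eta>: "(\<eta> \<longlongrightarrow> 0) at_top" "\<And>R. R \<ge> 1 \<Longrightarrow> sint R (\<lambda>x. Bn x * fl R x)
       \<le> t * sint R (\<lambda>x. rho R x * f x) + C0 / t + \<eta> R * (1 + sint R f)"
      using flux[OF t] by blast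
    define \<eta>' where "\<eta>' R = 4 * A * \<bar>\<eta> (4 * R)\<bar>" for R
    have "filterlim (\<lambda>R::real. 4 * R) at_top at_top"
      by (rule filterlim_tendsto_pos_mult_at_top[OF tendsto_const _ filterlim_ident]) simp
    from filterlim_compose[OF \<eta>(1) this]
    have "((\<lambda>R. 4 * A * \<bar>\<eta> (4 * R)\<bar>) \<longlongrightarrow> 4 * A * \<bar>0\<bar>) at_top" by (intro tendsto_intros)
    then have lim: "(\<eta>' \<longlongrightarrow> 0) at_top" by (simp add: \<eta>'_def[abs_def])
    have main: "sint R f + 2 * \<alpha> * bint R U2 \<le> \<tau> * (sint (4 * R) (\<lambda>x. rho (4 * R) x * f x) + 2 * \<alpha> * bint (4 * R) (\<lambda>x. rho (4 * R) x * U2 x))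
         + C / \<tau> + \<eta>' R * (1 + (sint (4 * R) f + 2 * \<alpha> * bint (4 * R) U2))" if R: "R \<ge> 1" for R
    proof -
      have R4: "4 * R \<ge> 1" "4 * R > 0" using R by auto
      define W where "W = sint (4 * R) (\<lambda>x. rho (4 * R) x * f x)"
      define Y where "Y = sint (4 * R) f + 2 * \<alpha> * bint (4 * R) U2"
      have sf0: "0 \<le> sint (4 * R) f" by (rule sint_nonneg) (auto intro: continuous_intros f_nonneg)
      have ab0: "0 \<le> 2 * \<alpha> * bint (4 * R) U2" using alpha_nonneg bU by simp
      have "E (4 * R) \<le> (t * W + C1 / t) + (t * W + C0 / t + \<eta> (4 * R) * (1 + sint (4 * R) f))"
        unfolding E_def energy_identity[OF R4(2)] W_def by (intro add_mono first[OF t R4(1)] \<eta>(2)[OF R4(1)])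
      also have "\<eta> (4 * R) * (1 + sint (4 * R) f) \<le> \<bar>\<eta> (4 * R)\<bar> * (1 + Y)"
        using sf0 ab0 by (intro mult_mono) (auto simp: Y_def)
      finally have "4 * A * E (4 * R) \<le> 4 * A * ((t * W + C1 / t) + (t * W + C0 / t + \<bar>\<eta> (4 * R)\<bar> * (1 + Y)))"
        using A by (intro mult_left_mono) auto
      also have "\<dots> = (8 * A * t) * W + 4 * A * (C0 + C1) / t + \<eta>' R * (1 + Y)"
        by (simp add: \<eta>'_def algebra_simps add_divide_distrib)
      also have "8 * A * t = \<tau>" using A by (simp add: t_def)
      also have "4 * A * (C0 + C1) / t = 32 * A\<^sup>2 * (C0 + C1) / \<tau>" by (simp add: t_def power2_eq_square)
      finally have 1: "4 * A * E (4 * R) \<le> \<tau> * W + 32 * A\<^sup>2 * (C0 + C1) / \<tau> + \<eta>' R * (1 + Y)" .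
      have "0 \<le> 2 * \<alpha> * bint (4 * R) (\<lambda>x. rho (4 * R) x * U2 x)"
        using alpha_nonneg by (intro mult_nonneg_nonneg bint_nonneg) (auto intro!: continuous_intros simp: rho_nonneg U2_nonneg)
      then have "\<tau> * W \<le> \<tau> * (W + 2 * \<alpha> * bint (4 * R) (\<lambda>x. rho (4 * R) x * U2 x))" using \<tau> by (intro mult_left_mono) auto
      moreover have "32 * A\<^sup>2 * (C0 + C1) / \<tau> \<le> C / \<tau>"
        using CC \<tau> by (intro divide_right_mono) (auto simp: C_def)
      ultimately show ?thesis using total[OF R] 1 unfolding W_def Y_def by linarith
    qed
    show "\<exists>\<eta>. (\<eta> \<longlongrightarrow> 0) at_top \<and> (\<forall>R\<ge>1. sint R f + 2 * \<alpha> * bint R U2 \<le>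
       \<tau> * (sint (4 * R) (\<lambda>x. rho (4 * R) x * f x) + 2 * \<alpha> * bint (4 * R) (\<lambda>x. rho (4 * R) x * U2 x))
         + C / \<tau> + \<eta> R * (1 + (sint (4 * R) f + 2 * \<alpha> * bint (4 * R) U2)))"
      using lim main by blast
  qed (use alpha_nonneg in \<open>auto intro: continuous_intros f_nonneg U2_nonneg\<close>)
  then show ?thesis using g2_nonneg[of x] L2_nonneg[of x] by (simp add: f_def add_nonneg_eq_0_iff)
qed

definition KQ :: real where "KQ = 2 + 216 * M\<^sup>2"

lemma q2_le: "x \<in> cslab \<Longrightarrow> (q 1 x)\<^sup>2 + (q 2 x)\<^sup>2 + (q 3 x)\<^sup>2 \<le> KQ * f x"
proof -
  assume x: "x \<in> cslab"
  have "(q 1 x)\<^sup>2 + (q 2 x)\<^sup>2 + (q 3 x)\<^sup>2 \<le> 2 * L2 x + 216 * M\<^sup>2 * g2 x"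
    using q_le[OF x, of 1] q_le[OF x, of 2] q_le[OF x, of 3] by (simp add: L2_def sum_3)
  also have "\<dots> \<le> KQ * f x"
  proof -
    have "0 \<le> 216 * M\<^sup>2 * L2 x" "0 \<le> 2 * g2 x" using L2_nonneg g2_nonneg by auto
    then show ?thesis by (simp add: KQ_def f_def algebra_simps)
  qed
  finally show ?thesis .
qed

lemma flux_zero_mean:
  assumes z: "\<And>p. vint xu p = 0" and x: "x \<in> cslab"
  shows "g2 x = 0"
proof -
  define C0 where "C0 = KQ * (32 * M)\<^sup>2"
  have KQ: "KQ > 0" by (simp add: KQ_def add_pos_nonneg)
  show ?thesis
  proof (rule vanishing_gradient[OF _ _ x])
    show "0 \<le> C0" using KQ by (simp add: C0_def)
    fix \<tau> :: real assume \<tau>: "\<tau> > 0"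
    define t where "t = \<tau> / KQ"
    have t: "t > 0" using \<tau> KQ by (simp add: t_def)
    have "sint R (\<lambda>x. Bn x * fl R x) \<le> \<tau> * sint R (\<lambda>x. rho R x * f x) + C0 / \<tau> + 0 * (1 + sint R f)" if R: "R \<ge> 1" for R
    proof -
      have R0: "R > 0" using R by simp
      have "sint R (\<lambda>x. Bn x * fl R x) \<le> sint R (\<lambda>x. 32 * M / R * (cutoff R x ^ 3 * (rho R x * sqrt (rho R x))) * \<bar>q 3 x\<bar>)"
        unfolding sint_def
      proof (rule hint_mono)
        fix a b
        define m where "m = cutoff R (pt a b 0)" define r where "r = rho R (pt a b 0)"
        have m0: "0 \<le> m" "0 \<le> r" by (simp_all add: m_def r_def cutoff_nonneg rho_nonneg)
        have mr: "cutoff R (pt a b z) = m" "rho R (pt a b z) = r" for z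
          unfolding m_def r_def by (rule cutoff_horizontal)+
        \<comment> \<open>Neither the cutoff nor \<open>rho\<close> depends on the height, so along
          the segment \<open>fl R\<close> is this constant times \<open>xu\<close>.\<close>
        define \<omega> where "\<omega> = - (16 / R\<^sup>2) * (m ^ 3 * r)"
        have cc: "continuous_on {0..1} (\<lambda>z. xu (pt a b z))" "continuous_on {0..1} (\<lambda>z. q 3 (pt a b z))"
          by (auto intro!: continuous_on_pt_cslab[OF cont_xu] continuous_on_pt_cslab[OF cont_q] continuous_intros)
        have i0: "0 \<le> integral {0..1} (\<lambda>z. \<bar>q 3 (pt a b z)\<bar>)"
          by (rule integral_nonneg) (use cc(2) in \<open>auto intro!: integrable_continuous_interval continuous_intros\<close>)
        have "vint (\<lambda>x. Bn x * fl R x) (a, b) = integral {0..1} (\<lambda>z. \<omega> * (Bn (pt a b z) * xu (pt a b z)))"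
          unfolding vint_def by (rule integral_cong) (simp add: fl_eq mr \<omega>_def)
        also have "\<dots> = \<omega> * integral {0..1} (\<lambda>z. Bn (pt a b z) * xu (pt a b z))" by (rule integral_mult_right)
        also have "\<dots> \<le> \<bar>\<omega>\<bar> * \<bar>integral {0..1} (\<lambda>z. Bn (pt a b z) * xu (pt a b z))\<bar>"
          unfolding abs_mult[symmetric] by (rule abs_ge_self)
        also have "\<dots> \<le> \<bar>\<omega>\<bar> * (integral {0..1} (\<lambda>z. \<bar>q 3 (pt a b z)\<bar>) * integral {0..1} (\<lambda>z. \<bar>xu (pt a b z)\<bar>))"
          using z[of "(a, b)"] by (intro mult_left_mono integral_zero_mean_bound cc pdv_line3[OF pdv_Bn]) (auto simp: vint_def)
        also have "\<dots> \<le> \<bar>\<omega>\<bar> * (integral {0..1} (\<lambda>z. \<bar>q 3 (pt a b z)\<bar>) * ((1 - 0) * (2 * M * R * sqrt r)))"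
          using xu_le[OF R0, of "pt a b _"] mr by (intro mult_left_mono integral_abs_le_const cc i0) auto
        also have "\<dots> = 32 * M / R * (m ^ 3 * (r * sqrt r)) * integral {0..1} (\<lambda>z. \<bar>q 3 (pt a b z)\<bar>)"
          using m0 R0 by (simp add: \<omega>_def abs_mult power2_eq_square)
        also have "\<dots> = vint (\<lambda>x. 32 * M / R * (cutoff R x ^ 3 * (rho R x * sqrt (rho R x))) * \<bar>q 3 x\<bar>) (a, b)"
          unfolding vint_def fst_conv snd_conv mr by (rule integral_mult_right[symmetric])
        finally show "vint (\<lambda>x. Bn x * fl R x) (a, b) \<le> vint (\<lambda>x. 32 * M / R * (cutoff R x ^ 3 * (rho R x * sqrt (rho R x))) * \<bar>q 3 x\<bar>) (a, b)" .
      qed (use R0 in \<open>auto intro!: continuous_intros\<close>)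
      also have "\<dots> \<le> sint R (\<lambda>x. \<tau> * (rho R x * f x) + (32 * M / R)\<^sup>2 / (4 * t))"
      proof (rule sint_mono)
        fix x assume x: "x \<in> cslab"
        have "cutoff R x ^ 3 * (rho R x * sqrt (rho R x)) \<le> sqrt (rho R x)"
          using rho_cutoff_le[of "sqrt (rho R x)" 3 R x] cutoff_mult_le[of "sqrt (rho R x)" R x 3]
          by (simp add: rho_nonneg mult.left_commute)
        then have "32 * M / R * (cutoff R x ^ 3 * (rho R x * sqrt (rho R x))) * \<bar>q 3 x\<bar> \<le> 32 * M / R * sqrt (rho R x) * \<bar>q 3 x\<bar>"
          using M_nonneg R0 by (intro mult_right_mono mult_left_mono) auto
        also have "\<dots> = (sqrt (rho R x) * \<bar>q 3 x\<bar>) * (32 * M / R)" by simp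
        also have "\<dots> \<le> t * (sqrt (rho R x) * \<bar>q 3 x\<bar>)\<^sup>2 + (32 * M / R)\<^sup>2 / (4 * t)" by (rule young2[OF t])
        also have "(sqrt (rho R x) * \<bar>q 3 x\<bar>)\<^sup>2 = rho R x * (q 3 x)\<^sup>2" using rho_nonneg by (simp add: power_mult_distrib)
        also have "t * (rho R x * (q 3 x)\<^sup>2) \<le> t * (rho R x * (KQ * f x))"
        proof (intro mult_left_mono)
          show "(q 3 x)\<^sup>2 \<le> KQ * f x" using q2_le[OF x] zero_le_power2[of "q 1 x"] zero_le_power2[of "q 2 x"] by linarith
        qed (use t rho_nonneg in auto)
        also have "t * (rho R x * (KQ * f x)) = \<tau> * (rho R x * f x)" using KQ by (simp add: t_def)
        finally show "32 * M / R * (cutoff R x ^ 3 * (rho R x * sqrt (rho R x))) * \<bar>q 3 x\<bar> \<le> \<tau> * (rho R x * f x) + (32 * M / R)\<^sup>2 / (4 * t)"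
          by simp
      qed (use R0 in \<open>auto intro!: continuous_intros\<close>)
      also have "\<dots> = \<tau> * sint R (\<lambda>x. rho R x * f x) + 4 * R\<^sup>2 * ((32 * M / R)\<^sup>2 / (4 * t))"
        using R0 by (subst sint_add, (intro continuous_intros)+) (simp only: sint_cmult, simp add: sint_const)
      also have "4 * R\<^sup>2 * ((32 * M / R)\<^sup>2 / (4 * t)) = C0 / \<tau>" using R0 \<tau> by (simp add: C0_def t_def power_divide)
      finally show ?thesis by simp
    qed
    then show "\<exists>\<eta>. (\<eta> \<longlongrightarrow> 0) at_top \<and> (\<forall>R\<ge>1. sint R (\<lambda>x. Bn x * fl R x)
       \<le> \<tau> * sint R (\<lambda>x. rho R x * f x) + C0 / \<tau> + \<eta> R * (1 + sint R f))"
      by (intro exI[of _ "\<lambda>_. 0"]) auto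
  qed
qed

text \<open>\<open>fl R\<close> is the divergence of \<open>cutoff R ^ 4\<close> times the velocity,
  a field without flux through the walls or the lateral faces. It supplies the zero mean for
  \<open>sint_mean_zero_bound\<close>.\<close>

lemma total_flux_zero: "R > 0 \<Longrightarrow> sint R (fl R) = 0"
proof -
  assume R: "R > 0"
  define G where "G j x = v j x * cutoff R x ^ 4" for j x
  define G' where "G' j x = d j j x * cutoff R x ^ 4 + v j x * dcut 2 R j x" for j x
  have D: "pdv j (G j) (G' j)" for j unfolding G_def G'_def by (intro pdv_mult pdv_flow pdv_cutoff4)
  have cG': "continuous_on cslab (G' j)" for j unfolding G'_def by (intro continuous_intros)
  have cG: "continuous_on cslab (G 3)" unfolding G_def by (intro continuous_intros)
  have "sint R (fl R) = sint R (\<lambda>x. G' 1 x + G' 2 x + G' 3 x)"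
  proof (rule sint_cong)
    fix x assume x: "x \<in> cslab"
    have "G' 1 x + G' 2 x + G' 3 x = (d 1 1 x + d 2 2 x + d 3 3 x) * cutoff R x ^ 4 + fl R x"
      by (simp add: G'_def fl_def sum_3 algebra_simps)
    then show "fl R x = G' 1 x + G' 2 x + G' 3 x" using div_free[OF x] by simp
  qed (intro continuous_intros cG')+
  also have "\<dots> = hint R (\<lambda>p. G 3 (pt (fst p) (snd p) 1)) - hint R (\<lambda>p. G 3 (pt (fst p) (snd p) 0))"
    by (rule divergence_theorem[of R G G', OF _ D cG' cG]) (use R cutoff_lateral in \<open>auto simp: G_def\<close>)
  also have "\<dots> = 0" using bc3 by (simp add: G_def)
  finally show ?thesis .
qed

text \<open>Only the total flux vanishes here, so the mean-zero bound on the whole box is used. Its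
  factor \<open>R\<close> against the \<open>16 / R^2\<close> of \<open>fl\<close> leaves
  \<open>1 / R\<close>, just enough to bound the integral of the Bernoulli gradient by the energy
  and a constant. The gain is the supremum \<open>ee R\<close>, which tends to zero.\<close>

lemma flux_decay:
  assumes dec: "\<And>\<epsilon>. \<epsilon> > 0 \<Longrightarrow> \<exists>R. \<forall>x\<in>cslab. rad x \<ge> R \<longrightarrow> \<bar>xu x\<bar> \<le> \<epsilon>" and x: "x \<in> cslab"
  shows "g2 x = 0"
proof -
  define box where "box R = {x \<in> cslab. \<bar>x$1\<bar> \<le> R \<and> \<bar>x$2\<bar> \<le> R}" for R :: real
  define ff where "ff R x = cutoff R x ^ 3 * rho R x * \<bar>xu x\<bar>" for R x
  define ee where "ee R = (SUP x\<in>box R. ff R x)" for R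
  have ff0: "0 \<le> ff R x" for R x unfolding ff_def using cutoff_nonneg rho_nonneg by simp
  have ff1: "ff R x \<le> \<bar>xu x\<bar>" for R x
    using rho_cutoff_le[of "\<bar>xu x\<bar>" 3 R x] cutoff_mult_le[of "\<bar>xu x\<bar>" R x 3] unfolding ff_def by (simp add: mult_ac)
  have ne: "pt 0 0 0 \<in> box R" if "R \<ge> 0" for R using that by (simp add: box_def)
  have bdd: "bdd_above (ff R ` box R)" for R
  proof (rule bdd_aboveI2)
    fix x assume "x \<in> box R"
    then have x: "x \<in> cslab" "\<bar>x$1\<bar> \<le> R" "\<bar>x$2\<bar> \<le> R" by (auto simp: box_def)
    have "\<bar>x$1 * v 1 x\<bar> \<le> R * M" "\<bar>x$2 * v 2 x\<bar> \<le> R * M"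
      by (intro abs_mult_le v_le x)+
    then have "\<bar>xu x\<bar> \<le> 2 * (R * M)" unfolding xu_def by linarith
    then show "ff R x \<le> 2 * (R * M)" using ff1[of R x] by linarith
  qed
  have up: "ff R x \<le> ee R" if "x \<in> box R" for R x
    unfolding ee_def by (rule cSUP_upper[OF that bdd])
  have ee0: "0 \<le> ee R" if "R \<ge> 0" for R using up[OF ne[OF that]] ff0[of R "pt 0 0 0"] by linarith
  have lim: "(ee \<longlongrightarrow> 0) at_top"
  proof (rule tendstoI)
    fix \<epsilon> :: real assume \<epsilon>: "\<epsilon> > 0"
    obtain S0 where S0: "\<And>x. x \<in> cslab \<Longrightarrow> rad x \<ge> S0 \<Longrightarrow> \<bar>xu x\<bar> \<le> \<epsilon> / 2"
      using dec[of "\<epsilon> / 2"] \<epsilon> by auto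
    define S where "S = max 1 S0"
    have S: "S \<ge> 1" "S \<ge> S0" by (auto simp: S_def)
    \<comment> \<open>Outside the cylinder of radius \<open>S\<close> the flux is small by
      assumption. Inside it \<open>rho\<close> is at most \<open>S^2 / R^2\<close> and the flux at
      most \<open>2 * M * S\<close>, so the product is at most \<open>\<epsilon> / 2\<close> beyond
      the chosen radius.\<close>
    show "eventually (\<lambda>R. dist (ee R) 0 < \<epsilon>) at_top"
      using eventually_ge_at_top[of "max 1 (4 * M * S ^ 3 / \<epsilon>)"]
    proof eventually_elim
      case (elim R)
      then have R: "R \<ge> 1" "4 * M * S ^ 3 / \<epsilon> \<le> R" by auto
      have "ee R \<le> \<epsilon> / 2" unfolding ee_def
      proof (rule cSUP_least)
        show "box R \<noteq> {}" using ne[of R] R by auto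
        fix x assume "x \<in> box R"
        then have x: "x \<in> cslab" by (simp add: box_def)
        show "ff R x \<le> \<epsilon> / 2"
        proof (cases "rad x \<ge> S")
          case True
          then show ?thesis using S0[OF x] S ff1[of R x] by force
        next
          case False
          have r: "rad x = R * sqrt (rho R x)" using R by (simp add: rad_def rho_def real_sqrt_divide)
          have xr: "\<bar>xu x\<bar> \<le> 2 * M * rad x" using xu_le[of R x, OF _ x] R by (simp add: r mult_ac)
          have "0 \<le> rad x" by (simp add: rad_def)
          then have "(rad x)\<^sup>2 \<le> S\<^sup>2" using False by (intro power_mono) auto
          then have "rho R x \<le> S\<^sup>2 / R\<^sup>2" using R by (simp add: rho_def rad_def divide_right_mono)
          moreover have "\<bar>xu x\<bar> \<le> 2 * M * S" using xr False M_nonneg mult_left_mono[of "rad x" S "2 * M"] by simp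
          ultimately have "rho R x * \<bar>xu x\<bar> \<le> S\<^sup>2 / R\<^sup>2 * (2 * M * S)" by (intro mult_mono) auto
          also have "\<dots> = 2 * M * S ^ 3 / R\<^sup>2" by (simp add: power2_eq_square power3_eq_cube)
          also have "\<dots> \<le> 2 * M * S ^ 3 / R"
            using R M_nonneg S by (intro divide_left_mono) (auto simp: power2_eq_square)
          also have "\<dots> \<le> \<epsilon> / 2"
          proof -
            have "4 * M * S ^ 3 \<le> R * \<epsilon>" using R(2) \<epsilon> by (simp add: pos_divide_le_eq)
            then show ?thesis using R(1) by (simp add: field_simps)
          qed
          finally have "rho R x * \<bar>xu x\<bar> \<le> \<epsilon> / 2" .
          moreover have "ff R x \<le> rho R x * \<bar>xu x\<bar>"
            unfolding ff_def using cutoff_mult_le[of "rho R x * \<bar>xu x\<bar>" R x 3] rho_nonneg by (simp add: mult.assoc)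
          ultimately show ?thesis by linarith
        qed
      qed
      then show ?case using ee0[of R] R \<epsilon> by (simp add: dist_real_def)
    qed
  qed
  have KQ: "KQ > 0" by (simp add: KQ_def add_pos_nonneg)
  show ?thesis
  proof (rule vanishing_gradient[OF _ _ x])
    show "(0::real) \<le> 0" by simp
    fix \<tau> :: real assume \<tau>: "\<tau> > 0"
    define \<eta> where "\<eta> R = 64 * (KQ + 12) * ee R" for R
    have "((\<lambda>R. 64 * (KQ + 12) * ee R) \<longlongrightarrow> 64 * (KQ + 12) * 0) at_top" by (intro tendsto_intros lim)
    then have "(\<eta> \<longlongrightarrow> 0) at_top" by (simp add: \<eta>_def[abs_def])
    moreover have "sint R (\<lambda>x. Bn x * fl R x) \<le> \<tau> * sint R (\<lambda>x. rho R x * f x) + 0 / \<tau> + \<eta> R * (1 + sint R f)" if R: "R \<ge> 1" for R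
    proof -
      have R0: "R > 0" using R by simp
      have e0: "0 \<le> ee R" using ee0[of R] R by simp
      have sf0: "0 \<le> sint R f" by (rule sint_nonneg) (auto intro: continuous_intros f_nonneg)
      have "sint R (\<lambda>x. Bn x * fl R x) \<le> 4 * R * (16 / R\<^sup>2 * ee R) * (sint R (\<lambda>x. \<bar>q 1 x\<bar>) + sint R (\<lambda>x. \<bar>q 2 x\<bar>) + sint R (\<lambda>x. \<bar>q 3 x\<bar>))"
      proof (rule sint_mean_zero_bound[OF R pdv_Bn cont_q cont_Bn cont_fl _ total_flux_zero[OF R0]])
        fix x assume "x \<in> cslab" "\<bar>x$1\<bar> \<le> R" "\<bar>x$2\<bar> \<le> R"
        then have "16 / R\<^sup>2 * ff R x \<le> 16 / R\<^sup>2 * ee R" by (intro mult_left_mono up) (auto simp: box_def)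
        then show "\<bar>fl R x\<bar> \<le> 16 / R\<^sup>2 * ee R"
          using cutoff_nonneg rho_nonneg by (simp add: fl_eq ff_def abs_mult)
      qed
      also have "\<dots> = 64 * ee R * (1 / R * (sint R (\<lambda>x. \<bar>q 1 x\<bar>) + sint R (\<lambda>x. \<bar>q 2 x\<bar>) + sint R (\<lambda>x. \<bar>q 3 x\<bar>)))"
        using R0 by (simp add: power2_eq_square)
      finally have 1: "sint R (\<lambda>x. Bn x * fl R x) \<le> 64 * ee R * (1 / R * (sint R (\<lambda>x. \<bar>q 1 x\<bar>) + sint R (\<lambda>x. \<bar>q 2 x\<bar>) + sint R (\<lambda>x. \<bar>q 3 x\<bar>)))" .
      have "1 / R * (sint R (\<lambda>x. \<bar>q 1 x\<bar>) + sint R (\<lambda>x. \<bar>q 2 x\<bar>) + sint R (\<lambda>x. \<bar>q 3 x\<bar>)) = sint R (\<lambda>x. 1 / R * (\<bar>q 1 x\<bar> + \<bar>q 2 x\<bar> + \<bar>q 3 x\<bar>))"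
        by (subst sint_cmult, subst sint_add, (intro continuous_intros)+, subst sint_add, (intro continuous_intros)+) simp
      also have "\<dots> \<le> sint R (\<lambda>x. KQ * f x + 3 / R\<^sup>2)"
      proof (rule sint_mono)
        fix x assume x: "x \<in> cslab"
        \<comment> \<open>A splitting with unit weight instead of \<open>\<tau>\<close> suffices:
          the prefactor \<open>ee R\<close> tends to zero, so the whole product goes into the
          \<open>\<eta>\<close> term.\<close>
        have y: "1 / R * \<bar>y\<bar> \<le> y\<^sup>2 + 1 / R\<^sup>2" for y :: real
        proof -
          have "0 \<le> (\<bar>y\<bar> - 1 / R)\<^sup>2" by simp
          also have "\<dots> = y\<^sup>2 - 2 * (1 / R * \<bar>y\<bar>) + 1 / R\<^sup>2" by (simp add: power2_diff power_divide)
          finally have "2 * (1 / R * \<bar>y\<bar>) \<le> y\<^sup>2 + 1 / R\<^sup>2" by simp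
          moreover have "0 \<le> 1 / R * \<bar>y\<bar>" using R0 by simp
          ultimately show ?thesis by linarith
        qed
        have "1 / R * (\<bar>q 1 x\<bar> + \<bar>q 2 x\<bar> + \<bar>q 3 x\<bar>) \<le> ((q 1 x)\<^sup>2 + 1 / R\<^sup>2) + ((q 2 x)\<^sup>2 + 1 / R\<^sup>2) + ((q 3 x)\<^sup>2 + 1 / R\<^sup>2)"
          unfolding distrib_left by (intro add_mono y)
        also have "\<dots> \<le> KQ * f x + 3 / R\<^sup>2" using q2_le[OF x] by simp
        finally show "1 / R * (\<bar>q 1 x\<bar> + \<bar>q 2 x\<bar> + \<bar>q 3 x\<bar>) \<le> KQ * f x + 3 / R\<^sup>2" .
      qed (use R0 in \<open>auto intro!: continuous_intros\<close>)
      also have "\<dots> = KQ * sint R f + 12"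
        using R0 by (subst sint_add, (intro continuous_intros)+) (simp_all add: sint_cmult sint_const)
      also have "\<dots> \<le> (KQ + 12) * (1 + sint R f)" using KQ sf0 by (simp add: algebra_simps)
      finally have "64 * ee R * (1 / R * (sint R (\<lambda>x. \<bar>q 1 x\<bar>) + sint R (\<lambda>x. \<bar>q 2 x\<bar>) + sint R (\<lambda>x. \<bar>q 3 x\<bar>)))
          \<le> 64 * ee R * ((KQ + 12) * (1 + sint R f))" using e0 by (intro mult_left_mono) auto
      then have "sint R (\<lambda>x. Bn x * fl R x) \<le> \<eta> R * (1 + sint R f)"
        using 1 unfolding \<eta>_def by (simp only: mult_ac)
      moreover have "0 \<le> \<tau> * sint R (\<lambda>x. rho R x * f x)"
        using \<tau> by (intro mult_nonneg_nonneg sint_nonneg) (auto intro!: continuous_intros simp: rho_nonneg f_nonneg)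
      ultimately show ?thesis by simp
    qed
    ultimately show "\<exists>\<eta>. (\<eta> \<longlongrightarrow> 0) at_top \<and> (\<forall>R\<ge>1. sint R (\<lambda>x. Bn x * fl R x)
       \<le> \<tau> * sint R (\<lambda>x. rho R x * f x) + 0 / \<tau> + \<eta> R * (1 + sint R f))" by blast
  qed
qed

end

section \<open>Axisymmetric components\<close>

text \<open>Rotations and rays are not parallel to the axes, so their chain rule needs total
  differentiability in the horizontal plane. Continuity of one partial derivative supplies
  it.\<close>

lemma sm_has_derivative_horizontal:
  assumes h: "sm h" and z: "0 \<le> z" "z \<le> 1"
  shows "((\<lambda>(x, y). h (pt x y z)) has_derivative (\<lambda>(s, t). pd 1 h (pt x y z) * s + pd 2 h (pt x y z) * t)) (at (x, y))"
proof -
  have c2: "continuous_on UNIV (\<lambda>p. pd 2 h (pt (fst p) (snd p) z))"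
    by (rule bcont[OF sm_continuous[OF sm_pd[OF h]] z])
  have "((\<lambda>(x, y). h (pt x y z)) has_derivative
     (\<lambda>(s, t). pd 1 h (pt x y z) * s + blinfun_apply (blinfun_mult_right (pd 2 h (pt x y z))) t)) (at (x, y) within UNIV \<times> UNIV)"
  proof (rule has_derivative_partialsI)
    show "((\<lambda>x. h (pt x y z)) has_derivative (\<lambda>s. pd 1 h (pt x y z) * s)) (at x within UNIV)"
      using pdv_line[OF sm_pdv[OF h] z] by (simp add: has_field_derivative_def)
    show "((\<lambda>y. h (pt x y z)) has_derivative blinfun_apply (blinfun_mult_right (pd 2 h (pt x y z)))) (at y within UNIV)" for x y
      using pdv_line2[OF sm_pdv[OF h] z] by (simp add: has_field_derivative_def)
    have "isCont (\<lambda>p. pd 2 h (pt (fst p) (snd p) z)) (x, y)"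
      using c2 by (simp add: continuous_on_eq_continuous_at)
    then show "continuous (at (x, y) within UNIV \<times> UNIV) (\<lambda>(x, y). blinfun_mult_right (pd 2 h (pt x y z)))"
      using bounded_linear.isCont[OF bounded_linear_blinfun_mult_right] by (simp add: case_prod_unfold)
  qed auto
  then show ?thesis by simp
qed

lemma sm_chain_horizontal:
  assumes h: "sm h" and z: "0 \<le> z" "z \<le> 1"
    and X: "(X has_real_derivative X') (at s)" and Y: "(Y has_real_derivative Y') (at s)"
  shows "((\<lambda>s. h (pt (X s) (Y s) z)) has_real_derivative
     pd 1 h (pt (X s) (Y s) z) * X' + pd 2 h (pt (X s) (Y s) z) * Y') (at s)"
proof -
  have "((\<lambda>s. (X s, Y s)) has_derivative (\<lambda>t. (X' * t, Y' * t))) (at s)"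
    using X Y unfolding has_field_derivative_def by (intro has_derivative_Pair)
  from has_derivative_compose[OF this sm_has_derivative_horizontal[OF h z]]
  have "((\<lambda>s. h (pt (X s) (Y s) z)) has_derivative
     (\<lambda>t. pd 1 h (pt (X s) (Y s) z) * (X' * t) + pd 2 h (pt (X s) (Y s) z) * (Y' * t))) (at s)" by simp
  then show ?thesis unfolding has_field_derivative_def
    by (rule has_derivative_eq_rhs) (simp add: fun_eq_iff algebra_simps)
qed

context slab_flow begin

lemma rad_u_theta: "rad x * u_theta u x = - x$2 * v 1 x + x$1 * v 2 x"
proof (cases "rad x = 0")
  case True
  then have "x$1 = 0" "x$2 = 0" by (auto simp: rad_def sum_power2_eq_zero_iff)
  then show ?thesis using True by simp
qed (simp add: u_theta_def v_def)

lemma rad_u_r: "rad x * u_r u x = xu x"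
proof (cases "rad x = 0")
  case True
  then have "x$1 = 0" "x$2 = 0" by (auto simp: rad_def sum_power2_eq_zero_iff)
  then show ?thesis using True by (simp add: xu_def)
qed (simp add: u_r_def v_def xu_def)

text \<open>If \<open>r u\<^sub>\<theta>\<close> is rotation invariant, its vanishing angular derivative turns the radial derivative of the flux density into a multiple of the vertical derivative of the vertical velocity.\<close>
lemma angular_relation:
  fixes a b z :: real
  assumes ax: "axisymmetric (u_theta u)" and ab: "a\<^sup>2 + b\<^sup>2 > 0" and z: "0 < z" "z < 1"
  shows "b\<^sup>2 * d 1 1 (pt a b z) - a * b * (d 1 2 (pt a b z) + d 2 1 (pt a b z)) + a\<^sup>2 * d 2 2 (pt a b z) = xu (pt a b z)"
proof -
  \<comment> \<open>The curve rotates the point \<open>(a, b)\<close> about the axis, and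
    \<open>T\<close> is the distance to the axis times the angular velocity component along
    it.\<close>
  define X where "X s = a * cos s - b * sin s" for s
  define Y where "Y s = a * sin s + b * cos s" for s
  define T where "T s = - Y s * v 1 (pt (X s) (Y s) z) + X s * v 2 (pt (X s) (Y s) z)" for s
  have z': "0 \<le> z" "z \<le> 1" using z by auto
  have DX: "(X has_real_derivative - b) (at 0)" unfolding X_def by (auto intro!: derivative_eq_intros)
  have DY: "(Y has_real_derivative a) (at 0)" unfolding Y_def by (auto intro!: derivative_eq_intros)
  have XY0: "X 0 = a" "Y 0 = b" by (simp_all add: X_def Y_def)
  have Dv: "((\<lambda>s. v i (pt (X s) (Y s) z)) has_real_derivative d i 1 (pt a b z) * (- b) + d i 2 (pt a b z) * a) (at 0)" for i
    using sm_chain_horizontal[OF sm_v z' DX DY, of i] by (simp add: XY0 d_def)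
  have "(T has_real_derivative (- a * v 1 (pt a b z) + - b * (d 1 1 (pt a b z) * (- b) + d 1 2 (pt a b z) * a))
     + (- b * v 2 (pt a b z) + a * (d 2 1 (pt a b z) * (- b) + d 2 2 (pt a b z) * a))) (at 0)"
    unfolding T_def by (rule derivative_eq_intros DX DY Dv refl)+ (simp add: XY0)
  moreover have "T s = T 0" for s
  proof -
    have "(X s)\<^sup>2 + (Y s)\<^sup>2 = a\<^sup>2 * ((sin s)\<^sup>2 + (cos s)\<^sup>2) + b\<^sup>2 * ((sin s)\<^sup>2 + (cos s)\<^sup>2)"
      unfolding X_def Y_def by algebra
    then have r: "rad (pt (X s) (Y s) z) = sqrt (a\<^sup>2 + b\<^sup>2)" by (simp add: rad_def)
    have r0: "rad (pt a b z) = sqrt (a\<^sup>2 + b\<^sup>2)" by (simp add: rad_def)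
    have "u_theta u (pt (X s) (Y s) z) = u_theta u (pt a b z)"
      using ax[unfolded axisymmetric_def, rule_format, of "pt (X s) (Y s) z" "pt a b z"] r r0 z ab
      by (simp add: slab_def)
    then have "rad (pt (X s) (Y s) z) * u_theta u (pt (X s) (Y s) z) = rad (pt a b z) * u_theta u (pt a b z)"
      using r r0 by simp
    then show ?thesis unfolding rad_u_theta by (simp add: T_def XY0)
  qed
  then have "T = (\<lambda>_. T 0)" by (simp add: fun_eq_iff)
  then have "(T has_real_derivative 0) (at 0)" by (metis DERIV_const)
  ultimately have "(- a * v 1 (pt a b z) + - b * (d 1 1 (pt a b z) * (- b) + d 1 2 (pt a b z) * a))
     + (- b * v 2 (pt a b z) + a * (d 2 1 (pt a b z) * (- b) + d 2 2 (pt a b z) * a)) = 0"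
    by (rule DERIV_unique)
  then show ?thesis by (simp add: xu_def power2_eq_square algebra_simps)
qed

text \<open>Along a ray from the axis the derivative of \<open>xu\<close> is, by
  \<open>angular_relation\<close> and incompressibility, a multiple of \<open>d 3 3\<close>. Its
  vertical integral vanishes because \<open>v 3\<close> is zero on both walls, so the vertical mean
  of \<open>xu\<close> keeps its value zero from the axis.\<close>

lemma flux_zero_theta:
  assumes ax: "axisymmetric (u_theta u)"
  shows "vint xu p = 0"
proof (cases "(fst p)\<^sup>2 + (snd p)\<^sup>2 > 0")
  case False
  then have "fst p = 0" "snd p = 0" by (auto simp: not_less sum_power2_le_zero_iff)
  then show ?thesis by (simp add: vint_def xu_def)
next
  case True
  define a where "a = fst p" define b where "b = snd p"
  have ab: "a\<^sup>2 + b\<^sup>2 > 0" using True by (simp add: a_def b_def)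
  define D where "D t z = (let x = pt (t * a) (t * b) z in a * v 1 x + b * v 2 x
     + t * a * (d 1 1 x * a + d 1 2 x * b) + t * b * (d 2 1 x * a + d 2 2 x * b))" for t z
  have cD: "continuous_on (U \<times> {0..1}) (\<lambda>(t, z). D t z)" for U
    unfolding D_def Let_def case_prod_unfold
    by (intro continuous_intros continuous_on_pt_cslab sm_cont) auto
  have K: "((\<lambda>t. integral (cbox 0 1) (\<lambda>z. xu (pt (t * a) (t * b) z))) has_real_derivative integral (cbox 0 1) (D t)) (at t within UNIV)" for t
  proof (rule leibniz_rule_field_derivative)
    fix t z :: real assume "z \<in> cbox 0 1"
    then have z: "0 \<le> z" "z \<le> 1" by auto
    have X: "((\<lambda>t. t * a) has_real_derivative a) (at t)" "((\<lambda>t. t * b) has_real_derivative b) (at t)"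
      by (auto intro!: derivative_eq_intros)
    have Dv: "((\<lambda>s. v i (pt (s * a) (s * b) z)) has_real_derivative d i 1 (pt (t * a) (t * b) z) * a + d i 2 (pt (t * a) (t * b) z) * b) (at t)" for i
      using sm_chain_horizontal[OF sm_v z X, of i] by (simp add: d_def)
    show "((\<lambda>t. xu (pt (t * a) (t * b) z)) has_real_derivative D t z) (at t within UNIV)"
      unfolding xu_def pt_nth D_def Let_def
      by (rule derivative_eq_intros X Dv refl)+ (simp add: algebra_simps)
  next
    show "(\<lambda>z. xu (pt (t * a) (t * b) z)) integrable_on cbox 0 1" for t
      using vint_integrable[OF cont_xu] by simp
    show "continuous_on (UNIV \<times> cbox 0 1) (\<lambda>(t, z). D t z)" using cD by simp
  qed auto
  have D0: "integral (cbox 0 1) (D t) = 0" if t: "0 < t" for t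
  proof -
    have eq: "D t z = - (t * (a\<^sup>2 + b\<^sup>2)) * d 3 3 (pt (t * a) (t * b) z)" if z: "z \<in> {0..1}" for z
    proof -
      \<comment> \<open>\<open>angular_relation\<close> holds at interior heights only. Both sides
        are read as functions of the height alone so that \<open>cslab_eqI\<close> covers the wall
        heights.\<close>
      have c0: "continuous_on cslab (\<lambda>x. (t, x$3))" by (intro continuous_intros)
      have c1: "continuous_on cslab (\<lambda>x. D t (x$3))"
        using continuous_on_compose2[OF cD[of UNIV] c0] by (force simp: cslab_def)
      have c2: "continuous_on cslab (\<lambda>x. - (t * (a\<^sup>2 + b\<^sup>2)) * d 3 3 (pt (t * a) (t * b) (x$3)))"
        by (intro continuous_intros continuous_on_pt_cslab sm_cont) (auto simp: cslab_def)
      have "D t (pt 0 0 z $ 3) = - (t * (a\<^sup>2 + b\<^sup>2)) * d 3 3 (pt (t * a) (t * b) (pt 0 0 z $ 3))"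
      proof (rule cslab_eqI[OF c1 c2])
        fix x assume "x \<in> slab"
        define z where "z = x$3"
        have z: "0 < z" "z < 1" using \<open>x \<in> slab\<close> by (auto simp: slab_def z_def)
        define y where "y = pt (t * a) (t * b) z"
        have y: "y \<in> cslab" using z by (simp add: y_def)
        have "t\<^sup>2 * (a\<^sup>2 + b\<^sup>2) > 0" using t ab by simp
        then have "(t * a)\<^sup>2 + (t * b)\<^sup>2 > 0" by (simp add: power_mult_distrib algebra_simps)
        from angular_relation[OF ax this z]
        have 1: "(t * b)\<^sup>2 * d 1 1 y - t * a * (t * b) * (d 1 2 y + d 2 1 y) + (t * a)\<^sup>2 * d 2 2 y = t * a * v 1 y + t * b * v 2 y"
          by (simp add: y_def xu_def)
        have "t * D t z = (t * a * v 1 y + t * b * v 2 y) + (t * a)\<^sup>2 * d 1 1 y + t * a * (t * b) * (d 1 2 y + d 2 1 y) + (t * b)\<^sup>2 * d 2 2 y"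
          unfolding D_def Let_def y_def[symmetric] by (simp add: power2_eq_square algebra_simps)
        also have "\<dots> = ((t * a)\<^sup>2 + (t * b)\<^sup>2) * (d 1 1 y + d 2 2 y)" unfolding 1[symmetric] by (simp add: algebra_simps)
        also have "d 1 1 y + d 2 2 y = - d 3 3 y" using div_free[OF y] by simp
        also have "((t * a)\<^sup>2 + (t * b)\<^sup>2) * - d 3 3 y = t * (- (t * (a\<^sup>2 + b\<^sup>2)) * d 3 3 y)"
          by (simp add: power2_eq_square algebra_simps)
        finally have "D t z = - (t * (a\<^sup>2 + b\<^sup>2)) * d 3 3 y"
          unfolding mult_cancel_left using t by linarith
        then show "D t (x$3) = - (t * (a\<^sup>2 + b\<^sup>2)) * d 3 3 (pt (t * a) (t * b) (x$3))" by (simp add: z_def y_def)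
      qed (use that in auto)
      then show ?thesis by simp
    qed
    have "integral {0..1} (D t) = integral {0..1} (\<lambda>z. - (t * (a\<^sup>2 + b\<^sup>2)) * d 3 3 (pt (t * a) (t * b) z))"
      by (rule integral_cong) (rule eq)
    also have "\<dots> = - (t * (a\<^sup>2 + b\<^sup>2)) * vint (d 3 3) (t * a, t * b)"
      unfolding vint_def fst_conv snd_conv by (rule integral_mult_right)
    also have "vint (d 3 3) (t * a, t * b) = 0" unfolding vint_pdv3[OF pdv_v] by (simp add: bc3)
    finally show ?thesis by simp
  qed
  define k where "k t = integral (cbox 0 1) (\<lambda>z. xu (pt (t * a) (t * b) z))" for t
  have Dk: "(k has_real_derivative integral (cbox 0 1) (D t)) (at t)" for t using K[of t] by (simp add: k_def[abs_def])
  have "k 1 = k 0"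
  proof (rule DERIV_isconst2[of 0 1])
    show "continuous_on {0..1} k" by (intro continuous_at_imp_continuous_on ballI DERIV_isCont[OF Dk])
    show "(k has_real_derivative 0) (at t)" if "0 < t" "t < 1" for t using Dk[of t] D0[OF that(1)] by simp
  qed auto
  then show ?thesis by (simp add: k_def vint_def a_def b_def xu_def)
qed

text \<open>The velocity is orthogonal to the gradient of a radial function; as the flux \<open>\<gamma>\<close> is itself radial,
choosing that gradient proportional to \<open>\<gamma>\<close> times a cutoff gives a vanishing integral of \<open>\<gamma>\<^sup>2\<close>.\<close>
lemma flux_zero_r:
  assumes ax: "axisymmetric (u_r u)"
  shows "vint xu p = 0"
proof -
  \<comment> \<open>The flux as a function of the squared radius. The truncation keeps it continuous
    on the whole real line, where a primitive is formed below.\<close>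
  define \<gamma> where "\<gamma> s = vint xu (sqrt (max 0 s), 0)" for s
  have c\<gamma>: "continuous_on A \<gamma>" for A unfolding \<gamma>_def
    by (rule continuous_on_compose2[OF continuous_on_vint[OF cont_xu, of UNIV]]) (auto intro!: continuous_intros)
  have cr: "continuous_on A rad" for A unfolding rad_def[abs_def] by (intro continuous_intros)
  have eq: "xu x = xu (pt (rad x) 0 (x$3))" if "x \<in> cslab" for x
  proof (rule cslab_eqI[where f = xu and g = "\<lambda>x. xu (pt (rad x) 0 (x$3))", OF cont_xu _ _ that])
    show "continuous_on cslab (\<lambda>x. xu (pt (rad x) 0 (x$3)))"
      by (intro continuous_on_pt_cslab[OF cont_xu] cr continuous_intros) (auto simp: cslab_def)
    fix y assume y: "y \<in> slab"
    have ry: "0 \<le> rad y" by (simp add: rad_def)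
    have r: "rad (pt (rad y) 0 (y$3)) = rad y" using ry by (simp add: rad_def[of "pt _ _ _"])
    show "xu y = xu (pt (rad y) 0 (y$3))"
    proof (cases "rad y = 0")
      case True
      then have "y$1 = 0" "y$2 = 0" by (auto simp: rad_def sum_power2_eq_zero_iff)
      then show ?thesis using True by (simp add: xu_def)
    next
      case False
      have "u_r u y = u_r u (pt (rad y) 0 (y$3))"
        using ax[unfolded axisymmetric_def, rule_format, of y "pt (rad y) 0 (y$3)"] y r False ry
        by (simp add: slab_def)
      then show ?thesis using rad_u_r[of y] rad_u_r[of "pt (rad y) 0 (y$3)"] r by simp
    qed
  qed
  have \<gamma>: "vint xu (a, b) = \<gamma> (a\<^sup>2 + b\<^sup>2)" for a b
    unfolding \<gamma>_def vint_def fst_conv snd_conv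
  proof (rule integral_cong)
    fix z :: real assume "z \<in> {0..1}"
    then show "xu (pt a b z) = xu (pt (sqrt (max 0 (a\<^sup>2 + b\<^sup>2))) 0 z)"
      using eq[of "pt a b z"] by (simp add: rad_def max_def)
  qed
  define R where "R = 1 + \<bar>fst p\<bar> + \<bar>snd p\<bar>"
  have R: "R > 0" by (simp add: R_def)
  define k where "k s = \<gamma> s * max 0 (R\<^sup>2 - s)" for s
  have ck: "continuous_on A k" for A unfolding k_def by (intro continuous_intros c\<gamma>)
  \<comment> \<open>The primitive is normalised to vanish at \<open>R^2\<close>; as \<open>k\<close>
    is zero from there on, it vanishes beyond. The lower limit -1 makes 0 an interior point, so the
    derivative at the axis is two-sided.\<close>
  define h where "h s = integral {-1..s} k - integral {-1..R\<^sup>2} k" for s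
  have Dh: "(h has_real_derivative k s) (at s)" if "s \<ge> 0" for s
  proof -
    have "((\<lambda>s. integral {-1..s} k) has_real_derivative k s) (at s within {-1..s+1})"
      using that by (intro integral_has_real_derivative ck) auto
    moreover have "at s within {-1..s+1} = at s" using that by (intro at_within_interior) auto
    ultimately show ?thesis unfolding h_def by (auto intro!: derivative_eq_intros)
  qed
  have h0: "h s = 0" if "s \<ge> R\<^sup>2" for s
  proof -
    have "(-1::real) \<le> R\<^sup>2" by (rule order_trans[OF _ zero_le_power2]) simp
    then have "integral {-1..R\<^sup>2} k + integral {R\<^sup>2..s} k = integral {-1..s} k"
      using that by (intro Henstock_Kurzweil_Integration.integral_combine integrable_continuous_interval ck) auto
    moreover have "integral {R\<^sup>2..s} k = 0" by (rule integral_eq_0I) (simp add: k_def)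
    ultimately show ?thesis by (simp add: h_def)
  qed
  define \<phi> where "\<phi> x = h ((x$1)\<^sup>2 + (x$2)\<^sup>2)" for x :: "real^3"
  define \<phi>' where "\<phi>' j x = k ((x$1)\<^sup>2 + (x$2)\<^sup>2) * (2 * hx j x)" for j and x :: "real^3"
  have p\<phi>: "pdv j \<phi> (\<phi>' j)" for j
    unfolding \<phi>_def \<phi>'_def
  proof (rule pdv_chain[where h = h and h' = k])
    show "pdv j (\<lambda>x. (x$1)\<^sup>2 + (x$2)\<^sup>2) (\<lambda>x. 2 * hx j x)"
      by (rule pdv_cong, rule pdv_add[OF pdv_power[OF pdv_coord] pdv_power[OF pdv_coord]])
         (use exhaust_3[of j] in \<open>auto simp: hx_def\<close>)
  qed (auto intro!: Dh)
  have ck2: "continuous_on A (\<lambda>x. k ((f x)\<^sup>2 + (g x)\<^sup>2))" if "continuous_on A f" "continuous_on A g" for A and f g :: "'x::topological_space \<Rightarrow> real"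
    by (rule continuous_on_compose2[OF ck[of UNIV]]) (auto intro!: continuous_intros that)
  have c\<phi>': "continuous_on cslab (\<phi>' j)" for j unfolding \<phi>'_def by (intro continuous_intros ck2)
  have c\<phi>: "continuous_on cslab \<phi>"
  proof -
    have "continuous_on {0..} h" by (intro continuous_at_imp_continuous_on ballI DERIV_isCont[OF Dh]) auto
    then show ?thesis unfolding \<phi>_def by (rule continuous_on_compose2) (auto intro!: continuous_intros)
  qed
  define G where "G j x = v j x * \<phi> x" for j x
  define G' where "G' j x = d j j x * \<phi> x + v j x * \<phi>' j x" for j x
  have D: "pdv j (G j) (G' j)" for j unfolding G_def G'_def by (intro pdv_mult pdv_flow p\<phi>)
  have cG': "continuous_on cslab (G' j)" for j unfolding G'_def by (intro continuous_intros c\<phi> c\<phi>')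
  have cG: "continuous_on cslab (G 3)" unfolding G_def by (intro continuous_intros c\<phi>)
  have lat: "G j x = 0" if "\<bar>x$1\<bar> = R \<or> \<bar>x$2\<bar> = R" for j x
  proof -
    have "(x$1)\<^sup>2 = R\<^sup>2 \<or> (x$2)\<^sup>2 = R\<^sup>2" using that by (metis power2_abs)
    then have "R\<^sup>2 \<le> (x$1)\<^sup>2 + (x$2)\<^sup>2" by auto
    then show ?thesis by (simp add: G_def \<phi>_def h0)
  qed
  have "sint R (\<lambda>x. G' 1 x + G' 2 x + G' 3 x) = hint R (\<lambda>p. G 3 (pt (fst p) (snd p) 1)) - hint R (\<lambda>p. G 3 (pt (fst p) (snd p) 0))"
    by (rule divergence_theorem[of R G G', OF _ D cG' cG]) (use R lat in auto)
  also have "\<dots> = 0" using bc3 by (simp add: G_def)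
  finally have "sint R (\<lambda>x. G' 1 x + G' 2 x + G' 3 x) = 0" .
  moreover have "sint R (\<lambda>x. G' 1 x + G' 2 x + G' 3 x) = sint R (\<lambda>x. (2 * k ((x$1)\<^sup>2 + (x$2)\<^sup>2)) * xu x)"
  proof (rule sint_cong)
    fix x assume x: "x \<in> cslab"
    have "G' 1 x + G' 2 x + G' 3 x = (d 1 1 x + d 2 2 x + d 3 3 x) * \<phi> x + (2 * k ((x$1)\<^sup>2 + (x$2)\<^sup>2)) * xu x"
      by (simp add: G'_def \<phi>'_def hx_def xu_def algebra_simps)
    then show "G' 1 x + G' 2 x + G' 3 x = (2 * k ((x$1)\<^sup>2 + (x$2)\<^sup>2)) * xu x" using div_free[OF x] by simp
  qed (intro continuous_intros cG' ck2)+
  moreover have "vint (\<lambda>x. (2 * k ((x$1)\<^sup>2 + (x$2)\<^sup>2)) * xu x) = (\<lambda>q. 2 * (\<gamma> ((fst q)\<^sup>2 + (snd q)\<^sup>2))\<^sup>2 * max 0 (R\<^sup>2 - ((fst q)\<^sup>2 + (snd q)\<^sup>2)))"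
  proof
    fix q
    show "vint (\<lambda>x. (2 * k ((x$1)\<^sup>2 + (x$2)\<^sup>2)) * xu x) q = 2 * (\<gamma> ((fst q)\<^sup>2 + (snd q)\<^sup>2))\<^sup>2 * max 0 (R\<^sup>2 - ((fst q)\<^sup>2 + (snd q)\<^sup>2))"
      using vint_horizontal[of "\<lambda>a b. 2 * k (a\<^sup>2 + b\<^sup>2)" xu q] \<gamma>[of "fst q" "snd q"]
      by (simp add: k_def power2_eq_square)
  qed
  ultimately have i0: "hint R (\<lambda>q. 2 * (\<gamma> ((fst q)\<^sup>2 + (snd q)\<^sup>2))\<^sup>2 * max 0 (R\<^sup>2 - ((fst q)\<^sup>2 + (snd q)\<^sup>2))) = 0"
    by (simp only: sint_def)
  define F where "F q = 2 * (\<gamma> ((fst q)\<^sup>2 + (snd q)\<^sup>2))\<^sup>2 * max 0 (R\<^sup>2 - ((fst q)\<^sup>2 + (snd q)\<^sup>2))" for q :: "real \<times> real"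
  have cF: "continuous_on A F" for A
  proof -
    have "continuous_on A (\<lambda>q. \<gamma> ((fst q)\<^sup>2 + (snd q)\<^sup>2))"
      by (rule continuous_on_compose2[OF c\<gamma>[of UNIV]]) (auto intro!: continuous_intros)
    then show ?thesis unfolding F_def by (intro continuous_intros)
  qed
  have "box (-R,-R) (R,R) \<noteq> {}"
  proof -
    have "(0,0) \<in> box (-R,-R) (R,R)" using R by (auto simp: mem_box Basis_prod_def)
    then show ?thesis by blast
  qed
  then have "\<forall>q\<in>cbox (-R,-R) (R,R). F q = 0"
    using i0 by (subst integral_cbox_eq_0_iff[symmetric, OF cF]) (auto simp: F_def[abs_def] hint_def)
  moreover have "p \<in> cbox (-R,-R) (R,R)" by (cases p) (auto simp: cbox_Pair_iff R_def)
  ultimately have "F p = 0" by blast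
  moreover have "(fst p)\<^sup>2 + (snd p)\<^sup>2 < R\<^sup>2"
  proof -
    have "(fst p)\<^sup>2 + (snd p)\<^sup>2 \<le> (\<bar>fst p\<bar> + \<bar>snd p\<bar>)\<^sup>2" by (simp add: power2_sum)
    also have "\<dots> < R\<^sup>2" unfolding R_def by (intro power_strict_mono) auto
    finally show ?thesis .
  qed
  ultimately have "\<gamma> ((fst p)\<^sup>2 + (snd p)\<^sup>2) = 0" by (simp add: F_def)
  then show ?thesis using \<gamma>[of "fst p" "snd p"] by simp
qed

section \<open>From a vanishing gradient to the trivial flow\<close>

lemma rigid_constant:
  assumes "\<And>x. x \<in> cslab \<Longrightarrow> g2 x = 0" "x \<in> cslab"
  shows "v i x = v i (pt 0 0 0)" "v 3 x = 0"
proof -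
  have d0: "d i j y = 0" if "y \<in> cslab" for i j y
    using d_le[of i j y] assms(1)[OF that] by simp
  show "v i x = v i (pt 0 0 0)" for i
    by (rule const_cslab[OF sm_v _ assms(2)]) (use d0 in \<open>simp add: d_def\<close>)
  from this[of 3] show "v 3 x = 0" using bc3[of "pt 0 0 0"] by simp
qed

lemma axisymmetric_trivial:
  assumes z: "\<And>p. vint xu p = 0" and x: "x \<in> slab"
  shows "u x = 0"
proof -
  have c: "x \<in> cslab" using x slab_subset_cslab by auto
  have g0: "g2 y = 0" if "y \<in> cslab" for y by (rule flux_zero_mean[OF z that])
  have r: "v i y = v i (pt 0 0 0)" "v 3 y = 0" if "y \<in> cslab" for i y
    using rigid_constant[OF g0 that] by auto
  \<comment> \<open>The flux of a constant flow is linear in the horizontal position, so its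
    vanishing at two unit vectors removes both components.\<close>
  have "vint xu (a, b) = a * v 1 (pt 0 0 0) + b * v 2 (pt 0 0 0)" for a b
  proof -
    have "integral {0..1} (\<lambda>s. xu (pt a b s)) = integral {0..1} (\<lambda>s::real. a * v 1 (pt 0 0 0) + b * v 2 (pt 0 0 0))"
    proof (rule integral_cong)
      fix s :: real assume "s \<in> {0..1}"
      then have "pt a b s \<in> cslab" by simp
      from r(1)[OF this, of 1] r(1)[OF this, of 2]
      show "xu (pt a b s) = a * v 1 (pt 0 0 0) + b * v 2 (pt 0 0 0)" by (simp add: xu_def)
    qed
    then show ?thesis by (simp add: vint_def)
  qed
  from this[of 1 0] this[of 0 1] have "v 1 (pt 0 0 0) = 0" "v 2 (pt 0 0 0) = 0" by (simp_all add: z)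
  then show ?thesis using r(1)[OF c, of 1] r(1)[OF c, of 2] r(2)[OF c] by (simp add: vec_eq_iff forall_3 v_def)
qed

lemma decaying_trivial:
  assumes dec: "\<forall>\<epsilon>>0. \<exists>R. \<forall>x\<in>slab. rad x \<ge> R \<longrightarrow> \<bar>rad x * u_r u x\<bar> < \<epsilon>" and x: "x \<in> slab"
  shows "u x = 0"
proof -
  have c: "x \<in> cslab" using x slab_subset_cslab by auto
  \<comment> \<open>A wall point is approached with its horizontal position fixed, so the condition
    on the radius is preserved; only the strict inequality becomes weak.\<close>
  have dec': "\<exists>R. \<forall>x\<in>cslab. rad x \<ge> R \<longrightarrow> \<bar>xu x\<bar> \<le> \<epsilon>" if eps: "\<epsilon> > 0" for \<epsilon>
  proof -
    obtain R where R: "\<And>x. x \<in> slab \<Longrightarrow> rad x \<ge> R \<Longrightarrow> \<bar>xu x\<bar> < \<epsilon>"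
      using dec[rule_format, OF eps] unfolding rad_u_r by blast
    have "\<bar>xu x\<bar> \<le> \<epsilon>" if x: "x \<in> cslab" and r: "rad x \<ge> R" for x
    proof -
      have "\<bar>xu (pt (x$1) (x$2) (x$3))\<bar> \<le> \<epsilon>"
      proof (rule cslab_leI[where f = "\<lambda>y. \<bar>xu (pt (x$1) (x$2) (y$3))\<bar>", OF _ _ x])
        show "continuous_on cslab (\<lambda>y. \<bar>xu (pt (x$1) (x$2) (y$3))\<bar>)"
          by (intro continuous_intros continuous_on_pt_cslab[OF cont_xu]) (auto simp: cslab_def)
        fix y assume "y \<in> slab"
        then have "\<bar>xu (pt (x$1) (x$2) (y$3))\<bar> < \<epsilon>" using r by (intro R) (auto simp: slab_def rad_def)
        then show "\<bar>xu (pt (x$1) (x$2) (y$3))\<bar> \<le> \<epsilon>" by simp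
      qed
      then show ?thesis by simp
    qed
    then show ?thesis by blast
  qed
  have g0: "g2 y = 0" if "y \<in> cslab" for y by (rule flux_decay[OF dec' that])
  have r: "v i y = v i (pt 0 0 0)" "v 3 y = 0" if "y \<in> cslab" for i y
    using rigid_constant[OF g0 that] by auto
  define c1 where "c1 = v 1 (pt 0 0 0)" define c2 where "c2 = v 2 (pt 0 0 0)"
  have small: "\<bar>c1\<bar> \<le> \<epsilon> \<and> \<bar>c2\<bar> \<le> \<epsilon>" if \<epsilon>: "\<epsilon> > 0" for \<epsilon>
  proof -
    obtain R where R: "\<And>x. x \<in> cslab \<Longrightarrow> rad x \<ge> R \<Longrightarrow> \<bar>xu x\<bar> \<le> \<epsilon>" using dec'[OF \<epsilon>] by blast
    define t where "t = max 1 R"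
    have t: "t \<ge> 1" "t \<ge> R" by (auto simp: t_def)
    have "\<bar>xu (pt t 0 0)\<bar> \<le> \<epsilon>" "\<bar>xu (pt 0 t 0)\<bar> \<le> \<epsilon>" using t by (auto intro!: R simp: rad_def)
    moreover have "xu (pt t 0 0) = t * c1" "xu (pt 0 t 0) = t * c2"
      using r(1)[of "pt t 0 0" 1] r(1)[of "pt 0 t 0" 2] by (simp_all add: xu_def c1_def c2_def)
    ultimately have "t * \<bar>c1\<bar> \<le> \<epsilon>" "t * \<bar>c2\<bar> \<le> \<epsilon>" using t by (simp_all add: abs_mult)
    moreover have "1 * \<bar>c1\<bar> \<le> t * \<bar>c1\<bar>" "1 * \<bar>c2\<bar> \<le> t * \<bar>c2\<bar>" using t by (intro mult_right_mono; simp)+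
    ultimately show ?thesis by linarith
  qed
  have "c1 = 0"
  proof (rule ccontr)
    assume "c1 \<noteq> 0"
    then show False using small[of "\<bar>c1\<bar> / 2"] by simp
  qed
  moreover have "c2 = 0"
  proof (rule ccontr)
    assume "c2 \<noteq> 0"
    then show False using small[of "\<bar>c2\<bar> / 2"] by simp
  qed
  ultimately show ?thesis using r(1)[OF c, of 1] r(1)[OF c, of 2] r(2)[OF c] by (simp add: vec_eq_iff forall_3 v_def c1_def c2_def)
qed

end

theorem theorem1p2:
  fixes u :: "real^3 \<Rightarrow> real^3" and P :: "real^3 \<Rightarrow> real" and \<alpha> :: real
  assumes alpha_nonneg: "\<alpha> \<ge> 0"
    and smooth_u: "\<And>i. smooth_up_to_boundary (\<lambda>x. u x $ i)"
    and smooth_P: "smooth_up_to_boundary P"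
    and NS: "steady_NS u P"
    and bounded_u: "bounded (u ` slab)"
    and BC: "navier_bc \<alpha> u"
  shows
    "((axisymmetric (u_theta u) \<or> axisymmetric (u_r u) \<or>
       (\<forall>\<epsilon>>0. \<exists>R. \<forall>x\<in>slab. rad x \<ge> R \<longrightarrow> \<bar>rad x * u_r u x\<bar> < \<epsilon>))
        \<longrightarrow> (\<forall>x\<in>slab. u x = 0))
   \<and> ((\<alpha> = 0 \<and> (SUP x\<in>slab. norm (u x)) < pi)
        \<longrightarrow> (\<exists>C1 C2. \<forall>x\<in>slab. u x = vector [C1, C2, 0]))
   \<and> ((\<alpha> > 0 \<and> (SUP x\<in>slab. norm (u x)) < min (\<alpha> / 2) (1 / 4))
        \<longrightarrow> (\<exists>C3 C4. \<forall>x\<in>slab.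
              u x = vector [C3 * (- 2 * \<alpha> * (x$3)\<^sup>2 + 2 * \<alpha> * x$3 + 1),
                            C4 * (- 2 * \<alpha> * (x$3)\<^sup>2 + 2 * \<alpha> * x$3 + 1), 0]))"
proof -
  interpret slab_flow u P \<alpha>
    using assms by unfold_locales
  show ?thesis
    using axisymmetric_trivial[OF flux_zero_theta] axisymmetric_trivial[OF flux_zero_r] decaying_trivial
      constant_flow poiseuille_rigidity
    unfolding M_def by (intro conjI impI) blast+
qed

end
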